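(* The t'Hooft ansatz applied to the function $\frac{1}{x_1^2+x_2^2+x_3^2+x_4^2}$ on $\mathbb{R}^4\setminus\{0\}$ (i.e. the global t'Hooft ansatz $\phi$ applied to its X-ray transform) yields the basic split anti-instanton. Moreover, all the split anti-instantons of topological charge $-1$ can be obtained (up to gauge equivalence) via the t'Hooft ansatz.
   Context: $Gr=Gr(2,\mathbb{R}^4)=\mathbb{H}_{\mathbb{R}}\mathbb{P}^1$. For $g\in SL(4,\mathbb{R})$ the chart $\Psi_g:M_2(\mathbb{R})\to Gr$ sends $X=(x_{ij})$ to the column span of $g\begin{pmatrix} X \\ I \end{pmatrix}$; $U_g$ is its image. With $h^{-1}g=\begin{pmatrix} k_{11} & k_{12} \\ k_{21} & k_{22} \end{pmatrix}$ in $2\times2$ blocks, the coordinate change is $\Psi_{g,h}(X)=(k_{11}X+k_{12})(k_{21}X+k_{22})^{-1}$. $Gr$ carries the conformal structure and orientation given on each chart by $ds^2=2(dx_{11}dx_{22}-dx_{12}dx_{21})$ and $dx_{11}\wedge dx_{21}\wedge dx_{12}\wedge dx_{22}$; a 2-form $\omega$ is ASD if $*\omega=-\omega$ (on each chart the ASD forms are spanned by $dx_{11}\wedge dx_{12}$, $dx_{21}\wedge dx_{22}$, $dx_{11}\wedge dx_{22}-dx_{12}\wedge dx_{21}$). $\mathcal{P}$ is the tautological rank-2 bundle on $Gr$ (fibre at $p$ is $p$), with standard frame over $U_g$ given by the columns of $g\begin{pmatrix} X \\ I \end{pmatrix}$. $\widetilde{\varepsilon[-1]}$ is the line bundle whose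 sections are families of functions $(f_g)_{g\in SL(4,\mathbb{R})}$ on $M_2(\mathbb{R})$ with $f_h\circ\Psi_{g,h}=|\det(k_{21}X+k_{22})|f_g$. The global t'Hooft ansatz $\phi$ sends a nowhere vanishing section $s=(f_g)$ to the connection on $\mathcal{P}$ whose potential in the standard frame over $U_g$ is $A(f_g)=-\frac{1}{f_g}\frac{\partial f_g}{\partial X}dX$, where $\frac{\partial f}{\partial X}=\begin{pmatrix} \partial f/\partial x_{11} & \partial f/\partial x_{21} \\ \partial f/\partial x_{12} & \partial f/\partial x_{22} \end{pmatrix}$ and $dX=(dx_{ij})$. X-ray transform: a smooth function $F$ on $\mathbb{R}^4\setminus\{0\}$ which is homogeneous of degree $-2$ (i.e. a section of the line bundle $\varepsilon(-2)$ on $\mathbb{R}\mathbb{P}^3$) is sent to the section of $\widetilde{\varepsilon[-1]}$ given on $U_g$ by $f_g(X)=\frac{1}{2\pi}\int_0^{2\pi}F\left(g\begin{pmatrix} X \\ I \end{pmatrix}\begin{pmatrix} \cos\theta \\ \sin\theta \end{pmatrix}\right)d\theta$; it is a bijection onto $\ker\square_{2,2}$, where $\square_{2,2}=\frac{\partial^2}{\partial x_{11}\partial x_{22}}-\frac{\partial^2}{\partial x_{12}\partial x_{21}}$ on each chart. Applying the t'Hooft ansatz to $F$ means applying $\phi$ to the X-ray transform of $F$ (when nowhere vanishing). The basic split anti-instanton is the $O(2)$-ASDYM solution on $Gr$ given by $\mathcal{P}\subset Gr\times\mathbb{R}^4$ with the orthogonal projection (for the standard inner product on $\mathbb{R}^4$)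 of the trivial connection; on the chart $X\mapsto\begin{pmatrix} X \\ I \end{pmatrix}$ its connection potential is $(1+X^tX)^{-1}X^tdX$. An $O(2)$-ASDYM solution is a real rank-2 bundle with fibrewise inner product and compatible connection with ASD curvature $C$; its topological charge is $-\frac{1}{8\pi^2}\int\mathrm{tr}(C\wedge C)$. $SL(4,\mathbb{R})$ acts on $Gr$ by its linear action on planes and hence on solutions by pull-back. A split anti-instanton of topological charge $-1$ is an $O(2)$-ASDYM solution of topological charge $-1$ on $Gr$ which is invariant (up to gauge transformation) under some maximal compact subgroup of $SL(4,\mathbb{R})$. Bundles are considered up to T-isomorphism, i.e. up to isomorphism and tensoring with the nontrivial (flat) real line bundle on $Gr$. *)

theory Defs
  imports "HOL-Analysis.Analysis" "HOL-Algebra.Group" "HOL-Combinatorics.Permutations"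
begin

section \<open>Smooth functions on open subsets of Euclidean spaces\<close>

primrec Ck_on :: "nat \<Rightarrow> 'a::euclidean_space set \<Rightarrow> ('a \<Rightarrow> 'b::real_normed_vector) \<Rightarrow> bool" where
  "Ck_on 0 S f \<longleftrightarrow> continuous_on S f"
| "Ck_on (Suc n) S f \<longleftrightarrow>
     (\<forall>x\<in>S. f differentiable (at x)) \<and> (\<forall>v. Ck_on n S (\<lambda>x. frechet_derivative f (at x) v))"

text \<open>Only meaningful for open \<open>S\<close>, and only used for such.\<close>

definition smooth_on :: "'a::euclidean_space set \<Rightarrow> ('a \<Rightarrow> 'b::real_normed_vector) \<Rightarrow> bool" where
  "smooth_on S f \<longleftrightarrow> (\<forall>n. Ck_on n S f)"


section \<open>The Grassmannian and its charts\<close>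

type_synonym M2 = "real^2^2"

definition SL4 :: "(real^4^4) monoid" where
  "SL4 = \<lparr>carrier = {g. det g = 1}, mult = (**), one = mat 1\<rparr>"

definition Gr :: "(real^4) set set" where
  "Gr = {p. subspace p \<and> dim p = 2}"

definition stack :: "M2 \<Rightarrow> M2 \<Rightarrow> real^2^4" where
  "stack X Y = vector [X $ 1, X $ 2, Y $ 1, Y $ 2]"

definition upper_block :: "real^2^4 \<Rightarrow> M2" where
  "upper_block M = vector [M $ 1, M $ 2]"

definition lower_block :: "real^2^4 \<Rightarrow> M2" where
  "lower_block M = vector [M $ 3, M $ 4]"

text \<open>The columns of \<open>std_frame g X\<close> are the standard frame of the tautological bundle over \<open>U\<^sub>g\<close>.\<close>

definition std_frame :: "real^4^4 \<Rightarrow> M2 \<Rightarrow> real^2^4" where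
  "std_frame g X = g ** stack X (mat 1)"

definition Psi :: "real^4^4 \<Rightarrow> M2 \<Rightarrow> (real^4) set" where
  "Psi g X = span (columns (std_frame g X))"

text \<open>With \<open>k = h\<inverse> g\<close> in \<open>2 \<times> 2\<close> blocks, \<open>chart_num g h X = k\<^sub>1\<^sub>1 X + k\<^sub>1\<^sub>2\<close> and
  \<open>chart_den g h X = k\<^sub>2\<^sub>1 X + k\<^sub>2\<^sub>2\<close>.\<close>

definition chart_num :: "real^4^4 \<Rightarrow> real^4^4 \<Rightarrow> M2 \<Rightarrow> M2" where
  "chart_num g h X = upper_block ((matrix_inv h ** g) ** stack X (mat 1))"

definition chart_den :: "real^4^4 \<Rightarrow> real^4^4 \<Rightarrow> M2 \<Rightarrow> M2" where
  "chart_den g h X = lower_block ((matrix_inv h ** g) ** stack X (mat 1))"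

definition chart_change :: "real^4^4 \<Rightarrow> real^4^4 \<Rightarrow> M2 \<Rightarrow> M2" where
  "chart_change g h X = chart_num g h X ** matrix_inv (chart_den g h X)"


section \<open>Forms on a chart\<close>

text \<open>A matrix-valued 1-form on (an open part of) a chart is a function \<open>A X V\<close> of the point \<open>X\<close>
  and the tangent vector \<open>V\<close>; a 2-form at a point is a function of two tangent vectors.
  The oriented coordinates are \<open>x\<^sub>1\<^sub>1, x\<^sub>2\<^sub>1, x\<^sub>1\<^sub>2, x\<^sub>2\<^sub>2\<close>, in this order.\<close>

definition coords :: "M2 \<Rightarrow> real^4" where
  "coords V = vector [V $ 1 $ 1, V $ 2 $ 1, V $ 1 $ 2, V $ 2 $ 2]"

definition coord_basis :: "4 \<Rightarrow> M2" where
  "coord_basis i = (THE V. coords V = axis i 1)"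

definition volume_form :: "M2 \<Rightarrow> M2 \<Rightarrow> M2 \<Rightarrow> M2 \<Rightarrow> real" where
  "volume_form V1 V2 V3 V4 = det (vector [coords V1, coords V2, coords V3, coords V4] :: real^4^4)"

text \<open>The symmetric bilinear form of \<open>ds\<^sup>2 = 2 (dx\<^sub>1\<^sub>1 dx\<^sub>2\<^sub>2 - dx\<^sub>1\<^sub>2 dx\<^sub>2\<^sub>1)\<close>; its Gram matrix in the
  coordinate basis has determinant 1, so \<open>volume_form\<close> is its volume form.\<close>

definition split_metric :: "M2 \<Rightarrow> M2 \<Rightarrow> real" where
  "split_metric V W =
     V $ 1 $ 1 * W $ 2 $ 2 + V $ 2 $ 2 * W $ 1 $ 1 - V $ 1 $ 2 * W $ 2 $ 1 - V $ 2 $ 1 * W $ 1 $ 2"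

text \<open>The vector corresponding to the \<open>i\<close>-th coordinate 1-form under the metric.\<close>

definition dual_basis :: "4 \<Rightarrow> M2" where
  "dual_basis i = (THE U. \<forall>V. split_metric U V = coords V $ i)"

text \<open>\<open>(*\<omega>)\<^sub>k\<^sub>l = 1/2 \<omega>\<^sup>i\<^sup>j vol\<^sub>i\<^sub>j\<^sub>k\<^sub>l\<close>. On 2-forms in dimension 4 the star depends only on the conformal
  class and the orientation, so it may be computed in any of the charts.\<close>

definition hodge_star :: "(M2 \<Rightarrow> M2 \<Rightarrow> 'b::real_vector) \<Rightarrow> M2 \<Rightarrow> M2 \<Rightarrow> 'b" where
  "hodge_star \<omega> V W = (1/2) *\<^sub>R (\<Sum>i\<in>UNIV. \<Sum>j\<in>UNIV.
     volume_form (coord_basis i) (coord_basis j) V W *\<^sub>R \<omega> (dual_basis i) (dual_basis j))"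

text \<open>\<open>dA + A \<and> A\<close>\<close>

definition curvature :: "(M2 \<Rightarrow> M2 \<Rightarrow> M2) \<Rightarrow> M2 \<Rightarrow> M2 \<Rightarrow> M2 \<Rightarrow> M2" where
  "curvature A X V W =
     frechet_derivative (\<lambda>Y. A Y W) (at X) V - frechet_derivative (\<lambda>Y. A Y V) (at X) W
     + A X V ** A X W - A X W ** A X V"

text \<open>The coefficient of \<open>tr (C \<and> C)\<close> with respect to
  \<open>dx\<^sub>1\<^sub>1 \<and> dx\<^sub>2\<^sub>1 \<and> dx\<^sub>1\<^sub>2 \<and> dx\<^sub>2\<^sub>2\<close>, for a matrix-valued 2-form \<open>C\<close> at a point.\<close>

definition trace_wedge_square :: "(M2 \<Rightarrow> M2 \<Rightarrow> M2) \<Rightarrow> real" where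
  "trace_wedge_square C = (1/4) * (\<Sum>p | p permutes (UNIV :: 4 set).
     of_int (sign p) * trace (C (coord_basis (p 1)) (coord_basis (p 2)) **
                              C (coord_basis (p 3)) (coord_basis (p 4))))"


section \<open>Rank-2 bundles with fibre metric and connection\<close>

text \<open>A real rank-2 vector bundle on \<open>Gr\<close> is given by local frames over an arbitrary open cover by
  coordinate patches: the patch \<open>i\<close> is the image under \<open>Psi (chart i)\<close> of the open set
  \<open>patch_dom i\<close>. Everything on patch \<open>i\<close> is expressed in the coordinate \<open>X\<close> of that chart.
  If \<open>e\<^sub>i\<close> (a row of two sections) is the frame on patch \<open>i\<close>, then \<open>e\<^sub>i = e\<^sub>j \<cdot> trans i j\<close> on overlaps,
  \<open>\<nabla> e\<^sub>i = e\<^sub>i \<cdot> pot i\<close>, and \<open>gram i\<close> is the Gram matrix of \<open>e\<^sub>i\<close> for the fibrewise inner product.\<close>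

record 'i metric_bundle =
  patches :: "'i set"
  chart :: "'i \<Rightarrow> real^4^4"
  patch_dom :: "'i \<Rightarrow> M2 set"
  trans :: "'i \<Rightarrow> 'i \<Rightarrow> M2 \<Rightarrow> M2"
  pot :: "'i \<Rightarrow> M2 \<Rightarrow> M2 \<Rightarrow> M2"
  gram :: "'i \<Rightarrow> M2 \<Rightarrow> M2"

text \<open>The part of the first patch lying in the second one, in the coordinate of the first. The two
  patches may belong to different bundles.\<close>

definition overlap :: "('i, 'x) metric_bundle_scheme \<Rightarrow> 'i \<Rightarrow> ('j, 'y) metric_bundle_scheme \<Rightarrow> 'j \<Rightarrow> M2 set" where
  "overlap E i E' j = {X \<in> patch_dom E i. det (chart_den (chart E i) (chart E' j) X) \<noteq> 0 \<and>
     chart_change (chart E i) (chart E' j) X \<in> patch_dom E' j}"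

definition is_vector_bundle :: "'i metric_bundle \<Rightarrow> bool" where
  "is_vector_bundle E \<longleftrightarrow>
     (\<forall>i\<in>patches E. chart E i \<in> carrier SL4 \<and> open (patch_dom E i)) \<and>
     Gr = (\<Union>i\<in>patches E. Psi (chart E i) ` patch_dom E i) \<and>
     (\<forall>i\<in>patches E. \<forall>j\<in>patches E.
        smooth_on (overlap E i E j) (trans E i j) \<and>
        (\<forall>X\<in>overlap E i E j. det (trans E i j X) \<noteq> 0)) \<and>
     (\<forall>i\<in>patches E. \<forall>X\<in>patch_dom E i. trans E i i X = mat 1) \<and>
     (\<forall>i\<in>patches E. \<forall>j\<in>patches E. \<forall>k\<in>patches E. \<forall>X \<in> overlap E i E j \<inter> overlap E i E k.
        trans E i k X = trans E j k (chart_change (chart E i) (chart E j) X) ** trans E i j X)"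

definition is_connection :: "'i metric_bundle \<Rightarrow> bool" where
  "is_connection E \<longleftrightarrow>
     (\<forall>i\<in>patches E. (\<forall>X\<in>patch_dom E i. linear (pot E i X)) \<and>
        (\<forall>V. smooth_on (patch_dom E i) (\<lambda>X. pot E i X V))) \<and>
     (\<forall>i\<in>patches E. \<forall>j\<in>patches E. \<forall>X\<in>overlap E i E j. \<forall>V.
        let T = trans E i j; \<psi> = chart_change (chart E i) (chart E j) in
        pot E i X V =
          matrix_inv (T X) ** pot E j (\<psi> X) (frechet_derivative \<psi> (at X) V) ** T X
          + matrix_inv (T X) ** frechet_derivative T (at X) V)"

definition is_fibre_metric :: "'i metric_bundle \<Rightarrow> bool" where
  "is_fibre_metric E \<longleftrightarrow>
     (\<forall>i\<in>patches E. smooth_on (patch_dom E i) (gram E i) \<and>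
        (\<forall>X\<in>patch_dom E i. transpose (gram E i X) = gram E i X \<and>
           (\<forall>v. v \<noteq> 0 \<longrightarrow> v \<bullet> (gram E i X *v v) > 0))) \<and>
     (\<forall>i\<in>patches E. \<forall>j\<in>patches E. \<forall>X\<in>overlap E i E j.
        gram E i X = transpose (trans E i j X) **
          gram E j (chart_change (chart E i) (chart E j) X) ** trans E i j X)"

definition metric_compatible :: "'i metric_bundle \<Rightarrow> bool" where
  "metric_compatible E \<longleftrightarrow> (\<forall>i\<in>patches E. \<forall>X\<in>patch_dom E i. \<forall>V.
     frechet_derivative (gram E i) (at X) V =
       transpose (pot E i X V) ** gram E i X + gram E i X ** pot E i X V)"

definition ASD_curvature :: "'i metric_bundle \<Rightarrow> bool" where
  "ASD_curvature E \<longleftrightarrow> (\<forall>i\<in>patches E. \<forall>X\<in>patch_dom E i. \<forall>V W.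
     hodge_star (curvature (pot E i) X) V W = - curvature (pot E i) X V W)"

definition O2_ASDYM_solution :: "'i metric_bundle \<Rightarrow> bool" where
  "O2_ASDYM_solution E \<longleftrightarrow> is_vector_bundle E \<and> is_connection E \<and> is_fibre_metric E \<and>
     metric_compatible E \<and> ASD_curvature E"


section \<open>Topological charge\<close>

text \<open>A finite smooth partition of unity on \<open>Gr\<close> with \<open>\<rho> i\<close> compactly supported in patch \<open>i\<close>.\<close>

definition partition_of_unity ::
    "'i metric_bundle \<Rightarrow> 'i set \<Rightarrow> ('i \<Rightarrow> (real^4) set \<Rightarrow> real) \<Rightarrow> bool" where
  "partition_of_unity E J \<rho> \<longleftrightarrow> finite J \<and> J \<subseteq> patches E \<and>
     (\<forall>i\<in>J. (\<forall>g\<in>carrier SL4. smooth_on UNIV (\<lambda>X. \<rho> i (Psi g X))) \<and>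
        (\<forall>p\<in>Gr. \<rho> i p \<ge> 0) \<and>
        (\<exists>S. compact S \<and> S \<subseteq> patch_dom E i \<and> (\<forall>p\<in>Gr. \<rho> i p \<noteq> 0 \<longrightarrow> p \<in> Psi (chart E i) ` S))) \<and>
     (\<forall>p\<in>Gr. (\<Sum>i\<in>J. \<rho> i p) = 1)"

text \<open>\<open>c = - 1/(8 \<pi>\<^sup>2) \<integral> tr (C \<and> C)\<close>, the integral over the compact oriented manifold \<open>Gr\<close> being computed
  with a partition of unity (the value does not depend on it).\<close>

definition has_topological_charge :: "'i metric_bundle \<Rightarrow> real \<Rightarrow> bool" where
  "has_topological_charge E c \<longleftrightarrow> (\<exists>J \<rho>. partition_of_unity E J \<rho> \<and>
     c = - (1 / (8 * pi\<^sup>2)) * (\<Sum>i\<in>J. integral (patch_dom E i)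
           (\<lambda>X. \<rho> i (Psi (chart E i) X) * trace_wedge_square (curvature (pot E i) X))))"


section \<open>Gauge equivalence and T-isomorphism\<close>

text \<open>An isometric, connection-preserving bundle isomorphism covering the identity of \<open>Gr\<close>; it
  sends the frame \<open>e\<^sub>i\<close> of \<open>E\<close> to \<open>e'\<^sub>j \<cdot> u i j\<close>, where \<open>e'\<^sub>j\<close> is the frame of \<open>E'\<close>.\<close>

definition gauge_equivalence ::
    "'i metric_bundle \<Rightarrow> 'j metric_bundle \<Rightarrow> ('i \<Rightarrow> 'j \<Rightarrow> M2 \<Rightarrow> M2) \<Rightarrow> bool" where
  "gauge_equivalence E E' u \<longleftrightarrow>
     (\<forall>i\<in>patches E. \<forall>j\<in>patches E'.
        smooth_on (overlap E i E' j) (u i j) \<and>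
        (\<forall>X\<in>overlap E i E' j. det (u i j X) \<noteq> 0 \<and>
           (let \<psi> = chart_change (chart E i) (chart E' j) in
             gram E i X = transpose (u i j X) ** gram E' j (\<psi> X) ** u i j X \<and>
             (\<forall>V. pot E i X V =
                matrix_inv (u i j X) ** pot E' j (\<psi> X) (frechet_derivative \<psi> (at X) V) ** u i j X
                + matrix_inv (u i j X) ** frechet_derivative (u i j) (at X) V)))) \<and>
     (\<forall>i\<in>patches E. \<forall>k\<in>patches E. \<forall>j\<in>patches E'. \<forall>l\<in>patches E'.
        \<forall>X \<in> overlap E i E k \<inter> overlap E i E' j \<inter> overlap E i E' l.
          u k l (chart_change (chart E i) (chart E k) X) ** trans E i k X =
          trans E' j l (chart_change (chart E i) (chart E' j) X) ** u i j X)"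

definition gauge_equivalent :: "'i metric_bundle \<Rightarrow> 'j metric_bundle \<Rightarrow> bool" where
  "gauge_equivalent E E' \<longleftrightarrow> (\<exists>u. gauge_equivalence E E' u)"

text \<open>Tensor product with the nontrivial flat real line bundle, i.e. the orientation bundle of the
  tautological bundle, whose transition functions are the signs of \<open>det (k\<^sub>2\<^sub>1 X + k\<^sub>2\<^sub>2)\<close>.\<close>

definition flat_twist :: "'i metric_bundle \<Rightarrow> 'i metric_bundle" where
  "flat_twist E = E\<lparr>trans :=
     (\<lambda>i j X. sgn (det (chart_den (chart E i) (chart E j) X)) *\<^sub>R trans E i j X)\<rparr>"

definition T_isomorphic :: "'i metric_bundle \<Rightarrow> 'j metric_bundle \<Rightarrow> bool" where
  "T_isomorphic E E' \<longleftrightarrow> gauge_equivalent E E' \<or> gauge_equivalent (flat_twist E) E'"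


section \<open>Split anti-instantons\<close>

text \<open>The pull-back under \<open>p \<mapsto> k p\<close>: patch \<open>i\<close> is replaced by its preimage, and since
  \<open>k (Psi (k\<inverse> g) X) = Psi g X\<close> the coordinate expressions do not change.\<close>

definition pull_back :: "real^4^4 \<Rightarrow> 'i metric_bundle \<Rightarrow> 'i metric_bundle" where
  "pull_back k E = E\<lparr>chart := (\<lambda>i. matrix_inv k ** chart E i)\<rparr>"

definition maximal_compact_subgroup :: "(real^4^4) set \<Rightarrow> bool" where
  "maximal_compact_subgroup K \<longleftrightarrow> subgroup K SL4 \<and> compact K \<and>
     (\<forall>K'. subgroup K' SL4 \<and> compact K' \<and> K \<subseteq> K' \<longrightarrow> K' = K)"

definition split_anti_instanton_charge_minus_1 :: "'i metric_bundle \<Rightarrow> bool" where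
  "split_anti_instanton_charge_minus_1 E \<longleftrightarrow> O2_ASDYM_solution E \<and> has_topological_charge E (-1) \<and>
     (\<exists>K. maximal_compact_subgroup K \<and> (\<forall>k\<in>K. T_isomorphic (pull_back k E) E))"

text \<open>The tautological bundle in its standard frames, with a connection given by its potentials \<open>A\<close>
  and a fibre metric given by its Gram matrices \<open>\<mu>\<close> in these frames.\<close>

definition tautological ::
    "(real^4^4 \<Rightarrow> M2 \<Rightarrow> M2 \<Rightarrow> M2) \<Rightarrow> (real^4^4 \<Rightarrow> M2 \<Rightarrow> M2) \<Rightarrow> (real^4^4) metric_bundle" where
  "tautological A \<mu> = \<lparr>patches = carrier SL4, chart = (\<lambda>g. g), patch_dom = (\<lambda>g. UNIV),
     trans = chart_den, pot = A, gram = \<mu>\<rparr>"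

definition orth_proj :: "(real^4) set \<Rightarrow> real^4 \<Rightarrow> real^4" where
  "orth_proj S v = (THE u. u \<in> S \<and> (\<forall>w\<in>S. orthogonal (v - u) w))"

text \<open>Projection of the trivial connection of \<open>Gr \<times> \<real>\<^sup>4\<close>: the derivative of the \<open>j\<close>-th frame vector
  in direction \<open>V\<close>, projected to the plane \<open>Psi g X\<close>, is the combination of the frame vectors with
  coefficients in the \<open>j\<close>-th column of the potential. Potentials are made \<open>undefined\<close> for
  \<open>g \<notin> SL(4,\<real>)\<close>, so that equality of potentials means equality on all charts.\<close>

definition projected_pot :: "real^4^4 \<Rightarrow> M2 \<Rightarrow> M2 \<Rightarrow> M2" where
  "projected_pot = (\<lambda>g\<in>carrier SL4. \<lambda>X V. THE A. \<forall>j.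
     column j (std_frame g X ** A) =
     orth_proj (Psi g X) (column j (frechet_derivative (std_frame g) (at X) V)))"

definition euclidean_gram :: "real^4^4 \<Rightarrow> M2 \<Rightarrow> M2" where
  "euclidean_gram g X = transpose (std_frame g X) ** std_frame g X"

definition basic_split_anti_instanton :: "(real^4^4) metric_bundle" where
  "basic_split_anti_instanton = tautological projected_pot euclidean_gram"


section \<open>The t'Hooft ansatz and the X-ray transform\<close>

text \<open>Nowhere vanishing smooth sections of \<open>\<epsilon>[-1]\<close> with the tilde (absolute value of the determinant).\<close>

definition nowhere_vanishing_section :: "(real^4^4 \<Rightarrow> M2 \<Rightarrow> real) \<Rightarrow> bool" where
  "nowhere_vanishing_section f \<longleftrightarrow>
     (\<forall>g\<in>carrier SL4. smooth_on UNIV (f g) \<and> (\<forall>X. f g X \<noteq> 0)) \<and>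
     (\<forall>g\<in>carrier SL4. \<forall>h\<in>carrier SL4. \<forall>X. det (chart_den g h X) \<noteq> 0 \<longrightarrow>
        f h (chart_change g h X) = \<bar>det (chart_den g h X)\<bar> * f g X)"

text \<open>The entry of \<open>\<partial>f/\<partial>X\<close> in row \<open>i\<close> and column \<open>j\<close> is \<open>\<partial>f/\<partial>x\<^sub>j\<^sub>i\<close>.\<close>

definition matrix_derivative :: "(M2 \<Rightarrow> real) \<Rightarrow> M2 \<Rightarrow> M2" where
  "matrix_derivative f X = (\<chi> i j. frechet_derivative f (at X) (axis j (axis i 1)))"

definition thooft_pot :: "(real^4^4 \<Rightarrow> M2 \<Rightarrow> real) \<Rightarrow> real^4^4 \<Rightarrow> M2 \<Rightarrow> M2 \<Rightarrow> M2" where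
  "thooft_pot f = (\<lambda>g\<in>carrier SL4. \<lambda>X V. - (1 / f g X) *\<^sub>R (matrix_derivative (f g) X ** V))"

definition xray :: "(real^4 \<Rightarrow> real) \<Rightarrow> real^4^4 \<Rightarrow> M2 \<Rightarrow> real" where
  "xray F g X = 1 / (2 * pi) *
     integral {0..2 * pi} (\<lambda>\<theta>. F (std_frame g X *v vector [cos \<theta>, sin \<theta>]))"

text \<open>Those functions on \<open>\<real>\<^sup>4 - {0}\<close> to which the ansatz can be applied.\<close>

definition thooft_applicable :: "(real^4 \<Rightarrow> real) \<Rightarrow> bool" where
  "thooft_applicable F \<longleftrightarrow> smooth_on (- {0}) F \<and>
     (\<forall>c x. c \<noteq> 0 \<and> x \<noteq> 0 \<longrightarrow> F (c *\<^sub>R x) = F x / c\<^sup>2) \<and>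
     nowhere_vanishing_section (xray F)"

end

theory Submission
  imports Defs "HOL-Real_Asymp.Real_Asymp"
begin

text \<open>The proof identifies a solution through its curvature. A maximal compact subgroup of
  \<open>SL(4,\<real>)\<close> is the special orthogonal group of an inner product, with Gram matrix \<open>transpose h ** h\<close>
  say. It acts transitively on \<open>Gr\<close>, and the isotropy group of a plane leaves invariant, up to sign,
  only a line of ASD 2-forms; so the curvature of an invariant solution is, up to sign, a constant
  multiple of that of the pull-back of the basic solution by \<open>h\<close>, and the topological charge shows that
  the constant is \<open>\<plusminus>1\<close>. In orthonormal frames an \<open>O(2)\<close>-connection is a real 1-form determined by its
  curvature up to exact forms. Hence local gauge transformations to the pull-back exist, and two of
  them differ by a constant rotation, whose sense depends on an orientation of the fibre. They form a
  flat circle bundle twisted by the orientation bundle of the tautological bundle. Such a bundle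
  has a global section: it has one over each chart, and across the two components of an overlap the two
  rotation angles are removed together because they enter with opposite signs. Finally, the pull-back of
  the basic solution comes from the ansatz, since the X-ray transform of the inverse square norm of
  \<open>h x\<close> is \<open>det (transpose M ** M) powr (-1/2)\<close> with \<open>M = h g (X, I)\<close>.\<close>

text \<open>The final gluing succeeds for a cohomological reason. The fundamental group of
  \<open>Gr\<close> has order two and its generator inverts the circle, so a twisted flat circle
  bundle is given by one angle, and rotating the reference section by b changes that angle by 2 b:
  the class always vanishes. Thus a gauge equivalence is obtained, not only a T-isomorphism. The
  twist is forced by the curvature, which vanishes nowhere and so decides the sign of the
  determinant of every local gauge transformation. The obstacle throughout is orientation. A change
  of frame with negative determinant reverses the generator of the rotations of the fibre, so the
  curvature coefficient is defined only up to sign, and this sign is carried along until local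
  sections fix it. Moreover the cover of a bundle is arbitrary; hence sections are families indexed
  by its patches, but are studied over sets of planes. The charge is a volume computation: the
  inverse square of the Gram determinant integrates over a chart to 2 \<pi>^2, and t times the basic
  curvature gives 4 t^2 times this density for the trace of its wedge square; so the charge is -
  t^2.\<close>

lemma vector_4 [simp]:
  "(vector [a, b, c, d] :: 'a::zero^4) $ 1 = a" "(vector [a, b, c, d] :: 'a^4) $ 2 = b"
  "(vector [a, b, c, d] :: 'a^4) $ 3 = c" "(vector [a, b, c, d] :: 'a^4) $ 4 = d"
  by (simp_all add: vector_def)

section \<open>Matrix inverses and the bilinearity of the matrix product\<close>

lemma matrix_inv_props:
  fixes A :: "real^'n^'n"
  assumes "det A \<noteq> 0"
  shows "matrix_inv A ** A = mat 1" "A ** matrix_inv A = mat 1"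
proof -
  have "invertible A" using assms by (simp add: invertible_det_nz)
  then have "A ** matrix_inv A = mat 1 \<and> matrix_inv A ** A = mat 1"
    unfolding invertible_def matrix_inv_def by (rule someI_ex)
  then show "matrix_inv A ** A = mat 1" "A ** matrix_inv A = mat 1" by auto
qed

lemma matrix_inv_eqI:
  fixes A :: "real^'n^'n"
  assumes "B ** A = mat 1"
  shows "matrix_inv A = B"
proof -
  have "det B * det A = 1" using assms by (metis det_I det_mul)
  then have "det A \<noteq> 0" by auto
  then have "A ** matrix_inv A = mat 1" by (rule matrix_inv_props)
  then have "B ** (A ** matrix_inv A) = B" by simp
  then show ?thesis using assms by (simp add: matrix_mul_assoc)
qed

lemma det_matrix_inv:
  fixes A :: "real^'n^'n"
  assumes "det A \<noteq> 0"
  shows "det (matrix_inv A) = 1 / det A"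
  using matrix_inv_props(1)[OF assms] assms by (metis det_I det_mul nonzero_eq_divide_eq)

lemma matrix_inv_mult:
  fixes A B :: "real^'n^'n"
  assumes "det A \<noteq> 0" "det B \<noteq> 0"
  shows "matrix_inv (A ** B) = matrix_inv B ** matrix_inv A"
proof (rule matrix_inv_eqI)
  have "matrix_inv B ** matrix_inv A ** (A ** B) = matrix_inv B ** (matrix_inv A ** A) ** B"
    by (simp only: matrix_mul_assoc)
  then show "matrix_inv B ** matrix_inv A ** (A ** B) = mat 1"
    using assms by (simp add: matrix_inv_props)
qed

lemma matrix_inv_inv:
  fixes A :: "real^'n^'n"
  assumes "det A \<noteq> 0"
  shows "matrix_inv (matrix_inv A) = A"
  using assms by (intro matrix_inv_eqI) (simp add: matrix_inv_props)

lemma matrix_inv_mat_1: "matrix_inv (mat 1 :: real^'n^'n) = mat 1"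
  by (rule matrix_inv_eqI) simp

lemma matrix_inv_transpose:
  fixes A :: "real^'n^'n"
  assumes "det A \<noteq> 0"
  shows "matrix_inv (transpose A) = transpose (matrix_inv A)"
  using assms by (intro matrix_inv_eqI)
    (metis matrix_inv_props(2) matrix_transpose_mul transpose_mat)

lemma matrix_cancel_left:
  fixes A :: "real^'n^'n"
  assumes "det A \<noteq> 0"
  shows "A ** X = A ** Y \<longleftrightarrow> X = Y"
  by (metis assms matrix_inv_props(1) matrix_mul_assoc matrix_mul_lid)

lemma matrix_cancel_right:
  fixes A :: "real^'n^'n"
  assumes "det A \<noteq> 0"
  shows "X ** A = Y ** A \<longleftrightarrow> X = Y"
  by (metis assms matrix_inv_props(2) matrix_mul_assoc matrix_mul_rid)

lemma matrix_inv_mult_cancel: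
  fixes A :: "real^'n^'n"
  assumes "det A \<noteq> 0"
  shows "matrix_inv A ** (A ** X) = X" "A ** (matrix_inv A ** X) = X"
    "Y ** A ** matrix_inv A = Y" "Y ** matrix_inv A ** A = Y"
  using assms by (simp_all add: matrix_mul_assoc matrix_inv_props)
    (simp_all add: matrix_mul_assoc[symmetric] matrix_inv_props)

lemma bounded_bilinear_matrix_mult:
  "bounded_bilinear ((**) :: real^'n^'m \<Rightarrow> real^'p^'n \<Rightarrow> real^'p^'m)"
proof -
  have "bilinear ((**) :: real^'n^'m \<Rightarrow> real^'p^'n \<Rightarrow> real^'p^'m)"
    unfolding bilinear_def by (auto intro!: linearI
      simp: vec_eq_iff matrix_matrix_mult_def sum.distrib algebra_simps sum_distrib_left)
  then show ?thesis by (simp add: bilinear_conv_bounded_bilinear)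
qed

lemmas matrix_mult_diff_distrib =
  bounded_bilinear.diff_left[OF bounded_bilinear_matrix_mult]
  bounded_bilinear.diff_right[OF bounded_bilinear_matrix_mult]

lemmas matrix_mult_add_distrib =
  bounded_bilinear.add_left[OF bounded_bilinear_matrix_mult]
  bounded_bilinear.add_right[OF bounded_bilinear_matrix_mult]

lemmas matrix_mult_minus_distrib =
  bounded_bilinear.minus_left[OF bounded_bilinear_matrix_mult]
  bounded_bilinear.minus_right[OF bounded_bilinear_matrix_mult]

lemmas matrix_mult_scaleR =
  bounded_bilinear.scaleR_left[OF bounded_bilinear_matrix_mult]
  bounded_bilinear.scaleR_right[OF bounded_bilinear_matrix_mult]

lemmas matrix_mult_zero =
  bounded_bilinear.zero_left[OF bounded_bilinear_matrix_mult]
  bounded_bilinear.zero_right[OF bounded_bilinear_matrix_mult]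

lemmas matrix_mult_algebra = matrix_mult_diff_distrib matrix_mult_add_distrib
  matrix_mult_minus_distrib matrix_mult_scaleR matrix_mult_zero

lemmas has_derivative_matrix_mult = bounded_bilinear.FDERIV[OF bounded_bilinear_matrix_mult]

lemma bounded_linear_transpose:
  "bounded_linear (transpose :: real^'n^'m \<Rightarrow> real^'m^'n)"
proof -
  have "linear (transpose :: real^'n^'m \<Rightarrow> real^'m^'n)"
    by (rule linearI) (simp_all add: vec_eq_iff transpose_def)
  then show ?thesis by (simp add: linear_conv_bounded_linear)
qed

lemma bounded_linear_trace: "bounded_linear (trace :: real^'n^'n \<Rightarrow> real)"
proof -
  have "linear (trace :: real^'n^'n \<Rightarrow> real)"
    by (rule linearI) (simp_all add: trace_def sum.distrib sum_distrib_left)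
  then show ?thesis by (simp add: linear_conv_bounded_linear)
qed

section \<open>Two by two matrices\<close>

lemmas M2_simps = vec_eq_iff forall_2 sum_2 matrix_matrix_mult_def transpose_def mat_def det_2

lemma mat2_eqI:
  fixes A B :: M2
  assumes "A$1$1 = B$1$1" "A$1$2 = B$1$2" "A$2$1 = B$2$1" "A$2$2 = B$2$2"
  shows "A = B"
  using assms by (simp add: vec_eq_iff forall_2)

text \<open>The quarter turn; the skew 2x2 matrices, which form the Lie algebra of O(2), are its
  multiples.\<close>

definition J2 :: M2 where
  "J2 = vector [vector [0, -1], vector [1, 0]]"

lemma J2_nth [simp]: "J2$1$1 = 0" "J2$1$2 = -1" "J2$2$1 = 1" "J2$2$2 = 0"
  by (simp_all add: J2_def)

definition adj2 :: "M2 \<Rightarrow> M2" where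
  "adj2 A = vector [vector [A$2$2, - A$1$2], vector [- A$2$1, A$1$1]]"

lemma adj2_nth [simp]: "adj2 A$1$1 = A$2$2" "adj2 A$1$2 = - A$1$2" "adj2 A$2$1 = - A$2$1" "adj2 A$2$2 = A$1$1"
  by (simp_all add: adj2_def)

lemma adj2_mult: "adj2 A ** A = det A *\<^sub>R mat 1"
  by (rule mat2_eqI) (simp_all add: M2_simps algebra_simps)

lemma matrix_inv2: "det A \<noteq> 0 \<Longrightarrow> matrix_inv A = (1 / det A) *\<^sub>R adj2 A" for A :: M2
  by (intro matrix_inv_eqI) (simp add: matrix_mult_scaleR adj2_mult)

lemma J2_sq: "J2 ** J2 = - mat 1"
  by (rule mat2_eqI) (simp_all add: M2_simps)

lemma det_J2 [simp]: "det J2 = 1" by (simp add: det_2)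

text \<open>\<open>J2\<close> is the Gram matrix of an area form, which a linear map multiplies by
  its determinant.\<close>

lemma congruence_J2: "transpose A ** J2 ** A = det A *\<^sub>R J2"
  by (rule mat2_eqI) (simp_all add: M2_simps algebra_simps)

lemma congruence_J2': "A ** J2 ** transpose A = det A *\<^sub>R J2"
  by (rule mat2_eqI) (simp_all add: M2_simps algebra_simps)

lemma antisym2_eq:
  fixes A :: M2
  assumes "transpose A = - A"
  shows "A = (A$2$1) *\<^sub>R J2"
proof -
  have *: "A $ j $ i = - A $ i $ j" for i j
    using arg_cong[OF assms, of "\<lambda>B. B $ i $ j"]
    by (simp only: transpose_def vec_lambda_beta vector_uminus_component)
  show ?thesis using *[of 1 1] *[of 2 2] *[of 2 1] by (intro mat2_eqI) auto
qed

lemma sym2_eq: "transpose S = S \<Longrightarrow> S $ i $ j = S $ j $ i" for S :: "real^'n^'n"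
  by (drule arg_cong[of _ _ "\<lambda>B. B $ j $ i"]) (simp only: transpose_def vec_lambda_beta)

text \<open>The quarter turn for the inner product with Gram matrix \<open>S\<close>, in the
  orientation of the frame; it generates the rotations of that inner product.\<close>

definition jmat :: "M2 \<Rightarrow> M2" where
  "jmat S = sqrt (det S) *\<^sub>R (matrix_inv S ** J2)"

definition pos_def :: "real^'n^'n \<Rightarrow> bool" where
  "pos_def S \<longleftrightarrow> transpose S = S \<and> (\<forall>v. v \<noteq> 0 \<longrightarrow> v \<bullet> (S *v v) > 0)"

lemma pos_defD:
  fixes S :: M2
  assumes "pos_def S"
  shows "S$2$1 = S$1$2" "S$1$1 > 0" "det S > 0"
proof -
  have t: "transpose S = S" and p: "\<And>v. v \<noteq> 0 \<Longrightarrow> v \<bullet> (S *v v) > 0"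
    using assms by (auto simp: pos_def_def)
  show s: "S$2$1 = S$1$2" using t by (rule sym2_eq)
  have "axis 1 1 \<noteq> (0::real^2)" by simp
  from p[OF this] show p11: "S$1$1 > 0"
    by (simp add: inner_vec_def matrix_vector_mult_def sum_2 axis_def)
  \<comment> \<open>This vector is orthogonal to the first basis vector with respect to
    \<open>S\<close>, and the form takes the value \<open>S$1$1 * det S\<close> on it.\<close>
  let ?v = "vector [S$1$2, - S$1$1] :: real^2"
  have "?v \<noteq> 0" using p11 by (auto simp: vec_eq_iff forall_2)
  from p[OF this] have "S$1$1 * det S > 0"
    using s by (simp add: inner_vec_def matrix_vector_mult_def sum_2 det_2 algebra_simps)
  then show "det S > 0" using p11 by (simp add: zero_less_mult_iff)
qed

lemma jmat_sq: assumes "transpose S = S" "det S > 0" shows "jmat S ** jmat S = - mat 1"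
proof -
  have d: "det S \<noteq> 0" using assms by simp
  have t: "transpose (matrix_inv S) = matrix_inv S"
    using matrix_inv_transpose[OF d] assms by simp
  have "jmat S ** jmat S = det S *\<^sub>R (matrix_inv S ** J2 ** transpose (matrix_inv S) ** J2)"
    using assms by (simp add: jmat_def matrix_mult_scaleR t matrix_mul_assoc)
  then show ?thesis
    using d by (simp add: congruence_J2' det_matrix_inv matrix_mult_scaleR J2_sq)
qed

text \<open>A frame change of negative determinant reverses the orientation and with it the sense of
  the quarter turn. All later sign ambiguities originate here.\<close>

lemma jmat_congruence:
  assumes "det S > 0" "det D \<noteq> 0"
  shows "jmat (transpose D ** S ** D) = sgn (det D) *\<^sub>R (matrix_inv D ** jmat S ** D)"
proof -
  have tr: "det (transpose D) \<noteq> 0" using assms by (simp add: det_transpose)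
  have e: "det D *\<^sub>R (matrix_inv (transpose D) ** J2) = J2 ** D"
    using matrix_inv_mult_cancel(1)[OF tr, of "J2 ** D"]
    by (simp add: congruence_J2 matrix_mul_assoc matrix_mult_scaleR)
  have *: "matrix_inv (transpose D) ** J2 = (1 / det D) *\<^sub>R (J2 ** D)"
    using assms(2) by (simp add: e[symmetric])
  have "sqrt (det (transpose D ** S ** D)) = \<bar>det D\<bar> * sqrt (det S)"
  proof -
    have "det (transpose D ** S ** D) = (det D)\<^sup>2 * det S"
      by (simp add: det_mul det_transpose power2_eq_square)
    then show ?thesis by (simp add: real_sqrt_mult)
  qed
  moreover have "matrix_inv (transpose D ** S ** D) ** J2
     = matrix_inv D ** matrix_inv S ** (matrix_inv (transpose D) ** J2)"
    using assms tr by (simp add: matrix_inv_mult det_mul matrix_mul_assoc)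
  ultimately show ?thesis using assms
    by (simp add: jmat_def * matrix_mult_scaleR matrix_mul_assoc sgn_if abs_if)
qed

text \<open>The upper triangular Cholesky factor, which passes to coordinates in the Gram-Schmidt
  frame. The closed formula shows that it depends smoothly on \<open>S\<close> and keeps the
  orientation.\<close>

definition chol :: "M2 \<Rightarrow> M2" where
  "chol S = vector [vector [sqrt (S$1$1), S$1$2 / sqrt (S$1$1)], vector [0, sqrt (det S / S$1$1)]]"

lemma chol_nth [simp]:
  "chol S$1$1 = sqrt (S$1$1)" "chol S$1$2 = S$1$2 / sqrt (S$1$1)"
  "chol S$2$1 = 0" "chol S$2$2 = sqrt (det S / S$1$1)"
  by (simp_all add: chol_def)

lemma chol_sq:
  assumes "pos_def S"
  shows "transpose (chol S) ** chol S = S"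
proof -
  note p = pos_defD[OF assms]
  have "sqrt (S$1$1) * sqrt (S$1$1) = S$1$1" using p by simp
  moreover have "S$1$1 * (det S / S$1$1) = S$1$1 * S$2$2 - (S$1$2)\<^sup>2"
    using p by (simp add: det_2 power2_eq_square)
  then have "(S$1$2)\<^sup>2 / S$1$1 + det S / S$1$1 = S$2$2"
    using p(2) by (simp add: field_simps)
  moreover have "0 \<le> det S / S$1$1" using p by simp
  ultimately show ?thesis using p
    by (intro mat2_eqI)
      (simp_all add: matrix_matrix_mult_def transpose_def sum_2 power2_eq_square)
qed

lemma det_chol: "pos_def S \<Longrightarrow> det (chol S) = sqrt (det S)"
  using pos_defD[of S] by (simp add: det_2[of "chol S"] real_sqrt_divide)

lemma det_chol_pos: "pos_def S \<Longrightarrow> det (chol S) > 0"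
  using pos_defD(3)[of S] by (simp add: det_chol)

lemma jmat_chol:
  assumes "pos_def S"
  shows "jmat S = matrix_inv (chol S) ** J2 ** chol S"
proof -
  have "jmat (transpose (chol S) ** mat 1 ** chol S)
      = sgn (det (chol S)) *\<^sub>R (matrix_inv (chol S) ** jmat (mat 1) ** chol S)"
    using det_chol_pos[OF assms] by (intro jmat_congruence) auto
  then show ?thesis
    using det_chol_pos[OF assms] chol_sq[OF assms]
    by (simp add: jmat_def[of "mat 1"] matrix_inv_mat_1)
qed

lemma pos_def_congruence:
  fixes S :: "real^'n^'n" and D :: "real^'m^'n"
  assumes "pos_def S" "\<And>v. D *v v = 0 \<Longrightarrow> v = 0"
  shows "pos_def (transpose D ** S ** D)"
proof -
  have "v \<bullet> (w v* D) = (D *v v) \<bullet> w" for v w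
    using dot_lmul_matrix[of w D v] by (simp add: inner_commute)
  then have "v \<bullet> ((transpose D ** S ** D) *v v) = (D *v v) \<bullet> (S *v (D *v v))" for v
    by (simp add: matrix_vector_mul_assoc[symmetric] transpose_matrix_vector)
  then show ?thesis using assms
    by (auto simp: pos_def_def matrix_transpose_mul matrix_mul_assoc)
qed

lemma pos_def_mat_1: "pos_def (mat 1 :: real^'n^'n)"
  by (auto simp: pos_def_def)

section \<open>Calculus of smooth functions\<close>

lemma has_derivative_cong_open:
  assumes "open S" "x \<in> S" "\<And>y. y \<in> S \<Longrightarrow> f y = g y"
  shows "(f has_derivative D) (at x) \<longleftrightarrow> (g has_derivative D) (at x)"
  using assms has_derivative_transform_within_open[of f D x UNIV S g]
    has_derivative_transform_within_open[of g D x UNIV S f] by auto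

lemma frechet_derivative_cong_open:
  assumes "open S" "x \<in> S" "\<And>y. y \<in> S \<Longrightarrow> f y = g y"
  shows "frechet_derivative f (at x) = frechet_derivative g (at x)"
  unfolding frechet_derivative_def using has_derivative_cong_open[OF assms] by simp

lemma frechet_derivative_eqI:
  "(f has_derivative D) (at x) \<Longrightarrow> frechet_derivative f (at x) = D"
  using frechet_derivative_at by metis

lemma differentiable_has_frechet:
  "f differentiable (at x) \<Longrightarrow> (f has_derivative frechet_derivative f (at x)) (at x)"
  by (simp add: frechet_derivative_works)

lemma Ck_on_cong:
  assumes "open S" "\<And>x. x \<in> S \<Longrightarrow> f x = g x" "Ck_on n S f"
  shows "Ck_on n S g"
  using assms(2,3)
proof (induction n arbitrary: f g)
  case 0
  then show ?case using continuous_on_cong[of S S f g] by simp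
next
  case (Suc n)
  have "g differentiable (at x)" if "x \<in> S" for x
  proof -
    have "\<exists>D. (f has_derivative D) (at x)" using Suc.prems that by (simp add: differentiable_def)
    then show ?thesis
      using that has_derivative_cong_open[OF assms(1) that, of f g] Suc.prems(1)
      by (simp add: differentiable_def)
  qed
  moreover have "Ck_on n S (\<lambda>x. frechet_derivative g (at x) v)" for v
  proof (rule Suc.IH)
    show "Ck_on n S (\<lambda>x. frechet_derivative f (at x) v)" using Suc.prems by simp
    show "\<And>x. x \<in> S \<Longrightarrow> frechet_derivative f (at x) v = frechet_derivative g (at x) v"
      using frechet_derivative_cong_open[OF assms(1) _ Suc.prems(1)] by simp
  qed
  ultimately show ?case by simp
qed

lemma Ck_on_SucI:
  assumes "open S" "\<And>x. x \<in> S \<Longrightarrow> (f has_derivative D x) (at x)"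
    "\<And>v. Ck_on n S (\<lambda>x. D x v)"
  shows "Ck_on (Suc n) S f"
proof -
  have "Ck_on n S (\<lambda>x. frechet_derivative f (at x) v)" for v
    using assms frechet_derivative_eqI by (intro Ck_on_cong[OF assms(1) _ assms(3)[of v]]) fastforce
  then show ?thesis using assms by (auto simp: differentiable_def)
qed

lemma Ck_on_SucD: "Ck_on (Suc n) S f \<Longrightarrow> Ck_on n S f"
proof (induction n arbitrary: f)
  case 0
  then have "f differentiable_on S"
    by (auto simp: differentiable_on_def intro: differentiable_at_withinI)
  then show ?case using differentiable_imp_continuous_on by auto
next
  case (Suc n)
  then show ?case by simp
qed

lemma Ck_on_subset: "Ck_on n S f \<Longrightarrow> T \<subseteq> S \<Longrightarrow> Ck_on n T f"
  by (induction n arbitrary: f) (auto intro: continuous_on_subset)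

lemma Ck_on_const: "open S \<Longrightarrow> Ck_on n S (\<lambda>x. c)"
proof (induction n arbitrary: c)
  case (Suc n)
  show ?case by (rule Ck_on_SucI[where D = "\<lambda>x v. 0"]) (use Suc in auto)
qed simp

lemma Ck_on_bounded_linear:
  assumes "bounded_linear L" "open S"
  shows "Ck_on n S f \<Longrightarrow> Ck_on n S (\<lambda>x. L (f x))"
proof (induction n arbitrary: f)
  case 0
  then show ?case using assms by (auto intro: bounded_linear.continuous_on)
next
  case (Suc n)
  show ?case
  proof (rule Ck_on_SucI[OF assms(2)])
    show "((\<lambda>x. L (f x)) has_derivative (\<lambda>v. L (frechet_derivative f (at x) v))) (at x)"
      if "x \<in> S" for x
      using Suc.prems that
      by (intro bounded_linear.has_derivative[OF assms(1)] differentiable_has_frechet) auto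
    show "Ck_on n S (\<lambda>x. L (frechet_derivative f (at x) v))" for v
      using Suc.prems by (intro Suc.IH) auto
  qed
qed

lemma Ck_on_ident: "open S \<Longrightarrow> Ck_on n S (\<lambda>x. x)"
proof (induction n)
  case (Suc n)
  show ?case by (rule Ck_on_SucI[where D = "\<lambda>x v. v"]) (use Suc Ck_on_const in auto)
qed simp

lemma Ck_on_add:
  assumes "open S"
  shows "Ck_on n S h \<Longrightarrow> Ck_on n S k \<Longrightarrow> Ck_on n S (\<lambda>x. h x + k x)"
proof (induction n arbitrary: h k)
  case 0
  then show ?case by (auto intro: continuous_on_add)
next
  case (Suc n)
  show ?case
  proof (rule Ck_on_SucI[OF assms])
    show "((\<lambda>x. h x + k x) has_derivative
       (\<lambda>v. frechet_derivative h (at x) v + frechet_derivative k (at x) v)) (at x)"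
      if "x \<in> S" for x
      using Suc.prems that by (intro has_derivative_add differentiable_has_frechet) auto
    show "Ck_on n S (\<lambda>x. frechet_derivative h (at x) v + frechet_derivative k (at x) v)" for v
      using Suc.prems by (intro Suc.IH) auto
  qed
qed

lemma Ck_on_bilinear:
  assumes "bounded_bilinear pr" "open S"
  shows "Ck_on n S f \<Longrightarrow> Ck_on n S g \<Longrightarrow> Ck_on n S (\<lambda>x. pr (f x) (g x))"
proof (induction n arbitrary: f g)
  case 0
  then show ?case using assms by (auto intro: bounded_bilinear.continuous_on)
next
  case (Suc n)
  show ?case
  proof (rule Ck_on_SucI[OF assms(2)])
    show "((\<lambda>x. pr (f x) (g x)) has_derivative
       (\<lambda>v. pr (f x) (frechet_derivative g (at x) v) + pr (frechet_derivative f (at x) v) (g x))) (at x)"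
      if "x \<in> S" for x
      using Suc.prems that
      by (intro bounded_bilinear.FDERIV[OF assms(1)] differentiable_has_frechet) auto
    show "Ck_on n S (\<lambda>x. pr (f x) (frechet_derivative g (at x) v) + pr (frechet_derivative f (at x) v) (g x))" for v
      using Suc.prems Ck_on_SucD[OF Suc.prems(1)] Ck_on_SucD[OF Suc.prems(2)]
      by (intro Ck_on_add[OF assms(2)] Suc.IH) auto
  qed
qed

lemma Ck_on_sum:
  assumes "open S" "\<And>i. i \<in> I \<Longrightarrow> Ck_on n S (f i)"
  shows "Ck_on n S (\<lambda>x. \<Sum>i\<in>I. f i x)"
  using assms(2)
  by (induction I rule: infinite_finite_induct)
    (simp_all add: Ck_on_const assms(1) Ck_on_add[OF assms(1)])

lemma frechet_derivative_expand:
  fixes f :: "'a::euclidean_space \<Rightarrow> 'b::real_normed_vector"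
  assumes "f differentiable (at x)"
  shows "frechet_derivative f (at x) w = (\<Sum>b\<in>Basis. (w \<bullet> b) *\<^sub>R frechet_derivative f (at x) b)"
proof -
  have l: "linear (frechet_derivative f (at x))"
    using assms by (rule linear_frechet_derivative)
  show ?thesis
    using l by (subst (1) euclidean_representation[of w, symmetric]) (simp add: linear_sum linear_cmul)
qed

text \<open>\<open>Ck_on\<close> controls derivatives in fixed directions, whereas the chain rule
  differentiates \<open>g\<close> in the varying direction given by the derivative of
  \<open>f\<close>. That direction is therefore expanded over \<open>Basis\<close>.\<close>

lemma Ck_on_compose:
  fixes f :: "'a::euclidean_space \<Rightarrow> 'b::euclidean_space"
    and g :: "'b \<Rightarrow> 'c::real_normed_vector"
  assumes "open S" "f ` S \<subseteq> T"
  shows "Ck_on n S f \<Longrightarrow> Ck_on n T g \<Longrightarrow> Ck_on n S (\<lambda>x. g (f x))"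
proof (induction n arbitrary: g)
  case 0
  then show ?case using assms(2) continuous_on_compose2 by (simp, blast)
next
  case (Suc n)
  have fd: "f differentiable (at x)" if "x \<in> S" for x using Suc.prems that by auto
  have gd: "g differentiable (at (f x))" if "x \<in> S" for x
    using Suc.prems that assms(2) by auto
  have fn: "Ck_on n S f" by (rule Ck_on_SucD) (rule Suc.prems(1))
  show ?case
  proof (rule Ck_on_SucI[OF assms(1)])
    show "((\<lambda>x. g (f x)) has_derivative
       (\<lambda>v. \<Sum>b\<in>Basis. (frechet_derivative f (at x) v \<bullet> b) *\<^sub>R frechet_derivative g (at (f x)) b)) (at x)"
      if "x \<in> S" for x
    proof -
      have "((\<lambda>x. g (f x)) has_derivative
        (\<lambda>v. frechet_derivative g (at (f x)) (frechet_derivative f (at x) v))) (at x)"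
        using diff_chain_at[OF differentiable_has_frechet[OF fd[OF that]]
            differentiable_has_frechet[OF gd[OF that]]]
        by (simp add: o_def)
      then show ?thesis
        by (subst (asm) frechet_derivative_expand[OF gd[OF that]])
    qed
    show "Ck_on n S (\<lambda>x. \<Sum>b\<in>Basis. (frechet_derivative f (at x) v \<bullet> b) *\<^sub>R frechet_derivative g (at (f x)) b)" for v
      using Suc.prems fn
      by (intro Ck_on_sum assms Ck_on_bilinear[OF bounded_bilinear_scaleR]
          Ck_on_bounded_linear[OF bounded_linear_inner_left] Suc.IH) auto
  qed
qed

lemma smooth_onD: "smooth_on S f \<Longrightarrow> x \<in> S \<Longrightarrow> f differentiable (at x)"
  unfolding smooth_on_def by (metis Ck_on.simps(2))

lemma smooth_on_has_derivative:
  "smooth_on S f \<Longrightarrow> x \<in> S \<Longrightarrow> (f has_derivative frechet_derivative f (at x)) (at x)"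
  by (rule differentiable_has_frechet) (rule smooth_onD)

lemma smooth_on_derivative: "smooth_on S f \<Longrightarrow> smooth_on S (\<lambda>x. frechet_derivative f (at x) v)"
  unfolding smooth_on_def by (metis Ck_on.simps(2))

lemma smooth_on_imp_continuous_on: "smooth_on S f \<Longrightarrow> continuous_on S f"
  unfolding smooth_on_def by (metis Ck_on.simps(1))

lemma smooth_on_subset: "smooth_on S f \<Longrightarrow> T \<subseteq> S \<Longrightarrow> smooth_on T f"
  unfolding smooth_on_def using Ck_on_subset by blast

lemma smooth_on_cong:
  "open S \<Longrightarrow> (\<And>x. x \<in> S \<Longrightarrow> f x = g x) \<Longrightarrow> smooth_on S f \<Longrightarrow> smooth_on S g"
  unfolding smooth_on_def using Ck_on_cong by blast

lemma smooth_on_const: "open S \<Longrightarrow> smooth_on S (\<lambda>x. c)"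
  unfolding smooth_on_def using Ck_on_const by blast

lemma smooth_on_ident: "open S \<Longrightarrow> smooth_on S (\<lambda>x. x)"
  unfolding smooth_on_def using Ck_on_ident by blast

lemma smooth_on_bounded_linear:
  "bounded_linear L \<Longrightarrow> open S \<Longrightarrow> smooth_on S f \<Longrightarrow> smooth_on S (\<lambda>x. L (f x))"
  unfolding smooth_on_def using Ck_on_bounded_linear by blast

lemma smooth_on_bilinear:
  "bounded_bilinear pr \<Longrightarrow> open S \<Longrightarrow> smooth_on S f \<Longrightarrow> smooth_on S g \<Longrightarrow> smooth_on S (\<lambda>x. pr (f x) (g x))"
  unfolding smooth_on_def using Ck_on_bilinear by blast

lemma smooth_on_add:
  "open S \<Longrightarrow> smooth_on S f \<Longrightarrow> smooth_on S g \<Longrightarrow> smooth_on S (\<lambda>x. f x + g x)"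
  unfolding smooth_on_def using Ck_on_add by blast

lemma smooth_on_sum:
  "open S \<Longrightarrow> (\<And>i. i \<in> I \<Longrightarrow> smooth_on S (f i)) \<Longrightarrow> smooth_on S (\<lambda>x. \<Sum>i\<in>I. f i x)"
  by (simp add: smooth_on_def Ck_on_sum)

lemma smooth_on_compose:
  fixes f :: "'a::euclidean_space \<Rightarrow> 'b::euclidean_space"
  shows "smooth_on T g \<Longrightarrow> smooth_on S f \<Longrightarrow> open S \<Longrightarrow> f ` S \<subseteq> T \<Longrightarrow> smooth_on S (\<lambda>x. g (f x))"
  by (simp add: smooth_on_def Ck_on_compose)

lemmas smooth_on_scaleR = smooth_on_bilinear[OF bounded_bilinear_scaleR]
lemmas smooth_on_mult = smooth_on_bilinear[OF bounded_bilinear_mult]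
lemmas smooth_on_matrix_mult = smooth_on_bilinear[OF bounded_bilinear_matrix_mult]
lemmas smooth_on_transpose = smooth_on_bounded_linear[OF bounded_linear_transpose]
lemmas smooth_on_nth = smooth_on_bounded_linear[OF bounded_linear_vec_nth]
lemmas smooth_on_minus = smooth_on_bounded_linear[OF bounded_linear_minus[OF bounded_linear_ident]]

lemma smooth_on_diff:
  "open S \<Longrightarrow> smooth_on S f \<Longrightarrow> smooth_on S g \<Longrightarrow> smooth_on S (\<lambda>x. f x - g x)"
  using smooth_on_add[of S f "\<lambda>x. - g x"] smooth_on_minus[of S g] by simp

lemma bounded_linear_axis: "bounded_linear (axis i :: 'b::real_normed_vector \<Rightarrow> 'b^'n)"
proof (rule bounded_linear_intro[where K = 1])
  fix x y :: 'b and r :: real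
  show "axis i (x + y) = axis i x + axis i y" "axis i (r *\<^sub>R x) = r *\<^sub>R axis i x"
    by (auto simp: vec_eq_iff axis_def)
  have "norm (axis i x) \<le> (\<Sum>k\<in>UNIV. norm (axis i x $ k))"
    unfolding norm_vec_def by (rule L2_set_le_sum) simp
  also have "\<dots> = (\<Sum>k\<in>UNIV. if k = i then norm x else 0)"
    by (rule sum.cong) (auto simp: axis_def)
  finally show "norm (axis i x) \<le> norm x * 1" by simp
qed

lemma smooth_on_vec:
  fixes f :: "'a::euclidean_space \<Rightarrow> 'b::real_normed_vector^'n"
  assumes "open S" "\<And>i. smooth_on S (\<lambda>x. f x $ i)"
  shows "smooth_on S f"
proof -
  have "smooth_on S (\<lambda>x. \<Sum>i\<in>UNIV. axis i (f x $ i))"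
    using assms by (intro smooth_on_sum smooth_on_bounded_linear[OF bounded_linear_axis])
  moreover have "(\<Sum>i\<in>UNIV. axis i (v $ i)) = v" for v :: "'b^'n"
  proof (subst vec_eq_iff, intro allI)
    fix k
    have "(\<Sum>i\<in>UNIV. axis i (v $ i)) $ k = (\<Sum>i\<in>UNIV. if k = i then v $ i else 0)"
      by (simp add: axis_def)
    then show "(\<Sum>i\<in>UNIV. axis i (v $ i)) $ k = v $ k" by simp
  qed
  ultimately show ?thesis by simp
qed

text \<open>The derivative is a polynomial in the function itself, which keeps the induction on the
  order running.\<close>

lemma smooth_on_inverse_real: "smooth_on (- {0}) (inverse :: real \<Rightarrow> real)"
  unfolding smooth_on_def
proof
  fix n
  have o: "open (- {0::real})" by auto
  show "Ck_on n (- {0}) (inverse :: real \<Rightarrow> real)"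
  proof (induction n)
    case 0
    then show ?case by (auto intro!: continuous_intros)
  next
    case (Suc n)
    show ?case
    proof (rule Ck_on_SucI[OF o])
      show "(inverse has_derivative (\<lambda>v. - ((inverse x * inverse x) * v))) (at x)"
        if "x \<in> - {0}" for x :: real
        using that by (auto intro!: derivative_eq_intros simp: algebra_simps)
      show "Ck_on n (- {0}) (\<lambda>x::real. - ((inverse x * inverse x) * v))" for v
        by (intro Ck_on_bounded_linear[OF bounded_linear_minus[OF bounded_linear_mult_left]]
            Ck_on_bilinear[OF bounded_bilinear_mult o] Suc o)
    qed
  qed
qed

lemma smooth_on_inverse:
  fixes f :: "'a::euclidean_space \<Rightarrow> real"
  shows "open S \<Longrightarrow> smooth_on S f \<Longrightarrow> (\<And>x. x \<in> S \<Longrightarrow> f x \<noteq> 0) \<Longrightarrow> smooth_on S (\<lambda>x. inverse (f x))"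
  by (rule smooth_on_compose[OF smooth_on_inverse_real]) auto

lemma smooth_on_divide:
  fixes f g :: "'a::euclidean_space \<Rightarrow> real"
  shows "open S \<Longrightarrow> smooth_on S f \<Longrightarrow> smooth_on S g \<Longrightarrow> (\<And>x. x \<in> S \<Longrightarrow> g x \<noteq> 0) \<Longrightarrow> smooth_on S (\<lambda>x. f x / g x)"
  unfolding divide_inverse by (intro smooth_on_mult smooth_on_inverse)

lemma smooth_on_sqrt_real: "smooth_on {0<..} sqrt"
  unfolding smooth_on_def
proof
  fix n
  have o: "open {0::real<..}" by auto
  show "Ck_on n {0<..} sqrt"
  proof (induction n)
    case 0
    then show ?case by (auto intro!: continuous_intros)
  next
    case (Suc n)
    show ?case
    proof (rule Ck_on_SucI[OF o])
      show "(sqrt has_derivative (\<lambda>v. inverse (sqrt x) * (v / 2))) (at x)"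
        if "x \<in> {0<..}" for x
        using that by (auto intro!: derivative_eq_intros simp: field_simps)
      have "Ck_on n {0<..} (\<lambda>x. inverse (sqrt x))"
        using smooth_on_inverse_real
        by (intro Ck_on_compose[OF o _ Suc, of "- {0}"]) (auto simp: smooth_on_def)
      then show "Ck_on n {0<..} (\<lambda>x. inverse (sqrt x) * (v / 2))" for v
        by (intro Ck_on_bounded_linear[OF bounded_linear_mult_left] o)
    qed
  qed
qed

lemma smooth_on_sqrt:
  fixes f :: "'a::euclidean_space \<Rightarrow> real"
  shows "open S \<Longrightarrow> smooth_on S f \<Longrightarrow> (\<And>x. x \<in> S \<Longrightarrow> f x > 0) \<Longrightarrow> smooth_on S (\<lambda>x. sqrt (f x))"
  by (rule smooth_on_compose[OF smooth_on_sqrt_real]) auto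

lemma smooth_on_det2:
  fixes f :: "'a::euclidean_space \<Rightarrow> M2"
  shows "open S \<Longrightarrow> smooth_on S f \<Longrightarrow> smooth_on S (\<lambda>x. det (f x))"
  unfolding det_2 by (intro smooth_on_diff smooth_on_mult smooth_on_nth)

lemma bounded_linear_adj2: "bounded_linear adj2"
proof -
  have "linear adj2" by (rule linearI) (simp_all add: vec_eq_iff forall_2)
  then show ?thesis by (simp add: linear_conv_bounded_linear)
qed

lemma smooth_on_matrix_inv2:
  fixes f :: "'a::euclidean_space \<Rightarrow> M2"
  assumes "open S" "smooth_on S f" "\<And>x. x \<in> S \<Longrightarrow> det (f x) \<noteq> 0"
  shows "smooth_on S (\<lambda>x. matrix_inv (f x))"
proof (rule smooth_on_cong[OF assms(1)])
  show "smooth_on S (\<lambda>x. inverse (det (f x)) *\<^sub>R adj2 (f x))"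
    using assms by (intro smooth_on_scaleR smooth_on_inverse smooth_on_det2
        smooth_on_bounded_linear[OF bounded_linear_adj2])
qed (use assms(3) in \<open>simp add: matrix_inv2 divide_inverse\<close>)

lemma smooth_on_chol:
  fixes f :: "'a::euclidean_space \<Rightarrow> M2"
  assumes "open S" "smooth_on S f" "\<And>x. x \<in> S \<Longrightarrow> pos_def (f x)"
  shows "smooth_on S (\<lambda>x. chol (f x))"
proof -
  note n = assms(1) smooth_on_nth[OF assms(1) smooth_on_nth[OF assms(1,2)]]
    smooth_on_det2[OF assms(1,2)]
  have p: "f x $1$1 > 0" "det (f x) > 0" "f x $1$1 \<noteq> 0" if "x \<in> S" for x
    using assms(3) pos_defD[of "f x"] that by auto
  have 1: "smooth_on S (\<lambda>x. sqrt (f x $1$1))"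
    by (rule smooth_on_sqrt) (use n p in auto)
  have 2: "smooth_on S (\<lambda>x. f x$1$2 / sqrt (f x $1$1))"
    by (rule smooth_on_divide) (use n 1 p in auto)
  have 3: "smooth_on S (\<lambda>x. sqrt (det (f x) / f x $1$1))"
    by (rule smooth_on_sqrt, rule n, rule smooth_on_divide) (use n p in auto)
  have "smooth_on S (\<lambda>x. chol (f x) $ i $ j)" for i j
    using exhaust_2[of i] exhaust_2[of j]
    by (elim disjE) (simp_all add: 1 2 3 smooth_on_const[OF assms(1)])
  then show ?thesis by (intro smooth_on_vec assms(1))
qed

text \<open>Differentiability comes from the adjugate formula; the value then follows by
  differentiating \<open>matrix_inv (f y) ** f y = mat 1\<close>.\<close>

lemma has_derivative_matrix_inv:
  fixes f :: "'a::real_normed_vector \<Rightarrow> M2"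
  assumes "(f has_derivative f') (at x)" "open S" "x \<in> S" "\<And>y. y \<in> S \<Longrightarrow> det (f y) \<noteq> 0"
  shows "((\<lambda>y. matrix_inv (f y)) has_derivative
     (\<lambda>v. - (matrix_inv (f x) ** f' v ** matrix_inv (f x)))) (at x)"
proof -
  note c = bounded_linear.has_derivative[OF bounded_linear_vec_nth]
  have "(\<lambda>y. det (f y)) differentiable (at x)"
    unfolding det_2 differentiable_def
    by (rule exI, (rule has_derivative_diff has_derivative_mult c assms(1))+)
  moreover have "(\<lambda>y. adj2 (f y)) differentiable (at x)"
    unfolding differentiable_def
    by (rule exI, rule bounded_linear.has_derivative[OF bounded_linear_adj2 assms(1)])
  ultimately have "(\<lambda>y. inverse (det (f y)) *\<^sub>R adj2 (f y)) differentiable (at x)"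
    using assms(3,4) by (intro differentiable_scaleR differentiable_inverse) auto
  then have "(\<lambda>y. matrix_inv (f y)) differentiable (at x)"
    using has_derivative_cong_open[OF assms(2,3), of "\<lambda>y. inverse (det (f y)) *\<^sub>R adj2 (f y)" "\<lambda>y. matrix_inv (f y)"]
      assms(4) by (auto simp: differentiable_def matrix_inv2 divide_inverse)
  then obtain D where D: "((\<lambda>y. matrix_inv (f y)) has_derivative D) (at x)"
    by (auto simp: differentiable_def)
  have "((\<lambda>y. matrix_inv (f y) ** f y) has_derivative (\<lambda>v. matrix_inv (f x) ** f' v + D v ** f x)) (at x)"
    by (rule has_derivative_matrix_mult[OF D assms(1)])
  then have "((\<lambda>y. mat 1) has_derivative (\<lambda>v. matrix_inv (f x) ** f' v + D v ** f x)) (at x)"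
    by (rule has_derivative_cong_open[OF assms(2,3), THEN iffD1, rotated])
      (simp add: assms(4) matrix_inv_props)
  from has_derivative_unique[OF this has_derivative_const]
  have e: "matrix_inv (f x) ** f' v + D v ** f x = 0" for v by metis
  have "D v = - (matrix_inv (f x) ** f' v ** matrix_inv (f x))" for v
  proof -
    have "D v ** f x ** matrix_inv (f x) = - (matrix_inv (f x) ** f' v) ** matrix_inv (f x)"
      using e[of v] by (metis add.commute eq_neg_iff_add_eq_0)
    then show ?thesis using assms by (simp add: matrix_inv_mult_cancel matrix_mult_algebra)
  qed
  then show ?thesis using D by (metis (no_types, lifting) ext)
qed

section \<open>Second derivatives, curvature and closed forms\<close>

lemma has_real_derivative_along_line:
  fixes f :: "'a::real_normed_vector \<Rightarrow> real"
  assumes "f differentiable (at (y + t *\<^sub>R v))"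
  shows "((\<lambda>t. f (y + t *\<^sub>R v)) has_real_derivative frechet_derivative f (at (y + t *\<^sub>R v)) v) (at t)"
proof -
  have "((\<lambda>t. y + t *\<^sub>R v) has_derivative (\<lambda>h. h *\<^sub>R v)) (at t)"
    by (auto intro!: derivative_eq_intros)
  from diff_chain_at[OF this differentiable_has_frechet[OF assms]]
  have "((\<lambda>t. f (y + t *\<^sub>R v)) has_derivative (\<lambda>h. frechet_derivative f (at (y + t *\<^sub>R v)) (h *\<^sub>R v))) (at t)"
    by (simp add: o_def)
  moreover have "frechet_derivative f (at (y + t *\<^sub>R v)) (h *\<^sub>R v)
      = frechet_derivative f (at (y + t *\<^sub>R v)) v * h" for h
    using linear_cmul[OF linear_frechet_derivative[OF assms], of h v] by simp
  ultimately show ?thesis by (simp add: has_field_derivative_def)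
qed

text \<open>The mean value theorem is used twice: along \<open>v\<close> for the difference of
  \<open>f\<close> on two parallel sides of the parallelogram, and then along
  \<open>w\<close>.\<close>

lemma second_difference_mean_value:
  fixes f :: "'a::euclidean_space \<Rightarrow> real"
  assumes f: "smooth_on S f" and s: "s > 0"
    and S: "\<And>a b. 0 \<le> a \<Longrightarrow> a \<le> s \<Longrightarrow> 0 \<le> b \<Longrightarrow> b \<le> s \<Longrightarrow> x + a *\<^sub>R v + b *\<^sub>R w \<in> S"
  obtains a b where "0 \<le> a" "a \<le> s" "0 \<le> b" "b \<le> s"
    "f (x + s *\<^sub>R v + s *\<^sub>R w) - f (x + s *\<^sub>R v) - (f (x + s *\<^sub>R w) - f x) =
      s * (s * frechet_derivative (\<lambda>y. frechet_derivative f (at y) v) (at (x + a *\<^sub>R v + b *\<^sub>R w)) w)"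
proof -
  have S0: "x + a *\<^sub>R v \<in> S" if "0 \<le> a" "a \<le> s" for a
    using S[of a 0] that s by simp
  have Ss: "x + s *\<^sub>R w + a *\<^sub>R v \<in> S" if "0 \<le> a" "a \<le> s" for a
    using S[of a s] that s by (simp add: algebra_simps)
  have "\<exists>z>0. z < s \<and> (f (x + s *\<^sub>R w + s *\<^sub>R v) - f (x + s *\<^sub>R v)) - (f (x + s *\<^sub>R w + 0 *\<^sub>R v) - f (x + 0 *\<^sub>R v)) =
     (s - 0) * (frechet_derivative f (at (x + s *\<^sub>R w + z *\<^sub>R v)) v - frechet_derivative f (at (x + z *\<^sub>R v)) v)"
    using s S0 Ss smooth_onD[OF f]
    by (intro MVT2 DERIV_diff has_real_derivative_along_line) auto
  then obtain a where a: "0 < a" "a < s" and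
    1: "f (x + s *\<^sub>R w + s *\<^sub>R v) - f (x + s *\<^sub>R v) - (f (x + s *\<^sub>R w) - f x) =
     s * (frechet_derivative f (at (x + s *\<^sub>R w + a *\<^sub>R v)) v - frechet_derivative f (at (x + a *\<^sub>R v)) v)"
    by auto
  have "\<exists>z>0. z < s \<and> frechet_derivative f (at (x + a *\<^sub>R v + s *\<^sub>R w)) v - frechet_derivative f (at (x + a *\<^sub>R v + 0 *\<^sub>R w)) v
    = (s - 0) * frechet_derivative (\<lambda>y. frechet_derivative f (at y) v) (at (x + a *\<^sub>R v + z *\<^sub>R w)) w"
    using s S a smooth_onD[OF smooth_on_derivative[OF f]]
    by (intro MVT2 has_real_derivative_along_line) auto
  then obtain b where b: "0 < b" "b < s" and
    2: "frechet_derivative f (at (x + a *\<^sub>R v + s *\<^sub>R w)) v - frechet_derivative f (at (x + a *\<^sub>R v)) v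
    = s * frechet_derivative (\<lambda>y. frechet_derivative f (at y) v) (at (x + a *\<^sub>R v + b *\<^sub>R w)) w"
    by auto
  show thesis
    by (rule that[of a b]) (use a b 1 2 in \<open>simp_all add: ac_simps\<close>)
qed

text \<open>The second difference over a parallelogram is symmetric in \<open>v\<close> and
  \<open>w\<close>, and it equals \<open>s * s\<close> times either mixed derivative at some point
  nearby. Continuity of both then excludes a gap between their values at \<open>x\<close>.\<close>

lemma frechet_derivative_commute_real:
  fixes f :: "'a::euclidean_space \<Rightarrow> real"
  assumes f: "smooth_on S f" and S: "open S" "x \<in> S"
  shows "frechet_derivative (\<lambda>y. frechet_derivative f (at y) v) (at x) w =
         frechet_derivative (\<lambda>y. frechet_derivative f (at y) w) (at x) v"
proof (rule ccontr)
  define P where "P v w y = frechet_derivative (\<lambda>y. frechet_derivative f (at y) v) (at y) w" for v w y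
  assume "\<not> ?thesis"
  then have ne: "P v w x \<noteq> P w v x" by (simp add: P_def)
  define e where "e = \<bar>P v w x - P w v x\<bar> / 2"
  have e: "e > 0" using ne by (simp add: e_def)
  have "continuous_on S (P v w)" for v w
    unfolding P_def by (intro smooth_on_imp_continuous_on smooth_on_derivative f)
  then have c: "isCont (P v w) x" for v w
    using S continuous_on_eq_continuous_at by blast
  obtain d1 where d1: "d1 > 0" "\<And>y. dist y x < d1 \<Longrightarrow> dist (P v w y) (P v w x) < e"
    using c[of v w] e unfolding continuous_at_eps_delta by meson
  obtain d2 where d2: "d2 > 0" "\<And>y. dist y x < d2 \<Longrightarrow> dist (P w v y) (P w v x) < e"
    using c[of w v] e unfolding continuous_at_eps_delta by meson
  obtain d3 where d3: "d3 > 0" "ball x d3 \<subseteq> S" using S openE by blast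
  define d where "d = min d1 (min d2 d3)"
  have d: "d > 0" "d \<le> d1" "d \<le> d2" "d \<le> d3" using d1 d2 d3 by (auto simp: d_def)
  \<comment> \<open>This side length keeps the whole parallelogram within distance d / 2 of
    \<open>x\<close>; the summand 1 prevents division by zero when both vectors vanish.\<close>
  define s where "s = d / (2 * (norm v + norm w + 1))"
  have s: "s > 0" using d by (simp add: s_def add_nonneg_pos)
  have near: "dist (x + a *\<^sub>R v + b *\<^sub>R w) x < d" if "0 \<le> a" "a \<le> s" "0 \<le> b" "b \<le> s" for a b
  proof -
    have "dist (x + a *\<^sub>R v + b *\<^sub>R w) x \<le> a * norm v + b * norm w"
      using norm_triangle_ineq[of "a *\<^sub>R v" "b *\<^sub>R w"] that by (simp add: dist_norm)
    also have "\<dots> \<le> s * (norm v + norm w + 1)"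
      using that s mult_right_mono[of a s "norm v"] mult_right_mono[of b s "norm w"]
      by (simp add: algebra_simps)
    also have "\<dots> = d / 2" 
    proof -
      have "norm v + norm w + 1 \<noteq> 0" using norm_ge_zero[of v] norm_ge_zero[of w] by linarith
      then show ?thesis unfolding s_def by (simp add: divide_simps)
    qed
    finally show ?thesis using d by simp
  qed
  have near': "dist (x + a *\<^sub>R w + b *\<^sub>R v) x < d" if "0 \<le> a" "a \<le> s" "0 \<le> b" "b \<le> s" for a b
    using near[of b a] that by (simp add: ac_simps)
  have inS: "y \<in> S" if "dist y x < d" for y
    using that d(4) d3(2) by (auto simp: dist_commute subset_iff)
  obtain a b where ab: "0 \<le> a" "a \<le> s" "0 \<le> b" "b \<le> s" and
    1: "f (x + s *\<^sub>R v + s *\<^sub>R w) - f (x + s *\<^sub>R v) - (f (x + s *\<^sub>R w) - f x) = s * (s * P v w (x + a *\<^sub>R v + b *\<^sub>R w))"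
    unfolding P_def
    by (rule second_difference_mean_value[OF f s inS[OF near]])
  obtain a' b' where ab': "0 \<le> a'" "a' \<le> s" "0 \<le> b'" "b' \<le> s" and
    2: "f (x + s *\<^sub>R w + s *\<^sub>R v) - f (x + s *\<^sub>R w) - (f (x + s *\<^sub>R v) - f x) = s * (s * P w v (x + a' *\<^sub>R w + b' *\<^sub>R v))"
    unfolding P_def
    by (rule second_difference_mean_value[OF f s inS[OF near']])
  have "s * (s * P v w (x + a *\<^sub>R v + b *\<^sub>R w)) = s * (s * P w v (x + a' *\<^sub>R w + b' *\<^sub>R v))"
    using 1 2 add.assoc add.commute[of "s *\<^sub>R v" "s *\<^sub>R w"] by (simp only: add.assoc)
  then have "P v w (x + a *\<^sub>R v + b *\<^sub>R w) = P w v (x + a' *\<^sub>R w + b' *\<^sub>R v)" using s by simp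
  moreover have "dist (P v w (x + a *\<^sub>R v + b *\<^sub>R w)) (P v w x) < e"
    using near[OF ab] d by (intro d1) simp
  moreover have "dist (P w v (x + a' *\<^sub>R w + b' *\<^sub>R v)) (P w v x) < e"
    using near'[OF ab'] d by (intro d2) simp
  ultimately show False
    using dist_triangle2[of "P v w x" "P w v x" "P v w (x + a *\<^sub>R v + b *\<^sub>R w)"]
    by (simp add: e_def dist_real_def[symmetric] dist_commute)
qed

lemma frechet_derivative_bounded_linear:
  assumes "bounded_linear L" "f differentiable (at x)"
  shows "frechet_derivative (\<lambda>y. L (f y)) (at x) v = L (frechet_derivative f (at x) v)"
  by (subst frechet_derivative_eqI[OF bounded_linear.has_derivative[OF assms(1)
        differentiable_has_frechet[OF assms(2)]]]) simp

lemma frechet_derivative_commute: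
  fixes f :: "'a::euclidean_space \<Rightarrow> 'b::euclidean_space"
  assumes f: "smooth_on S f" and S: "open S" "x \<in> S"
  shows "frechet_derivative (\<lambda>y. frechet_derivative f (at y) v) (at x) w =
         frechet_derivative (\<lambda>y. frechet_derivative f (at y) w) (at x) v"
proof (rule euclidean_eqI)
  fix b :: 'b
  assume "b \<in> Basis"
  have 1: "frechet_derivative (\<lambda>y. f y \<bullet> b) (at y) v = frechet_derivative f (at y) v \<bullet> b"
    if "y \<in> S" for y v
    using frechet_derivative_bounded_linear[OF bounded_linear_inner_left smooth_onD[OF f that]] .
  have 2: "frechet_derivative (\<lambda>y. frechet_derivative (\<lambda>y. f y \<bullet> b) (at y) v) (at x) w
     = frechet_derivative (\<lambda>y. frechet_derivative f (at y) v) (at x) w \<bullet> b" for v w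
  proof -
    have "frechet_derivative (\<lambda>y. frechet_derivative (\<lambda>y. f y \<bullet> b) (at y) v) (at x)
      = frechet_derivative (\<lambda>y. frechet_derivative f (at y) v \<bullet> b) (at x)"
      using 1 by (intro frechet_derivative_cong_open[OF S]) auto
    then show ?thesis
      using frechet_derivative_bounded_linear[OF bounded_linear_inner_left
          smooth_onD[OF smooth_on_derivative[OF f] S(2)]] by simp
  qed
  have "smooth_on S (\<lambda>y. f y \<bullet> b)"
    by (intro smooth_on_bounded_linear[OF bounded_linear_inner_left] f S)
  from frechet_derivative_commute_real[OF this S]
  show "frechet_derivative (\<lambda>y. frechet_derivative f (at y) v) (at x) w \<bullet> b =
        frechet_derivative (\<lambda>y. frechet_derivative f (at y) w) (at x) v \<bullet> b"
    by (simp only: 2)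
qed

section \<open>Derivatives of 1-forms and gauge covariance of the curvature\<close>

lemma linear_expand:
  fixes L :: "'a::euclidean_space \<Rightarrow> 'b::real_normed_vector"
  assumes "linear L"
  shows "L w = (\<Sum>b\<in>Basis. (w \<bullet> b) *\<^sub>R L b)"
  using assms by (subst (1) euclidean_representation[of w, symmetric])
    (simp add: linear_sum linear_cmul)

lemma frechet_derivative_form_expand:
  fixes B :: "'a::euclidean_space \<Rightarrow> 'd::euclidean_space \<Rightarrow> 'c::real_normed_vector"
  assumes "open T" "y \<in> T" "\<And>Y. Y \<in> T \<Longrightarrow> linear (B Y)"
    "\<And>W. (\<lambda>Y. B Y W) differentiable (at y)"
  shows "frechet_derivative (\<lambda>Y. B Y w) (at y) u =
    (\<Sum>b\<in>Basis. (w \<bullet> b) *\<^sub>R frechet_derivative (\<lambda>Y. B Y b) (at y) u)"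
proof -
  have 1: "frechet_derivative (\<lambda>Y. \<Sum>b\<in>Basis. (w \<bullet> b) *\<^sub>R B Y b) (at y) =
     (\<lambda>u. \<Sum>b\<in>Basis. (w \<bullet> b) *\<^sub>R frechet_derivative (\<lambda>Y. B Y b) (at y) u)"
    by (intro frechet_derivative_eqI has_derivative_sum has_derivative_scaleR_right
        differentiable_has_frechet assms)
  have 2: "frechet_derivative (\<lambda>Y. B Y w) (at y)
     = frechet_derivative (\<lambda>Y. \<Sum>b\<in>Basis. (w \<bullet> b) *\<^sub>R B Y b) (at y)"
    by (intro frechet_derivative_cong_open[OF assms(1,2)] linear_expand assms(3))
  show ?thesis by (simp only: 1 2)
qed

text \<open>Differentiability of \<open>B\<close> is assumed for each fixed vector only, so the form
  is expanded over \<open>Basis\<close> before the product rule applies. The expansion is valid on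
  \<open>T\<close>, hence near \<open>x\<close>.\<close>

lemma has_derivative_form:
  fixes B :: "'a::euclidean_space \<Rightarrow> 'd::euclidean_space \<Rightarrow> 'c::real_normed_vector"
    and \<psi> :: "'e::real_normed_vector \<Rightarrow> 'a"
  assumes T: "open T" "\<psi> x \<in> T" "\<And>Y. Y \<in> T \<Longrightarrow> linear (B Y)"
    and B: "\<And>W. (\<lambda>Y. B Y W) differentiable (at (\<psi> x))"
    and \<psi>: "(\<psi> has_derivative \<psi>') (at x)" and \<omega>: "(\<omega> has_derivative \<omega>') (at x)"
  shows "((\<lambda>X. B (\<psi> X) (\<omega> X)) has_derivative
     (\<lambda>v. frechet_derivative (\<lambda>Y. B Y (\<omega> x)) (at (\<psi> x)) (\<psi>' v) + B (\<psi> x) (\<omega>' v))) (at x)"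
proof -
  have Bd: "((\<lambda>X. B (\<psi> X) b) has_derivative (\<lambda>v. frechet_derivative (\<lambda>Y. B Y b) (at (\<psi> x)) (\<psi>' v))) (at x)" for b
    using diff_chain_at[OF \<psi> differentiable_has_frechet[OF B[of b]]] by (simp add: o_def)
  have "((\<lambda>X. \<Sum>b\<in>Basis. (\<omega> X \<bullet> b) *\<^sub>R B (\<psi> X) b) has_derivative
     (\<lambda>v. \<Sum>b\<in>Basis. (\<omega> x \<bullet> b) *\<^sub>R frechet_derivative (\<lambda>Y. B Y b) (at (\<psi> x)) (\<psi>' v)
        + (\<omega>' v \<bullet> b) *\<^sub>R B (\<psi> x) b)) (at x)"
    by (intro has_derivative_sum has_derivative_scaleR bounded_linear.has_derivative[OF bounded_linear_inner_left] \<omega> Bd)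
  also have "(\<lambda>v. \<Sum>b\<in>Basis. (\<omega> x \<bullet> b) *\<^sub>R frechet_derivative (\<lambda>Y. B Y b) (at (\<psi> x)) (\<psi>' v)
        + (\<omega>' v \<bullet> b) *\<^sub>R B (\<psi> x) b) =
     (\<lambda>v. frechet_derivative (\<lambda>Y. B Y (\<omega> x)) (at (\<psi> x)) (\<psi>' v) + B (\<psi> x) (\<omega>' v))"
  proof
    fix v
    note h = frechet_derivative_form_expand[OF T B, of "\<omega> x" "\<psi>' v"]
      linear_expand[OF T(3)[OF T(2)], of "\<omega>' v"]
    show "(\<Sum>b\<in>Basis. (\<omega> x \<bullet> b) *\<^sub>R frechet_derivative (\<lambda>Y. B Y b) (at (\<psi> x)) (\<psi>' v)
        + (\<omega>' v \<bullet> b) *\<^sub>R B (\<psi> x) b) =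
      frechet_derivative (\<lambda>Y. B Y (\<omega> x)) (at (\<psi> x)) (\<psi>' v) + B (\<psi> x) (\<omega>' v)"
      by (simp only: h sum.distrib)
  qed
  finally have *: "((\<lambda>X. \<Sum>b\<in>Basis. (\<omega> X \<bullet> b) *\<^sub>R B (\<psi> X) b) has_derivative
     (\<lambda>v. frechet_derivative (\<lambda>Y. B Y (\<omega> x)) (at (\<psi> x)) (\<psi>' v) + B (\<psi> x) (\<omega>' v))) (at x)" .
  have ev: "\<forall>\<^sub>F X in at x. \<psi> X \<in> T"
    using has_derivative_continuous[OF \<psi>] T(1,2)
    by (metis continuous_at_open continuous_within topological_tendstoD)
  have "\<forall>\<^sub>F X in at x. (\<Sum>b\<in>Basis. (\<omega> X \<bullet> b) *\<^sub>R B (\<psi> X) b) = B (\<psi> X) (\<omega> X)"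
    by (rule eventually_mono[OF ev]) (rule linear_expand[OF T(3), symmetric])
  then show ?thesis
    by (rule has_derivative_transform_eventually[OF *])
      (rule linear_expand[OF T(3)[OF T(2)], symmetric], rule UNIV_I)
qed

text \<open>The gauge equation, multiplied through by \<open>T\<close> so that it is a sum of
  products, is differentiated and antisymmetrised. The second derivatives of \<open>T\<close> and of
  \<open>\<psi>\<close> drop out by symmetry.\<close>

lemma curvature_gauge:
  fixes T \<psi> :: "M2 \<Rightarrow> M2"
  assumes S: "open S" "x \<in> S" and T: "smooth_on S T" and \<psi>: "smooth_on S \<psi>" 
    and S': "open S'" "\<psi> ` S \<subseteq> S'"
    and B: "\<And>V. smooth_on S' (\<lambda>Y. B Y V)" "\<And>Y. Y \<in> S' \<Longrightarrow> linear (B Y)"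
    and A: "\<And>V. smooth_on S (\<lambda>X. A X V)"
    and eq: "\<And>X V. X \<in> S \<Longrightarrow> T X ** A X V =
       B (\<psi> X) (frechet_derivative \<psi> (at X) V) ** T X + frechet_derivative T (at X) V"
  shows "T x ** curvature A x V W =
    curvature B (\<psi> x) (frechet_derivative \<psi> (at x) V) (frechet_derivative \<psi> (at x) W) ** T x"
proof -
  let ?p = "frechet_derivative \<psi> (at x)" and ?t = "frechet_derivative T (at x)"
  have \<psi>x: "\<psi> x \<in> S'" using S S' by auto
  have E: "?t V ** A x W + T x ** frechet_derivative (\<lambda>X. A X W) (at x) V =
     B (\<psi> x) (?p W) ** ?t V + (frechet_derivative (\<lambda>Y. B Y (?p W)) (at (\<psi> x)) (?p V)
       + B (\<psi> x) (frechet_derivative (\<lambda>X. frechet_derivative \<psi> (at X) W) (at x) V)) ** T x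
     + frechet_derivative (\<lambda>X. frechet_derivative T (at X) W) (at x) V" for V W
  proof -
    have 1: "((\<lambda>X. T X ** A X W) has_derivative
       (\<lambda>V. T x ** frechet_derivative (\<lambda>X. A X W) (at x) V + ?t V ** A x W)) (at x)"
      using smooth_on_has_derivative[OF T S(2)] smooth_on_has_derivative[OF A S(2)]
      by (rule has_derivative_matrix_mult)
    have 2: "((\<lambda>X. B (\<psi> X) (frechet_derivative \<psi> (at X) W) ** T X + frechet_derivative T (at X) W) has_derivative
      (\<lambda>V. (B (\<psi> x) (?p W) ** ?t V + (frechet_derivative (\<lambda>Y. B Y (?p W)) (at (\<psi> x)) (?p V)
       + B (\<psi> x) (frechet_derivative (\<lambda>X. frechet_derivative \<psi> (at X) W) (at x) V)) ** T x)
     + frechet_derivative (\<lambda>X. frechet_derivative T (at X) W) (at x) V)) (at x)"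
      by (intro has_derivative_add has_derivative_matrix_mult has_derivative_form[where B = B and \<psi> = \<psi> and T = S', OF S'(1) \<psi>x B(2)]
          smooth_on_has_derivative[OF _ S(2)] smooth_on_derivative T \<psi> smooth_onD[OF B(1) \<psi>x])
    have "((\<lambda>X. T X ** A X W) has_derivative
      (\<lambda>V. (B (\<psi> x) (?p W) ** ?t V + (frechet_derivative (\<lambda>Y. B Y (?p W)) (at (\<psi> x)) (?p V)
       + B (\<psi> x) (frechet_derivative (\<lambda>X. frechet_derivative \<psi> (at X) W) (at x) V)) ** T x)
     + frechet_derivative (\<lambda>X. frechet_derivative T (at X) W) (at x) V)) (at x)"
      by (subst has_derivative_cong_open[OF S eq]) (assumption, rule 2)
    from fun_cong[OF has_derivative_unique[OF 1 this], of V]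
    show ?thesis by (simp only: add.commute[of "?t V ** A x W"])
  qed
  have sT: "frechet_derivative (\<lambda>X. frechet_derivative T (at X) W) (at x) V
     = frechet_derivative (\<lambda>X. frechet_derivative T (at X) V) (at x) W"
    by (rule frechet_derivative_commute[OF T S])
  have s\<psi>: "frechet_derivative (\<lambda>X. frechet_derivative \<psi> (at X) W) (at x) V
     = frechet_derivative (\<lambda>X. frechet_derivative \<psi> (at X) V) (at x) W"
    by (rule frechet_derivative_commute[OF \<psi> S])
  \<comment> \<open>The gauge equation is used once more to eliminate the remaining first
    derivatives of \<open>T\<close>.\<close>
  have t: "?t V = T x ** A x V - B (\<psi> x) (?p V) ** T x" for V
    using eq[OF S(2), of V] by simp
  have "T x ** frechet_derivative (\<lambda>X. A X W) (at x) V - T x ** frechet_derivative (\<lambda>X. A X V) (at x) W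
     = (B (\<psi> x) (?p W) ** ?t V - B (\<psi> x) (?p V) ** ?t W) - (?t V ** A x W - ?t W ** A x V)
       + frechet_derivative (\<lambda>Y. B Y (?p W)) (at (\<psi> x)) (?p V) ** T x
       - frechet_derivative (\<lambda>Y. B Y (?p V)) (at (\<psi> x)) (?p W) ** T x"
    using arg_cong2[OF E[of V W] E[of W V], of "(-)"]
    by (simp add: sT s\<psi> matrix_mult_algebra algebra_simps)
  then show ?thesis
    unfolding curvature_def
    by (simp add: t matrix_mult_algebra matrix_mul_assoc algebra_simps)
qed

text \<open>In the orthonormal frame obtained by the Gram-Schmidt process a compatible connection on a
  rank-2 bundle is a real 1-form \<open>a\<close> times \<open>J2\<close>, and its curvature is the exterior derivative of \<open>a\<close>.\<close>

lemma orthonormal_connection_form: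
  fixes A :: "M2 \<Rightarrow> M2 \<Rightarrow> M2" and S :: "M2 \<Rightarrow> M2"
  assumes O: "open O'" and S: "smooth_on O' S" "\<And>X. X \<in> O' \<Longrightarrow> pos_def (S X)"
    and A: "\<And>V. smooth_on O' (\<lambda>X. A X V)" "\<And>X. X \<in> O' \<Longrightarrow> linear (A X)"
    and compat: "\<And>X V. X \<in> O' \<Longrightarrow> frechet_derivative S (at X) V = transpose (A X V) ** S X + S X ** A X V"
  obtains a :: "M2 \<Rightarrow> M2 \<Rightarrow> real" where
    "\<And>V. smooth_on O' (\<lambda>X. a X V)" "\<And>X. X \<in> O' \<Longrightarrow> linear (a X)"
    "\<And>X V. X \<in> O' \<Longrightarrow> chol (S X) ** A X V = a X V *\<^sub>R (J2 ** chol (S X)) + frechet_derivative (\<lambda>X. chol (S X)) (at X) V"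
    "\<And>X V W. X \<in> O' \<Longrightarrow> curvature A X V W =
       (frechet_derivative (\<lambda>Y. a Y W) (at X) V - frechet_derivative (\<lambda>Y. a Y V) (at X) W) *\<^sub>R jmat (S X)"
proof -
  define T where "T X = chol (S X)" for X
  have T: "smooth_on O' T" unfolding T_def by (rule smooth_on_chol[OF O S])
  have dT: "det (T X) \<noteq> 0" if "X \<in> O'" for X
    using det_chol_pos[OF S(2)[OF that]] by (simp add: T_def)
  define A' where "A' X V = (T X ** A X V - frechet_derivative T (at X) V) ** matrix_inv (T X)" for X V
  define a where "a X V = A' X V $ 2 $ 1" for X V
  have A's: "smooth_on O' (\<lambda>X. A' X V)" for V
    unfolding A'_def
    by (intro smooth_on_matrix_mult smooth_on_diff O T A smooth_on_derivative smooth_on_matrix_inv2 dT)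
  have a1: "smooth_on O' (\<lambda>X. a X V)" for V
    unfolding a_def by (intro smooth_on_nth O A's)
  have a2: "linear (a X)" if "X \<in> O'" for X
  proof -
    have "linear (frechet_derivative T (at X))"
      using smooth_onD[OF T that] by (rule linear_frechet_derivative)
    then show ?thesis using A(2)[OF that]
      by (auto intro!: linearI simp: a_def A'_def linear_add linear_cmul matrix_mult_algebra algebra_simps)
  qed
  have J: "A' X V = a X V *\<^sub>R J2" if X: "X \<in> O'" for X V
  proof -
    let ?t = "frechet_derivative T (at X) V" and ?i = "matrix_inv (T X)"
    have 1: "frechet_derivative (\<lambda>X. transpose (T X) ** T X) (at X) =
       (\<lambda>V. transpose (T X) ** frechet_derivative T (at X) V + transpose (frechet_derivative T (at X) V) ** T X)"
      by (intro frechet_derivative_eqI has_derivative_matrix_mult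
          bounded_linear.has_derivative[OF bounded_linear_transpose] smooth_on_has_derivative[OF T X])
    have ST: "S Y = transpose (T Y) ** T Y" if "Y \<in> O'" for Y
      using chol_sq[OF S(2)[OF that]] by (simp add: T_def)
    have 2: "frechet_derivative S (at X) = frechet_derivative (\<lambda>X. transpose (T X) ** T X) (at X)"
      by (rule frechet_derivative_cong_open[OF O X ST])
    have "transpose (T X) ** ?t + transpose ?t ** T X = transpose (A X V) ** S X + S X ** A X V"
      using compat[OF X, of V] by (simp only: 2 1)
    then have e: "transpose (T X) ** ?t + transpose ?t ** T X
      = transpose (A X V) ** (transpose (T X) ** T X) + (transpose (T X) ** T X) ** A X V"
      using ST[OF X] by simp
    have ti: "transpose ?i ** transpose (T X) = mat 1"
      using matrix_inv_props(2)[OF dT[OF X]] by (metis matrix_transpose_mul transpose_mat)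
    have it: "T X ** ?i = mat 1" using matrix_inv_props(2)[OF dT[OF X]] .
    have "transpose ?i ** (transpose (T X) ** ?t + transpose ?t ** T X) ** ?i =
       transpose ?i ** (transpose (T X) ** ?t) ** ?i + transpose ?i ** transpose ?t ** (T X ** ?i)"
      by (simp add: matrix_mult_algebra matrix_mul_assoc)
    also have "\<dots> = ?t ** ?i + transpose ?i ** transpose ?t"
      by (simp add: matrix_mul_assoc ti it)
    finally have 1: "transpose ?i ** (transpose (T X) ** ?t + transpose ?t ** T X) ** ?i
       = ?t ** ?i + transpose ?i ** transpose ?t" .
    have "transpose ?i ** (transpose (A X V) ** (transpose (T X) ** T X) + (transpose (T X) ** T X) ** A X V) ** ?i
       = transpose ?i ** transpose (A X V) ** transpose (T X) ** (T X ** ?i)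
         + (transpose ?i ** transpose (T X)) ** T X ** A X V ** ?i"
      by (simp add: matrix_mult_algebra matrix_mul_assoc)
    also have "\<dots> = transpose ?i ** transpose (A X V) ** transpose (T X) + T X ** A X V ** ?i"
      by (simp add: ti it)
    finally have 3: "?t ** ?i + transpose ?i ** transpose ?t =
        transpose ?i ** transpose (A X V) ** transpose (T X) + T X ** A X V ** ?i"
      using 1 by (simp only: e)
    have 4: "A' X V = T X ** A X V ** ?i - ?t ** ?i"
      by (simp add: A'_def matrix_mult_algebra)
    have 5: "transpose (A' X V) = transpose ?i ** transpose (A X V) ** transpose (T X) - transpose ?i ** transpose ?t"
      unfolding 4 linear_diff[OF bounded_linear.linear[OF bounded_linear_transpose]]
      by (simp only: matrix_transpose_mul matrix_mul_assoc)
    have aux: "r - q = - (s - p)" if "p + q = r + s" for p q r s :: M2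
    proof -
      have "(r - q) - - (s - p) = (r + s) - (p + q)" by (simp add: algebra_simps)
      with that show ?thesis by simp
    qed
    \<comment> \<open>In an orthonormal frame compatibility with the metric means that the potential
      is skew.\<close>
    have "transpose (A' X V) = - A' X V"
      by (rule trans[OF 5]) (simp only: 4 aux[OF 3])
    from antisym2_eq[OF this] show ?thesis by (simp add: a_def)
  qed
  have a3: "T X ** A X V = (a X V *\<^sub>R J2) ** T X + frechet_derivative T (at X) V" if X: "X \<in> O'" for X V
  proof -
    have "A' X V ** T X = T X ** A X V - frechet_derivative T (at X) V"
      using dT[OF X] by (simp add: A'_def matrix_inv_mult_cancel)
    then show ?thesis using J[OF X] by (simp add: algebra_simps)
  qed
  have a4: "curvature A X V W =
       (frechet_derivative (\<lambda>Y. a Y W) (at X) V - frechet_derivative (\<lambda>Y. a Y V) (at X) W) *\<^sub>R jmat (S X)"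
    if X: "X \<in> O'" for X V W
  proof -
    have id: "frechet_derivative (\<lambda>X::M2. X) (at X) = (\<lambda>V. V)" for X
      by (rule frechet_derivative_eqI) (rule has_derivative_ident)
    have Bs: "smooth_on O' (\<lambda>Y. a Y V *\<^sub>R J2)" for V
      by (intro smooth_on_scaleR O a1 smooth_on_const)
    have dB: "frechet_derivative (\<lambda>Y. a Y W *\<^sub>R J2) (at X) V = frechet_derivative (\<lambda>Y. a Y W) (at X) V *\<^sub>R J2" for V W
      by (rule frechet_derivative_bounded_linear[OF bounded_linear_scaleR_left smooth_onD[OF a1 X]])
    have "T X ** curvature A X V W = curvature (\<lambda>X V. a X V *\<^sub>R J2) X V W ** T X"
      using curvature_gauge[of O' X T "\<lambda>X. X" O' "\<lambda>X V. a X V *\<^sub>R J2" A V W]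
        O X T smooth_on_ident[OF O] Bs A a2 a3
      by (auto simp: id linear_iff scaleR_left_distrib)
    also have "curvature (\<lambda>X V. a X V *\<^sub>R J2) X V W
      = (frechet_derivative (\<lambda>Y. a Y W) (at X) V - frechet_derivative (\<lambda>Y. a Y V) (at X) W) *\<^sub>R J2"
      by (simp add: curvature_def dB matrix_mult_algebra algebra_simps)
    finally have "matrix_inv (T X) ** (T X ** curvature A X V W) =
      (frechet_derivative (\<lambda>Y. a Y W) (at X) V - frechet_derivative (\<lambda>Y. a Y V) (at X) W) *\<^sub>R
        (matrix_inv (T X) ** J2 ** T X)"
      by (simp add: matrix_mult_scaleR matrix_mul_assoc)
    then show ?thesis
      using jmat_chol[OF S(2)[OF X]] dT[OF X] by (simp add: matrix_inv_mult_cancel T_def)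
  qed
  show thesis
  proof (rule that[of a])
    show "chol (S X) ** A X V = a X V *\<^sub>R (J2 ** chol (S X)) + frechet_derivative (\<lambda>X. chol (S X)) (at X) V"
      if "X \<in> O'" for X V
      using a3[OF that, of V] by (simp only: T_def[abs_def] matrix_mult_scaleR)
  qed (use a1 a2 a4 in auto)
qed

text \<open>The Poincare lemma: the primitive is the integral of the form along the segment from the
  centre, differentiated under the integral sign.\<close>

lemma closed_form_exact_on_ball:
  fixes \<alpha> :: "'a::euclidean_space \<Rightarrow> 'a \<Rightarrow> real"
  assumes \<alpha>: "\<And>V. smooth_on (ball c r) (\<lambda>X. \<alpha> X V)" "\<And>X. X \<in> ball c r \<Longrightarrow> linear (\<alpha> X)"
    and closed: "\<And>X V W. X \<in> ball c r \<Longrightarrow>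
      frechet_derivative (\<lambda>Y. \<alpha> Y W) (at X) V = frechet_derivative (\<lambda>Y. \<alpha> Y V) (at X) W"
  obtains \<theta> where "\<And>X. X \<in> ball c r \<Longrightarrow> (\<theta> has_derivative \<alpha> X) (at X)"
proof -
  let ?U = "ball c r"
  define y where "y X t = c + t *\<^sub>R (X - c)" for X and t :: real
  have y: "y X t \<in> ?U" if "X \<in> ?U" "t \<in> {0..1}" for X t
  proof -
    have "dist c (y X t) = t * dist c X" using that by (simp add: y_def dist_norm norm_minus_commute)
    also have "\<dots> \<le> dist c X" using that by (simp add: mult_left_le_one_le)
    finally show ?thesis using that by simp
  qed
  define D where "D X V W = frechet_derivative (\<lambda>Y. \<alpha> Y W) (at X) V" for X V W
  define L where "L X t V = D (y X t) (t *\<^sub>R V) (X - c) + \<alpha> (y X t) V" for X t V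
  have der: "((\<lambda>X. \<alpha> (y X t) (X - c)) has_derivative L X t) (at X)" if "X \<in> ?U" "t \<in> {0..1}" for X t
    unfolding L_def D_def
    by (rule has_derivative_form[where B = \<alpha> and \<psi> = "\<lambda>X. y X t", OF open_ball y[OF that] \<alpha>(2) smooth_onD[OF \<alpha>(1) y[OF that]]])
      (auto simp: y_def intro!: derivative_eq_intros)
  have bl: "bounded_linear (L X t)" if "X \<in> ?U" "t \<in> {0..1}" for X t
    using der[OF that] by (rule has_derivative_bounded_linear)
  have contD: "continuous_on ?U (\<lambda>X. D X V W)" for V W
    unfolding D_def by (intro smooth_on_imp_continuous_on smooth_on_derivative \<alpha>)
  have cont\<alpha>: "continuous_on ?U (\<lambda>X. \<alpha> X V)" for V
    by (intro smooth_on_imp_continuous_on \<alpha>)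
  have Dlin: "D X (t *\<^sub>R V) W = t * D X V W" if "X \<in> ?U" for X t V W
    using linear_cmul[OF linear_frechet_derivative[OF smooth_onD[OF \<alpha>(1) that]]] by (simp add: D_def)
  have Dexp: "D X V W = (\<Sum>b\<in>Basis. (W \<bullet> b) * D X V b)" if "X \<in> ?U" for X V W
    using frechet_derivative_form_expand[where B = \<alpha>, OF open_ball that \<alpha>(2) smooth_onD[OF \<alpha>(1) that], of W V]
    by (simp only: D_def real_scaleR_def)
  have cy: "continuous_on (?U \<times> {0..1}) (\<lambda>p. y (fst p) (snd p))"
    unfolding y_def by (intro continuous_intros)
  have yim: "(\<lambda>p. y (fst p) (snd p)) ` (?U \<times> {0..1}) \<subseteq> ?U" using y by auto
  have contL: "continuous_on (?U \<times> {0..1}) (\<lambda>p. L (fst p) (snd p) V)" for V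
  proof -
    have "continuous_on (?U \<times> {0..1}) (\<lambda>p. snd p * (\<Sum>b\<in>Basis. ((fst p - c) \<bullet> b) * D (y (fst p) (snd p)) V b)
        + \<alpha> (y (fst p) (snd p)) V)"
      by (intro continuous_intros continuous_on_compose2[OF contD cy yim] continuous_on_compose2[OF cont\<alpha> cy yim])
    then show ?thesis
      by (rule continuous_on_cong[THEN iffD1, rotated 2])
        (use y in \<open>auto simp: L_def Dlin Dexp[where W = "w - c" for w]
          sum_distrib_left mult.left_commute\<close>)
  qed
  \<comment> \<open>The Leibniz rule requires the derivative of the integrand as a continuous
    function with values in the bounded linear maps.\<close>
  define F where "F X t = Blinfun (L X t)" for X t
  have F: "blinfun_apply (F X t) = L X t" if "X \<in> ?U" "t \<in> {0..1}" for X t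
    unfolding F_def using bl[OF that] by (rule bounded_linear_Blinfun_apply)
  have contF: "continuous_on (?U \<times> {0..1}) (\<lambda>p. F (fst p) (snd p))"
  proof (rule continuous_on_blinfun_componentwise)
    fix i :: 'a
    show "continuous_on (?U \<times> {0..1}) (\<lambda>p. blinfun_apply (F (fst p) (snd p)) i)"
      using contL[of i] by (rule continuous_on_cong[THEN iffD1, rotated 2]) (auto simp: F)
  qed
  have contFX: "continuous_on {0..1} (F X)" if "X \<in> ?U" for X
  proof -
    have "continuous_on {0..1} (\<lambda>t::real. (X, t))" by (intro continuous_intros)
    moreover have "Pair X ` {0..1::real} \<subseteq> ?U \<times> {0..1}" using that by auto
    ultimately show ?thesis using continuous_on_compose2[OF contF] by fastforce
  qed
  define \<theta> where "\<theta> X = integral {0..1} (\<lambda>t. \<alpha> (y X t) (X - c))" for X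
  have "(\<theta> has_derivative \<alpha> X) (at X)" if X: "X \<in> ?U" for X
  proof -
    have int: "(\<lambda>t. \<alpha> (y X t) (X - c)) integrable_on cbox 0 1" if "X \<in> ?U" for X
    proof -
      have "continuous_on {0..1} (\<lambda>t. \<alpha> (y X t) (X - c))"
        by (rule continuous_on_compose2[OF cont\<alpha>, of _ "y X"])
          (use y that in \<open>auto simp: y_def intro!: continuous_intros\<close>)
      then show ?thesis using integrable_continuous_real by auto
    qed
    have "((\<lambda>X. integral (cbox 0 1) (\<lambda>t. \<alpha> (y X t) (X - c))) has_derivative
       blinfun_apply (integral (cbox 0 1) (F X))) (at X within ?U)"
    proof (rule leibniz_rule[where fx = F])
      show "((\<lambda>X. \<alpha> (y X t) (X - c)) has_derivative blinfun_apply (F X t)) (at X within ?U)"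
        if "X \<in> ?U" "t \<in> cbox 0 1" for X t
        using der[of X t] F[of X t] that by (auto intro: has_derivative_at_withinI)
      show "continuous_on (?U \<times> cbox 0 1) (\<lambda>(x, t). F x t)"
        using contF by (simp add: case_prod_beta')
    qed (use int X in auto)
    then have 1: "(\<theta> has_derivative blinfun_apply (integral {0..1} (F X))) (at X)"
      using X by (simp add: \<theta>_def[abs_def] at_within_open[OF X open_ball])
    have "blinfun_apply (integral {0..1} (F X)) V = \<alpha> X V" for V
    proof -
      have "F X integrable_on {0..1}" using contFX[OF X] by (rule integrable_continuous_real)
      from integral_linear[OF this blinfun.bounded_linear_left, of V]
      have "blinfun_apply (integral {0..1} (F X)) V = integral {0..1} (\<lambda>t. blinfun_apply (F X t) V)"
        by (simp add: o_def)
      also have "\<dots> = integral {0..1} (\<lambda>t. L X t V)"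
        using F[OF X] by (intro integral_cong) auto
      \<comment> \<open>By closedness the integrand is the derivative in t of t times the form at
        the point with parameter t of the segment.\<close>
      also have "\<dots> = 1 * \<alpha> (y X 1) V - 0 * \<alpha> (y X 0) V"
      proof (rule integral_unique, rule fundamental_theorem_of_calculus)
        fix t :: real assume t: "t \<in> {0..1}"
        have "((\<lambda>s. \<alpha> (c + s *\<^sub>R (X - c)) V) has_real_derivative D (y X t) (X - c) V) (at t)"
          using has_real_derivative_along_line[of "\<lambda>Y. \<alpha> Y V" c t "X - c"] smooth_onD[OF \<alpha>(1) y[OF X t]]
          by (simp add: y_def D_def)
        then have "((\<lambda>s. s * \<alpha> (y X s) V) has_real_derivative (1 * \<alpha> (y X t) V + D (y X t) (X - c) V * t)) (at t)"
          unfolding y_def by (intro DERIV_mult DERIV_ident)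
        moreover have "1 * \<alpha> (y X t) V + D (y X t) (X - c) V * t = L X t V"
          using closed[OF y[OF X t]] Dlin[OF y[OF X t]] by (simp add: L_def D_def)
        ultimately show "((\<lambda>s. s * \<alpha> (y X s) V) has_vector_derivative L X t V) (at t within {0..1})"
          by (simp add: has_real_derivative_iff_has_vector_derivative has_vector_derivative_at_within)
      qed simp
      finally show ?thesis by (simp add: y_def)
    qed
    then have "blinfun_apply (integral {0..1} (F X)) = \<alpha> X" by auto
    with 1 show ?thesis by simp
  qed
  then show thesis by (rule that)
qed

section \<open>The charts of the Grassmannian\<close>

lemma det_4:
  "det (A::'a::comm_ring_1^4^4) =
    A$1$1 * (A$2$2 * (A$3$3 * A$4$4 - A$3$4 * A$4$3) - A$2$3 * (A$3$2 * A$4$4 - A$3$4 * A$4$2) + A$2$4 * (A$3$2 * A$4$3 - A$3$3 * A$4$2))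
  - A$1$2 * (A$2$1 * (A$3$3 * A$4$4 - A$3$4 * A$4$3) - A$2$3 * (A$3$1 * A$4$4 - A$3$4 * A$4$1) + A$2$4 * (A$3$1 * A$4$3 - A$3$3 * A$4$1))
  + A$1$3 * (A$2$1 * (A$3$2 * A$4$4 - A$3$4 * A$4$2) - A$2$2 * (A$3$1 * A$4$4 - A$3$4 * A$4$1) + A$2$4 * (A$3$1 * A$4$2 - A$3$2 * A$4$1))
  - A$1$4 * (A$2$1 * (A$3$2 * A$4$3 - A$3$3 * A$4$2) - A$2$2 * (A$3$1 * A$4$3 - A$3$3 * A$4$1) + A$2$3 * (A$3$1 * A$4$2 - A$3$2 * A$4$1))"
proof -
  have f1234: "finite {2::4, 3, 4}" "1 \<notin> {2::4, 3, 4}" by auto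
  have f234: "finite {3::4, 4}" "2 \<notin> {3::4, 4}" by auto
  have f34: "finite {4::4}" "3 \<notin> {4::4}" by auto
  show ?thesis
    unfolding det_def UNIV_4
    unfolding sum_over_permutations_insert[OF f1234]
    unfolding sum_over_permutations_insert[OF f234]
    unfolding sum_over_permutations_insert[OF f34]
    unfolding permutes_sing
    by (simp add: sign_swap_id permutation_swap_id permutation_compose sign_compose sign_id swap_id_eq algebra_simps)
qed

lemma stack_nth [simp]:
  "stack X Y $ 1 = X $ 1" "stack X Y $ 2 = X $ 2" "stack X Y $ 3 = Y $ 1" "stack X Y $ 4 = Y $ 2"
  by (simp_all add: stack_def)

lemma upper_block_nth [simp]: "upper_block M $ 1 = M $ 1" "upper_block M $ 2 = M $ 2"
  by (simp_all add: upper_block_def)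

lemma lower_block_nth [simp]: "lower_block M $ 1 = M $ 3" "lower_block M $ 2 = M $ 4"
  by (simp_all add: lower_block_def)

lemma stack_blocks [simp]: "stack (upper_block M) (lower_block M) = M"
  by (simp add: vec_eq_iff[of "stack _ _"] forall_4)

lemma blocks_stack [simp]: "upper_block (stack X Y) = X" "lower_block (stack X Y) = Y"
  by (simp_all add: vec_eq_iff[of "upper_block _"] vec_eq_iff[of "lower_block _"] forall_2)

lemma matrix_mult_row: "(A ** B) $ i = A $ i v* B"
  by (simp add: vec_eq_iff matrix_matrix_mult_def vector_matrix_mult_def mult.commute)

lemma stack_mult: "stack X Y ** Z = stack (X ** Z) (Y ** Z)"
  by (simp add: vec_eq_iff[of "stack _ _ ** _"] forall_4 matrix_mult_row)

lemma upper_block_mult: "upper_block (M ** Z) = upper_block M ** Z"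
  by (metis blocks_stack(1) stack_blocks stack_mult)

lemma lower_block_mult: "lower_block (M ** Z) = lower_block M ** Z"
  by (metis blocks_stack(2) stack_blocks stack_mult)

lemma stack_add: "stack (X + X') (Y + Y') = stack X Y + stack X' Y'"
  by (simp add: vec_eq_iff[of "stack _ _"] forall_4)

lemma linear_blocks: "linear upper_block" "linear lower_block"
  by (auto intro!: linearI simp: vec_eq_iff[of "upper_block _"] vec_eq_iff[of "lower_block _"] forall_2)

lemma bounded_linear_blocks: "bounded_linear upper_block" "bounded_linear lower_block"
  using linear_blocks by (simp_all add: linear_conv_bounded_linear)

lemma range_matrix_vector_mult: "range ((*v) A) = span (columns A)" for A :: "real^'n^'m"
proof
  show "range ((*v) A) \<subseteq> span (columns A)"
    using matrix_vector_mult_in_columnspace by blast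
  have "subspace (range ((*v) A))"
    by (intro linear_subspace_image matrix_vector_mul_linear) (rule subspace_UNIV)
  moreover have "columns A \<subseteq> range ((*v) A)"
    by (auto simp: columns_def) (metis matrix_vector_mult_basis rangeI)
  ultimately show "span (columns A) \<subseteq> range ((*v) A)" by (rule span_minimal[rotated])
qed

text \<open>The first two columns of \<open>g\<close>: they are the linear part of the affine map
  \<open>std_frame g\<close>, and they represent a frame of the quotient of \<real>^4 by each plane
  of the chart.\<close>

definition left_cols :: "real^4^4 \<Rightarrow> real^2^4" where
  "left_cols g = g ** stack (mat 1) 0"

lemma std_frame_diff: "std_frame g X = g ** stack 0 (mat 1) + left_cols g ** X"
proof -
  have "stack X (mat 1) = stack 0 (mat 1) + stack (mat 1) 0 ** X"
    by (simp add: stack_mult stack_add[symmetric])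
  then show ?thesis
    by (simp add: std_frame_def left_cols_def matrix_mult_algebra matrix_mul_assoc)
qed

lemma has_derivative_std_frame: "(std_frame g has_derivative (\<lambda>V. left_cols g ** V)) (at X)"
  unfolding std_frame_diff[abs_def]
  by (rule derivative_eq_intros bounded_linear.has_derivative[OF
        bounded_bilinear.bounded_linear_right[OF bounded_bilinear_matrix_mult]] refl)+ simp

lemma smooth_on_std_frame: "open S \<Longrightarrow> smooth_on S (std_frame g)"
  unfolding std_frame_diff[abs_def]
  by (intro smooth_on_add smooth_on_const smooth_on_ident
      smooth_on_bounded_linear[OF bounded_bilinear.bounded_linear_right[OF bounded_bilinear_matrix_mult]])

lemma std_frame_left_inverse:
  assumes "det g \<noteq> 0"
  shows "lower_block (matrix_inv g ** (std_frame g X ** Z)) = Z"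
  using assms unfolding std_frame_def
  by (simp add: matrix_mul_assoc matrix_inv_props) (simp add: stack_mult)

lemma std_frame_cancel:
  fixes Z Z' :: M2
  assumes "det g \<noteq> 0"
  shows "std_frame g X ** Z = std_frame g X ** Z' \<longleftrightarrow> Z = Z'"
proof
  assume "std_frame g X ** Z = std_frame g X ** Z'"
  then have "lower_block (matrix_inv g ** (std_frame g X ** Z)) = lower_block (matrix_inv g ** (std_frame g X ** Z'))"
    by (rule arg_cong)
  then show "Z = Z'" by (simp only: std_frame_left_inverse[OF assms])
qed (rule arg_cong)

lemma std_frame_vec_cancel:
  assumes "det g \<noteq> 0" "std_frame g X *v v = 0"
  shows "v = 0"
proof -
  let ?Z = "(\<chi> i j. v $ i) :: M2"
  have "std_frame g X ** ?Z = std_frame g X ** 0"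
    using assms(2) by (simp add: vec_eq_iff matrix_matrix_mult_def matrix_vector_mult_def)
  then have "?Z = 0" using std_frame_cancel[OF assms(1)] by blast
  then have "?Z $ i $ 1 = 0" for i by simp
  then have "v $ i = 0 $ i" for i by simp
  then show ?thesis by (simp only: vec_eq_iff simp_thms)
qed

lemma Psi_range: "Psi g X = range ((*v) (std_frame g X))"
  by (simp add: Psi_def range_matrix_vector_mult)

lemma range_le_factor:
  fixes A :: "real^'n^'m" and B :: "real^'p^'m"
  assumes "range ((*v) A) \<subseteq> range ((*v) B)"
  obtains Z where "A = B ** Z"
proof -
  have "\<forall>j. \<exists>v. A *v axis j 1 = B *v v" using assms by blast
  then obtain f where f: "\<And>j. A *v axis j 1 = B *v f j" by metis
  have "A = B ** (\<chi> i j. f j $ i)"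
    using f by (simp add: vec_eq_iff matrix_vector_mult_basis column_def)
      (simp add: matrix_vector_mult_def matrix_matrix_mult_def)
  then show thesis by (rule that)
qed

lemma range_mult_subset: "range ((*v) (A ** B)) \<subseteq> range ((*v) A)"
  by (auto simp: matrix_vector_mul_assoc[symmetric])

lemma chart_blocks: 
  assumes "det h \<noteq> 0"
  shows "std_frame g X = h ** stack (chart_num g h X) (chart_den g h X)"
  using assms by (simp add: chart_num_def chart_den_def std_frame_def matrix_mul_assoc matrix_inv_props)

lemma std_frame_change:
  assumes "det h \<noteq> 0" "det (chart_den g h X) \<noteq> 0"
  shows "std_frame g X = std_frame h (chart_change g h X) ** chart_den g h X"
  using assms by (subst chart_blocks[OF assms(1)])
    (simp add: std_frame_def chart_change_def matrix_mul_assoc[symmetric] stack_mult matrix_inv_props)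

lemma frame_in_chart:
  assumes "det h \<noteq> 0" "std_frame g X = std_frame h Y ** Z"
  shows "chart_den g h X = Z" "chart_num g h X = Y ** Z"
proof -
  have "matrix_inv h ** g ** stack X (mat 1) = stack Y (mat 1) ** Z"
    using assms by (metis (no_types) matrix_inv_mult_cancel(1) matrix_mul_assoc std_frame_def)
  then show "chart_den g h X = Z" "chart_num g h X = Y ** Z"
    by (simp_all add: chart_den_def chart_num_def stack_mult)
qed

text \<open>Two frames of one plane differ by an invertible matrix, and a comparison of the lower
  blocks identifies this matrix with \<open>chart_den\<close>. Every later statement about overlaps
  rests on this.\<close>

lemma Psi_eq_iff:
  assumes "det g \<noteq> 0" "det h \<noteq> 0"
  shows "Psi g X = Psi h Y \<longleftrightarrow> det (chart_den g h X) \<noteq> 0 \<and> Y = chart_change g h X"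
proof
  assume "Psi g X = Psi h Y"
  then have "range ((*v) (std_frame g X)) \<subseteq> range ((*v) (std_frame h Y))"
    "range ((*v) (std_frame h Y)) \<subseteq> range ((*v) (std_frame g X))" by (simp_all add: Psi_range)
  then obtain Z Z' where Z: "std_frame g X = std_frame h Y ** Z" and Z': "std_frame h Y = std_frame g X ** Z'"
    by (metis range_le_factor)
  have "std_frame h Y ** (Z ** Z') = std_frame h Y ** mat 1"
    using Z Z' by (simp add: matrix_mul_assoc)
  then have "Z ** Z' = mat 1" using std_frame_cancel assms by blast
  then have "det Z * det Z' = 1" by (metis det_I det_mul)
  then have dZ: "det Z \<noteq> 0" by auto
  show "det (chart_den g h X) \<noteq> 0 \<and> Y = chart_change g h X"
    using frame_in_chart[OF assms(2) Z] dZ by (simp add: chart_change_def matrix_inv_mult_cancel)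
next
  assume r: "det (chart_den g h X) \<noteq> 0 \<and> Y = chart_change g h X"
  then have e: "std_frame g X = std_frame h Y ** chart_den g h X"
    using std_frame_change[OF assms(2)] by blast
  then have e': "std_frame h Y = std_frame g X ** matrix_inv (chart_den g h X)"
    using r by (simp add: matrix_inv_mult_cancel)
  show "Psi g X = Psi h Y"
    unfolding Psi_range using e e' range_mult_subset by (metis subset_antisym)
qed

lemma Psi_chart_change:
  "det g \<noteq> 0 \<Longrightarrow> det h \<noteq> 0 \<Longrightarrow> det (chart_den g h X) \<noteq> 0 \<Longrightarrow> Psi h (chart_change g h X) = Psi g X"
  using Psi_eq_iff by metis

lemma Psi_inj: "det g \<noteq> 0 \<Longrightarrow> Psi g X = Psi g Y \<Longrightarrow> X = Y"
proof -
  assume g: "det g \<noteq> 0" and "Psi g X = Psi g Y"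
  then have "Y = chart_change g g X" using Psi_eq_iff by blast
  moreover have "std_frame g X = std_frame g X ** mat 1" by simp
  from frame_in_chart[OF g this] have "chart_change g g X = X"
    by (simp add: chart_change_def matrix_inv_mat_1)
  ultimately show ?thesis by simp
qed

lemma chart_self: "det g \<noteq> 0 \<Longrightarrow> chart_den g g X = mat 1" "det g \<noteq> 0 \<Longrightarrow> chart_change g g X = X"
proof -
  assume g: "det g \<noteq> 0"
  have "std_frame g X = std_frame g X ** mat 1" by simp
  from frame_in_chart[OF g this] show "chart_den g g X = mat 1" "chart_change g g X = X"
    by (simp_all add: chart_change_def matrix_inv_mat_1)
qed

lemma chart_den_cocycle:
  assumes "det h \<noteq> 0" "det (chart_den g h X) \<noteq> 0"
  shows "chart_den g k X = chart_den h k (chart_change g h X) ** chart_den g h X"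
    "chart_num g k X = chart_num h k (chart_change g h X) ** chart_den g h X"
proof -
  have "matrix_inv k ** g ** stack X (mat 1) = matrix_inv k ** std_frame g X"
    by (simp add: std_frame_def matrix_mul_assoc)
  also have "\<dots> = matrix_inv k ** h ** stack (chart_change g h X) (mat 1) ** chart_den g h X"
    by (subst std_frame_change[OF assms]) (simp add: std_frame_def matrix_mul_assoc)
  finally show "chart_den g k X = chart_den h k (chart_change g h X) ** chart_den g h X"
    "chart_num g k X = chart_num h k (chart_change g h X) ** chart_den g h X"
    by (simp_all add: chart_den_def chart_num_def lower_block_mult[symmetric] upper_block_mult[symmetric])
qed

lemma chart_change_cocycle:
  assumes "det h \<noteq> 0" "det (chart_den g h X) \<noteq> 0" "det (chart_den g k X) \<noteq> 0"
  shows "det (chart_den h k (chart_change g h X)) \<noteq> 0"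
    "chart_change h k (chart_change g h X) = chart_change g k X"
proof -
  show d: "det (chart_den h k (chart_change g h X)) \<noteq> 0"
    using assms chart_den_cocycle(1)[OF assms(1,2), of k] by (auto simp: det_mul)
  show "chart_change h k (chart_change g h X) = chart_change g k X"
    unfolding chart_change_def[of g k] chart_den_cocycle[OF assms(1,2), of k]
    using assms(2) d by (simp add: matrix_inv_mult matrix_mul_assoc matrix_inv_mult_cancel chart_change_def[of h k])
qed

lemma chart_den_inverse:
  assumes "det g \<noteq> 0" "det h \<noteq> 0" "det (chart_den g h X) \<noteq> 0"
  shows "chart_den h g (chart_change g h X) = matrix_inv (chart_den g h X)"
    "chart_change h g (chart_change g h X) = X"
    "det (chart_den h g (chart_change g h X)) \<noteq> 0"
proof -
  have "chart_den h g (chart_change g h X) ** chart_den g h X = mat 1"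
    using chart_den_cocycle(1)[OF assms(2,3), of g] chart_self[OF assms(1)] by simp
  from matrix_inv_eqI[OF this] matrix_inv_inv
  show e: "chart_den h g (chart_change g h X) = matrix_inv (chart_den g h X)"
    by (metis \<open>chart_den h g (chart_change g h X) ** chart_den g h X = mat 1\<close> assms(3) matrix_inv_eqI)
  have "det (chart_den g g X) \<noteq> 0" using chart_self[OF assms(1)] by simp
  from chart_change_cocycle[OF assms(2,3) this] chart_self[OF assms(1)]
  show "chart_change h g (chart_change g h X) = X" "det (chart_den h g (chart_change g h X)) \<noteq> 0" by auto
qed

text \<open>Coordinate changes depend only on \<open>matrix_inv h ** g\<close>, from which a common
  left factor cancels. This is why a pull-back under a linear map leaves the coordinate expressions
  alone.\<close>

lemma chart_translate:
  assumes "det a \<noteq> 0" "det h \<noteq> 0"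
  shows "chart_den (a ** g) (a ** h) = chart_den g h" "chart_num (a ** g) (a ** h) = chart_num g h"
    "chart_change (a ** g) (a ** h) = chart_change g h"
proof -
  have "matrix_inv (a ** h) ** (a ** g) = matrix_inv h ** (matrix_inv a ** (a ** g))"
    using assms by (simp add: matrix_inv_mult matrix_mul_assoc)
  also have "\<dots> = matrix_inv h ** g" using assms by (simp add: matrix_inv_mult_cancel)
  finally show "chart_den (a ** g) (a ** h) = chart_den g h" "chart_num (a ** g) (a ** h) = chart_num g h"
    "chart_change (a ** g) (a ** h) = chart_change g h"
    by (simp_all add: fun_eq_iff chart_den_def chart_num_def chart_change_def)
qed

lemma std_frame_translate: "std_frame (a ** g) X = a ** std_frame g X" "left_cols (a ** g) = a ** left_cols g"
  by (simp_all add: std_frame_def left_cols_def matrix_mul_assoc)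

text \<open>The tangent space of \<open>Gr\<close> at a plane consists of the maps from the plane to
  its quotient space. The derivative of a coordinate change therefore multiplies from the right by
  the inverse of \<open>chart_den\<close>, and from the left by the present matrix, the transition
  function of the quotient bundle in the frames \<open>left_cols\<close>.\<close>

definition chart_lin :: "real^4^4 \<Rightarrow> real^4^4 \<Rightarrow> M2 \<Rightarrow> M2" where
  "chart_lin g h X = upper_block (matrix_inv h ** left_cols g) - chart_change g h X ** lower_block (matrix_inv h ** left_cols g)"

lemma chart_affine:
  "chart_num g h X = upper_block (matrix_inv h ** std_frame g X)"
  "chart_den g h X = lower_block (matrix_inv h ** std_frame g X)"
  by (simp_all add: chart_num_def chart_den_def std_frame_def matrix_mul_assoc)

lemma has_derivative_chart_num_den:
  "(chart_num g h has_derivative (\<lambda>V. upper_block (matrix_inv h ** left_cols g) ** V)) (at X)"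
  "(chart_den g h has_derivative (\<lambda>V. lower_block (matrix_inv h ** left_cols g) ** V)) (at X)"
proof -
  have *: "((\<lambda>X. matrix_inv h ** std_frame g X) has_derivative (\<lambda>V. matrix_inv h ** (left_cols g ** V))) (at X)"
    by (rule bounded_linear.has_derivative[OF
        bounded_bilinear.bounded_linear_right[OF bounded_bilinear_matrix_mult] has_derivative_std_frame])
  show "(chart_num g h has_derivative (\<lambda>V. upper_block (matrix_inv h ** left_cols g) ** V)) (at X)"
    using bounded_linear.has_derivative[OF bounded_linear_blocks(1) *]
    unfolding chart_affine[abs_def] by (simp only: upper_block_mult[symmetric] matrix_mul_assoc)
  show "(chart_den g h has_derivative (\<lambda>V. lower_block (matrix_inv h ** left_cols g) ** V)) (at X)"
    using bounded_linear.has_derivative[OF bounded_linear_blocks(2) *]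
    unfolding chart_affine[abs_def] by (simp only: lower_block_mult[symmetric] matrix_mul_assoc)
qed

lemma smooth_on_chart_den: "open S \<Longrightarrow> smooth_on S (chart_den g h)"
  unfolding chart_affine[abs_def]
  by (intro smooth_on_bounded_linear[OF bounded_linear_blocks(2)] smooth_on_std_frame
      smooth_on_bounded_linear[OF bounded_bilinear.bounded_linear_right[OF bounded_bilinear_matrix_mult]])

lemma smooth_on_chart_num: "open S \<Longrightarrow> smooth_on S (chart_num g h)"
  unfolding chart_affine[abs_def]
  by (intro smooth_on_bounded_linear[OF bounded_linear_blocks(1)] smooth_on_std_frame
      smooth_on_bounded_linear[OF bounded_bilinear.bounded_linear_right[OF bounded_bilinear_matrix_mult]])

definition chart_dom :: "real^4^4 \<Rightarrow> real^4^4 \<Rightarrow> M2 set" where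
  "chart_dom g h = {X. det (chart_den g h X) \<noteq> 0}"

lemma open_chart_dom: "open (chart_dom g h)"
proof -
  have "continuous_on UNIV (\<lambda>X. det (chart_den g h X))"
    by (intro smooth_on_imp_continuous_on smooth_on_det2 smooth_on_chart_den) auto
  then have "open ((\<lambda>X. det (chart_den g h X)) -` (- {0}))"
    by (rule open_vimage[rotated]) auto
  moreover have "chart_dom g h = (\<lambda>X. det (chart_den g h X)) -` (- {0})" by (auto simp: chart_dom_def)
  ultimately show ?thesis by simp
qed

lemma smooth_on_chart_change: "smooth_on (chart_dom g h) (chart_change g h)"
  unfolding chart_change_def[abs_def]
  by (intro smooth_on_matrix_mult smooth_on_chart_num smooth_on_matrix_inv2 smooth_on_chart_den open_chart_dom)
    (simp add: chart_dom_def)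

lemma has_derivative_chart_change:
  assumes "det (chart_den g h X) \<noteq> 0"
  shows "(chart_change g h has_derivative (\<lambda>V. chart_lin g h X ** V ** matrix_inv (chart_den g h X))) (at X)"
proof -
  have X: "X \<in> chart_dom g h" using assms by (simp add: chart_dom_def)
  have "(chart_change g h has_derivative (\<lambda>V.
     chart_num g h X ** - (matrix_inv (chart_den g h X) ** (lower_block (matrix_inv h ** left_cols g) ** V) ** matrix_inv (chart_den g h X))
     + (upper_block (matrix_inv h ** left_cols g) ** V) ** matrix_inv (chart_den g h X))) (at X)"
    unfolding chart_change_def[abs_def]
    by (intro has_derivative_matrix_mult has_derivative_chart_num_den
        has_derivative_matrix_inv[OF _ open_chart_dom X]) (simp add: chart_dom_def)
  then show ?thesis
    by (simp add: chart_lin_def chart_change_def matrix_mult_algebra matrix_mul_assoc)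
qed

lemmas frechet_chart_change = frechet_derivative_eqI[OF has_derivative_chart_change]

section \<open>Block determinants and the Jacobian of a coordinate change\<close>

definition hcat :: "real^2^4 \<Rightarrow> real^2^4 \<Rightarrow> real^4^4" where
  "hcat A B = (\<chi> i. vector [A $ i $ 1, A $ i $ 2, B $ i $ 1, B $ i $ 2])"

lemma hcat_nth [simp]: "hcat A B $ i $ 1 = A $ i $ 1" "hcat A B $ i $ 2 = A $ i $ 2"
  "hcat A B $ i $ 3 = B $ i $ 1" "hcat A B $ i $ 4 = B $ i $ 2"
  by (simp_all add: hcat_def)

lemma mult_hcat: "g ** hcat A B = hcat (g ** A) (g ** B)"
  by (simp add: vec_eq_iff forall_4 matrix_matrix_mult_def)

lemma hcat_mult_stack: "hcat A B ** stack X Y = A ** X + B ** Y"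
  by (simp add: vec_eq_iff forall_4 matrix_matrix_mult_def sum_4 sum_2 algebra_simps)

lemma hcat_mult: "hcat A B ** hcat (stack X Y) (stack Z W) = hcat (A ** X + B ** Y) (A ** Z + B ** W)"
  by (simp add: mult_hcat hcat_mult_stack)

lemma hcat_cols: "hcat (g ** stack (mat 1) 0) (g ** stack 0 (mat 1)) = g"
proof -
  have "hcat (stack (mat 1) 0) (stack 0 (mat 1)) = mat 1"
    by (simp add: vec_eq_iff forall_4 mat_def)
  then show ?thesis using mult_hcat[of g "stack (mat 1) 0" "stack 0 (mat 1)"] by simp
qed

lemma det_block_triangular:
  "det (hcat (stack A C) (stack 0 D)) = det A * det D"
  "det (hcat (stack A 0) (stack B D)) = det A * det D"
  by (simp_all add: det_4 det_2 algebra_simps)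

lemma det_hcat_shear: "det (hcat A (A ** X + B)) = det (hcat A B)"
proof -
  have "hcat A (A ** X + B) = hcat A B ** hcat (stack (mat 1) 0) (stack X (mat 1))"
    by (simp add: hcat_mult matrix_mult_algebra)
  then show ?thesis by (simp add: det_mul det_block_triangular)
qed

lemma det_frame: "det (hcat (left_cols g) (std_frame g X)) = det g"
  using det_hcat_shear[of "left_cols g" X "g ** stack 0 (mat 1)"] hcat_cols[of g]
  by (simp add: std_frame_diff left_cols_def add.commute)

text \<open>In the frames adapted to the plane, \<open>matrix_inv h ** g\<close> is block triangular
  with diagonal blocks \<open>chart_lin\<close> and \<open>chart_den\<close>; its determinant is
  1.\<close>

lemma det_chart_lin:
  assumes "det g = 1" "det h = 1" "det (chart_den g h X) \<noteq> 0"
  shows "det (chart_lin g h X) * det (chart_den g h X) = 1"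
proof -
  let ?a = "upper_block (matrix_inv h ** left_cols g)" and ?c = "lower_block (matrix_inv h ** left_cols g)"
  let ?Y = "chart_change g h X" and ?d = "chart_den g h X"
  have "matrix_inv h ** hcat (left_cols g) (std_frame g X) = hcat (stack ?a ?c) (stack (chart_num g h X) ?d)"
    by (simp add: mult_hcat chart_affine)
  also have "chart_num g h X = ?Y ** ?d"
    using assms(3) by (simp add: chart_change_def matrix_inv_mult_cancel)
  also have "stack ?a ?c = stack (mat 1) 0 ** chart_lin g h X + stack ?Y (mat 1) ** ?c"
    by (simp only: stack_mult stack_add[symmetric]) (simp add: chart_lin_def matrix_mult_algebra)
  also have "hcat \<dots> (stack (?Y ** ?d) ?d) =
     hcat (stack (mat 1) 0) (stack ?Y (mat 1)) ** hcat (stack (chart_lin g h X) ?c) (stack 0 ?d)"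
    by (simp add: hcat_mult stack_mult)
  finally have "det (matrix_inv h ** hcat (left_cols g) (std_frame g X)) = det (chart_lin g h X) * det ?d"
    by (simp add: det_mul det_block_triangular)
  then show ?thesis using assms by (simp add: det_mul det_frame det_matrix_inv)
qed

lemma Psi_in_Gr: "det g \<noteq> 0 \<Longrightarrow> Psi g X \<in> Gr"
proof -
  assume g: "det g \<noteq> 0"
  have "inj ((*v) (std_frame g X))"
    using std_frame_vec_cancel[OF g]
    by (intro linear_injective_0[THEN iffD2]) (auto simp: matrix_vector_mul_linear)
  then have "dim (range ((*v) (std_frame g X))) = 2"
    by (subst dim_image_eq) (auto simp: matrix_vector_mul_linear inj_on_subset)
  then show ?thesis unfolding Gr_def Psi_range
    by (auto intro!: linear_subspace_image matrix_vector_mul_linear subspace_UNIV)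
qed

section \<open>Anti-self-dual forms on a chart\<close>

text \<open>For symmetric \<open>G\<close> the matrix in brackets is skew, and the form is G11 dx11
  \<and> dx12 + G22 dx21 \<and> dx22 + G12 (dx11 \<and> dx22 - dx12 \<and> dx21), the general ASD
  form.\<close>

definition asd_form :: "M2 \<Rightarrow> M2 \<Rightarrow> M2 \<Rightarrow> real" where
  "asd_form G V W = - ((transpose V ** G ** W - transpose W ** G ** V) $ 2 $ 1)"

lemma asd_form_matrix:
  assumes "transpose G = G"
  shows "transpose V ** G ** W - transpose W ** G ** V = - (asd_form G V W *\<^sub>R J2)"
proof -
  have "transpose (transpose V ** G ** W - transpose W ** G ** V)
      = - (transpose V ** G ** W - transpose W ** G ** V)"
    using assms by (simp add: linear_diff[OF bounded_linear.linear[OF bounded_linear_transpose]]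
        matrix_transpose_mul matrix_mul_assoc)
  from antisym2_eq[OF this] show ?thesis
    unfolding asd_form_def by (simp only: scaleR_minus_left minus_minus)
qed

lemma asd_form_explicit:
  "asd_form G V W = G$1$1 * (V$1$1 * W$1$2 - W$1$1 * V$1$2) + G$2$2 * (V$2$1 * W$2$2 - W$2$1 * V$2$2)
     + G$1$2 * (V$1$1 * W$2$2 - W$2$1 * V$1$2 ) + G$2$1 * (V$2$1 * W$1$2 - W$1$1 * V$2$2)"
  if "G$1$2 = G$2$1"
  using that by (simp add: asd_form_def matrix_matrix_mult_def transpose_def sum_2 algebra_simps)

text \<open>The right factor acts on the skew matrix by congruence, hence through its determinant
  alone, and only the left factor moves \<open>G\<close>. Under coordinate changes an ASD form thus
  behaves like a quadratic form on the quotient bundle, up to a factor.\<close>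

lemma asd_form_congruence:
  assumes "transpose G = G"
  shows "asd_form G (P ** V ** Q) (P ** W ** Q) = det Q * asd_form (transpose P ** G ** P) V W"
proof -
  have G': "transpose (transpose P ** G ** P) = transpose P ** G ** P"
    using assms by (simp add: matrix_transpose_mul matrix_mul_assoc)
  have "transpose (P ** V ** Q) ** G ** (P ** W ** Q) - transpose (P ** W ** Q) ** G ** (P ** V ** Q)
    = transpose Q ** (transpose V ** (transpose P ** G ** P) ** W - transpose W ** (transpose P ** G ** P) ** V) ** Q"
    by (simp add: matrix_transpose_mul matrix_mult_algebra matrix_mul_assoc)
  then have "- (asd_form G (P ** V ** Q) (P ** W ** Q) *\<^sub>R J2) = - ((det Q * asd_form (transpose P ** G ** P) V W) *\<^sub>R J2)"
    unfolding asd_form_matrix[OF assms] asd_form_matrix[OF G']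
    by (simp add: matrix_mult_algebra congruence_J2 mult.commute)
  from arg_cong[OF this, of "\<lambda>A. A $ 2 $ 1"] show ?thesis by simp
qed

lemma asd_form_scale: "asd_form (c *\<^sub>R G) V W = c * asd_form G V W"
  by (simp add: asd_form_def matrix_mult_scaleR algebra_simps)

abbreviation E11 :: M2 where "E11 \<equiv> axis 1 (axis 1 1)"
abbreviation E12 :: M2 where "E12 \<equiv> axis 1 (axis 2 1)"
abbreviation E21 :: M2 where "E21 \<equiv> axis 2 (axis 1 1)"
abbreviation E22 :: M2 where "E22 \<equiv> axis 2 (axis 2 1)"

lemma axis_nth_if [simp]: "axis i c $ j = (if i = j then c else 0)"
  by (simp add: axis_def)

lemma M2_expand: "V = V$1$1 *\<^sub>R E11 + V$1$2 *\<^sub>R E12 + V$2$1 *\<^sub>R E21 + V$2$2 *\<^sub>R E22"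
  by (rule mat2_eqI) simp_all

lemma coord_basis_simps:
  "coord_basis 1 = E11" "coord_basis 2 = E21" "coord_basis 3 = E12" "coord_basis 4 = E22"
  unfolding coord_basis_def
  by (rule the_equality; (simp add: coords_def vec_eq_iff forall_4 forall_2 axis_def; blast?))+

lemma dual_basis_eqI:
  assumes "\<And>V. split_metric U V = coords V $ i"
  shows "dual_basis i = U"
  unfolding dual_basis_def
proof (rule the_equality)
  fix U' assume "\<forall>V. split_metric U' V = coords V $ i"
  then have e: "split_metric U' V = split_metric U V" for V using assms by simp
  show "U' = U"
    using e[of E11] e[of E12] e[of E21] e[of E22] by (intro mat2_eqI) (simp_all add: split_metric_def)
qed (use assms in auto)

lemma dual_basis_simps:
  "dual_basis 1 = E22" "dual_basis 2 = - E12" "dual_basis 3 = - E21" "dual_basis 4 = E11"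
  by (rule dual_basis_eqI; simp add: split_metric_def coords_def)+

lemma volume_form_explicit:
  "volume_form E11 E21 V W = V$1$2 * W$2$2 - V$2$2 * W$1$2"
  "volume_form E11 E12 V W = - (V$2$1 * W$2$2 - V$2$2 * W$2$1)"
  "volume_form E11 E22 V W = V$2$1 * W$1$2 - V$1$2 * W$2$1"
  "volume_form E21 E12 V W = V$1$1 * W$2$2 - V$2$2 * W$1$1"
  "volume_form E21 E22 V W = - (V$1$1 * W$1$2 - V$1$2 * W$1$1)"
  "volume_form E12 E22 V W = V$1$1 * W$2$1 - V$2$1 * W$1$1"
  "volume_form E21 E11 V W = - (V$1$2 * W$2$2 - V$2$2 * W$1$2)"
  "volume_form E12 E11 V W = V$2$1 * W$2$2 - V$2$2 * W$2$1"
  "volume_form E22 E11 V W = - (V$2$1 * W$1$2 - V$1$2 * W$2$1)"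
  "volume_form E12 E21 V W = - (V$1$1 * W$2$2 - V$2$2 * W$1$1)"
  "volume_form E22 E21 V W = V$1$1 * W$1$2 - V$1$2 * W$1$1"
  "volume_form E22 E12 V W = - (V$1$1 * W$2$1 - V$2$1 * W$1$1)"
  "volume_form E11 E11 V W = 0" "volume_form E12 E12 V W = 0"
  "volume_form E21 E21 V W = 0" "volume_form E22 E22 V W = 0"
  by (simp_all add: volume_form_def det_4 coords_def)

lemma hodge_star_explicit:
  fixes \<omega> :: "M2 \<Rightarrow> M2 \<Rightarrow> real"
  assumes b: "\<And>V. linear (\<omega> V)" "\<And>W. linear (\<lambda>V. \<omega> V W)" and a: "\<And>V W. \<omega> W V = - \<omega> V W"
  shows "hodge_star \<omega> V W =
      (V$1$2 * W$2$2 - V$2$2 * W$1$2) * \<omega> E12 E22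
    + (V$2$1 * W$2$2 - V$2$2 * W$2$1) * - \<omega> E21 E22
    + (V$2$1 * W$1$2 - V$1$2 * W$2$1) * - \<omega> E11 E22
    + (V$1$1 * W$2$2 - V$2$2 * W$1$1) * \<omega> E12 E21
    + (V$1$1 * W$1$2 - V$1$2 * W$1$1) * - \<omega> E11 E12
    + (V$1$1 * W$2$1 - V$2$1 * W$1$1) * \<omega> E11 E21"
proof -
  have n: "\<omega> (- V) W = - \<omega> V W" "\<omega> V (- W) = - \<omega> V W" for V W
    using linear_neg[OF b(1)] linear_neg[OF b(2)] by auto
  have "\<omega> E22 E11 = - \<omega> E11 E22" "\<omega> E12 E11 = - \<omega> E11 E12" "\<omega> E21 E11 = - \<omega> E11 E21"
    "\<omega> E21 E12 = - \<omega> E12 E21" "\<omega> E22 E12 = - \<omega> E12 E22" "\<omega> E22 E21 = - \<omega> E21 E22"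
    by (rule a)+
  then show ?thesis
    unfolding hodge_star_def sum_4 coord_basis_simps dual_basis_simps
    by (simp add: volume_form_explicit n algebra_simps)
qed

lemma bilinear_asd_form: "linear (asd_form G V)" "linear (\<lambda>V. asd_form G V W)"
  by (auto intro!: linearI simp: asd_form_def matrix_mult_algebra algebra_simps
      linear_add[OF bounded_linear.linear[OF bounded_linear_transpose]]
      linear_cmul[OF bounded_linear.linear[OF bounded_linear_transpose]])

lemma hodge_star_asd_form:
  assumes "transpose G = G"
  shows "hodge_star (asd_form G) V W = - asd_form G V W"
proof -
  have s: "G$1$2 = G$2$1" using sym2_eq[OF assms] .
  have "hodge_star (asd_form G) V W =
      (V$1$2 * W$2$2 - V$2$2 * W$1$2) * asd_form G E12 E22
    + (V$2$1 * W$2$2 - V$2$2 * W$2$1) * - asd_form G E21 E22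
    + (V$2$1 * W$1$2 - V$1$2 * W$2$1) * - asd_form G E11 E22
    + (V$1$1 * W$2$2 - V$2$2 * W$1$1) * asd_form G E12 E21
    + (V$1$1 * W$1$2 - V$1$2 * W$1$1) * - asd_form G E11 E12
    + (V$1$1 * W$2$1 - V$2$1 * W$1$1) * asd_form G E11 E21"
    by (rule hodge_star_explicit[OF bilinear_asd_form]) (simp add: asd_form_def)
  then show ?thesis
    unfolding asd_form_explicit[OF s] by (simp add: s algebra_simps)
qed

lemma hodge_star_scaleR:
  "hodge_star (\<lambda>V W. \<omega> V W *\<^sub>R c) V W = hodge_star \<omega> V W *\<^sub>R c" for \<omega> :: "M2 \<Rightarrow> M2 \<Rightarrow> real"
  by (simp add: hodge_star_def scaleR_sum_left[symmetric])

text \<open>Of the six coefficients of a 2-form the ASD equation kills two and ties two others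
  together; the three that remain are the entries of a symmetric matrix.\<close>

lemma asd_form_exists:
  fixes \<omega> :: "M2 \<Rightarrow> M2 \<Rightarrow> real"
  assumes b: "\<And>V. linear (\<omega> V)" "\<And>W. linear (\<lambda>V. \<omega> V W)" and a: "\<And>V W. \<omega> W V = - \<omega> V W"
    and asd: "\<And>V W. hodge_star \<omega> V W = - \<omega> V W"
  obtains G where "transpose G = G" "\<omega> = asd_form G"
proof -
  note h = asd[unfolded hodge_star_explicit[OF b a]]
  have z: "\<omega> E11 E21 = 0" "\<omega> E12 E22 = 0" "\<omega> E12 E21 = - \<omega> E11 E22"
    using h[of E11 E21] h[of E12 E22] h[of E12 E21] by simp_all
  have d: "\<omega> V V = 0" for V using a[of V V] by simp
  have s: "\<omega> E22 E11 = - \<omega> E11 E22" "\<omega> E12 E11 = - \<omega> E11 E12" "\<omega> E21 E11 = 0"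
    "\<omega> E21 E12 = \<omega> E11 E22" "\<omega> E22 E12 = 0" "\<omega> E22 E21 = - \<omega> E21 E22"
    using a[of E22 E11] a[of E12 E11] a[of E21 E11] a[of E21 E12] a[of E22 E12] a[of E22 E21] z by simp_all
  define G :: M2 where "G = vector [vector [\<omega> E11 E12, \<omega> E11 E22], vector [\<omega> E11 E22, \<omega> E21 E22]]"
  have G: "G$1$1 = \<omega> E11 E12" "G$1$2 = \<omega> E11 E22" "G$2$1 = \<omega> E11 E22" "G$2$2 = \<omega> E21 E22"
    by (simp_all add: G_def)
  have "\<omega> V W = asd_form G V W" for V W
  proof -
    have "\<omega> V W = \<omega> (V$1$1 *\<^sub>R E11 + V$1$2 *\<^sub>R E12 + V$2$1 *\<^sub>R E21 + V$2$2 *\<^sub>R E22)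
       (W$1$1 *\<^sub>R E11 + W$1$2 *\<^sub>R E12 + W$2$1 *\<^sub>R E21 + W$2$2 *\<^sub>R E22)"
      using M2_expand by metis
    also have "\<dots> = asd_form G V W"
      by (simp add: linear_add[OF b(1)] linear_cmul[OF b(1)] linear_add[OF b(2)] linear_cmul[OF b(2)]
          d s z asd_form_explicit G algebra_simps)
    finally show ?thesis .
  qed
  then show thesis
    by (intro that[of G]) (auto simp: G fun_eq_iff intro!: mat2_eqI simp: transpose_def)
qed

text \<open>The trace of the square of \<open>j\<close> is -2, and the wedge square of the 2-form is
  -2 \<open>det G\<close> times the volume form.\<close>

lemma trace_wedge_square_asd:
  assumes "transpose G = G" "j ** j = - mat 1"
  shows "trace_wedge_square (\<lambda>V W. asd_form G V W *\<^sub>R j) = 4 * det G"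
proof -
  have s: "G$1$2 = G$2$1" using sym2_eq[OF assms(1)] .
  have t: "trace (asd_form G A B *\<^sub>R j ** asd_form G C D *\<^sub>R j) = - 2 * (asd_form G A B * asd_form G C D)" for A B C D
    by (simp add: matrix_mult_scaleR assms(2)) (simp add: trace_def sum_2 mat_def)
  have f1234: "finite {2::4, 3, 4}" "1 \<notin> {2::4, 3, 4}" by auto
  have f234: "finite {3::4, 4}" "2 \<notin> {3::4, 4}" by auto
  have f34: "finite {4::4}" "3 \<notin> {4::4}" by auto
  show ?thesis
    unfolding trace_wedge_square_def t UNIV_4
    unfolding sum_over_permutations_insert[OF f1234]
    unfolding sum_over_permutations_insert[OF f234]
    unfolding sum_over_permutations_insert[OF f34]
    unfolding permutes_sing
    by (simp add: sign_swap_id permutation_swap_id permutation_compose sign_compose sign_id swap_id_eq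
        coord_basis_simps asd_form_explicit[OF s] det_2 s)
qed

section \<open>The basic split anti-instanton\<close>

text \<open>The normal equations for the orthogonal projection of the derivative of the frame. For
  \<open>g = mat 1\<close> this is the potential
  \<open>(1 + X\<^sup>t X)\<^sup>-\<^sup>1 X\<^sup>t dX\<close>.\<close>

definition basic_pot :: "real^4^4 \<Rightarrow> M2 \<Rightarrow> M2 \<Rightarrow> M2" where
  "basic_pot g X V = matrix_inv (euclidean_gram g X) ** (transpose (std_frame g X) ** (left_cols g ** V))"

text \<open>The Gram matrix of the projections of the first two columns of \<open>g\<close> to the orthogonal complement
  of \<open>Psi g X\<close>.\<close>

definition comp_gram :: "real^4^4 \<Rightarrow> M2 \<Rightarrow> M2" where
  "comp_gram g X = transpose (left_cols g) **
     (mat 1 - std_frame g X ** matrix_inv (euclidean_gram g X) ** transpose (std_frame g X)) ** left_cols g"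

lemma pos_def_euclidean_gram: "det g \<noteq> 0 \<Longrightarrow> pos_def (euclidean_gram g X)"
  using pos_def_congruence[OF pos_def_mat_1, of "std_frame g X"] std_frame_vec_cancel[of g X]
  by (simp add: euclidean_gram_def)

lemma det_euclidean_gram: "det g \<noteq> 0 \<Longrightarrow> det (euclidean_gram g X) > 0"
  using pos_defD(3)[OF pos_def_euclidean_gram] .

lemma det_euclidean_gram_nz: "det g \<noteq> 0 \<Longrightarrow> det (euclidean_gram g X) \<noteq> 0"
  using det_euclidean_gram[of g X] by simp

lemma transpose_euclidean_gram [simp]: "transpose (euclidean_gram g X) = euclidean_gram g X"
  by (simp add: euclidean_gram_def matrix_transpose_mul)

lemma transpose_inv_gram: "det g \<noteq> 0 \<Longrightarrow>
    transpose (matrix_inv (euclidean_gram g X)) = matrix_inv (euclidean_gram g X)"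
  using matrix_inv_transpose[of "euclidean_gram g X"] det_euclidean_gram[of g X] by simp

lemma transpose_comp_gram: "det g \<noteq> 0 \<Longrightarrow> transpose (comp_gram g X) = comp_gram g X"
  by (simp add: comp_gram_def matrix_transpose_mul linear_diff[OF bounded_linear.linear[OF bounded_linear_transpose]]
      transpose_inv_gram matrix_mul_assoc)

lemma smooth_on_euclidean_gram: "open S \<Longrightarrow> smooth_on S (euclidean_gram g)"
  unfolding euclidean_gram_def[abs_def] by (intro smooth_on_matrix_mult smooth_on_transpose smooth_on_std_frame)

lemma smooth_on_basic_pot: "open S \<Longrightarrow> det g \<noteq> 0 \<Longrightarrow> smooth_on S (\<lambda>X. basic_pot g X V)"
  unfolding basic_pot_def
  by (intro smooth_on_matrix_mult smooth_on_transpose smooth_on_std_frame smooth_on_const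
      smooth_on_matrix_inv2 smooth_on_euclidean_gram det_euclidean_gram_nz)

lemma linear_basic_pot: "linear (basic_pot g X)"
  by (rule linearI) (simp_all add: basic_pot_def matrix_mult_algebra)

lemma has_derivative_euclidean_gram:
  "(euclidean_gram g has_derivative
     (\<lambda>V. transpose (std_frame g X) ** (left_cols g ** V) + transpose (left_cols g ** V) ** std_frame g X)) (at X)"
  unfolding euclidean_gram_def[abs_def]
  by (intro has_derivative_matrix_mult bounded_linear.has_derivative[OF bounded_linear_transpose]
      has_derivative_std_frame)

lemma gram_basic_pot: "det g \<noteq> 0 \<Longrightarrow>
    euclidean_gram g X ** basic_pot g X V = transpose (std_frame g X) ** (left_cols g ** V)"
  using det_euclidean_gram[of g X] by (simp add: basic_pot_def matrix_inv_mult_cancel)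

lemma basic_compatible:
  assumes "det g \<noteq> 0"
  shows "frechet_derivative (euclidean_gram g) (at X) V =
    transpose (basic_pot g X V) ** euclidean_gram g X + euclidean_gram g X ** basic_pot g X V"
proof -
  have "transpose (basic_pot g X V) ** euclidean_gram g X = transpose (euclidean_gram g X ** basic_pot g X V)"
    by (simp add: matrix_transpose_mul)
  also have "\<dots> = transpose (left_cols g ** V) ** std_frame g X"
    using assms by (simp add: gram_basic_pot matrix_transpose_mul)
  finally show ?thesis
    using assms by (simp add: frechet_derivative_eqI[OF has_derivative_euclidean_gram] gram_basic_pot)
qed

text \<open>The Gauss equation of a subbundle of a flat bundle: the curvature pairs the components
  of the derivatives of the frame orthogonal to the plane. As the frame moves by
  \<open>left_cols g ** V\<close>, these pairings combine to the skew matrix that defines an ASD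
  form.\<close>

lemma curvature_basic:
  assumes g: "det g \<noteq> 0"
  shows "curvature (basic_pot g) X V W =
    - (asd_form (comp_gram g X) V W *\<^sub>R (matrix_inv (euclidean_gram g X) ** J2))"
proof -
  let ?N = "euclidean_gram g X" and ?M = "std_frame g X" and ?L = "left_cols g"
  let ?i = "matrix_inv ?N"
  have d: "frechet_derivative (\<lambda>Y. basic_pot g Y W) (at X) V =
     ?i ** (transpose (?L ** V) ** (?L ** W))
     - ?i ** (transpose ?M ** (?L ** V) + transpose (?L ** V) ** ?M) ** ?i ** (transpose ?M ** (?L ** W))" for V W
  proof -
    have 1: "((\<lambda>Y. matrix_inv (euclidean_gram g Y)) has_derivative
       (\<lambda>V. - (?i ** (transpose ?M ** (?L ** V) + transpose (?L ** V) ** ?M) ** ?i))) (at X)"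
      by (rule has_derivative_matrix_inv[OF has_derivative_euclidean_gram open_UNIV])
        (simp_all add: det_euclidean_gram_nz g)
    have 2: "((\<lambda>Y. transpose (std_frame g Y) ** (?L ** W)) has_derivative (\<lambda>V. transpose (?L ** V) ** (?L ** W))) (at X)"
      by (rule bounded_linear.has_derivative[OF bounded_bilinear.bounded_linear_left[OF bounded_bilinear_matrix_mult]
          bounded_linear.has_derivative[OF bounded_linear_transpose has_derivative_std_frame]])
    show ?thesis
      unfolding basic_pot_def fun_cong[OF frechet_derivative_eqI[OF has_derivative_matrix_mult[OF 1 2]], of V]
      by (simp add: matrix_mult_algebra algebra_simps)
  qed
  have s: "frechet_derivative (\<lambda>Y. basic_pot g Y W) (at X) V + basic_pot g X V ** basic_pot g X W
     = ?i ** (transpose V ** comp_gram g X ** W)" for V W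
    unfolding d unfolding basic_pot_def comp_gram_def
    by (simp add: matrix_mult_algebra matrix_transpose_mul matrix_mul_assoc)
  have "curvature (basic_pot g) X V W =
     (frechet_derivative (\<lambda>Y. basic_pot g Y W) (at X) V + basic_pot g X V ** basic_pot g X W)
     - (frechet_derivative (\<lambda>Y. basic_pot g Y V) (at X) W + basic_pot g X W ** basic_pot g X V)"
    by (simp add: curvature_def)
  also have "\<dots> = ?i ** (transpose V ** comp_gram g X ** W - transpose W ** comp_gram g X ** V)"
    unfolding s by (simp add: matrix_mult_algebra)
  finally show ?thesis
    unfolding asd_form_matrix[OF transpose_comp_gram[OF g]] by (simp add: matrix_mult_algebra)
qed

lemma gram_change:
  assumes "det h \<noteq> 0" "det (chart_den g h X) \<noteq> 0"
  shows "euclidean_gram g X = transpose (chart_den g h X) ** euclidean_gram h (chart_change g h X) ** chart_den g h X"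
  unfolding euclidean_gram_def std_frame_change[OF assms]
  by (simp add: matrix_transpose_mul matrix_mul_assoc)

text \<open>The relation between the two frames is differentiated and multiplied by the transposed
  frame, which amounts to projecting to the plane. The Gram matrix is cancelled only at the
  end.\<close>

lemma basic_pot_change:
  assumes g: "det g \<noteq> 0" and h: "det h \<noteq> 0" and d: "det (chart_den g h X) \<noteq> 0"
  shows "chart_den g h X ** basic_pot g X V =
    basic_pot h (chart_change g h X) (frechet_derivative (chart_change g h) (at X) V) ** chart_den g h X
    + frechet_derivative (chart_den g h) (at X) V"
proof -
  let ?d = "chart_den g h X" and ?Y = "chart_change g h X"
  let ?d' = "frechet_derivative (chart_den g h) (at X)" and ?Y' = "frechet_derivative (chart_change g h) (at X)"
  have X: "X \<in> chart_dom g h" using d by (simp add: chart_dom_def)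
  have 1: "(chart_den g h has_derivative ?d') (at X)"
    by (rule smooth_on_has_derivative[OF smooth_on_chart_den[OF open_UNIV]]) simp
  have 2: "(chart_change g h has_derivative ?Y') (at X)"
    by (rule smooth_on_has_derivative[OF smooth_on_chart_change X])
  have 3: "((\<lambda>X. std_frame h (chart_change g h X)) has_derivative (\<lambda>V. left_cols h ** ?Y' V)) (at X)"
    using diff_chain_at[OF 2 has_derivative_std_frame] by (simp add: o_def)
  have "((\<lambda>X. std_frame h (chart_change g h X) ** chart_den g h X) has_derivative (\<lambda>V. left_cols g ** V)) (at X)"
    by (rule has_derivative_cong_open[OF open_chart_dom X, THEN iffD1, OF _ has_derivative_std_frame])
      (rule std_frame_change[OF h], simp add: chart_dom_def)
  from fun_cong[OF has_derivative_unique[OF has_derivative_matrix_mult[OF 3 1] this], of V]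
  have L: "left_cols g ** V = std_frame h ?Y ** ?d' V + left_cols h ** ?Y' V ** ?d" by simp
  have "transpose ?d ** (euclidean_gram h ?Y ** (?d ** basic_pot g X V)) = euclidean_gram g X ** basic_pot g X V"
    unfolding gram_change[OF h d] by (simp add: matrix_mul_assoc)
  also have "\<dots> = transpose ?d ** (transpose (std_frame h ?Y) ** (std_frame h ?Y ** ?d' V + left_cols h ** ?Y' V ** ?d))"
    unfolding gram_basic_pot[OF g] L std_frame_change[OF h d]
    by (simp add: matrix_transpose_mul matrix_mul_assoc)
  also have "\<dots> = transpose ?d ** (euclidean_gram h ?Y ** (basic_pot h ?Y (?Y' V) ** ?d + ?d' V))"
    using gram_basic_pot[OF h, of ?Y "?Y' V"]
    by (simp add: matrix_mult_algebra matrix_mul_assoc euclidean_gram_def add.commute)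
  finally show ?thesis
    using d det_euclidean_gram[OF h, of ?Y]
    by (simp add: matrix_cancel_left det_transpose)
qed

lemma carrier_SL4: "g \<in> carrier SL4 \<longleftrightarrow> det g = 1"
  by (simp add: SL4_def)

lemma orth_proj_frame:
  assumes g: "det g \<noteq> 0"
  shows "orth_proj (Psi g X) v = std_frame g X *v (matrix_inv (euclidean_gram g X) *v (transpose (std_frame g X) *v v))"
proof -
  let ?M = "std_frame g X" and ?N = "euclidean_gram g X"
  let ?u = "?M *v (matrix_inv ?N *v (transpose ?M *v v))"
  have inner: "x \<bullet> (?M *v y) = (transpose ?M *v x) \<bullet> y" for x y
    using dot_lmul_matrix[of x ?M y] by (simp add: transpose_matrix_vector)
  have "transpose ?M *v ?u = (?N ** matrix_inv ?N) *v (transpose ?M *v v)"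
    by (simp add: euclidean_gram_def matrix_vector_mul_assoc matrix_mul_assoc)
  then have e: "transpose ?M *v (v - ?u) = 0"
    using det_euclidean_gram[OF g, of X] by (simp add: matrix_inv_props matrix_vector_mult_diff_distrib)
  have o: "orthogonal (v - ?u) w" if "w \<in> Psi g X" for w
    using that e inner unfolding Psi_range orthogonal_def by force
  show ?thesis
    unfolding orth_proj_def
  proof (rule the_equality)
    show "?u \<in> Psi g X \<and> (\<forall>w\<in>Psi g X. orthogonal (v - ?u) w)"
      using o by (auto simp: Psi_range)
    fix u assume u: "u \<in> Psi g X \<and> (\<forall>w\<in>Psi g X. orthogonal (v - u) w)"
    have "subspace (Psi g X)" unfolding Psi_def by (rule subspace_span)
    then have w: "u - ?u \<in> Psi g X" using u by (intro subspace_diff) (auto simp: Psi_range)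
    have "(v - ?u) \<bullet> (u - ?u) - (v - u) \<bullet> (u - ?u) = 0"
      using o[OF w] u w by (simp add: orthogonal_def)
    then have "(u - ?u) \<bullet> (u - ?u) = 0" by (simp add: inner_diff_left)
    then show "u = ?u" by simp
  qed
qed

lemma column_mult: "column j (A ** B) = A *v column j B"
  by (simp add: vec_eq_iff column_def matrix_matrix_mult_def matrix_vector_mult_def)

lemma matrix_eq_columns: "A = B \<longleftrightarrow> (\<forall>j. column j A = column j B)"
  by (auto simp: vec_eq_iff column_def)

lemma projected_pot_eq:
  assumes "g \<in> carrier SL4"
  shows "projected_pot g = basic_pot g"
proof (intro ext)
  fix X V
  have g: "det g \<noteq> 0" using assms by (simp add: carrier_SL4)
  have "(THE A. \<forall>j. column j (std_frame g X ** A) =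
     orth_proj (Psi g X) (column j (frechet_derivative (std_frame g) (at X) V))) = basic_pot g X V"
  proof -
    have "(\<forall>j. column j (std_frame g X ** A) = orth_proj (Psi g X) (column j (frechet_derivative (std_frame g) (at X) V)))
       \<longleftrightarrow> A = basic_pot g X V" for A
    proof -
      have "orth_proj (Psi g X) (column j (frechet_derivative (std_frame g) (at X) V))
          = column j (std_frame g X ** basic_pot g X V)" for j
        by (simp add: orth_proj_frame[OF g] frechet_derivative_eqI[OF has_derivative_std_frame]
            column_mult basic_pot_def)
      then have "(\<forall>j. column j (std_frame g X ** A) = orth_proj (Psi g X) (column j (frechet_derivative (std_frame g) (at X) V)))
       \<longleftrightarrow> std_frame g X ** A = std_frame g X ** basic_pot g X V"
        by (simp add: matrix_eq_columns[of "std_frame g X ** A"])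
      then show ?thesis using std_frame_cancel[OF g] by simp
    qed
    then show ?thesis by simp
  qed
  then show "projected_pot g X V = basic_pot g X V"
    using assms by (simp add: projected_pot_def)
qed

section \<open>The X-ray transform of the inverse square\<close>

lemma integral_inverse_quadratic_form:
  fixes a b c :: real
  assumes a: "a > 0" and D: "a * c - b\<^sup>2 > 0"
  shows "((\<lambda>\<theta>. 1 / (a * (cos \<theta>)\<^sup>2 + 2 * b * cos \<theta> * sin \<theta> + c * (sin \<theta>)\<^sup>2))
     has_integral 2 * pi / sqrt (a * c - b\<^sup>2)) {0..2 * pi}"
proof -
  define d where "d = sqrt (a * c - b\<^sup>2)"
  have d: "d > 0" "d\<^sup>2 = a * c - b\<^sup>2" using D by (simp_all add: d_def)
  have c: "c > 0"
  proof -
    have "a * c > 0" using D zero_le_power2[of b] by linarith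
    then show ?thesis using a by (simp add: zero_less_mult_iff)
  qed
  text \<open>With \<open>B = N + \<surd>det N\<close>, a multiple of the square root of the form \<open>N\<close>, \<open>x/y\<close> is the tangent
    of the angle from \<open>v = (cos \<theta>, sin \<theta>)\<close> to \<open>B v\<close>, which stays in \<open>(-\<pi>/2, \<pi>/2)\<close>.\<close>
  define Q where "Q t = a * (cos t)\<^sup>2 + 2 * b * cos t * sin t + c * (sin t)\<^sup>2" for t
  define x where "x t = b * ((cos t)\<^sup>2 - (sin t)\<^sup>2) + (c - a) * cos t * sin t" for t
  define x' where "x' t = - 4 * b * cos t * sin t + (c - a) * ((cos t)\<^sup>2 - (sin t)\<^sup>2)" for t
  have Q: "Q t > 0" for t
  proof -
    have "a * Q t = (a * cos t + b * sin t)\<^sup>2 + d\<^sup>2 * (sin t)\<^sup>2"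
      unfolding Q_def d by (simp add: power2_eq_square algebra_simps)
    also have "\<dots> > 0"
    proof (cases "sin t = 0")
      case True
      then have "cos t \<noteq> 0" using sin_cos_squared_add[of t] by auto
      then show ?thesis using True a by simp
    next
      case False
      then have "0 < d\<^sup>2 * (sin t)\<^sup>2" using d(1) by (intro mult_pos_pos) auto
      then show ?thesis by (rule add_nonneg_pos[OF zero_le_power2])
    qed
    finally show ?thesis using a by (simp add: zero_less_mult_iff)
  qed
  define y where "y t = Q t + d" for t
  have y: "y t > 0" for t using Q[of t] d by (simp add: y_def)
  have dx: "(x has_real_derivative x' t) (at t)" for t
    unfolding x_def[abs_def] x'_def
    by (auto intro!: derivative_eq_intros simp: power2_eq_square algebra_simps)
  have dy: "(y has_real_derivative 2 * x t) (at t)" for t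
    unfolding y_def[abs_def] Q_def[abs_def] x_def
    by (auto intro!: derivative_eq_intros simp: power2_eq_square algebra_simps)
  \<comment> \<open>By Cayley-Hamilton the square of B = N + d is (a + c + 2 d) N, so the square
    norm of B v is this constant times Q. Here y is the component of B v along v, and x the one
    along the quarter turn of v.\<close>
  have xy: "(x t)\<^sup>2 + (y t)\<^sup>2 = (a + c + 2 * d) * Q t" for t
  proof -
    have s: "(sin t)\<^sup>2 = 1 - (cos t)\<^sup>2" using sin_squared_eq .
    have "((x t)\<^sup>2 + (y t)\<^sup>2) - (a + c + 2 * d) * Q t =
      (x t)\<^sup>2 + (Q t)\<^sup>2 - (a + c) * Q t + d\<^sup>2"
      by (simp add: y_def power2_eq_square algebra_simps)
    also have "\<dots> = 0"
    proof -
      define C where "C = cos t" define S where "S = sin t"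
      have e: "S * S = 1 - C * C" using s by (simp add: C_def S_def power2_eq_square)
      have "(x t)\<^sup>2 + (Q t)\<^sup>2 - (a + c) * Q t + d\<^sup>2 =
         (b * (C * C - S * S) + (c - a) * C * S)\<^sup>2 + (a * (C * C) + 2 * b * C * S + c * (S * S))\<^sup>2
          - (a + c) * (a * (C * C) + 2 * b * C * S + c * (S * S)) * (C * C + S * S) + (a * c - b\<^sup>2) * (C * C + S * S)\<^sup>2"
        unfolding x_def Q_def d C_def[symmetric] S_def[symmetric] by (simp add: e power2_eq_square)
      also have "\<dots> = 0" by (simp add: power2_eq_square algebra_simps)
      finally show ?thesis .
    qed
    finally show ?thesis by simp
  qed
  have key: "(a + c + 2 * d) * Q t + x' t * y t - 2 * (x t)\<^sup>2 = d * (a + c + 2 * d)" for t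
  proof -
    define C where "C = cos t" define S where "S = sin t"
    have e: "S * S = 1 - C * C" using sin_squared_eq[of t] by (simp add: C_def S_def power2_eq_square)
    have x'Q: "x' t = a + c - 2 * Q t"
      unfolding x'_def Q_def C_def[symmetric] S_def[symmetric]
      by (simp add: e power2_eq_square algebra_simps)
    have "(x t)\<^sup>2 = (a + c + 2 * d) * Q t - (y t)\<^sup>2" using xy[of t] by simp
    then show ?thesis unfolding x'Q by (simp add: y_def power2_eq_square algebra_simps)
  qed
  \<comment> \<open>The angle of B v has derivative det B divided by the square norm of B v, and det
    B = d (a + c + 2 d).\<close>
  have "((\<lambda>t. (t + arctan (x t / y t)) / d) has_real_derivative 1 / Q t) (at t)" for t
  proof -
    let ?k = "a + c + 2 * d"
    have k: "?k > 0" using a c d by simp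
    have "1 + (x t / y t)\<^sup>2 = ?k * Q t / (y t)\<^sup>2"
      using y[of t] xy[of t] by (simp add: field_simps)
    then have i: "inverse (1 + (x t / y t)\<^sup>2) = (y t * y t) / (?k * Q t)"
      by (simp add: power2_eq_square)
    have e: "inverse (1 + (x t / y t)\<^sup>2) * ((x' t * y t - x t * (2 * x t)) / (y t * y t)) =
       (x' t * y t - 2 * (x t)\<^sup>2) / (?k * Q t)"
      unfolding i using y[of t] by (simp add: power2_eq_square)
    have n: "?k * Q t \<noteq> 0" using k Q[of t] by (metis less_irrefl mult_pos_pos)
    have "?k * Q t + (x' t * y t - 2 * (x t)\<^sup>2) = d * ?k" using key[of t] by simp
    then have "(1 + (x' t * y t - 2 * (x t)\<^sup>2) / (?k * Q t)) = (d * ?k) / (?k * Q t)"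
      using n add_divide_distrib[of "?k * Q t" "x' t * y t - 2 * (x t)\<^sup>2" "?k * Q t"] by simp
    also have "\<dots> / d = 1 / Q t" using d k Q[of t] by simp
    finally have f: "(1 + (x' t * y t - 2 * (x t)\<^sup>2) / (?k * Q t)) / d = 1 / Q t" .
    have "((\<lambda>t. (t + arctan (x t / y t)) / d) has_real_derivative
       (1 + inverse (1 + (x t / y t)\<^sup>2) * ((x' t * y t - x t * (2 * x t)) / (y t * y t))) / d) (at t)"
      using y[of t] d by (auto intro!: derivative_eq_intros DERIV_divide dx dy)
    then show ?thesis unfolding e f .
  qed
  then have "((\<lambda>t. 1 / Q t) has_integral (2 * pi + arctan (x (2 * pi) / y (2 * pi))) / d - (0 + arctan (x 0 / y 0)) / d) {0..2 * pi}"
    by (intro fundamental_theorem_of_calculus)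
      (auto simp: has_real_derivative_iff_has_vector_derivative[symmetric] intro: has_field_derivative_at_within)
  \<comment> \<open>The arctangent is periodic in t, so that only the summand t contributes to the
    integral.\<close>
  moreover have "x (2 * pi) = x 0" "y (2 * pi) = y 0" by (simp_all add: x_def y_def Q_def)
  ultimately show ?thesis by (simp add: Q_def d_def add_divide_distrib)
qed

definition inverse_square :: "real^4 \<Rightarrow> real" where
  "inverse_square x = 1 / (x \<bullet> x)"

lemma xray_inverse_square:
  assumes g: "det g \<noteq> 0"
  shows "xray (\<lambda>x. inverse_square (a *v x)) g X = xray inverse_square (a ** g) X"
    "xray inverse_square g X = 1 / sqrt (det (euclidean_gram g X))"
proof -
  show "xray (\<lambda>x. inverse_square (a *v x)) g X = xray inverse_square (a ** g) X"
    by (simp add: xray_def std_frame_translate matrix_vector_mul_assoc)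
  let ?N = "euclidean_gram g X" and ?M = "std_frame g X"
  note p = pos_defD[OF pos_def_euclidean_gram[OF g, of X]]
  have "(?M *v v) \<bullet> (?M *v v) = v \<bullet> (?N *v v)" for v
    using dot_lmul_matrix[of "?M *v v" ?M v]
    by (simp add: euclidean_gram_def matrix_vector_mul_assoc[symmetric] transpose_matrix_vector inner_commute)
  also have "v \<bullet> (?N *v v) = ?N$1$1 * (v$1)\<^sup>2 + 2 * ?N$1$2 * v$1 * v$2 + ?N$2$2 * (v$2)\<^sup>2" for v
    using p(1) by (simp add: inner_vec_def matrix_vector_mult_def sum_2 power2_eq_square algebra_simps)
  finally have q: "(?M *v v) \<bullet> (?M *v v) = ?N$1$1 * (v$1)\<^sup>2 + 2 * ?N$1$2 * v$1 * v$2 + ?N$2$2 * (v$2)\<^sup>2" for v .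
  have "inverse_square (?M *v vector [cos t, sin t]) =
     1 / (?N$1$1 * (cos t)\<^sup>2 + 2 * ?N$1$2 * cos t * sin t + ?N$2$2 * (sin t)\<^sup>2)" for t
    by (simp add: inverse_square_def q)
  moreover have dd: "det ?N = ?N$1$1 * ?N$2$2 - (?N$1$2)\<^sup>2"
    using p(1) by (simp add: det_2 power2_eq_square)
  ultimately have "integral {0..2 * pi} (\<lambda>t. inverse_square (?M *v vector [cos t, sin t])) = 2 * pi / sqrt (det ?N)"
    using integral_inverse_quadratic_form[of "?N$1$1" "?N$2$2" "?N$1$2"] p
    by (simp add: integral_unique)
  then show "xray inverse_square g X = 1 / sqrt (det ?N)"
    by (simp add: xray_def)
qed

text \<open>The transposed indices in \<open>matrix_derivative\<close> make it the gradient for the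
  trace pairing of matrices.\<close>

lemma matrix_derivative_eqI:
  assumes "(f has_derivative (\<lambda>V. trace (K ** V))) (at X)"
  shows "matrix_derivative f X = K"
  by (rule mat2_eqI) (simp_all add: matrix_derivative_def frechet_derivative_eqI[OF assms]
      trace_def sum_2 matrix_matrix_mult_def)

lemma has_derivative_det_gram:
  assumes g: "det g \<noteq> 0"
  shows "((\<lambda>X. det (euclidean_gram g X)) has_derivative
    (\<lambda>V. 2 * det (euclidean_gram g X) * trace (basic_pot g X V))) (at X)"
proof -
  let ?N = "euclidean_gram g X"
  let ?D = "\<lambda>V. transpose (std_frame g X) ** (left_cols g ** V) + transpose (left_cols g ** V) ** std_frame g X"
  have n: "((\<lambda>X. euclidean_gram g X $ i $ j) has_derivative (\<lambda>V. ?D V $ i $ j)) (at X)" for i j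
    by (intro bounded_linear.has_derivative[OF bounded_linear_vec_nth] has_derivative_euclidean_gram)
  have "((\<lambda>X. det (euclidean_gram g X)) has_derivative
    (\<lambda>V. (?N$1$1 * ?D V $2$2 + ?D V$1$1 * ?N$2$2) - (?N$1$2 * ?D V$2$1 + ?D V$1$2 * ?N$2$1))) (at X)"
    unfolding det_2 by (intro has_derivative_diff has_derivative_mult n)
  also have "(\<lambda>V. (?N$1$1 * ?D V $2$2 + ?D V$1$1 * ?N$2$2) - (?N$1$2 * ?D V$2$1 + ?D V$1$2 * ?N$2$1))
     = (\<lambda>V. 2 * det ?N * trace (basic_pot g X V))"
  proof
    fix V
    let ?B = "basic_pot g X V"
    have s: "?N$2$1 = ?N$1$2" using sym2_eq[OF transpose_euclidean_gram] .
    have "?D V = ?N ** ?B + transpose (?N ** ?B)"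
      using gram_basic_pot[OF g, of X V] by (simp add: matrix_transpose_mul)
    then show "(?N$1$1 * ?D V $2$2 + ?D V$1$1 * ?N$2$2) - (?N$1$2 * ?D V$2$1 + ?D V$1$2 * ?N$2$1) = 2 * det ?N * trace ?B"
      by (simp add: matrix_matrix_mult_def transpose_def sum_2 det_2 trace_def s algebra_simps)
  qed
  finally show ?thesis .
qed

text \<open>The function is the Gram determinant to the power -1/2, so minus its logarithmic
  differential is half that of the Gram determinant, which is the trace of the basic potential. That
  potential has the form \<open>K ** V\<close>, and a matrix \<open>K\<close> can be recovered from
  all the traces of \<open>K ** V\<close>.\<close>

lemma thooft_pot_inverse_square:
  assumes "g \<in> carrier SL4" "det a = 1"
  shows "thooft_pot (xray (\<lambda>x. inverse_square (a *v x))) g = basic_pot (a ** g)"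
proof (intro ext)
  fix X V
  let ?h = "a ** g" and ?f = "\<lambda>X. 1 / sqrt (det (euclidean_gram (a ** g) X))"
  have g: "det g \<noteq> 0" and h: "det ?h \<noteq> 0" using assms by (simp_all add: carrier_SL4 det_mul)
  define K where "K = matrix_inv (euclidean_gram ?h X) ** transpose (std_frame ?h X) ** left_cols ?h"
  have K: "basic_pot ?h X V = K ** V" for V by (simp add: basic_pot_def K_def matrix_mul_assoc)
  have f: "xray (\<lambda>x. inverse_square (a *v x)) g = ?f"
    using g h by (simp add: fun_eq_iff xray_inverse_square)
  let ?d = "det (euclidean_gram ?h X)"
  have d: "?d > 0" using det_euclidean_gram[OF h] .
  have "((\<lambda>x. 1 / sqrt x) has_real_derivative - (1 / (2 * ?d * sqrt ?d))) (at ?d)"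
    using d by (auto intro!: derivative_eq_intros simp: field_simps power2_eq_square)
  from has_derivative_compose[OF has_derivative_det_gram[OF h, of X] this[unfolded has_field_derivative_def]]
  have "(?f has_derivative (\<lambda>V. - (1 / (2 * ?d * sqrt ?d)) * (2 * ?d * trace (basic_pot ?h X V)))) (at X)"
    by simp
  also have "(\<lambda>V. - (1 / (2 * ?d * sqrt ?d)) * (2 * ?d * trace (basic_pot ?h X V)))
     = (\<lambda>V. trace ((- ?f X *\<^sub>R K) ** V))"
    using d by (auto simp: K fun_eq_iff trace_def sum_2 matrix_mult_algebra field_simps)
  finally have "matrix_derivative ?f X = - ?f X *\<^sub>R K" by (rule matrix_derivative_eqI)
  then show "thooft_pot (xray (\<lambda>x. inverse_square (a *v x))) g X V = basic_pot ?h X V"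
    using assms(1) d by (simp add: thooft_pot_def f K matrix_mult_scaleR matrix_mult_algebra)
qed

lemma smooth_on_inverse_square: "smooth_on (- {0}) inverse_square"
proof -
  have o: "open (- {0::real^4})" by auto
  show ?thesis
    unfolding inverse_square_def[abs_def]
    by (intro smooth_on_divide o smooth_on_const smooth_on_bilinear[OF bounded_bilinear_inner] smooth_on_ident) auto
qed

lemma thooft_applicable_inverse_square:
  assumes a: "det a = 1"
  shows "thooft_applicable (\<lambda>x. inverse_square (a *v x))"
proof -
  have o: "open (- {0::real^4})" by auto
  have inj: "a *v x = 0 \<longleftrightarrow> x = 0" for x
    using a by (metis invertible_det_nz invertible_eq_bij matrix_left_invertible_ker matrix_vector_mult_0_right
        invertible_left_inverse zero_neq_one)
  have 1: "smooth_on (- {0}) (\<lambda>x. inverse_square (a *v x))"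
    by (rule smooth_on_compose[OF smooth_on_inverse_square _ o])
      (auto intro!: smooth_on_bounded_linear[OF matrix_vector_mul_bounded_linear] smooth_on_ident simp: inj)
  have 2: "inverse_square (a *v (c *\<^sub>R x)) = inverse_square (a *v x) / c\<^sup>2" for c x
    by (simp add: inverse_square_def matrix_vector_mult_scaleR power2_eq_square)
  have f: "xray (\<lambda>x. inverse_square (a *v x)) g = (\<lambda>X. 1 / sqrt (det (euclidean_gram (a ** g) X)))"
    and d: "det (euclidean_gram (a ** g) X) > 0"
    if "g \<in> carrier SL4" for g X
    using that a by (simp_all add: fun_eq_iff xray_inverse_square det_euclidean_gram carrier_SL4 det_mul)
  have "nowhere_vanishing_section (xray (\<lambda>x. inverse_square (a *v x)))"
    unfolding nowhere_vanishing_section_def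
  proof (intro conjI ballI allI impI)
    fix g X assume g: "g \<in> carrier SL4"
    show "smooth_on UNIV (xray (\<lambda>x. inverse_square (a *v x)) g)"
      unfolding f[OF g]
      by (intro smooth_on_divide smooth_on_const smooth_on_sqrt smooth_on_det2 smooth_on_euclidean_gram)
        (use d[OF g] in \<open>auto simp: less_imp_neq[THEN not_sym]\<close>)
    show "xray (\<lambda>x. inverse_square (a *v x)) g X \<noteq> 0" using d[OF g, of X] by (simp add: f[OF g])
  next
    fix g h X assume g: "g \<in> carrier SL4" and h: "h \<in> carrier SL4" and n: "det (chart_den g h X) \<noteq> 0"
    have t: "chart_den (a ** g) (a ** h) = chart_den g h" "chart_change (a ** g) (a ** h) = chart_change g h"
      using chart_translate[of a h g] a h by (simp_all add: carrier_SL4)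
    have "euclidean_gram (a ** g) X = transpose (chart_den g h X) **
        euclidean_gram (a ** h) (chart_change g h X) ** chart_den g h X"
      using gram_change[of "a ** h" "a ** g" X] a h n by (simp add: carrier_SL4 det_mul t)
    then have "det (euclidean_gram (a ** g) X) = (det (chart_den g h X))\<^sup>2 * det (euclidean_gram (a ** h) (chart_change g h X))"
      by (simp add: det_mul det_transpose power2_eq_square)
    then show "xray (\<lambda>x. inverse_square (a *v x)) h (chart_change g h X) =
        \<bar>det (chart_den g h X)\<bar> * xray (\<lambda>x. inverse_square (a *v x)) g X"
      using n d[OF h, of "chart_change g h X"] by (simp add: f[OF g] f[OF h] real_sqrt_mult)
  qed
  then show ?thesis using 1 2 by (simp add: thooft_applicable_def)
qed

section \<open>Coordinate charts cover the Grassmannian\<close>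

definition coord_chart :: "4 \<Rightarrow> 4 \<Rightarrow> 4 \<Rightarrow> 4 \<Rightarrow> real^4^4" where
  "coord_chart i j k l = transpose (vector [axis i 1, axis j 1, axis k 1, axis l 1])"

text \<open>\<open>coord_chart i j k l\<close> consists of the planes on which the coordinates \<open>k, l\<close> are independent.
  The permutations are even, so that the determinants are 1.\<close>

definition coord_charts :: "(real^4^4) set" where
  "coord_charts = {coord_chart 1 2 3 4, coord_chart 4 2 1 3, coord_chart 2 3 1 4,
     coord_chart 1 4 2 3, coord_chart 3 1 2 4, coord_chart 3 4 1 2}"

lemma det_coord_charts: "g \<in> coord_charts \<Longrightarrow> det g = 1"
  unfolding coord_charts_def coord_chart_def
  by (auto simp only: insert_iff empty_iff det_transpose) (simp_all add: det_4)

lemma matrix_inv_coord_chart: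
  assumes "coord_chart i j k l \<in> coord_charts"
  shows "matrix_inv (coord_chart i j k l) = transpose (coord_chart i j k l)"
proof -
  have "transpose g ** g = mat 1" if "g \<in> coord_charts" for g
    using that unfolding coord_charts_def coord_chart_def
    by (elim insertE emptyE) (simp_all add: vec_eq_iff forall_4 matrix_matrix_mult_def transpose_def sum_4 mat_def)
  from matrix_inv_eqI[OF this[OF assms]] show ?thesis .
qed

lemma coord_chart_mult: "transpose (coord_chart i j k l) ** M = vector [M $ i, M $ j, M $ k, M $ l]"
  for M :: "real^2^4"
proof -
  have "axis i 1 v* M = M $ i" for i :: 4
  proof (subst vec_eq_iff, intro allI)
    fix j
    have "(axis i 1 v* M) $ j = (\<Sum>k\<in>UNIV. if k = i then M $ k $ j else 0)"
      unfolding vector_matrix_mult_def vec_lambda_beta by (intro sum.cong) auto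
    then show "(axis i 1 v* M) $ j = M $ i $ j" by simp
  qed
  then show ?thesis
    by (simp add: coord_chart_def vec_eq_iff[of "_ ** _"] forall_4 matrix_mult_row)
qed

lemma blocks_coord_chart:
  "lower_block (transpose (coord_chart i j k l) ** M) = vector [M $ k, M $ l]"
  "upper_block (transpose (coord_chart i j k l) ** M) = vector [M $ i, M $ j]"
  by (simp_all add: coord_chart_mult lower_block_def upper_block_def)

lemma range_in_chart:
  assumes "det h \<noteq> 0" "det (lower_block (matrix_inv h ** M)) \<noteq> 0"
  shows "range ((*v) M) = Psi h (upper_block (matrix_inv h ** M) ** matrix_inv (lower_block (matrix_inv h ** M)))"
proof -
  let ?l = "lower_block (matrix_inv h ** M)" and ?u = "upper_block (matrix_inv h ** M)"
  have "M = h ** stack ?u ?l" using assms by (simp add: matrix_inv_mult_cancel)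
  also have "stack ?u ?l = stack (?u ** matrix_inv ?l) (mat 1) ** ?l"
    using assms by (simp add: stack_mult matrix_inv_mult_cancel)
  finally have M: "M = std_frame h (?u ** matrix_inv ?l) ** ?l"
    by (simp add: std_frame_def matrix_mul_assoc)
  then have "std_frame h (?u ** matrix_inv ?l) = M ** matrix_inv ?l"
    using assms(2) by (metis matrix_inv_mult_cancel(3))
  with M show ?thesis
    unfolding Psi_range by (metis range_mult_subset subset_antisym)
qed

lemma Gr_frame:
  assumes "p \<in> Gr"
  obtains M :: "real^2^4" where "p = range ((*v) M)" "\<And>v. M *v v = 0 \<Longrightarrow> v = 0"
proof -
  have p: "subspace p" "dim p = 2" using assms by (auto simp: Gr_def)
  obtain B where B: "B \<subseteq> p" "independent B" "p \<subseteq> span B" "card B = 2"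
    using basis_exists[of p] p by metis
  then obtain b1 b2 where b: "B = {b1, b2}" "b1 \<noteq> b2" by (meson card_2_iff)
  define M :: "real^2^4" where "M = (\<chi> i. vector [b1 $ i, b2 $ i])"
  have M: "M *v v = v$1 *\<^sub>R b1 + v$2 *\<^sub>R b2" for v
    by (simp add: M_def vec_eq_iff matrix_vector_mult_def sum_2 mult.commute)
  have "span B = range ((*v) M)"
  proof
    show "span B \<subseteq> range ((*v) M)"
    proof (rule span_minimal)
      have "b1 \<in> range ((*v) M)" using rangeI[of "(*v) M" "vector [1, 0]"] by (simp add: M)
      moreover have "b2 \<in> range ((*v) M)" using rangeI[of "(*v) M" "vector [0, 1]"] by (simp add: M)
      ultimately show "B \<subseteq> range ((*v) M)" using b by blast
      show "subspace (range ((*v) M))"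
        by (intro linear_subspace_image matrix_vector_mul_linear subspace_UNIV)
    qed
    show "range ((*v) M) \<subseteq> span B"
    proof clarify
      fix v
      show "M *v v \<in> span B" unfolding M by (intro span_add span_scale span_base) (simp_all add: b)
    qed
  qed
  moreover have "p = span B" using B p by (metis span_minimal subset_antisym)
  moreover have "v = 0" if "M *v v = 0" for v
  proof -
    have "v$1 *\<^sub>R b1 + v$2 *\<^sub>R b2 = 0" using that M by simp
    then have "v$1 = 0 \<and> v$2 = 0"
      using B(2) b independent_explicit_finite_subsets[of B]
      apply (simp add: independent_explicit)
      apply (drule spec[of _ "\<lambda>b. if b = b1 then v$1 else v$2"])
      apply auto
      done
    then show ?thesis by (simp add: vec_eq_iff forall_2)
  qed
  ultimately show thesis using that by blast
qed

text \<open>A matrix of rank two has a nonvanishing 2x2 minor; its two rows tell which chart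
  contains the plane.\<close>

lemma coord_charts_cover:
  assumes "p \<in> Gr"
  obtains g X where "g \<in> coord_charts" "p = Psi g X"
proof -
  note found = that
  obtain M :: "real^2^4" where M: "p = range ((*v) M)" "\<And>v. M *v v = 0 \<Longrightarrow> v = 0"
    using Gr_frame[OF assms] by blast
  have "\<exists>i j. M$i$1 * M$j$2 - M$i$2 * M$j$1 \<noteq> 0"
  proof (rule ccontr)
    assume "\<not> ?thesis"
    then have z: "M$i$1 * M$j$2 = M$i$2 * M$j$1" for i j by simp
    have "M *v vector [1, 0] \<noteq> 0" using M(2)[of "vector [1, 0]"] by (auto simp: vec_eq_iff forall_2)
    then obtain i where i: "M$i$1 \<noteq> 0" by (auto simp: vec_eq_iff matrix_vector_mult_def sum_2)
    have "M *v vector [M$i$2, - M$i$1] = 0"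
      using z[of i] by (simp add: vec_eq_iff matrix_vector_mult_def sum_2 mult.commute)
    from M(2)[OF this] i show False by (simp add: vec_eq_iff forall_2)
  qed
  then obtain i j where ij: "M$i$1 * M$j$2 - M$i$2 * M$j$1 \<noteq> 0" by blast
  have *: thesis if "coord_chart a b k l \<in> coord_charts" "M$k$1 * M$l$2 - M$k$2 * M$l$1 \<noteq> 0" for a b k l
  proof -
    let ?h = "coord_chart a b k l"
    have "det (lower_block (matrix_inv ?h ** M)) \<noteq> 0"
      unfolding matrix_inv_coord_chart[OF that(1)] blocks_coord_chart using that(2) by (simp add: det_2)
    then have "p = Psi ?h (upper_block (matrix_inv ?h ** M) ** matrix_inv (lower_block (matrix_inv ?h ** M)))"
      using range_in_chart[of ?h M] det_coord_charts[OF that(1)] M(1) by simp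
    with that(1) show thesis by (rule found)
  qed
  have ij': "M$j$1 * M$i$2 - M$j$2 * M$i$1 \<noteq> 0" using ij by (simp add: mult.commute)
  have "i \<noteq> j" using ij by (auto simp: mult.commute)
  then show thesis
    using *[of 1 2 3 4] *[of 4 2 1 3] *[of 2 3 1 4] *[of 1 4 2 3] *[of 3 1 2 4] *[of 3 4 1 2]
      ij ij' exhaust_4[of i] exhaust_4[of j]
    by (auto simp: coord_charts_def)
qed

section \<open>The solutions obtained from the ansatz\<close>

text \<open>The pull-back of the basic solution under the linear map \<open>a\<close>: its data on
  the chart \<open>g\<close> are the basic data on the chart \<open>a ** g\<close>.\<close>

definition thooft_solution :: "real^4^4 \<Rightarrow> (real^4^4) metric_bundle" where
  "thooft_solution a = tautological (thooft_pot (xray (\<lambda>x. inverse_square (a *v x)))) (\<lambda>g. euclidean_gram (a ** g))"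

lemma thooft_solution_simps [simp]:
  "patches (thooft_solution a) = carrier SL4" "chart (thooft_solution a) g = g"
  "patch_dom (thooft_solution a) g = UNIV" "trans (thooft_solution a) = chart_den"
  "gram (thooft_solution a) g = euclidean_gram (a ** g)"
  by (simp_all add: thooft_solution_def tautological_def)

lemma pot_thooft_solution:
  "g \<in> carrier SL4 \<Longrightarrow> det a = 1 \<Longrightarrow> pot (thooft_solution a) g = basic_pot (a ** g)"
  by (simp add: thooft_solution_def tautological_def thooft_pot_inverse_square)

lemma overlap_thooft_solution [simp]:
  "overlap (thooft_solution a) g (thooft_solution b) h = chart_dom g h"
  by (simp add: overlap_def chart_dom_def)

lemma Gr_eq_union_charts: "Gr = (\<Union>g\<in>carrier SL4. range (Psi g))"
proof
  show "Gr \<subseteq> (\<Union>g\<in>carrier SL4. range (Psi g))"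
  proof
    fix p assume "p \<in> Gr"
    then obtain g X where "g \<in> coord_charts" "p = Psi g X" by (rule coord_charts_cover)
    then show "p \<in> (\<Union>g\<in>carrier SL4. range (Psi g))"
      using det_coord_charts[of g] by (intro UN_I[of g]) (auto simp: carrier_SL4)
  qed
qed (auto simp: carrier_SL4 intro!: Psi_in_Gr)

theorem O2_ASDYM_thooft_solution:
  assumes a: "det a = 1"
  shows "O2_ASDYM_solution (thooft_solution a)"
proof -
  let ?E = "thooft_solution a"
  have ag: "det (a ** g) = 1" if "g \<in> carrier SL4" for g using that a by (simp add: carrier_SL4 det_mul)
  have t: "chart_den (a ** g) (a ** h) = chart_den g h" "chart_change (a ** g) (a ** h) = chart_change g h"
    if "h \<in> carrier SL4" for g h
    using chart_translate[of a h g] a that by (simp_all add: carrier_SL4)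
  have "is_vector_bundle ?E"
    unfolding is_vector_bundle_def thooft_solution_simps overlap_thooft_solution
    using Gr_eq_union_charts
    by (auto simp: carrier_SL4 chart_self chart_dom_def chart_den_cocycle(1)[symmetric]
        intro!: smooth_on_subset[OF smooth_on_chart_den[OF open_UNIV]])
  moreover have "is_connection ?E"
    unfolding is_connection_def thooft_solution_simps overlap_thooft_solution Let_def
  proof (intro conjI ballI allI)
    fix g assume g: "g \<in> carrier SL4"
    show "linear (pot ?E g X)" for X by (simp add: pot_thooft_solution g a linear_basic_pot)
    show "smooth_on UNIV (\<lambda>X. pot ?E g X V)" for V
      using ag[OF g] by (simp add: pot_thooft_solution g a smooth_on_basic_pot)
    fix h X V assume h: "h \<in> carrier SL4" and X: "X \<in> chart_dom g h"
    have d: "det (chart_den g h X) \<noteq> 0" using X by (simp add: chart_dom_def)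
    have "chart_den g h X ** pot ?E g X V =
       pot ?E h (chart_change g h X) (frechet_derivative (chart_change g h) (at X) V) ** chart_den g h X
       + frechet_derivative (chart_den g h) (at X) V"
      using basic_pot_change[of "a ** g" "a ** h" X V] ag[OF g] ag[OF h] d
      by (simp add: t[OF h] pot_thooft_solution g h a)
    then have "matrix_inv (chart_den g h X) ** (chart_den g h X ** pot ?E g X V) =
       matrix_inv (chart_den g h X) ** pot ?E h (chart_change g h X) (frechet_derivative (chart_change g h) (at X) V) ** chart_den g h X
       + matrix_inv (chart_den g h X) ** frechet_derivative (chart_den g h) (at X) V"
      by (simp add: matrix_mult_algebra matrix_mul_assoc)
    then show "pot ?E g X V =
       matrix_inv (chart_den g h X) ** pot ?E h (chart_change g h X) (frechet_derivative (chart_change g h) (at X) V) ** chart_den g h X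
       + matrix_inv (chart_den g h X) ** frechet_derivative (chart_den g h) (at X) V"
      using d by (simp add: matrix_inv_mult_cancel)
  qed
  moreover have "is_fibre_metric ?E"
    unfolding is_fibre_metric_def thooft_solution_simps overlap_thooft_solution
  proof (intro conjI ballI allI impI)
    fix g assume g: "g \<in> carrier SL4"
    show "smooth_on UNIV (euclidean_gram (a ** g))" by (simp add: smooth_on_euclidean_gram)
    show "v \<bullet> (euclidean_gram (a ** g) X *v v) > 0" if "v \<noteq> 0" for v X
      using pos_def_euclidean_gram[of "a ** g" X] ag[OF g] that by (simp add: pos_def_def)
    fix h X assume h: "h \<in> carrier SL4" and X: "X \<in> chart_dom g h"
    show "euclidean_gram (a ** g) X = transpose (chart_den g h X) **
        euclidean_gram (a ** h) (chart_change g h X) ** chart_den g h X"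
      using gram_change[of "a ** h" "a ** g" X] ag[OF h] X by (simp add: t[OF h] chart_dom_def)
  qed simp
  moreover have "metric_compatible ?E"
    unfolding metric_compatible_def thooft_solution_simps
    using ag by (simp add: pot_thooft_solution a basic_compatible)
  moreover have "ASD_curvature ?E"
    unfolding ASD_curvature_def thooft_solution_simps
  proof (intro ballI allI)
    fix g X V W assume g: "g \<in> carrier SL4"
    let ?G = "comp_gram (a ** g) X" and ?j = "- (matrix_inv (euclidean_gram (a ** g) X) ** J2)"
    have n: "det (a ** g) \<noteq> 0" using ag[OF g] by simp
    have "curvature (pot ?E g) X = (\<lambda>V W. asd_form ?G V W *\<^sub>R ?j)"
      using n by (simp add: fun_eq_iff pot_thooft_solution g a curvature_basic)
    then show "hodge_star (curvature (pot ?E g) X) V W = - curvature (pot ?E g) X V W"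
      by (simp only: hodge_star_scaleR hodge_star_asd_form[OF transpose_comp_gram[OF n]] scaleR_minus_left)
  qed
  ultimately show ?thesis by (simp add: O2_ASDYM_solution_def)
qed

section \<open>The curvature of an invariant solution\<close>

definition eq_up_to_sign :: "'a::group_add \<Rightarrow> 'a \<Rightarrow> bool" where
  "eq_up_to_sign A B \<longleftrightarrow> A = B \<or> A = - B"

lemma eq_up_to_sign_congruence:
  "eq_up_to_sign A B \<Longrightarrow> eq_up_to_sign (c *\<^sub>R (P ** A ** Q)) (c *\<^sub>R (P ** B ** Q))" for A B :: M2 and P Q :: M2
  by (auto simp: eq_up_to_sign_def matrix_mult_algebra)

lemma eq_up_to_sign_scale:
  "eq_up_to_sign A B \<Longrightarrow> eq_up_to_sign (c *\<^sub>R A) (c *\<^sub>R B)" for A :: "'a::real_vector"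
  by (auto simp: eq_up_to_sign_def)

lemma chart_lin_decomposition:
  assumes "det h \<noteq> 0"
  shows "left_cols g = left_cols h ** chart_lin g h X +
    std_frame h (chart_change g h X) ** lower_block (matrix_inv h ** left_cols g)"
proof -
  let ?a = "upper_block (matrix_inv h ** left_cols g)" and ?c = "lower_block (matrix_inv h ** left_cols g)"
  have "left_cols g = h ** stack ?a ?c" using assms by (simp add: matrix_inv_mult_cancel)
  also have "stack ?a ?c = stack (mat 1) 0 ** chart_lin g h X + stack (chart_change g h X) (mat 1) ** ?c"
    by (simp only: stack_mult stack_add[symmetric]) (simp add: chart_lin_def matrix_mult_algebra)
  finally show ?thesis
    by (simp add: left_cols_def[of h] std_frame_def matrix_mult_algebra matrix_mul_assoc)
qed

lemma chart_lin_eqI: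
  assumes "det h \<noteq> 0" "left_cols g = left_cols h ** A + std_frame h (chart_change g h X) ** B"
  shows "chart_lin g h X = A"
proof -
  have "matrix_inv h ** left_cols g = (matrix_inv h ** h) ** stack (mat 1) 0 ** A
      + (matrix_inv h ** h) ** stack (chart_change g h X) (mat 1) ** B"
    unfolding assms(2) by (simp add: left_cols_def std_frame_def matrix_mult_algebra matrix_mul_assoc)
  also have "\<dots> = stack (A + chart_change g h X ** B) B"
    using assms(1) by (simp add: matrix_inv_props stack_mult stack_add[symmetric])
  finally show ?thesis by (simp add: chart_lin_def)
qed

lemma chart_lin_cocycle:
  assumes "det h \<noteq> 0" "det k \<noteq> 0" "det (chart_den g h X) \<noteq> 0" "det (chart_den g k X) \<noteq> 0"
  shows "chart_lin g k X = chart_lin h k (chart_change g h X) ** chart_lin g h X"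
proof (rule chart_lin_eqI[OF assms(2)])
  let ?Y = "chart_change g h X"
  note c = chart_change_cocycle[OF assms(1,3,4)]
  have "left_cols g = (left_cols k ** chart_lin h k ?Y + std_frame k (chart_change h k ?Y) ** lower_block (matrix_inv k ** left_cols h)) ** chart_lin g h X
     + std_frame k (chart_change h k ?Y) ** chart_den h k ?Y ** lower_block (matrix_inv h ** left_cols g)"
    using chart_lin_decomposition[OF assms(1), of g X] chart_lin_decomposition[OF assms(2), of h ?Y]
      std_frame_change[OF assms(2) c(1)] by simp
  then show "left_cols g = left_cols k ** (chart_lin h k ?Y ** chart_lin g h X)
     + std_frame k (chart_change g k X) ** (lower_block (matrix_inv k ** left_cols h) ** chart_lin g h X
       + chart_den h k ?Y ** lower_block (matrix_inv h ** left_cols g))"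
    unfolding c(2) by (simp add: matrix_mult_algebra matrix_mul_assoc add.assoc)
qed

lemma chart_lin_translate:
  assumes "det a \<noteq> 0" "det h \<noteq> 0"
  shows "chart_lin (a ** g) (a ** h) = chart_lin g h"
proof -
  have "matrix_inv (a ** h) ** (a ** B) = matrix_inv h ** B" for B :: "real^2^4"
    using assms by (simp add: matrix_inv_mult matrix_mul_assoc[symmetric] matrix_inv_mult_cancel)
  then show ?thesis using chart_translate[OF assms] by (simp add: fun_eq_iff chart_lin_def std_frame_translate)
qed

text \<open>\<open>comp_gram\<close> is the Gram matrix of the inner product induced on the quotient
  bundle. The projector in its definition depends only on the plane and annihilates it, so of the
  change of \<open>left_cols\<close> only the part \<open>chart_lin\<close> survives.\<close>

lemma comp_gram_change:
  assumes h: "det h \<noteq> 0" and d: "det (chart_den g h X) \<noteq> 0"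
  shows "comp_gram g X = transpose (chart_lin g h X) ** comp_gram h (chart_change g h X) ** chart_lin g h X"
proof -
  let ?Y = "chart_change g h X" and ?d = "chart_den g h X" and ?l = "chart_lin g h X"
  let ?P = "\<lambda>g X. mat 1 - std_frame g X ** matrix_inv (euclidean_gram g X) ** transpose (std_frame g X)"
  let ?M = "std_frame h ?Y" and ?N = "euclidean_gram h ?Y"
  have N: "det ?N \<noteq> 0" using det_euclidean_gram_nz[OF h] .
  have dt: "det (transpose ?d) \<noteq> 0" using d by (simp add: det_transpose)
  have P: "?P g X = ?P h ?Y"
  proof -
    have "std_frame g X ** matrix_inv (euclidean_gram g X) ** transpose (std_frame g X)
      = ?M ** (?d ** matrix_inv ?d) ** matrix_inv ?N ** (matrix_inv (transpose ?d) ** transpose ?d) ** transpose ?M"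
      unfolding gram_change[OF h d] unfolding std_frame_change[OF h d]
      using N d dt by (simp add: matrix_inv_mult det_mul matrix_transpose_mul matrix_mul_assoc)
    then show ?thesis using d dt by (simp add: matrix_inv_props)
  qed
  have PM: "?P h ?Y ** ?M = 0"
  proof -
    have "?M ** matrix_inv ?N ** transpose ?M ** ?M = ?M ** (matrix_inv ?N ** ?N)"
      by (simp add: euclidean_gram_def matrix_mul_assoc)
    then show ?thesis using N by (simp add: matrix_mult_algebra matrix_inv_props)
  qed
  have MP: "transpose ?M ** ?P h ?Y = 0"
  proof -
    have "transpose ?M ** (?M ** matrix_inv ?N ** transpose ?M) = (?N ** matrix_inv ?N) ** transpose ?M"
      by (simp add: euclidean_gram_def matrix_mul_assoc)
    then show ?thesis using N by (simp add: matrix_mult_algebra matrix_inv_props)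
  qed
  define c where "c = lower_block (matrix_inv h ** left_cols g)"
  have L: "left_cols g = left_cols h ** ?l + ?M ** c"
    unfolding c_def by (rule chart_lin_decomposition[OF h])
  have PL: "?P h ?Y ** left_cols g = ?P h ?Y ** left_cols h ** ?l"
  proof -
    have "?P h ?Y ** left_cols g = ?P h ?Y ** left_cols h ** ?l + (?P h ?Y ** ?M) ** c"
      unfolding L by (simp only: matrix_mult_add_distrib matrix_mul_assoc)
    then show ?thesis by (simp add: PM matrix_mult_zero)
  qed
  have LP: "transpose (left_cols g) ** ?P h ?Y = transpose ?l ** transpose (left_cols h) ** ?P h ?Y"
  proof -
    have "transpose (left_cols g) ** ?P h ?Y = transpose ?l ** transpose (left_cols h) ** ?P h ?Y
        + transpose c ** (transpose ?M ** ?P h ?Y)"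
      unfolding L by (simp only: linear_add[OF bounded_linear.linear[OF bounded_linear_transpose]]
          matrix_transpose_mul matrix_mult_add_distrib matrix_mul_assoc)
    then show ?thesis by (simp add: MP matrix_mult_zero)
  qed
  have "comp_gram g X = transpose (left_cols g) ** ?P h ?Y ** left_cols g"
    unfolding comp_gram_def P ..
  also have "\<dots> = transpose ?l ** (transpose (left_cols h) ** (?P h ?Y ** left_cols g))"
    unfolding LP by (simp only: matrix_mul_assoc)
  also have "\<dots> = transpose ?l ** comp_gram h ?Y ** ?l"
    unfolding PL comp_gram_def by (simp only: matrix_mul_assoc)
  finally show ?thesis .
qed

lemma asd_form_inject:
  assumes "transpose G = G" "transpose H = H" "asd_form G = asd_form H"
  shows "G = H"
proof -
  have s: "G$1$2 = G$2$1" "H$1$2 = H$2$1" using sym2_eq assms by blast+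
  have "asd_form G V W = asd_form H V W" for V W using assms(3) by simp
  from this[of E11 E12] this[of E21 E22] this[of E11 E22]
  show ?thesis using s by (intro mat2_eqI) (simp_all add: asd_form_explicit)
qed

text \<open>The curvature of a metric connection of rank two is a real 2-form times
  \<open>jmat\<close>; when that form is ASD, it is recorded here by its symmetric matrix. Its sign
  depends on the orientation of the frame, through \<open>jmat\<close>.\<close>

definition curvature_matrix :: "'i metric_bundle \<Rightarrow> 'i \<Rightarrow> M2 \<Rightarrow> M2" where
  "curvature_matrix E i X = (THE G. transpose G = G \<and>
     (\<forall>V W. curvature (pot E i) X V W = asd_form G V W *\<^sub>R jmat (gram E i X)))"

locale asdym_solution =
  fixes E :: "'i metric_bundle"
  assumes solution: "O2_ASDYM_solution E"
begin

lemma det_chart: "i \<in> patches E \<Longrightarrow> det (chart E i) = 1"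
  and open_patch_dom: "i \<in> patches E \<Longrightarrow> open (patch_dom E i)"
  and Gr_patches: "Gr = (\<Union>i\<in>patches E. Psi (chart E i) ` patch_dom E i)"
  and smooth_trans: "i \<in> patches E \<Longrightarrow> j \<in> patches E \<Longrightarrow> smooth_on (overlap E i E j) (trans E i j)"
  and det_trans: "i \<in> patches E \<Longrightarrow> j \<in> patches E \<Longrightarrow> X \<in> overlap E i E j \<Longrightarrow> det (trans E i j X) \<noteq> 0"
  and trans_cocycle: "i \<in> patches E \<Longrightarrow> j \<in> patches E \<Longrightarrow> k \<in> patches E \<Longrightarrow>
     X \<in> overlap E i E j \<Longrightarrow> X \<in> overlap E i E k \<Longrightarrow>
     trans E i k X = trans E j k (chart_change (chart E i) (chart E j) X) ** trans E i j X"
  and linear_pot: "i \<in> patches E \<Longrightarrow> X \<in> patch_dom E i \<Longrightarrow> linear (pot E i X)"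
  and smooth_pot: "i \<in> patches E \<Longrightarrow> smooth_on (patch_dom E i) (\<lambda>X. pot E i X V)"
  and smooth_gram: "i \<in> patches E \<Longrightarrow> smooth_on (patch_dom E i) (gram E i)"
  and pos_def_gram: "i \<in> patches E \<Longrightarrow> X \<in> patch_dom E i \<Longrightarrow> pos_def (gram E i X)"
  and gram_trans: "i \<in> patches E \<Longrightarrow> j \<in> patches E \<Longrightarrow> X \<in> overlap E i E j \<Longrightarrow>
     gram E i X = transpose (trans E i j X) ** gram E j (chart_change (chart E i) (chart E j) X) ** trans E i j X"
  and compatible: "i \<in> patches E \<Longrightarrow> X \<in> patch_dom E i \<Longrightarrow>
     frechet_derivative (gram E i) (at X) V = transpose (pot E i X V) ** gram E i X + gram E i X ** pot E i X V"
  and asd: "i \<in> patches E \<Longrightarrow> X \<in> patch_dom E i \<Longrightarrow>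
     hodge_star (curvature (pot E i) X) V W = - curvature (pot E i) X V W"
proof -
  have vb: "is_vector_bundle E" and co: "is_connection E" and fm: "is_fibre_metric E"
    and mc: "metric_compatible E" and ac: "ASD_curvature E"
    using solution unfolding O2_ASDYM_solution_def by simp_all
  note v = vb[unfolded is_vector_bundle_def carrier_SL4]
  note v1 = conjunct1[OF v] and v2 = conjunct2[OF v]
  note v3 = conjunct1[OF conjunct2[OF v2]] and v5 = conjunct2[OF conjunct2[OF conjunct2[OF v2]]]
  note c = conjunct1[OF co[unfolded is_connection_def]]
  note f = fm[unfolded is_fibre_metric_def]
  note f1 = conjunct1[OF f] and f2 = conjunct2[OF f]
  show "i \<in> patches E \<Longrightarrow> det (chart E i) = 1" "i \<in> patches E \<Longrightarrow> open (patch_dom E i)"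
    using v1 by blast+
  show "Gr = (\<Union>i\<in>patches E. Psi (chart E i) ` patch_dom E i)" by (rule conjunct1[OF v2])
  show "i \<in> patches E \<Longrightarrow> j \<in> patches E \<Longrightarrow> smooth_on (overlap E i E j) (trans E i j)"
    "i \<in> patches E \<Longrightarrow> j \<in> patches E \<Longrightarrow> X \<in> overlap E i E j \<Longrightarrow> det (trans E i j X) \<noteq> 0"
    using v3 by blast+
  show "trans E i k X = trans E j k (chart_change (chart E i) (chart E j) X) ** trans E i j X"
    if "i \<in> patches E" "j \<in> patches E" "k \<in> patches E" "X \<in> overlap E i E j" "X \<in> overlap E i E k"
    using v5[rule_format, OF that(1-3) IntI[OF that(4,5)]] .
  show "i \<in> patches E \<Longrightarrow> X \<in> patch_dom E i \<Longrightarrow> linear (pot E i X)"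
    "i \<in> patches E \<Longrightarrow> smooth_on (patch_dom E i) (\<lambda>X. pot E i X V)"
    using c by blast+
  show "i \<in> patches E \<Longrightarrow> smooth_on (patch_dom E i) (gram E i)"
    using f1 by blast
  show "pos_def (gram E i X)" if "i \<in> patches E" "X \<in> patch_dom E i"
    using f1 that unfolding pos_def_def by blast
  show "gram E i X = transpose (trans E i j X) ** gram E j (chart_change (chart E i) (chart E j) X) ** trans E i j X"
    if "i \<in> patches E" "j \<in> patches E" "X \<in> overlap E i E j"
    using f2[rule_format, OF that] .
  show "frechet_derivative (gram E i) (at X) V = transpose (pot E i X V) ** gram E i X + gram E i X ** pot E i X V"
    if "i \<in> patches E" "X \<in> patch_dom E i"
    using mc[unfolded metric_compatible_def, rule_format, OF that] .
  show "hodge_star (curvature (pot E i) X) V W = - curvature (pot E i) X V W"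
    if "i \<in> patches E" "X \<in> patch_dom E i"
    using ac[unfolded ASD_curvature_def, rule_format, OF that] .
qed

lemma pot_trans:
  assumes "i \<in> patches E" "j \<in> patches E" "X \<in> overlap E i E j"
  shows "trans E i j X ** pot E i X V =
    pot E j (chart_change (chart E i) (chart E j) X) (frechet_derivative (chart_change (chart E i) (chart E j)) (at X) V)
      ** trans E i j X + frechet_derivative (trans E i j) (at X) V"
proof -
  let ?T = "trans E i j X" and ?t = "frechet_derivative (trans E i j) (at X) V"
  let ?A = "pot E j (chart_change (chart E i) (chart E j) X) (frechet_derivative (chart_change (chart E i) (chart E j)) (at X) V)"
  have "\<forall>i\<in>patches E. \<forall>j\<in>patches E. \<forall>X\<in>overlap E i E j. \<forall>V.
        let T = trans E i j; \<psi> = chart_change (chart E i) (chart E j) in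
        pot E i X V =
          matrix_inv (T X) ** pot E j (\<psi> X) (frechet_derivative \<psi> (at X) V) ** T X
          + matrix_inv (T X) ** frechet_derivative T (at X) V"
    using solution unfolding O2_ASDYM_solution_def is_connection_def by blast
  then have "pot E i X V = matrix_inv ?T ** ?A ** ?T + matrix_inv ?T ** ?t"
    using assms unfolding Let_def by blast
  then have "?T ** pot E i X V = ?T ** (matrix_inv ?T ** (?A ** ?T)) + ?T ** (matrix_inv ?T ** ?t)"
    by (simp add: matrix_mult_algebra matrix_mul_assoc)
  then show ?thesis using det_trans[OF assms] by (simp add: matrix_inv_mult_cancel)
qed

lemma connection_form:
  assumes "i \<in> patches E"
  obtains a :: "M2 \<Rightarrow> M2 \<Rightarrow> real" where
    "\<And>V. smooth_on (patch_dom E i) (\<lambda>X. a X V)" "\<And>X. X \<in> patch_dom E i \<Longrightarrow> linear (a X)"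
    "\<And>X V. X \<in> patch_dom E i \<Longrightarrow> chol (gram E i X) ** pot E i X V =
       a X V *\<^sub>R (J2 ** chol (gram E i X)) + frechet_derivative (\<lambda>X. chol (gram E i X)) (at X) V"
    "\<And>X V W. X \<in> patch_dom E i \<Longrightarrow> curvature (pot E i) X V W =
       (frechet_derivative (\<lambda>Y. a Y W) (at X) V - frechet_derivative (\<lambda>Y. a Y V) (at X) W) *\<^sub>R jmat (gram E i X)"
proof (rule orthonormal_connection_form[of "patch_dom E i" "gram E i" "pot E i"], goal_cases)
  case (7 a)
  show ?case by (rule 7(1)[OF 7(2) 7(3) 7(4) 7(5)])
qed (use assms in \<open>auto intro: open_patch_dom smooth_gram pos_def_gram smooth_pot linear_pot compatible\<close>)

lemma jmat_gram:
  assumes "i \<in> patches E" "X \<in> patch_dom E i"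
  shows "jmat (gram E i X) ** jmat (gram E i X) = - mat 1" "jmat (gram E i X) \<noteq> 0"
proof -
  show 1: "jmat (gram E i X) ** jmat (gram E i X) = - mat 1"
    using pos_def_gram[OF assms] pos_defD(3) by (intro jmat_sq) (auto simp: pos_def_def)
  show "jmat (gram E i X) \<noteq> 0"
  proof
    assume "jmat (gram E i X) = 0"
    then have "(- mat 1 :: M2) = 0" using 1 by (simp add: matrix_mult_zero)
    from arg_cong[OF this, of "\<lambda>A. A $ 1 $ 1"] show False by (simp add: mat_def)
  qed
qed

lemma curvature_matrix:
  assumes i: "i \<in> patches E" and X: "X \<in> patch_dom E i"
  shows "transpose (curvature_matrix E i X) = curvature_matrix E i X"
    "curvature (pot E i) X V W = asd_form (curvature_matrix E i X) V W *\<^sub>R jmat (gram E i X)"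
    "transpose H = H \<Longrightarrow> (\<And>V W. curvature (pot E i) X V W = asd_form H V W *\<^sub>R jmat (gram E i X)) \<Longrightarrow> curvature_matrix E i X = H"
proof -
  obtain a where a: "\<And>V. smooth_on (patch_dom E i) (\<lambda>X. a X V)" "\<And>X. X \<in> patch_dom E i \<Longrightarrow> linear (a X)"
    and c: "\<And>V W. curvature (pot E i) X V W =
       (frechet_derivative (\<lambda>Y. a Y W) (at X) V - frechet_derivative (\<lambda>Y. a Y V) (at X) W) *\<^sub>R jmat (gram E i X)"
    using connection_form[OF i] X by metis
  define \<omega> where "\<omega> V W = frechet_derivative (\<lambda>Y. a Y W) (at X) V - frechet_derivative (\<lambda>Y. a Y V) (at X) W" for V W
  have da: "(\<lambda>Y. a Y W) differentiable (at X)" for W by (rule smooth_onD[OF a(1) X])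
  have l1: "linear (\<lambda>V. frechet_derivative (\<lambda>Y. a Y W) (at X) V)" for W
    using linear_frechet_derivative[OF da] by (simp add: eta_contract_eq)
  have l2: "linear (\<lambda>W. frechet_derivative (\<lambda>Y. a Y W) (at X) V)" for V
  proof -
    have "(\<lambda>W. frechet_derivative (\<lambda>Y. a Y W) (at X) V) =
       (\<lambda>W. \<Sum>b\<in>Basis. (W \<bullet> b) *\<^sub>R frechet_derivative (\<lambda>Y. a Y b) (at X) V)"
      by (rule ext, rule frechet_derivative_form_expand[where B = a, OF open_patch_dom[OF i] X a(2) da])
    moreover have "linear (\<lambda>W. \<Sum>b\<in>Basis. (W \<bullet> b) *\<^sub>R frechet_derivative (\<lambda>Y. a Y b) (at X) V)"
      by (intro linear_compose_sum) (auto intro!: linearI simp: inner_add_left algebra_simps)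
    ultimately show ?thesis by simp
  qed
  have b: "linear (\<omega> V)" "linear (\<lambda>V. \<omega> V W)" for V W
    unfolding \<omega>_def using l1 l2 by (auto intro: linear_compose_sub)
  have as: "\<omega> W V = - \<omega> V W" for V W by (simp add: \<omega>_def)
  have c': "curvature (pot E i) X = (\<lambda>V W. \<omega> V W *\<^sub>R jmat (gram E i X))"
    by (simp add: fun_eq_iff c \<omega>_def)
  have "hodge_star \<omega> V W *\<^sub>R jmat (gram E i X) = (- \<omega> V W) *\<^sub>R jmat (gram E i X)" for V W
    using asd[OF i X, of V W] unfolding c' hodge_star_scaleR by simp
  then have "hodge_star \<omega> V W = - \<omega> V W" for V W using jmat_gram(2)[OF i X] by (metis scaleR_cancel_right)
  from asd_form_exists[OF b as this] obtain G where G: "transpose G = G" "\<omega> = asd_form G" .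
  have u: "H = G" if "transpose H = H" "\<And>V W. curvature (pot E i) X V W = asd_form H V W *\<^sub>R jmat (gram E i X)" for H
  proof (rule asd_form_inject[OF that(1) G(1)])
    show "asd_form H = asd_form G"
      using that(2) jmat_gram(2)[OF i X] unfolding c' G(2) by (simp add: fun_eq_iff)
  qed
  have e: "curvature_matrix E i X = G"
    unfolding curvature_matrix_def
  proof (rule the_equality)
    show "transpose G = G \<and> (\<forall>V W. curvature (pot E i) X V W = asd_form G V W *\<^sub>R jmat (gram E i X))"
      unfolding c' G(2) using G(1) by blast
    fix H assume H: "transpose H = H \<and> (\<forall>V W. curvature (pot E i) X V W = asd_form H V W *\<^sub>R jmat (gram E i X))"
    show "H = G" by (rule u[OF conjunct1[OF H] conjunct2[OF H, rule_format]])
  qed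
  show "transpose (curvature_matrix E i X) = curvature_matrix E i X" unfolding e by (rule G(1))
  show "curvature (pot E i) X V W = asd_form (curvature_matrix E i X) V W *\<^sub>R jmat (gram E i X)"
    unfolding e c' G(2) ..
  show "curvature_matrix E i X = H"
    if "transpose H = H" "\<And>V W. curvature (pot E i) X V W = asd_form H V W *\<^sub>R jmat (gram E i X)"
    unfolding e by (rule u[OF that, symmetric])
qed

text \<open>An isometry carries \<open>jmat\<close> to \<open>jmat\<close> up to the sign of its
  determinant, and the coordinate change acts on the ASD form by congruence with
  \<open>chart_lin\<close> and the inverse determinant of \<open>chart_den\<close>. The chart
  \<open>g\<close> need not be that of the patch \<open>i\<close>: for a pulled-back bundle it is
  the translated one.\<close>

lemma curvature_matrix_gauge:
  assumes i: "i \<in> patches E" and j: "j \<in> patches E" and g: "det g = 1"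
    and D: "open D" "X \<in> D" "D \<subseteq> patch_dom E i" "D \<subseteq> chart_dom g (chart E j)"
      "\<And>Y. Y \<in> D \<Longrightarrow> chart_change g (chart E j) Y \<in> patch_dom E j"
    and u: "smooth_on D u" "det (u X) \<noteq> 0"
      "gram E i X = transpose (u X) ** gram E j (chart_change g (chart E j) X) ** u X"
      "\<And>Y V. Y \<in> D \<Longrightarrow> u Y ** pot E i Y V =
        pot E j (chart_change g (chart E j) Y) (frechet_derivative (chart_change g (chart E j)) (at Y) V) ** u Y
        + frechet_derivative u (at Y) V"
  shows "eq_up_to_sign (curvature_matrix E i X)
    ((1 / det (chart_den g (chart E j) X)) *\<^sub>R (transpose (chart_lin g (chart E j) X) **
       curvature_matrix E j (chart_change g (chart E j) X) ** chart_lin g (chart E j) X))"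
proof -
  let ?\<psi> = "chart_change g (chart E j)" and ?l = "chart_lin g (chart E j) X" and ?d = "chart_den g (chart E j) X"
  let ?G = "curvature_matrix E i X" and ?H = "curvature_matrix E j (?\<psi> X)"
  have X: "X \<in> patch_dom E i" "?\<psi> X \<in> patch_dom E j" "det ?d \<noteq> 0"
    using D by (auto simp: chart_dom_def)
  have K: "transpose (transpose ?l ** ?H ** ?l) = transpose ?l ** ?H ** ?l"
    using curvature_matrix(1)[OF j X(2)] by (simp add: matrix_transpose_mul matrix_mul_assoc)
  have e: "u X ** curvature (pot E i) X V W =
      curvature (pot E j) (?\<psi> X) (frechet_derivative ?\<psi> (at X) V) (frechet_derivative ?\<psi> (at X) W) ** u X" for V W
    by (rule curvature_gauge[OF D(1,2) u(1) smooth_on_subset[OF smooth_on_chart_change D(4)] open_patch_dom[OF j]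
        _ smooth_pot[OF j] linear_pot[OF j] smooth_on_subset[OF smooth_pot[OF i] D(3)] u(4)])
      (use D(5) in auto)
  have "jmat (gram E i X) = sgn (det (u X)) *\<^sub>R (matrix_inv (u X) ** jmat (gram E j (?\<psi> X)) ** u X)"
    unfolding u(3) by (rule jmat_congruence[OF pos_defD(3)[OF pos_def_gram[OF j X(2)]] u(2)])
  then have j1: "matrix_inv (u X) ** jmat (gram E j (?\<psi> X)) ** u X = sgn (det (u X)) *\<^sub>R jmat (gram E i X)"
    using u(2) by (simp add: sgn_if)
  define s where "s = sgn (det (u X)) * (1 / det ?d)"
  have "curvature (pot E i) X V W = asd_form (s *\<^sub>R (transpose ?l ** ?H ** ?l)) V W *\<^sub>R jmat (gram E i X)" for V W
  proof -
    have "curvature (pot E i) X V W = matrix_inv (u X) ** (u X ** curvature (pot E i) X V W)"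
      using u(2) by (simp add: matrix_inv_mult_cancel)
    also have "\<dots> = asd_form ?H (?l ** V ** matrix_inv ?d) (?l ** W ** matrix_inv ?d) *\<^sub>R
       (matrix_inv (u X) ** jmat (gram E j (?\<psi> X)) ** u X)"
      unfolding e frechet_chart_change[OF X(3)] curvature_matrix(2)[OF j X(2)]
      by (simp add: matrix_mult_scaleR matrix_mul_assoc)
    finally show ?thesis
      unfolding asd_form_congruence[OF curvature_matrix(1)[OF j X(2)]] j1 det_matrix_inv[OF X(3)]
      by (simp add: asd_form_scale s_def mult.assoc mult.commute mult.left_commute)
  qed
  then have "?G = s *\<^sub>R (transpose ?l ** ?H ** ?l)"
    by (intro curvature_matrix(3)[OF i X(1)])
      (simp_all add: K linear_cmul[OF bounded_linear.linear[OF bounded_linear_transpose]])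
  then show ?thesis using u(2) by (auto simp: s_def sgn_if eq_up_to_sign_def)
qed

lemma open_overlap_like:
  assumes "i \<in> patches E" "j \<in> patches E"
  shows "open {X \<in> patch_dom E i. det (chart_den g (chart E j) X) \<noteq> 0 \<and> chart_change g (chart E j) X \<in> patch_dom E j}"
proof -
  have "open (chart_dom g (chart E j) \<inter> chart_change g (chart E j) -` patch_dom E j)"
    by (rule continuous_open_preimage[OF smooth_on_imp_continuous_on[OF smooth_on_chart_change] open_chart_dom
          open_patch_dom[OF assms(2)]])
  from open_Int[OF open_patch_dom[OF assms(1)] this] show ?thesis
    by (rule back_subst[where P = "open"]) (auto simp: chart_dom_def)
qed

lemma curvature_matrix_T_isomorphic:
  assumes iso: "T_isomorphic (pull_back a E) E" and a: "det a = 1"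
    and i: "i \<in> patches E" and j: "j \<in> patches E" and X: "X \<in> patch_dom E i"
    and g: "g = matrix_inv a ** chart E i"
    and d: "det (chart_den g (chart E j) X) \<noteq> 0" "chart_change g (chart E j) X \<in> patch_dom E j"
  shows "eq_up_to_sign (curvature_matrix E i X)
    ((1 / det (chart_den g (chart E j) X)) *\<^sub>R (transpose (chart_lin g (chart E j) X) **
       curvature_matrix E j (chart_change g (chart E j) X) ** chart_lin g (chart E j) X))"
proof -
  define D where "D = {X \<in> patch_dom E i. det (chart_den g (chart E j) X) \<noteq> 0 \<and> chart_change g (chart E j) X \<in> patch_dom E j}"
  obtain E' u where E': "E' = pull_back a E \<or> E' = flat_twist (pull_back a E)"
    and u: "gauge_equivalence E' E u"
    using iso unfolding T_isomorphic_def gauge_equivalent_def by blast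
  have s: "patches E' = patches E" "chart E' i = g" "pot E' = pot E" "gram E' = gram E" "patch_dom E' = patch_dom E"
    using E' by (auto simp: pull_back_def flat_twist_def g)
  have o: "overlap E' i E j = D" by (simp add: overlap_def D_def s)
  note ue = u[unfolded gauge_equivalence_def, THEN conjunct1, rule_format, unfolded s(1), OF i j, unfolded s o Let_def]
  show ?thesis
  proof (rule curvature_matrix_gauge[OF i j _ _ _ _ _ _ conjunct1[OF ue]])
    show "det g = 1" using a det_chart[OF i] by (simp add: g det_mul det_matrix_inv)
    show "open D" unfolding D_def by (rule open_overlap_like[OF i j])
    show XD: "X \<in> D" using X d by (simp add: D_def)
    show "D \<subseteq> patch_dom E i" "D \<subseteq> chart_dom g (chart E j)"
      "\<And>Y. Y \<in> D \<Longrightarrow> chart_change g (chart E j) Y \<in> patch_dom E j"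
      by (auto simp: D_def chart_dom_def)
    note uX = conjunct2[OF ue, rule_format]
    show "det (u i j X) \<noteq> 0" by (rule conjunct1[OF uX[OF XD]])
    show "gram E i X = transpose (u i j X) ** gram E j (chart_change g (chart E j) X) ** u i j X"
      by (rule conjunct1[OF conjunct2[OF uX[OF XD]]])
    fix Y V assume "Y \<in> D"
    note y = uX[OF this]
    let ?A = "pot E j (chart_change g (chart E j) Y) (frechet_derivative (chart_change g (chart E j)) (at Y) V)"
    have "pot E i Y V = matrix_inv (u i j Y) ** ?A ** u i j Y + matrix_inv (u i j Y) ** frechet_derivative (u i j) (at Y) V"
      by (rule conjunct2[OF conjunct2[OF y], rule_format])
    then have "u i j Y ** pot E i Y V = u i j Y ** (matrix_inv (u i j Y) ** (?A ** u i j Y))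
       + u i j Y ** (matrix_inv (u i j Y) ** frechet_derivative (u i j) (at Y) V)"
      by (simp add: matrix_mult_algebra matrix_mul_assoc)
    then show "u i j Y ** pot E i Y V = ?A ** u i j Y + frechet_derivative (u i j) (at Y) V"
      using conjunct1[OF y] by (simp add: matrix_inv_mult_cancel)
  qed
qed

end

text \<open>The curvature at the plane \<open>Psi k 0\<close>, transported from the patch
  \<open>i\<close> to the coordinates of the chart \<open>k\<close>. This makes the curvatures at
  different planes comparable.\<close>

definition centre_curvature :: "'i metric_bundle \<Rightarrow> real^4^4 \<Rightarrow> 'i \<Rightarrow> M2" where
  "centre_curvature E k i = (1 / det (chart_den k (chart E i) 0)) *\<^sub>R
     (transpose (chart_lin k (chart E i) 0) ** curvature_matrix E i (chart_change k (chart E i) 0) ** chart_lin k (chart E i) 0)"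

section \<open>Orthogonal charts centred at a given plane\<close>

lemma transpose_zero [simp]: "transpose 0 = (0 :: real^'n^'m)"
  by (simp add: transpose_def vec_eq_iff)

lemma transpose_stack_mult: "transpose (stack A B) ** stack C D = transpose A ** C + transpose B ** D"
  by (rule mat2_eqI) (simp_all add: matrix_matrix_mult_def transpose_def sum_4 sum_2)

lemma transpose_hcat_mult: "transpose (hcat A B) ** hcat C D =
    hcat (stack (transpose A ** C) (transpose B ** C)) (stack (transpose A ** D) (transpose B ** D))"
  by (simp add: vec_eq_iff forall_4 matrix_matrix_mult_def transpose_def)

lemma hcat_mat_1: "hcat (stack (mat 1) 0) (stack 0 (mat 1)) = mat 1"
  by (simp add: vec_eq_iff forall_4 mat_def)

lemma orthogonal_chart_centre:
  assumes "transpose \<kappa> ** \<kappa> = mat 1"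
  shows "euclidean_gram \<kappa> 0 = mat 1" "comp_gram \<kappa> 0 = mat 1"
proof -
  have *: "transpose (\<kappa> ** A) ** (\<kappa> ** B) = transpose A ** B" for A B :: "real^2^4"
  proof -
    have "transpose (\<kappa> ** A) ** (\<kappa> ** B) = transpose A ** (transpose \<kappa> ** \<kappa>) ** B"
      by (simp add: matrix_transpose_mul matrix_mul_assoc)
    then show ?thesis by (simp add: assms)
  qed
  show e: "euclidean_gram \<kappa> 0 = mat 1"
    by (simp add: euclidean_gram_def std_frame_def * transpose_stack_mult matrix_mult_zero)
  have "transpose (left_cols \<kappa>) ** std_frame \<kappa> 0 = 0" "transpose (left_cols \<kappa>) ** left_cols \<kappa> = mat 1"
    unfolding left_cols_def std_frame_def *
    by (simp_all add: transpose_stack_mult matrix_mult_zero)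
  then show "comp_gram \<kappa> 0 = mat 1"
    by (simp add: comp_gram_def e matrix_mult_algebra matrix_mul_assoc)
qed

text \<open>Block Gram-Schmidt: the first two columns of \<open>g\<close> are made orthogonal to the
  plane by subtracting their projections, and both pairs of columns are then orthonormalised. All
  factors have positive determinant, so the orthogonal matrix obtained has determinant 1.\<close>

lemma orthogonal_chart_exists:
  assumes g: "det g = 1"
  obtains \<kappa> where "transpose \<kappa> ** \<kappa> = mat 1" "det \<kappa> = 1" "Psi \<kappa> 0 = Psi g X"
proof -
  let ?L = "left_cols g" and ?M = "std_frame g X" and ?N = "euclidean_gram g X" and ?C = "comp_gram g X"
  have gn: "det g \<noteq> 0" using g by simp
  note N = det_euclidean_gram_nz[OF gn, of X]
  define c where "c = matrix_inv ?N ** transpose ?M ** ?L"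
  define L' where "L' = ?L - ?M ** c"
  have MtL: "transpose ?M ** L' = 0"
  proof -
    have "transpose ?M ** (?M ** c) = (?N ** matrix_inv ?N) ** transpose ?M ** ?L"
      by (simp add: c_def euclidean_gram_def matrix_mul_assoc)
    then show ?thesis using N by (simp add: L'_def matrix_mult_algebra matrix_inv_props)
  qed
  have "transpose L' ** ?M = transpose (transpose ?M ** L')" by (simp add: matrix_transpose_mul)
  then have LtM: "transpose L' ** ?M = 0" by (simp add: MtL)
  have LL: "transpose L' ** L' = ?C"
  proof -
    have "transpose L' ** L' = transpose ?L ** L' - transpose c ** (transpose ?M ** L')"
      by (simp add: L'_def[THEN arg_cong[of _ _ transpose]] matrix_transpose_mul matrix_mult_algebra matrix_mul_assoc
          linear_diff[OF bounded_linear.linear[OF bounded_linear_transpose]])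
    also have "\<dots> = ?C" unfolding MtL
      by (simp add: comp_gram_def L'_def c_def matrix_mult_algebra matrix_mul_assoc)
    finally show ?thesis .
  qed
  have L'0: "Z = 0" if "L' ** Z = 0" for Z :: M2
  proof -
    have "?L ** Z = ?M ** (c ** Z)" using that by (simp add: L'_def matrix_mult_algebra matrix_mul_assoc)
    then have "g ** stack Z 0 = g ** stack (X ** (c ** Z)) (c ** Z)"
      by (simp add: left_cols_def std_frame_def matrix_mul_assoc[symmetric] stack_mult matrix_mult_zero)
    then have "stack Z 0 = stack (X ** (c ** Z)) (c ** Z)"
      by (metis gn matrix_inv_mult_cancel(1))
    then have "Z = X ** (c ** Z)" "0 = c ** Z" by (metis blocks_stack)+
    then show "Z = 0" by (metis matrix_mult_zero(2))
  qed
  have "pos_def (transpose L' ** mat 1 ** L')"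
  proof (rule pos_def_congruence[OF pos_def_mat_1])
    fix v assume v: "L' *v v = 0"
    let ?Z = "(\<chi> i j. v $ i) :: M2"
    have "L' ** ?Z = 0" using v by (simp add: vec_eq_iff matrix_matrix_mult_def matrix_vector_mult_def)
    from arg_cong[OF L'0[OF this], of "\<lambda>A. A $ i $ 1" for i] have "v $ i = 0 $ i" for i by simp
    then show "v = 0" by (simp only: vec_eq_iff simp_thms)
  qed
  then have C: "pos_def ?C" by (simp add: LL)
  have pN: "pos_def ?N" by (rule pos_def_euclidean_gram[OF gn])
  have orth: "transpose (A ** matrix_inv (chol S)) ** (A ** matrix_inv (chol S)) = mat 1"
    if "transpose A ** A = S" "pos_def S" for A :: "real^2^4" and S
  proof -
    let ?T = "chol S"
    have d: "det ?T \<noteq> 0" using det_chol_pos[OF that(2)] by simp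
    have "transpose (A ** matrix_inv ?T) ** (A ** matrix_inv ?T) = transpose (matrix_inv ?T) ** (transpose A ** A) ** matrix_inv ?T"
      by (simp add: matrix_transpose_mul matrix_mul_assoc)
    also have "\<dots> = transpose (matrix_inv ?T) ** transpose ?T ** (?T ** matrix_inv ?T)"
      unfolding that(1)
      using arg_cong[OF chol_sq[OF that(2)], of "\<lambda>B. transpose (matrix_inv ?T) ** B ** matrix_inv ?T"]
      by (simp add: matrix_mul_assoc)
    also have "transpose (matrix_inv ?T) ** transpose ?T = mat 1"
      using matrix_inv_props(2)[OF d] by (metis matrix_transpose_mul transpose_mat)
    finally show ?thesis using d by (simp add: matrix_inv_props)
  qed
  let ?TC = "matrix_inv (chol ?C)" and ?TN = "matrix_inv (chol ?N)"
  define \<kappa> where "\<kappa> = hcat (L' ** ?TC) (?M ** ?TN)"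
  have z1: "transpose (L' ** ?TC) ** (?M ** ?TN) = transpose ?TC ** (transpose L' ** ?M) ** ?TN"
    by (simp add: matrix_transpose_mul matrix_mul_assoc)
  have z2: "transpose (?M ** ?TN) ** (L' ** ?TC) = transpose ?TN ** (transpose ?M ** L') ** ?TC"
    by (simp add: matrix_transpose_mul matrix_mul_assoc)
  have o: "transpose \<kappa> ** \<kappa> = mat 1"
    unfolding \<kappa>_def transpose_hcat_mult orth[OF LL C] orth[OF euclidean_gram_def[symmetric] pN] z1 z2
    by (simp add: LtM MtL matrix_mult_zero hcat_mat_1)
  have "\<kappa> = hcat ?L ?M ** hcat (stack (mat 1) (- c)) (stack 0 (mat 1)) ** hcat (stack ?TC 0) (stack 0 ?TN)"
    by (simp add: \<kappa>_def hcat_mult L'_def matrix_mult_algebra)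
  then have "det \<kappa> = det ?TC * det ?TN"
    by (simp add: det_mul det_frame g det_block_triangular)
  also have "\<dots> > 0"
    using det_chol_pos[OF C] det_chol_pos[OF pN] by (simp add: det_matrix_inv)
  finally have "det \<kappa> > 0" .
  moreover have "det \<kappa> * det \<kappa> = 1"
    using arg_cong[OF o, of det] by (simp add: det_mul det_transpose)
  ultimately have d: "det \<kappa> = 1"
    by (metis abs_of_pos abs_square_eq_1 power2_eq_square)
  have "std_frame \<kappa> 0 = ?M ** ?TN"
    by (simp add: std_frame_def \<kappa>_def hcat_mult_stack matrix_mult_zero)
  moreover have "det ?TN \<noteq> 0" using det_chol_pos[OF pN] by (simp add: det_matrix_inv)
  ultimately have "Psi \<kappa> 0 = Psi g X"
    unfolding Psi_range using range_mult_subset[of ?M ?TN] range_mult_subset[of "?M ** ?TN" "matrix_inv ?TN"]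
    by (simp add: matrix_inv_mult_cancel subset_antisym)
  with o d show thesis by (rule that)
qed

text \<open>Bases of determinant 1 that are orthonormal for the inner product
  \<open>transpose h ** h\<close>. The quotient of any two of them preserves this inner
  product.\<close>

definition adapted_frames :: "real^4^4 \<Rightarrow> (real^4^4) set" where
  "adapted_frames h = {k. det k = 1 \<and> transpose (h ** k) ** (h ** k) = mat 1}"

locale invariant_asdym_solution = asdym_solution E for E :: "'i metric_bundle" +
  fixes h :: "real^4^4"
  assumes det_h: "det h = 1"
    and invariant: "\<And>k k'. k \<in> adapted_frames h \<Longrightarrow> k' \<in> adapted_frames h \<Longrightarrow>
      T_isomorphic (pull_back (k ** matrix_inv k') E) E"
begin

definition covers_centre :: "real^4^4 \<Rightarrow> 'i \<Rightarrow> bool" where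
  "covers_centre k i \<longleftrightarrow> i \<in> patches E \<and> det (chart_den k (chart E i) 0) \<noteq> 0 \<and>
     chart_change k (chart E i) 0 \<in> patch_dom E i"

lemma covers_centreI:
  assumes "i \<in> patches E" "X \<in> patch_dom E i" "det k = 1" "Psi (chart E i) X = Psi k 0"
  shows "covers_centre k i" "chart_change k (chart E i) 0 = X"
  using assms Psi_eq_iff[of k "chart E i" 0 X] det_chart[OF assms(1)] by (auto simp: covers_centre_def)

lemma covers_centre_exists:
  assumes "det k = 1" obtains i where "covers_centre k i"
proof -
  have "Psi k 0 \<in> Gr" using assms by (intro Psi_in_Gr) simp
  then obtain i X where "i \<in> patches E" "X \<in> patch_dom E i" "Psi k 0 = Psi (chart E i) X"
    unfolding Gr_patches by blast
  then show thesis using covers_centreI(1) assms that by metis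
qed

text \<open>The group element \<open>k ** matrix_inv k'\<close> carries one centre to the other.
  Pulled back under it, the chart of the patch \<open>i\<close> has the same position relative to
  \<open>k'\<close> as the original chart has relative to \<open>k\<close>.\<close>

lemma centre_curvature_invariant:
  assumes k: "k \<in> adapted_frames h" and k': "k' \<in> adapted_frames h"
    and i: "covers_centre k i" and j: "covers_centre k' j"
  shows "eq_up_to_sign (centre_curvature E k i) (centre_curvature E k' j)"
proof -
  define a where "a = k ** matrix_inv k'"
  define g where "g = matrix_inv a ** chart E i"
  have d: "det k = 1" "det k' = 1" using k k' by (auto simp: adapted_frames_def)
  have ip: "i \<in> patches E" and jp: "j \<in> patches E" using i j by (auto simp: covers_centre_def)
  note gi = det_chart[OF ip] and gj = det_chart[OF jp]
  have da: "det a = 1" using d by (simp add: a_def det_mul det_matrix_inv)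
  have dai: "det (matrix_inv a) \<noteq> 0" using da by (simp add: det_matrix_inv)
  have ak: "matrix_inv a ** k = k'"
    using d by (simp add: a_def matrix_inv_mult det_matrix_inv matrix_inv_inv matrix_inv_mult_cancel)
  have dg: "det g = 1" using da gi by (simp add: g_def det_mul det_matrix_inv)
  have t: "chart_den k (chart E i) = chart_den k' g" "chart_change k (chart E i) = chart_change k' g"
    "chart_lin k (chart E i) = chart_lin k' g"
    using chart_translate[OF dai, of "chart E i" k] chart_lin_translate[OF dai, of "chart E i" k] gi
    by (simp_all add: ak g_def)
  define X where "X = chart_change k' g 0"
  have X: "X \<in> patch_dom E i" and n1: "det (chart_den k' g 0) \<noteq> 0"
    using i by (auto simp: covers_centre_def t X_def)
  have n2: "det (chart_den k' (chart E j) 0) \<noteq> 0" and Y: "chart_change k' (chart E j) 0 \<in> patch_dom E j"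
    using j by (auto simp: covers_centre_def)
  have gn: "det g \<noteq> 0" "det (chart E j) \<noteq> 0" using dg gj by auto
  note c = chart_change_cocycle[OF gn(1) n1 n2, folded X_def]
  note l = chart_lin_cocycle[OF gn n1 n2, folded X_def]
  note dn = chart_den_cocycle(1)[OF gn(1) n1, of "chart E j", folded X_def]
  have "T_isomorphic (pull_back a E) E" unfolding a_def by (rule invariant[OF k k'])
  from curvature_matrix_T_isomorphic[OF this da ip jp X g_def c(1)] Y
  have e: "eq_up_to_sign (curvature_matrix E i X)
    ((1 / det (chart_den g (chart E j) X)) *\<^sub>R (transpose (chart_lin g (chart E j) X) **
       curvature_matrix E j (chart_change k' (chart E j) 0) ** chart_lin g (chart E j) X))"
    by (simp only: c(2))
  show ?thesis
    using eq_up_to_sign_congruence[OF e, of "1 / det (chart_den k' g 0)" "transpose (chart_lin k' g 0)" "chart_lin k' g 0"]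
    unfolding centre_curvature_def t X_def[symmetric] l dn
    by (simp add: det_mul matrix_mult_scaleR matrix_transpose_mul matrix_mul_assoc mult.commute)
qed

lemma adapted_frames_inv_h: "matrix_inv h \<in> adapted_frames h"
  using det_h by (simp add: adapted_frames_def det_matrix_inv matrix_inv_props)

text \<open>Invariance under the rotation by 45 degrees of the first two basis vectors forces the curvature
  to be a multiple of a single form.\<close>

lemma rotation_invariant_scalar:
  fixes K :: M2
  assumes K: "transpose K = K" and r: "r\<^sup>2 = 1 / 2"
    and e: "eq_up_to_sign (transpose (vector [vector [r, - r], vector [r, r]]) ** K ** vector [vector [r, - r], vector [r, r]]) K"
  shows "\<exists>t. K = t *\<^sub>R mat 1"
proof -
  have s: "K$2$1 = K$1$2" using sym2_eq[OF K] .
  have rr: "r * r = 1 / 2" using r by (simp add: power2_eq_square)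
  have rx: "r * (r * x) = x / 2" for x using rr by (metis mult.assoc mult.commute times_divide_eq_right mult.right_neutral)
  let ?R = "vector [vector [r, - r], vector [r, r]] :: M2"
  let ?L = "transpose ?R ** K ** ?R"
  have L: "?L$1$1 = (K$1$1 + K$2$2) / 2 + K$1$2" "?L$2$2 = (K$1$1 + K$2$2) / 2 - K$1$2"
     "?L$1$2 = (K$2$2 - K$1$1) / 2"
    by (simp_all add: matrix_matrix_mult_def transpose_def sum_2 s algebra_simps rx)
  \<comment> \<open>On trace-free symmetric matrices a rotation acts with twice its angle, here as a
    quarter turn, which has neither 1 nor -1 as an eigenvalue. This explains the 45 degrees: a right
    angle would act as -1, which agreement up to sign permits.\<close>
  have "K$1$1 = K$2$2 \<and> K$1$2 = 0"
    using e unfolding eq_up_to_sign_def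
  proof
    assume "?L = K"
    then have "?L$1$1 = K$1$1" "?L$2$2 = K$2$2" "?L$1$2 = K$1$2" by simp_all
    then show ?thesis unfolding L by argo
  next
    assume "?L = - K"
    then have "?L$1$1 = - K$1$1" "?L$2$2 = - K$2$2" "?L$1$2 = - K$1$2" by simp_all
    then show ?thesis unfolding L by argo
  qed
  then have "K = K$1$1 *\<^sub>R mat 1" using s by (intro mat2_eqI) (simp_all add: mat_def)
  then show ?thesis ..
qed

text \<open>Multiplying the frame \<open>k\<close> by a rotation of its first two columns keeps the
  central plane and its frame, but turns the frame of the quotient. The two frames have the same
  curvature up to sign, and the rotation conjugates it.\<close>

lemma centre_curvature_scalar:
  obtains t where "\<And>k i. k \<in> adapted_frames h \<Longrightarrow> covers_centre k i \<Longrightarrow>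
    eq_up_to_sign (centre_curvature E k i) (t *\<^sub>R mat 1)"
proof -
  define k where "k = matrix_inv h"
  have kA: "k \<in> adapted_frames h" unfolding k_def by (rule adapted_frames_inv_h)
  have dk: "det k = 1" using kA by (simp add: adapted_frames_def)
  obtain i where i: "covers_centre k i" using covers_centre_exists[OF dk] .
  have ip: "i \<in> patches E" and n: "det (chart_den k (chart E i) 0) \<noteq> 0"
    and Y: "chart_change k (chart E i) 0 \<in> patch_dom E i" using i by (auto simp: covers_centre_def)
  define r where "r = sqrt (1 / 2)"
  have r: "r\<^sup>2 = 1 / 2" by (simp add: r_def)
  then have rr: "r * r = 1 / 2" by (simp add: power2_eq_square)
  define R :: M2 where "R = vector [vector [r, - r], vector [r, r]]"
  define \<rho> where "\<rho> = hcat (stack R 0) (stack 0 (mat 1))"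
  have RR: "transpose R ** R = mat 1"
    by (rule mat2_eqI) (simp_all add: R_def matrix_matrix_mult_def transpose_def sum_2 mat_def rr)
  have dR: "det R = 1" by (simp add: R_def det_2 rr)
  have d\<rho>: "det \<rho> = 1" by (simp add: \<rho>_def det_block_triangular dR)
  have \<rho>\<rho>: "transpose \<rho> ** \<rho> = mat 1"
    by (simp add: \<rho>_def transpose_hcat_mult transpose_stack_mult RR matrix_mult_zero hcat_mat_1)
  have kA': "k ** \<rho> \<in> adapted_frames h"
  proof -
    have "transpose (h ** (k ** \<rho>)) ** (h ** (k ** \<rho>)) = transpose \<rho> ** (transpose (h ** k) ** (h ** k)) ** \<rho>"
      by (simp add: matrix_transpose_mul matrix_mul_assoc)
    also have "\<dots> = mat 1" using kA by (simp add: adapted_frames_def \<rho>\<rho>)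
    finally show ?thesis by (simp add: adapted_frames_def det_mul dk d\<rho>)
  qed
  have s: "std_frame (k ** \<rho>) 0 = std_frame k 0 ** mat 1"
    by (simp add: std_frame_def \<rho>_def matrix_mul_assoc[symmetric] hcat_mult_stack matrix_mult_zero)
  have dkn: "det k \<noteq> 0" using dk by simp
  note c = frame_in_chart[OF dkn s]
  have c0: "chart_change (k ** \<rho>) k 0 = 0" by (simp add: chart_change_def c matrix_mult_zero)
  have l: "chart_lin (k ** \<rho>) k 0 = R"
  proof (rule chart_lin_eqI[OF dkn, where B = 0])
    show "left_cols (k ** \<rho>) = left_cols k ** R + std_frame k (chart_change (k ** \<rho>) k 0) ** 0"
      by (simp add: left_cols_def \<rho>_def matrix_mul_assoc[symmetric] hcat_mult_stack stack_mult matrix_mult_zero)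
  qed
  have n1: "det (chart_den (k ** \<rho>) k 0) \<noteq> 0" by (simp add: c)
  have gi: "det (chart E i) \<noteq> 0" using det_chart[OF ip] by simp
  have dn: "chart_den (k ** \<rho>) (chart E i) 0 = chart_den k (chart E i) 0"
    using chart_den_cocycle(1)[OF dkn n1, of "chart E i"] by (simp add: c c0)
  have nn: "chart_num (k ** \<rho>) (chart E i) 0 = chart_num k (chart E i) 0"
    using chart_den_cocycle(2)[OF dkn n1, of "chart E i"] by (simp add: c c0)
  have cc: "chart_change (k ** \<rho>) (chart E i) 0 = chart_change k (chart E i) 0"
    by (simp add: chart_change_def dn nn)
  have ll: "chart_lin (k ** \<rho>) (chart E i) 0 = chart_lin k (chart E i) 0 ** R"
    using chart_lin_cocycle[OF dkn gi n1] n by (simp add: dn c0 l)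
  have i': "covers_centre (k ** \<rho>) i" using i by (simp add: covers_centre_def dn cc)
  let ?K = "centre_curvature E k i"
  have "centre_curvature E (k ** \<rho>) i = transpose R ** ?K ** R"
    unfolding centre_curvature_def dn cc ll
    by (simp add: matrix_mult_scaleR matrix_transpose_mul matrix_mul_assoc)
  then have "eq_up_to_sign (transpose R ** ?K ** R) ?K"
    using centre_curvature_invariant[OF kA' kA i' i] by simp
  moreover have "transpose ?K = ?K"
    using curvature_matrix(1)[OF ip Y]
    by (simp add: centre_curvature_def linear_cmul[OF bounded_linear.linear[OF bounded_linear_transpose]]
        matrix_transpose_mul matrix_mul_assoc)
  ultimately obtain t where t: "?K = t *\<^sub>R mat 1"
    using rotation_invariant_scalar[OF _ r] unfolding R_def by blast
  show thesis
    by (rule that[of t]) (use centre_curvature_invariant[OF _ kA _ i] in \<open>simp add: t\<close>)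
qed

text \<open>Around every plane there is an adapted chart in which the curvature is scalar and
  \<open>comp_gram\<close> is the identity. On transport to the chart of the patch the identity
  becomes \<open>comp_gram\<close>, and the determinant factor becomes the inverse root of the Gram
  determinant, up to sign.\<close>

theorem curvature_matrix_basic:
  obtains t where "\<And>i X. i \<in> patches E \<Longrightarrow> X \<in> patch_dom E i \<Longrightarrow>
    eq_up_to_sign (curvature_matrix E i X)
      ((t / sqrt (det (euclidean_gram (h ** chart E i) X))) *\<^sub>R comp_gram (h ** chart E i) X)"
proof -
  obtain t where t: "\<And>k i. k \<in> adapted_frames h \<Longrightarrow> covers_centre k i \<Longrightarrow>
    eq_up_to_sign (centre_curvature E k i) (t *\<^sub>R mat 1)"
    using centre_curvature_scalar by blast
  have "eq_up_to_sign (curvature_matrix E i X)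
      ((t / sqrt (det (euclidean_gram (h ** chart E i) X))) *\<^sub>R comp_gram (h ** chart E i) X)"
    if i: "i \<in> patches E" and X: "X \<in> patch_dom E i" for i X
  proof -
    define b where "b = h ** chart E i"
    have gi: "det (chart E i) = 1" using det_chart[OF i] .
    have b: "det b = 1" using gi det_h by (simp add: b_def det_mul)
    have bn: "det b \<noteq> 0" using b by simp
    obtain \<kappa> where \<kappa>: "transpose \<kappa> ** \<kappa> = mat 1" "det \<kappa> = 1" "Psi \<kappa> 0 = Psi b X"
      using orthogonal_chart_exists[OF b] .
    define k where "k = matrix_inv h ** \<kappa>"
    have hn: "det h \<noteq> 0" using det_h by simp
    have hk: "h ** k = \<kappa>" using hn by (simp add: k_def matrix_inv_mult_cancel)
    have kA: "k \<in> adapted_frames h"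
      using \<kappa> det_h by (simp add: adapted_frames_def hk) (simp add: k_def det_mul det_matrix_inv)
    have tr: "chart_den \<kappa> b = chart_den k (chart E i)" "chart_change \<kappa> b = chart_change k (chart E i)"
      "chart_lin \<kappa> b = chart_lin k (chart E i)"
      using chart_translate[OF hn, of "chart E i" k] chart_lin_translate[OF hn, of "chart E i" k] gi
      by (simp_all add: hk b_def)
    have \<kappa>n: "det \<kappa> \<noteq> 0" using \<kappa> by simp
    have n: "det (chart_den \<kappa> b 0) \<noteq> 0" and c: "chart_change \<kappa> b 0 = X"
      using \<kappa>(3) Psi_eq_iff[OF \<kappa>n bn] by auto
    have cov: "covers_centre k i"
      using i X n c by (simp add: covers_centre_def tr)
    let ?G = "curvature_matrix E i X" and ?l = "chart_lin \<kappa> b 0" and ?d = "chart_den \<kappa> b 0"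
    let ?C = "comp_gram b X" and ?N = "euclidean_gram b X"
    have C: "transpose ?l ** ?C ** ?l = mat 1"
      using comp_gram_change[OF bn n] orthogonal_chart_centre(2)[OF \<kappa>(1)] by (simp add: c)
    have N: "(det ?d)\<^sup>2 * det ?N = 1"
      using arg_cong[OF gram_change[OF bn n], of det] orthogonal_chart_centre(1)[OF \<kappa>(1)]
      by (simp add: c det_mul det_transpose power2_eq_square mult_ac)
    have Np: "det ?N > 0" by (rule det_euclidean_gram[OF bn])
    have sN: "\<bar>det ?d\<bar> = 1 / sqrt (det ?N)"
    proof -
      have "\<bar>det ?d\<bar> * sqrt (det ?N) = 1"
        using arg_cong[OF N, of sqrt] by (simp add: real_sqrt_mult)
      then show ?thesis using Np by (simp add: field_simps)
    qed
    have dl: "det ?l \<noteq> 0" using arg_cong[OF C, of det] by (auto simp: det_mul)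
    have "eq_up_to_sign ((1 / det ?d) *\<^sub>R (transpose ?l ** ?G ** ?l)) (t *\<^sub>R mat 1)"
      using t[OF kA cov] by (simp add: centre_curvature_def tr[symmetric] c)
    from eq_up_to_sign_scale[OF this, of "det ?d"]
    have "eq_up_to_sign (transpose ?l ** ?G ** ?l) ((det ?d * t) *\<^sub>R (transpose ?l ** ?C ** ?l))"
      using n by (simp add: C)
    from eq_up_to_sign_congruence[OF this, of 1 "matrix_inv (transpose ?l)" "matrix_inv ?l"]
    have "eq_up_to_sign ?G ((det ?d * t) *\<^sub>R ?C)"
    proof -
      have dt: "det (transpose ?l) \<noteq> 0" using dl by (simp add: det_transpose)
      have *: "matrix_inv (transpose ?l) ** (transpose ?l ** A ** ?l) ** matrix_inv ?l = A" for A
      proof -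
        have "matrix_inv (transpose ?l) ** (transpose ?l ** A ** ?l) ** matrix_inv ?l
          = (matrix_inv (transpose ?l) ** transpose ?l) ** A ** (?l ** matrix_inv ?l)"
          by (simp add: matrix_mul_assoc)
        then show ?thesis using dl dt by (simp add: matrix_inv_props)
      qed
      then show ?thesis
        using \<open>eq_up_to_sign (1 *\<^sub>R _) (1 *\<^sub>R _)\<close> by (simp add: matrix_mult_scaleR *)
    qed
    moreover have "det ?d * t = \<bar>det ?d\<bar> * t \<or> det ?d * t = - (\<bar>det ?d\<bar> * t)" by (auto simp: abs_if)
    ultimately have "eq_up_to_sign ?G ((\<bar>det ?d\<bar> * t) *\<^sub>R ?C)"
      by (auto simp: eq_up_to_sign_def)
    then show ?thesis unfolding sN by (simp add: b_def)
  qed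
  then show thesis by (rule that)
qed

end

section \<open>Compact subgroups preserve an inner product\<close>

text \<open>A fixed point of a compact linear group in the convex hull of an orbit: the unique point of least
  norm for an invariant, strictly convex norm.\<close>

lemma compact_group_fixes_pos_def:
  fixes K :: "(real^'n^'n) set"
  assumes K: "compact K" "mat 1 \<in> K" "\<And>a b. a \<in> K \<Longrightarrow> b \<in> K \<Longrightarrow> a ** b \<in> K"
    and det: "\<And>a. a \<in> K \<Longrightarrow> det a \<noteq> 0" and inv: "\<And>a. a \<in> K \<Longrightarrow> matrix_inv a \<in> K"
  obtains B where "pos_def B" "\<And>a. a \<in> K \<Longrightarrow> transpose a ** B ** a = B"
proof -
  define act where "act a B = transpose a ** B ** a" for a B :: "real^'n^'n"
  have act_mult: "act a (act b B) = act (b ** a) B" for a b B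
    by (simp add: act_def matrix_transpose_mul matrix_mul_assoc)
  have act_lin: "bounded_linear (act a)" for a
    unfolding act_def by (rule bounded_linear_compose[OF
        bounded_bilinear.bounded_linear_left[OF bounded_bilinear_matrix_mult]
        bounded_bilinear.bounded_linear_right[OF bounded_bilinear_matrix_mult]])
  have act_cont: "continuous_on UNIV (\<lambda>a. act a B)" for B
    unfolding act_def
    by (intro bounded_bilinear.continuous_on[OF bounded_bilinear_matrix_mult] continuous_on_const continuous_on_id
        bounded_linear.continuous_on[OF bounded_linear_transpose])
  define C where "C = convex hull ((\<lambda>a. act a (mat 1)) ` K)"
  have C: "compact C" "convex C" "C \<noteq> {}"
    unfolding C_def using K(1,2) continuous_on_subset[OF act_cont]
    by (auto intro!: compact_convex_hull compact_continuous_image)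
  have actC: "act a B \<in> C" if "a \<in> K" "B \<in> C" for a B
  proof -
    have "act a ` C \<subseteq> C"
      unfolding C_def convex_hull_linear_image[OF bounded_linear.linear[OF act_lin]]
      by (rule hull_mono) (use K(3) that in \<open>auto simp: image_image act_mult\<close>)
    then show ?thesis using that by blast
  qed
  have posC: "pos_def B" if "B \<in> C" for B
  proof -
    have "convex {B :: real^'n^'n. pos_def B}"
    proof (rule convexI)
      fix A B :: "real^'n^'n" and u v :: real
      assume *: "A \<in> {B. pos_def B}" "B \<in> {B. pos_def B}" "0 \<le> u" "0 \<le> v" "u + v = 1"
      have "x \<bullet> ((u *\<^sub>R A + v *\<^sub>R B) *v x) > 0" if "x \<noteq> 0" for x
      proof -
        have "x \<bullet> ((u *\<^sub>R A + v *\<^sub>R B) *v x) = u * (x \<bullet> (A *v x)) + v * (x \<bullet> (B *v x))"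
          by (simp add: matrix_vector_mult_add_rdistrib scaleR_matrix_vector_assoc[symmetric] inner_add_right)
        moreover have "x \<bullet> (A *v x) > 0" "x \<bullet> (B *v x) > 0" using * that by (auto simp: pos_def_def)
        moreover have "u > 0 \<or> v > 0" using * by linarith
        ultimately show ?thesis using *(3,4)
          by (metis add_nonneg_pos add_pos_nonneg mult_nonneg_nonneg mult_pos_pos less_imp_le)
      qed
      then show "u *\<^sub>R A + v *\<^sub>R B \<in> {B. pos_def B}"
        using * by (auto simp: pos_def_def linear_add[OF bounded_linear.linear[OF bounded_linear_transpose]]
            linear_cmul[OF bounded_linear.linear[OF bounded_linear_transpose]])
    qed
    moreover have "(\<lambda>a. act a (mat 1)) ` K \<subseteq> {B. pos_def B}"
    proof clarify
      fix a assume "a \<in> K"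
      then have "a *v v = 0 \<Longrightarrow> v = 0" for v
        using det by (metis matrix_inv_props(1) matrix_vector_mul_assoc matrix_vector_mul_lid matrix_vector_mult_0_right)
      then show "pos_def (act a (mat 1))"
        unfolding act_def using pos_def_congruence[OF pos_def_mat_1] by blast
    qed
    ultimately have "C \<subseteq> {B. pos_def B}" unfolding C_def by (rule hull_minimal[rotated])
    then show ?thesis using that by blast
  qed
  \<comment> \<open>The supremum over the group turns the Euclidean norm into an invariant one;
    since it is attained, strict convexity is inherited.\<close>
  define N where "N B = (SUP a\<in>K. norm (act a B))" for B
  have attain: "\<exists>a\<in>K. N B = norm (act a B) \<and> (\<forall>b\<in>K. norm (act b B) \<le> norm (act a B))" for B
  proof -
    have "continuous_on K (\<lambda>a. norm (act a B))"
      by (intro continuous_on_norm continuous_on_subset[OF act_cont]) auto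
    from continuous_attains_sup[OF K(1) _ this] obtain a where a: "a \<in> K" "\<forall>b\<in>K. norm (act b B) \<le> norm (act a B)"
      using K(2) by blast
    then have "N B = norm (act a B)" unfolding N_def by (intro cSup_eq_maximum) auto
    then show ?thesis using a by blast
  qed
  have N_upper: "norm (act a B) \<le> N B" if "a \<in> K" for a B using attain[of B] that by metis
  have N_invariant: "N (act b B) \<le> N B" if "b \<in> K" for b B
  proof -
    obtain a where "a \<in> K" "N (act b B) = norm (act a (act b B))" using attain by blast
    then show ?thesis using N_upper[OF K(3)[OF that]] by (simp add: act_mult)
  qed
  have N_diff: "N A \<le> N B + N (A - B)" for A B
  proof -
    obtain a where a: "a \<in> K" "N A = norm (act a A)" using attain by blast
    have "act a A = act a B + act a (A - B)"
      by (simp add: linear_diff[OF bounded_linear.linear[OF act_lin]])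
    then have "N A \<le> norm (act a B) + norm (act a (A - B))" using a by (simp add: norm_triangle_ineq)
    then show ?thesis using N_upper[OF a(1)] by (smt (verit))
  qed
  have "\<exists>M. \<forall>a\<in>K. \<forall>B. norm (act a B) \<le> M * norm B"
  proof -
    obtain m where m: "\<And>a. a \<in> K \<Longrightarrow> norm a \<le> m" using compact_imp_bounded[OF K(1)] by (auto simp: bounded_iff)
    obtain c where c: "c > 0" "\<And>(A :: real^'n^'n) (B :: real^'n^'n). norm (A ** B) \<le> norm A * norm B * c"
      using bounded_bilinear.pos_bounded[OF bounded_bilinear_matrix_mult[where 'n = 'n and 'm = 'n and 'p = 'n]] by auto
    obtain d where d: "d > 0" "\<And>A :: real^'n^'n. norm (transpose A) \<le> norm A * d"
      using bounded_linear.pos_bounded[OF bounded_linear_transpose] by blast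
    have "norm (act a B) \<le> (m * d * c * m * c) * norm B" if a: "a \<in> K" for a B
    proof -
      have m0: "0 \<le> m" using m[OF a] norm_ge_zero order_trans by blast
      have "norm (transpose a ** B) \<le> norm (transpose a) * norm B * c" using c(2)[of "transpose a" B] .
      also have "\<dots> \<le> (m * d) * norm B * c"
        using d(2)[of a] m[OF a] d(1) c(1) by (intro mult_right_mono) (auto intro: order_trans mult_right_mono)
      finally have 1: "norm (transpose a ** B) \<le> (m * d) * norm B * c" .
      have "norm (act a B) \<le> norm (transpose a ** B) * norm a * c" unfolding act_def using c(2)[of "transpose a ** B" a] .
      also have "\<dots> \<le> ((m * d) * norm B * c) * m * c"
        using 1 m[OF a] m0 c(1) d(1) by (intro mult_right_mono mult_mono) auto
      finally show ?thesis by (simp add: mult_ac)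
    qed
    then show ?thesis by blast
  qed
  then obtain M where M: "\<And>a B. a \<in> K \<Longrightarrow> norm (act a B) \<le> M * norm B" by blast
  have NM: "N B \<le> M * norm B" for B using attain[of B] M by metis
  have "continuous_on C N"
  proof -
    have "dist (N A) (N B) \<le> M * dist A B" for A B
      using N_diff[of A B] N_diff[of B A] NM[of "A - B"] NM[of "B - A"]
      by (auto simp: dist_norm norm_minus_commute abs_le_iff)
    then have "\<bar>M\<bar>-lipschitz_on C N"
      by (intro lipschitz_onI order_trans[OF _ mult_right_mono[OF abs_ge_self]]) auto
    then show ?thesis by (rule lipschitz_on_continuous_on)
  qed
  from continuous_attains_inf[OF C(1,3) this] obtain B where B: "B \<in> C" "\<And>A. A \<in> C \<Longrightarrow> N B \<le> N A" by blast
  have "act b B = B" if b: "b \<in> K" for b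
  proof -
    let ?A = "act b B"
    have A: "?A \<in> C" "N ?A = N B" using actC[OF b B(1)] N_invariant[OF b] B(2) by (auto intro: antisym)
    let ?Z = "(1/2) *\<^sub>R ?A + (1/2) *\<^sub>R B"
    have "?Z \<in> C" using C(2) A(1) B(1) by (intro convexD) auto
    then have Z: "N B \<le> N ?Z" by (rule B(2))
    obtain a where a: "a \<in> K" "N ?Z = norm (act a ?Z)" using attain by blast
    have e: "act a ?Z = (1/2) *\<^sub>R act a ?A + (1/2) *\<^sub>R act a B"
      by (simp add: linear_add[OF bounded_linear.linear[OF act_lin]] linear_cmul[OF bounded_linear.linear[OF act_lin]])
    have n1: "norm (act a ?A) \<le> N B" and n2: "norm (act a B) \<le> N B" using N_upper[OF a(1)] A(2) by metis+
    have n3: "2 * N B \<le> norm (act a ?A + act a B)"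
    proof -
      have "act a ?Z = (1/2) *\<^sub>R (act a ?A + act a B)" unfolding e by (simp add: scaleR_add_right)
      then have "norm (act a ?Z) = norm (act a ?A + act a B) / 2" by simp
      then show ?thesis using Z a(2) by linarith
    qed
    \<comment> \<open>The parallelogram identity: both vectors have norm at most \<open>N B\<close>,
      while by minimality their midpoint has norm at least \<open>N B\<close>, so they
      coincide.\<close>
    have "norm (act a ?A + act a B) ^ 2 + norm (act a ?A - act a B) ^ 2 = 2 * norm (act a ?A) ^ 2 + 2 * norm (act a B) ^ 2"
      by (simp add: power2_norm_eq_inner inner_add_left inner_add_right inner_diff_left inner_diff_right inner_commute)
    moreover have "norm (act a ?A) ^ 2 \<le> N B ^ 2" "norm (act a B) ^ 2 \<le> N B ^ 2"
      using n1 n2 by (auto intro: power_mono)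
    moreover have "(2 * N B) ^ 2 \<le> norm (act a ?A + act a B) ^ 2"
      using n3 n2 norm_ge_zero[of "act a B"] by (intro power_mono) linarith+
    moreover have "(2 * N B) ^ 2 = 4 * N B ^ 2" by (simp add: power_mult_distrib)
    ultimately have "norm (act a ?A - act a B) ^ 2 \<le> 0" by linarith
    then have "act a ?A = act a B" by simp
    then have "act (matrix_inv a) (act a ?A) = act (matrix_inv a) (act a B)" by simp
    moreover have "act (mat 1) B = B" by (simp add: act_def)
    ultimately show ?thesis using det[OF a(1)] by (simp add: act_mult matrix_inv_mult_cancel matrix_inv_props)
  qed
  then show thesis using that[of B] posC[OF B(1)] by (simp add: act_def)
qed

section \<open>The volume integral\<close>

text \<open>The statement for half-lines is applied on both sides of 0, after a reflection on the
  negative side.\<close>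

lemma nn_integral_FTC_real_line:
  fixes f F :: "real \<Rightarrow> real"
  assumes f: "f \<in> borel_measurable borel" "\<And>x. 0 \<le> f x" "\<And>x. (F has_real_derivative f x) (at x)"
    and lim: "(F \<longlongrightarrow> T) at_top" "(F \<longlongrightarrow> B) at_bot"
  shows "(\<integral>\<^sup>+x. ennreal (f x) \<partial>lborel) = ennreal (T - B)"
proof -
  have [measurable]: "f \<in> borel_measurable borel" by (rule f)
  have m: "mono F"
    by (rule monoI) (use f(2,3) in \<open>auto intro: DERIV_nonneg_imp_nondecreasing\<close>)
  have FT: "F 0 \<le> T"
    using m by (intro tendsto_lowerbound[OF lim(1)]) (auto simp: eventually_at_top_linorder mono_def)
  have BF: "B \<le> F 0"
    using m by (intro tendsto_upperbound[OF lim(2)]) (auto simp: eventually_at_bot_linorder mono_def)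
  have 1: "(\<integral>\<^sup>+x. ennreal (f x) * indicator {0..} x \<partial>lborel) = ennreal (T - F 0)"
    by (rule nn_integral_FTC_atLeast[OF f(1) f(3) f(2) lim(1)])
  have "((\<lambda>x. - F (- x)) \<longlongrightarrow> - B) at_top"
    using lim(2) by (intro tendsto_minus) (simp add: filterlim_at_bot_mirror)
  then have 2: "(\<integral>\<^sup>+x. ennreal (f (- x)) * indicator {0..} x \<partial>lborel) = ennreal (- B - (- F (- 0)))"
    by (intro nn_integral_FTC_atLeast)
      (auto intro!: f(2) derivative_eq_intros DERIV_compose_FDERIV f(3)[THEN DERIV_chain2])
  have "(\<integral>\<^sup>+x. ennreal (f x) * indicator {..<0} x \<partial>lborel) =
      (\<integral>\<^sup>+x. ennreal (f (- x)) * indicator {..<0} (- x) \<partial>lborel)"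
    using nn_integral_real_affine[of "\<lambda>x. ennreal (f x) * indicator {..<0} x" "-1" 0] by simp
  also have "\<dots> = (\<integral>\<^sup>+x. ennreal (f (- x)) * indicator {0..} x \<partial>lborel)"
  proof (rule nn_integral_cong_AE)
    have "AE x::real in lborel. x \<noteq> 0" by (rule AE_lborel_singleton)
    then show "AE x in lborel. ennreal (f (- x)) * indicator {..<0} (- x) = ennreal (f (- x)) * indicator {0..} x"
      by eventually_elim (auto split: split_indicator)
  qed
  finally have 3: "(\<integral>\<^sup>+x. ennreal (f x) * indicator {..<0} x \<partial>lborel) = ennreal (F 0 - B)"
    using 2 by simp
  have "(\<integral>\<^sup>+x. ennreal (f x) \<partial>lborel) = (\<integral>\<^sup>+x. ennreal (f x) * indicator {0..} x + ennreal (f x) * indicator {..<0} x \<partial>lborel)"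
    by (intro nn_integral_cong) (auto split: split_indicator)
  also have "\<dots> = ennreal (T - F 0) + ennreal (F 0 - B)"
    by (subst nn_integral_add) (auto simp: 1 3)
  also have "\<dots> = ennreal (T - B)" using FT BF by (simp flip: ennreal_plus)
  finally show ?thesis .
qed

lemma nn_integral_inverse_power_3_2:
  fixes k :: real
  assumes k: "k > 0"
  shows "(\<integral>\<^sup>+x. ennreal (1 / ((k + x\<^sup>2) * sqrt (k + x\<^sup>2))) \<partial>lborel) = ennreal (2 / k)"
proof -
  have p: "k + x\<^sup>2 > 0" for x using k by (simp add: add_pos_nonneg)
  have "((\<lambda>x. x / (k * sqrt (k + x\<^sup>2))) has_real_derivative 1 / ((k + x\<^sup>2) * sqrt (k + x\<^sup>2))) (at x)" for x
  proof -
    define s where "s = sqrt (k + x\<^sup>2)"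
    have s: "s > 0" "s * s = k + x\<^sup>2" using p[of x] by (simp_all add: s_def)
    have "((\<lambda>x. x / (k * sqrt (k + x\<^sup>2))) has_real_derivative
       (1 * (k * s) - x * (k * (inverse s / 2 * (2 * x)))) / ((k * s) * (k * s))) (at x)"
      unfolding s_def using p[of x] k
      by (intro DERIV_divide DERIV_ident DERIV_cmult DERIV_chain2[where f = sqrt] DERIV_real_sqrt)
        (auto intro!: derivative_eq_intros)
    moreover have "(1 * (k * s) - x * (k * (inverse s / 2 * (2 * x)))) / ((k * s) * (k * s)) = (s * s - x\<^sup>2) / (k * (s * s) * s)"
      using s(1) k by (simp add: field_simps power2_eq_square)
    moreover have "\<dots> = 1 / ((k + x\<^sup>2) * s)" using k s p[of x] by (simp add: s(2))
    ultimately show ?thesis by (simp add: s_def)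
  qed
  moreover have "((\<lambda>x. x / (k * sqrt (k + x\<^sup>2))) \<longlongrightarrow> inverse k) at_top"
    using k by real_asymp
  moreover have "((\<lambda>x. x / (k * sqrt (k + x\<^sup>2))) \<longlongrightarrow> - inverse k) at_bot"
    using k by real_asymp
  ultimately have "(\<integral>\<^sup>+x. ennreal (1 / ((k + x\<^sup>2) * sqrt (k + x\<^sup>2))) \<partial>lborel) = ennreal (inverse k - - inverse k)"
    using p by (intro nn_integral_FTC_real_line) (auto intro!: mult_nonneg_nonneg simp: less_imp_le)
  then show ?thesis by (simp add: inverse_eq_divide)
qed

lemma nn_integral_inverse_quadratic_square:
  fixes a b c :: real
  assumes a: "a > 0" and D: "a * c - b\<^sup>2 > 0"
  shows "(\<integral>\<^sup>+x. ennreal (1 / (a * x\<^sup>2 - 2 * b * x + c)\<^sup>2) \<partial>lborel) =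
    ennreal (pi * a / (2 * ((a * c - b\<^sup>2) * sqrt (a * c - b\<^sup>2))))"
proof -
  define D where "D = a * c - b\<^sup>2"
  have D: "D > 0" using assms by (simp add: D_def)
  define r where "r = sqrt D"
  have r: "r > 0" "r * r = D" using D by (simp_all add: r_def)
  \<comment> \<open>With u = a x - b the polynomial becomes (u^2 + D) / a, and the bracket is the
    primitive of 1 / (u^2 + D)^2 with respect to u.\<close>
  define F where "F x = a * ((a * x - b) / (2 * D * ((a * x - b)\<^sup>2 + D)) + arctan ((a * x - b) / r) / (2 * D * r))" for x
  have "(F has_real_derivative 1 / (a * x\<^sup>2 - 2 * b * x + c)\<^sup>2) (at x)" for x
  proof -
    define u where "u = a * x - b"
    define w where "w = u\<^sup>2 + D"
    have w: "w > 0" using D by (simp add: w_def add_nonneg_pos)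
    have q: "a * x\<^sup>2 - 2 * b * x + c = w / a"
      using a by (simp add: w_def u_def D_def field_simps power2_eq_square)
    have i: "inverse (1 + (u / r)\<^sup>2) = D / w"
    proof -
      have "1 + (u / r)\<^sup>2 = w / D"
        using r D by (simp add: w_def power_divide power2_eq_square[of r] field_simps)
      then show ?thesis by simp
    qed
    define G where "G v = v / (2 * D * (v\<^sup>2 + D)) + arctan (v / r) / (2 * D * r)" for v
    have "(G has_real_derivative ((2 * D * w) - u * (2 * D * (2 * u))) / (2 * D * w * (2 * D * w))
       + (inverse (1 + (u / r)\<^sup>2) * (1 / r)) / (2 * D * r)) (at u)"
      unfolding G_def[abs_def] w_def using D r w[unfolded w_def]
      by (auto intro!: derivative_eq_intros simp: power2_eq_square mult_ac)
    moreover have "((2 * D * w) - u * (2 * D * (2 * u))) / (2 * D * w * (2 * D * w))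
       + (inverse (1 + (u / r)\<^sup>2) * (1 / r)) / (2 * D * r) = 1 / w\<^sup>2"
    proof -
      have "(inverse (1 + (u / r)\<^sup>2) * (1 / r)) / (2 * D * r) = D / (2 * D * w * (r * r))"
        unfolding i using r w by simp
      also have "\<dots> = w / (2 * D * w\<^sup>2)" using r D w by (simp add: power2_eq_square)
      finally have 1: "(inverse (1 + (u / r)\<^sup>2) * (1 / r)) / (2 * D * r) = w / (2 * D * w\<^sup>2)" .
      have "((2 * D * w) - u * (2 * D * (2 * u))) / (2 * D * w * (2 * D * w)) = (2 * D) * (w - 2 * u\<^sup>2) / ((2 * D) * (2 * D * w\<^sup>2))"
        by (simp add: power2_eq_square algebra_simps)
      also have "\<dots> = (w - 2 * u\<^sup>2) / (2 * D * w\<^sup>2)" using D by (intro mult_divide_mult_cancel_left) simp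
      finally have 2: "((2 * D * w) - u * (2 * D * (2 * u))) / (2 * D * w * (2 * D * w)) = (w - 2 * u\<^sup>2) / (2 * D * w\<^sup>2)" .
      have "(w - 2 * u\<^sup>2) / (2 * D * w\<^sup>2) + w / (2 * D * w\<^sup>2) = (2 * D) * 1 / ((2 * D) * w\<^sup>2)"
        unfolding add_divide_distrib[symmetric] by (simp add: w_def)
      then show ?thesis unfolding 1 2 using D by simp
    qed
    ultimately have G: "(G has_real_derivative 1 / w\<^sup>2) (at u)" by simp
    have "((\<lambda>x. a * x - b) has_real_derivative a) (at x)"
      by (auto intro!: derivative_eq_intros)
    from DERIV_cmult[OF DERIV_chain2[OF G[unfolded u_def] this], of a]
    have "(F has_real_derivative a * (1 / w\<^sup>2 * a)) (at x)"
      by (simp add: F_def[abs_def] G_def)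
    moreover have "a * (1 / w\<^sup>2 * a) = 1 / (w / a)\<^sup>2"
      using a by (simp add: power_divide power2_eq_square)
    ultimately show ?thesis by (simp add: q)
  qed
  moreover have "(F \<longlongrightarrow> a * (pi * (inverse D * inverse r)) / 4) at_top"
    unfolding F_def using a D r(1) by real_asymp
  moreover have "(F \<longlongrightarrow> - (a * (pi * (inverse D * inverse r)) / 4)) at_bot"
    unfolding F_def using a D r(1) by real_asymp
  moreover have "a * x\<^sup>2 - 2 * b * x + c \<noteq> 0" for x
  proof
    assume z: "a * x\<^sup>2 - 2 * b * x + c = 0"
    have "(a * x - b)\<^sup>2 + D = a * (a * x\<^sup>2 - 2 * b * x + c)" by (simp add: D_def power2_eq_square algebra_simps)
    then have "(a * x - b)\<^sup>2 + D = 0" using z by simp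
    then show False using D zero_le_power2[of "a * x - b"] by linarith
  qed
  ultimately have "(\<integral>\<^sup>+x. ennreal (1 / (a * x\<^sup>2 - 2 * b * x + c)\<^sup>2) \<partial>lborel)
     = ennreal (a * (pi * (inverse D * inverse r)) / 4 - - (a * (pi * (inverse D * inverse r)) / 4))"
    by (intro nn_integral_FTC_real_line) auto
  also have "a * (pi * (inverse D * inverse r)) / 4 - - (a * (pi * (inverse D * inverse r)) / 4) = pi * a / (2 * (D * r))"
    using D r by (simp add: field_simps)
  finally show ?thesis by (simp add: D_def r_def)
qed

lemma nn_integral_arctan: "(\<integral>\<^sup>+x. ennreal (1 / (1 + x\<^sup>2)) \<partial>lborel) = ennreal pi"
proof -
  have "(arctan has_real_derivative 1 / (1 + x\<^sup>2)) (at x)" for x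
    using DERIV_arctan[of x] by (simp add: inverse_eq_divide)
  moreover have "(arctan \<longlongrightarrow> pi / 2) at_top" "(arctan \<longlongrightarrow> - (pi / 2)) at_bot"
    by (rule tendsto_arctan_at_top tendsto_arctan_at_bot)+
  ultimately have "(\<integral>\<^sup>+x. ennreal (1 / (1 + x\<^sup>2)) \<partial>lborel) = ennreal (pi / 2 - - (pi / 2))"
    by (intro nn_integral_FTC_real_line) auto
  then show ?thesis by simp
qed

section \<open>Lebesgue measure on the space of 2x2 matrices and the volume of
  \<open>Gr\<close>\<close>

lemma Basis_M2: "(Basis :: M2 set) = {E11, E12, E21, E22}"
  by (auto simp: Basis_vec_def UNIV_2)

text \<open>Nested pairs, for iterated integration. The order of the coordinates is x11, x21, x12,
  x22.\<close>

definition M2_of :: "real \<times> real \<times> real \<times> real \<Rightarrow> M2" where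
  "M2_of p = vector [vector [fst p, fst (snd (snd p))], vector [fst (snd p), snd (snd (snd p))]]"

lemma M2_of_nth [simp]: "M2_of p $ 1 $ 1 = fst p" "M2_of p $ 2 $ 1 = fst (snd p)"
  "M2_of p $ 1 $ 2 = fst (snd (snd p))" "M2_of p $ 2 $ 2 = snd (snd (snd p))"
  by (simp_all add: M2_of_def)

lemma continuous_on_M2_of: "continuous_on S M2_of"
proof -
  have "linear M2_of" by (rule linearI) (auto intro!: mat2_eqI)
  then show ?thesis by (simp add: linear_continuous_on linear_conv_bounded_linear)
qed

lemma prod_Basis_M2: "(\<Prod>b\<in>Basis. f b) = f E11 * f E12 * f E21 * f E22" for f :: "M2 \<Rightarrow> real"
proof -
  have "E11 \<noteq> E12" "E11 \<noteq> E21" "E11 \<noteq> E22" "E12 \<noteq> E21" "E12 \<noteq> E22" "E21 \<noteq> E22"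
    by (simp_all add: axis_eq_axis)
  then show ?thesis unfolding Basis_M2 by (simp add: mult.assoc)
qed

lemma emeasure_lborel_Times:
  fixes A :: "'a::euclidean_space set" and B :: "'b::euclidean_space set"
  assumes "A \<in> sets borel" "B \<in> sets borel"
  shows "emeasure lborel (A \<times> B) = emeasure lborel A * emeasure lborel B"
  unfolding lborel_prod[symmetric] using assms by (intro lborel.emeasure_pair_measure_Times) auto

lemma lborel_M2: "(lborel :: M2 measure) = distr lborel borel M2_of"
proof (rule lborel_eqI)
  have [measurable]: "M2_of \<in> borel_measurable borel"
    by (rule borel_measurable_continuous_onI) (rule continuous_on_M2_of)
  fix l u :: M2
  assume le0: "\<And>b. b \<in> Basis \<Longrightarrow> l \<bullet> b \<le> u \<bullet> b"
  have le: "l$1$1 \<le> u$1$1" "l$1$2 \<le> u$1$2" "l$2$1 \<le> u$2$1" "l$2$2 \<le> u$2$2"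
    using le0[of E11] le0[of E12] le0[of E21] le0[of E22] by (simp_all add: Basis_M2 inner_axis)
  have "M2_of -` box l u = {l$1$1<..<u$1$1} \<times> {l$2$1<..<u$2$1} \<times> {l$1$2<..<u$1$2} \<times> {l$2$2<..<u$2$2}"
    unfolding box_def Basis_M2 by (auto simp: inner_axis)
  then have "emeasure (distr lborel borel M2_of) (box l u) =
     emeasure lborel ({l$1$1<..<u$1$1} \<times> {l$2$1<..<u$2$1} \<times> {l$1$2<..<u$1$2} \<times> {l$2$2<..<u$2$2})"
    by (simp add: emeasure_distr)
  also have "\<dots> = ennreal (u$1$1 - l$1$1) * (ennreal (u$2$1 - l$2$1) * (ennreal (u$1$2 - l$1$2) * ennreal (u$2$2 - l$2$2)))"
    using le by (simp add: emeasure_lborel_Times borel_open open_Times)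
  also have "\<dots> = ennreal (\<Prod>b\<in>Basis. (u - l) \<bullet> b)"
    using le by (simp add: prod_Basis_M2 inner_axis ennreal_mult[symmetric] mult_ac)
  finally show "emeasure (distr lborel borel M2_of) (box l u) = ennreal (\<Prod>b\<in>Basis. (u - l) \<bullet> b)" .
qed simp

lemma det_standard_gram:
  "det (euclidean_gram (mat 1) X) = (1 + (X$1$1)\<^sup>2) * (X$2$2)\<^sup>2 - 2 * (X$1$1 * X$2$1 * X$1$2) * X$2$2
     + ((1 + (X$1$1)\<^sup>2 + (X$2$1)\<^sup>2) + (1 + (X$2$1)\<^sup>2) * (X$1$2)\<^sup>2)"
proof -
  have "euclidean_gram (mat 1) X = transpose X ** X + mat 1"
    by (simp add: euclidean_gram_def std_frame_def transpose_stack_mult)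
  then show ?thesis
    by (simp add: det_2 matrix_matrix_mult_def transpose_def sum_2 mat_def power2_eq_square algebra_simps)
qed

lemma nn_integral_lborel_prod:
  fixes f :: "'a::euclidean_space \<times> 'b::euclidean_space \<Rightarrow> ennreal"
  assumes "f \<in> borel_measurable borel"
  shows "(\<integral>\<^sup>+p. f p \<partial>lborel) = (\<integral>\<^sup>+x. \<integral>\<^sup>+y. f (x, y) \<partial>lborel \<partial>lborel)"
  using lborel.nn_integral_fst[of f "lborel :: 'a measure"] assms by (simp add: lborel_prod)

text \<open>The Gram determinant is a quadratic polynomial in x22; integrating over this entry
  leaves a product in which x21 and x12 are separated. The last integral, over x11, is that of the
  derivative of the arctangent.\<close>

lemma nn_integral_volume:
  "(\<integral>\<^sup>+X. ennreal (1 / (det (euclidean_gram (mat 1) X))\<^sup>2) \<partial>lborel) = ennreal (2 * pi\<^sup>2)"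
proof -
  define q where "q x1 x2 y1 y2 = (1 + x1\<^sup>2) * y2\<^sup>2 - 2 * (x1 * x2 * y1) * y2 + ((1 + x1\<^sup>2 + x2\<^sup>2) + (1 + x2\<^sup>2) * y1\<^sup>2)" for x1 x2 y1 y2 :: real
  have det: "det (euclidean_gram (mat 1) (M2_of (x1, x2, y1, y2))) = q x1 x2 y1 y2" for x1 x2 y1 y2
    by (simp add: det_standard_gram q_def)
  have [measurable]: "M2_of \<in> borel_measurable borel"
    by (rule borel_measurable_continuous_onI) (rule continuous_on_M2_of)
  have "continuous_on UNIV (\<lambda>X. det (euclidean_gram (mat 1) X))"
    by (intro smooth_on_imp_continuous_on smooth_on_det2 smooth_on_euclidean_gram) auto
  then have [measurable]: "(\<lambda>X. det (euclidean_gram (mat 1) X)) \<in> borel_measurable borel"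
    by (rule borel_measurable_continuous_onI)
  let ?f = "\<lambda>p. ennreal (1 / (q (fst p) (fst (snd p)) (fst (snd (snd p))) (snd (snd (snd p))))\<^sup>2)"
  have fm [measurable]: "?f \<in> borel_measurable borel"
    unfolding q_def borel_prod[symmetric] by measurable
  have fm2: "(\<lambda>p. ?f (x, p)) \<in> borel_measurable borel" for x
    unfolding q_def borel_prod[symmetric] fst_conv snd_conv by measurable
  have fm3: "(\<lambda>p. ?f (x, y, p)) \<in> borel_measurable borel" for x y
    unfolding q_def borel_prod[symmetric] fst_conv snd_conv by measurable
  have "(\<integral>\<^sup>+X. ennreal (1 / (det (euclidean_gram (mat 1) X))\<^sup>2) \<partial>lborel)
     = (\<integral>\<^sup>+p. ennreal (1 / (det (euclidean_gram (mat 1) (M2_of p)))\<^sup>2) \<partial>lborel)"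
    by (subst lborel_M2) (simp add: nn_integral_distr)
  also have "\<dots> = (\<integral>\<^sup>+p. ?f p \<partial>lborel)"
    by (intro nn_integral_cong) (auto simp: det)
  also have "\<dots> = (\<integral>\<^sup>+x1. \<integral>\<^sup>+x2. \<integral>\<^sup>+y1. \<integral>\<^sup>+y2. ennreal (1 / (q x1 x2 y1 y2)\<^sup>2) \<partial>lborel \<partial>lborel \<partial>lborel \<partial>lborel)"
    unfolding nn_integral_lborel_prod[OF fm] nn_integral_lborel_prod[OF fm2] nn_integral_lborel_prod[OF fm3] by simp
  also have "\<dots> = (\<integral>\<^sup>+x1. \<integral>\<^sup>+x2. \<integral>\<^sup>+y1. ennreal (pi * (1 + x1\<^sup>2) / (2 * ((1 + x1\<^sup>2 + x2\<^sup>2) * sqrt (1 + x1\<^sup>2 + x2\<^sup>2))))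
       * ennreal (1 / ((1 + x1\<^sup>2 + y1\<^sup>2) * sqrt (1 + x1\<^sup>2 + y1\<^sup>2))) \<partial>lborel \<partial>lborel \<partial>lborel)"
  proof (intro nn_integral_cong)
    fix x1 x2 y1 :: real
    let ?s = "1 + x1\<^sup>2 + x2\<^sup>2" and ?k = "1 + x1\<^sup>2 + y1\<^sup>2"
    have p: "?s > 0" "?k > 0" "1 + x1\<^sup>2 > 0" by (simp_all add: add_pos_nonneg)
    \<comment> \<open>This factorisation of the discriminant is what separates the remaining
      variables.\<close>
    have D: "(1 + x1\<^sup>2) * (?s + (1 + x2\<^sup>2) * y1\<^sup>2) - (x1 * x2 * y1)\<^sup>2 = ?s * ?k"
      by (simp add: power2_eq_square algebra_simps)
    have Dp: "(1 + x1\<^sup>2) * (?s + (1 + x2\<^sup>2) * y1\<^sup>2) - (x1 * x2 * y1)\<^sup>2 > 0"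
      unfolding D using p by simp
    have "(\<integral>\<^sup>+y2. ennreal (1 / (q x1 x2 y1 y2)\<^sup>2) \<partial>lborel) = ennreal (pi * (1 + x1\<^sup>2) / (2 * ((?s * ?k) * sqrt (?s * ?k))))"
      unfolding q_def nn_integral_inverse_quadratic_square[OF p(3) Dp] D ..
    also have "pi * (1 + x1\<^sup>2) / (2 * ((?s * ?k) * sqrt (?s * ?k))) = pi * (1 + x1\<^sup>2) / (2 * (?s * sqrt ?s)) * (1 / (?k * sqrt ?k))"
      by (simp add: real_sqrt_mult mult_ac)
    also have "ennreal \<dots> = ennreal (pi * (1 + x1\<^sup>2) / (2 * (?s * sqrt ?s))) * ennreal (1 / (?k * sqrt ?k))"
      using p by (intro ennreal_mult) (auto intro!: divide_nonneg_pos mult_pos_pos)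
    finally show "(\<integral>\<^sup>+y2. ennreal (1 / (q x1 x2 y1 y2)\<^sup>2) \<partial>lborel) =
      ennreal (pi * (1 + x1\<^sup>2) / (2 * (?s * sqrt ?s))) * ennreal (1 / (?k * sqrt ?k))" .
  qed
  also have "\<dots> = (\<integral>\<^sup>+x1. \<integral>\<^sup>+x2. ennreal pi * ennreal (1 / ((1 + x1\<^sup>2 + x2\<^sup>2) * sqrt (1 + x1\<^sup>2 + x2\<^sup>2))) \<partial>lborel \<partial>lborel)"
  proof (intro nn_integral_cong)
    fix x1 x2 :: real
    let ?s = "1 + x1\<^sup>2 + x2\<^sup>2"
    have p: "?s > 0" "1 + x1\<^sup>2 > 0" by (simp_all add: add_pos_nonneg)
    have "(\<integral>\<^sup>+y1. ennreal (pi * (1 + x1\<^sup>2) / (2 * (?s * sqrt ?s))) * ennreal (1 / ((1 + x1\<^sup>2 + y1\<^sup>2) * sqrt (1 + x1\<^sup>2 + y1\<^sup>2))) \<partial>lborel)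
      = ennreal (pi * (1 + x1\<^sup>2) / (2 * (?s * sqrt ?s))) * ennreal (2 / (1 + x1\<^sup>2))"
      by (subst nn_integral_cmult) (simp_all add: nn_integral_inverse_power_3_2[OF p(2)])
    also have "\<dots> = ennreal (pi * (1 + x1\<^sup>2) / (2 * (?s * sqrt ?s)) * (2 / (1 + x1\<^sup>2)))"
      using p by (intro ennreal_mult[symmetric]) auto
    also have "pi * (1 + x1\<^sup>2) / (2 * (?s * sqrt ?s)) * (2 / (1 + x1\<^sup>2)) = pi * (1 / (?s * sqrt ?s))"
    proof -
      have "pi * k / (2 * S) * (2 / k) = pi * (1 / S)" if "k > 0" for k S :: real using that by simp
      from this[OF p(2)] show ?thesis .
    qed
    also have "\<dots> = ennreal pi * ennreal (1 / (?s * sqrt ?s))"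
      using p by (intro ennreal_mult) auto
    finally show "(\<integral>\<^sup>+y1. ennreal (pi * (1 + x1\<^sup>2) / (2 * (?s * sqrt ?s))) * ennreal (1 / ((1 + x1\<^sup>2 + y1\<^sup>2) * sqrt (1 + x1\<^sup>2 + y1\<^sup>2))) \<partial>lborel)
      = ennreal pi * ennreal (1 / (?s * sqrt ?s))" .
  qed
  also have "\<dots> = (\<integral>\<^sup>+x1. ennreal (2 * pi) * ennreal (1 / (1 + x1\<^sup>2)) \<partial>lborel)"
  proof (intro nn_integral_cong)
    fix x1 :: real
    have p: "1 + x1\<^sup>2 > 0" by (simp add: add_pos_nonneg)
    have "(\<integral>\<^sup>+x2. ennreal pi * ennreal (1 / ((1 + x1\<^sup>2 + x2\<^sup>2) * sqrt (1 + x1\<^sup>2 + x2\<^sup>2))) \<partial>lborel)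
       = ennreal pi * ennreal (2 / (1 + x1\<^sup>2))"
      by (subst nn_integral_cmult) (simp_all add: nn_integral_inverse_power_3_2[OF p])
    also have "\<dots> = ennreal (2 * pi) * ennreal (1 / (1 + x1\<^sup>2))"
      using p by (simp add: ennreal_mult[symmetric])
    finally show "(\<integral>\<^sup>+x2. ennreal pi * ennreal (1 / ((1 + x1\<^sup>2 + x2\<^sup>2) * sqrt (1 + x1\<^sup>2 + x2\<^sup>2))) \<partial>lborel)
       = ennreal (2 * pi) * ennreal (1 / (1 + x1\<^sup>2))" .
  qed
  also have "\<dots> = ennreal (2 * pi) * ennreal pi"
    by (subst nn_integral_cmult) (simp_all add: nn_integral_arctan)
  also have "\<dots> = ennreal (2 * pi\<^sup>2)"
    by (simp add: ennreal_mult[symmetric] power2_eq_square)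
  finally show ?thesis .
qed

section \<open>Change of coordinates in integrals over the Grassmannian\<close>

text \<open>The measure of \<open>S\<close> is the mean, over t in [0, 1], of the measures of its
  translates by multiples of \<open>v\<close>. After exchanging the integrals, the inner one runs
  along a line and vanishes.\<close>

lemma null_set_if_countable_on_lines:
  fixes S :: "'a::euclidean_space set"
  assumes S: "S \<in> sets borel" and c: "\<And>X. countable {t::real. X + t *\<^sub>R v \<in> S}"
  shows "emeasure lborel S = 0"
proof -
  let ?f = "\<lambda>p. indicator S (fst p + snd p *\<^sub>R v) * indicator {0..1} (snd p) :: ennreal"
  have [measurable]: "S \<in> sets borel" by (rule S)
  have fm: "?f \<in> borel_measurable (lborel \<Otimes>\<^sub>M (lborel :: real measure))" by measurable
  have "emeasure lborel S = (\<integral>\<^sup>+t. emeasure lborel S * indicator {0..1::real} t \<partial>lborel)"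
    by (subst nn_integral_cmult_indicator) auto
  also have "\<dots> = (\<integral>\<^sup>+t. \<integral>\<^sup>+X. ?f (X, t) \<partial>lborel \<partial>lborel)"
  proof (intro nn_integral_cong)
    fix t :: real
    have "(\<integral>\<^sup>+X. indicator S (X + t *\<^sub>R v) \<partial>lborel) = (\<integral>\<^sup>+X. indicator S X \<partial>distr lborel borel ((+) (t *\<^sub>R v)))"
      by (subst nn_integral_distr) (auto simp: add.commute)
    also have "\<dots> = emeasure lborel S" by (simp add: lborel_distr_plus)
    finally show "emeasure lborel S * indicator {0..1} t = (\<integral>\<^sup>+X. ?f (X, t) \<partial>lborel)"
      by (simp add: nn_integral_multc)
  qed
  also have "\<dots> = (\<integral>\<^sup>+X. \<integral>\<^sup>+t. ?f (X, t) \<partial>lborel \<partial>lborel)"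
    by (rule lborel_pair.Fubini[OF fm])
  also have "\<dots> = (\<integral>\<^sup>+(X::'a). 0 \<partial>lborel)"
  proof (intro nn_integral_cong)
    fix X
    have "AE t in lborel. t \<notin> {t::real. X + t *\<^sub>R v \<in> S}"
      by (rule AE_not_in) (rule countable_imp_null_set_lborel[OF c])
    then show "(\<integral>\<^sup>+t. ?f (X, t) \<partial>lborel) = 0"
      by (intro nn_integral_0_iff_AE[THEN iffD2]) (auto elim!: eventually_mono)
  qed
  finally show ?thesis by simp
qed

lemma finite_quadratic_roots:
  fixes a b c :: real
  assumes "a \<noteq> 0 \<or> b \<noteq> 0 \<or> c \<noteq> 0"
  shows "finite {t. a + b * t + c * t\<^sup>2 = 0}"
proof -
  have "[:a, b, c:] \<noteq> 0" using assms by auto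
  from poly_roots_finite[OF this] show ?thesis by (simp add: power2_eq_square algebra_simps)
qed

text \<open>Some \<open>2 \<times> 2\<close> minor of the last two rows of an invertible \<open>4 \<times> 4\<close> matrix does not vanish; it
  provides a direction along which \<open>det (chart_den g h X)\<close> is a nonzero polynomial.\<close>

lemma chart_dom_compl_null:
  assumes g: "det g = 1" and h: "det h = 1"
  shows "emeasure lborel (- chart_dom g h) = 0"
proof -
  define k where "k = matrix_inv h ** g"
  define c where "c = lower_block (k ** stack (mat 1) 0)"
  define e where "e = lower_block (k ** stack 0 (mat 1))"
  have den: "chart_den g h X = c ** X + e" for X
  proof -
    have "stack X (mat 1) = stack (mat 1) 0 ** X + stack 0 (mat 1)"
      by (simp add: stack_mult stack_add[symmetric])
    then show ?thesis
      by (simp add: chart_den_def k_def[symmetric] c_def e_def matrix_mult_algebra matrix_mul_assoc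
          linear_add[OF linear_blocks(2)] lower_block_mult)
  qed
  have ce: "c$1$1 = k$3$1" "c$1$2 = k$3$2" "c$2$1 = k$4$1" "c$2$2 = k$4$2"
    "e$1$1 = k$3$3" "e$1$2 = k$3$4" "e$2$1 = k$4$3" "e$2$2 = k$4$4"
    by (simp_all add: c_def e_def matrix_matrix_mult_def sum_4 mat_def)
  have dk: "det k \<noteq> 0" using g h by (simp add: k_def det_mul det_matrix_inv)
  \<comment> \<open>The polarisation of the determinant, that is the linear coefficient of
    \<open>det (A + t *\<^sub>R B)\<close> in t.\<close>
  define pol where "pol A B = A$1$1 * B$2$2 + B$1$1 * A$2$2 - A$1$2 * B$2$1 - B$1$2 * A$2$1" for A B :: M2
  have line: "det (chart_den g h (X + t *\<^sub>R V)) =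
     det (chart_den g h X) + (det c * pol X V + pol e (c ** V)) * t + (det c * det V) * t\<^sup>2" for X V t
    by (simp add: den det_2 pol_def matrix_matrix_mult_def sum_2 power2_eq_square algebra_simps)
  have closed: "- chart_dom g h \<in> sets borel"
    by (intro borel_closed closed_Compl open_chart_dom)
  have fin: "emeasure lborel (- chart_dom g h) = 0"
    if "\<And>X. det (chart_den g h X) \<noteq> 0 \<or> det c * pol X V + pol e (c ** V) \<noteq> 0 \<or> det c * det V \<noteq> 0" for V
  proof (rule null_set_if_countable_on_lines[OF closed, where v = V])
    fix X
    have "finite {t. det (chart_den g h (X + t *\<^sub>R V)) = 0}"
      unfolding line by (rule finite_quadratic_roots) (use that in blast)
    then show "countable {t. X + t *\<^sub>R V \<in> - chart_dom g h}"
      by (simp add: chart_dom_def countable_finite)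
  qed
  show ?thesis
  proof (cases "det c = 0")
    case False
    then show ?thesis by (intro fin[of "mat 1"]) simp
  next
    case True
    have dc: "k$3$1 * k$4$2 - k$3$2 * k$4$1 = 0" using True by (simp add: det_2 ce)
    show ?thesis
    proof (cases "\<exists>V. pol e (c ** V) \<noteq> 0")
      case True
      then obtain V where "pol e (c ** V) \<noteq> 0" by blast
      then show ?thesis using \<open>det c = 0\<close> by (intro fin[of V]) simp
    next
      case False
      then have z: "pol e (c ** V) = 0" for V by blast
      \<comment> \<open>Together with \<open>dc\<close> this says that all minors of the last two
        rows vanish except the one in columns 3 and 4. By Laplace expansion that one cannot vanish,
        and then \<open>det (chart_den g h X)\<close> is the nonzero constant
        \<open>det e\<close>.\<close>
      have m: "k$3$2 * k$4$4 - k$3$4 * k$4$2 = 0" "k$3$2 * k$4$3 - k$3$3 * k$4$2 = 0"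
        "k$3$1 * k$4$4 - k$3$4 * k$4$1 = 0" "k$3$1 * k$4$3 - k$3$3 * k$4$1 = 0"
        using z[of E11] z[of E12] z[of E21] z[of E22]
        by (simp_all add: pol_def matrix_matrix_mult_def sum_2 ce algebra_simps)
      have "k$3$3 * k$4$4 - k$3$4 * k$4$3 \<noteq> 0"
      proof
        assume z: "k$3$3 * k$4$4 - k$3$4 * k$4$3 = 0"
        have "det k = 0" unfolding det_4 by (simp only: z m dc mult_zero_right diff_zero add_0 diff_self)
        then show False using dk by simp
      qed
      then have "det e \<noteq> 0" by (simp add: det_2 ce)
      moreover have "det (chart_den g h X) = det e" for X
        using line[of 0 1 X] z[of X] \<open>det c = 0\<close> by (simp add: den matrix_mult_zero)
      ultimately show ?thesis by (intro fin[of 0]) simp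
    qed
  qed
qed

section \<open>Change of variables for functions of matrices, by transfer to \<real>^4, where
  Jacobians are determinants of matrices\<close>

definition M2_of4 :: "real^4 \<Rightarrow> M2" where
  "M2_of4 x = vector [vector [x$1, x$3], vector [x$2, x$4]]"

lemma M2_of4_nth [simp]: "M2_of4 x $ 1 $ 1 = x$1" "M2_of4 x $ 1 $ 2 = x$3" "M2_of4 x $ 2 $ 1 = x$2" "M2_of4 x $ 2 $ 2 = x$4"
  by (simp_all add: M2_of4_def)

lemma M2_of4_coords [simp]: "M2_of4 (coords V) = V" "coords (M2_of4 x) = x"
  by (simp_all add: mat2_eqI coords_def vec_eq_iff[of _ x] forall_4)

lemma linear_M2_of4: "linear M2_of4"
  by (rule linearI) (auto intro!: mat2_eqI)

lemma linear_coords: "linear coords"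
  by (rule linearI) (simp_all add: coords_def vec_eq_iff[of "vector _"] forall_4)

lemma bounded_linear_M2_of4: "bounded_linear M2_of4" and bounded_linear_coords: "bounded_linear coords"
  using linear_M2_of4 linear_coords by (simp_all add: linear_conv_bounded_linear)

lemma measurable_M2_of4 [measurable]: "M2_of4 \<in> borel_measurable borel"
  by (rule borel_measurable_continuous_onI) (rule linear_continuous_on[OF bounded_linear_M2_of4])

lemma Basis_real4: "(Basis :: (real^4) set) = {axis 1 1, axis 2 1, axis 3 1, axis 4 1}"
  by (auto simp: Basis_vec_def UNIV_4)

lemma lborel_M2_of4: "(lborel :: M2 measure) = distr lborel borel M2_of4"
proof (rule lborel_eqI)
  fix l u :: M2
  assume le0: "\<And>b. b \<in> Basis \<Longrightarrow> l \<bullet> b \<le> u \<bullet> b"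
  have le: "l$1$1 \<le> u$1$1" "l$1$2 \<le> u$1$2" "l$2$1 \<le> u$2$1" "l$2$2 \<le> u$2$2"
    using le0[of E11] le0[of E12] le0[of E21] le0[of E22] by (simp_all add: Basis_M2 inner_axis)
  have "M2_of4 -` box l u = box (coords l) (coords u)"
    unfolding box_def Basis_M2 Basis_real4 by (auto simp: inner_axis coords_def)
  then have "emeasure (distr lborel borel M2_of4) (box l u) = emeasure lborel (box (coords l) (coords u))"
    by (simp add: emeasure_distr)
  also have "\<dots> = ennreal (\<Prod>b\<in>Basis. (coords u - coords l) \<bullet> b)"
    by (rule emeasure_lborel_box) (use le in \<open>auto simp: Basis_real4 inner_axis coords_def\<close>)
  also have "(\<Prod>b\<in>Basis. (coords u - coords l) \<bullet> b) = (\<Prod>b\<in>Basis. (u - l) \<bullet> b)"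
    unfolding prod_Basis_M2 Basis_real4
    by (simp add: axis_eq_axis inner_axis coords_def mult_ac)
  finally show "emeasure (distr lborel borel M2_of4) (box l u) = ennreal (\<Prod>b\<in>Basis. (u - l) \<bullet> b)" .
qed simp

text \<open>The coordinates are ordered by columns. Thus left multiplication is block diagonal with
  two blocks \<open>P\<close>, and right multiplication is a Kronecker product with the identity;
  each contributes the square of a determinant.\<close>

lemma det_two_sided_mult: "det (matrix (\<lambda>x. coords (P ** M2_of4 x ** Q))) = (det P * det Q)\<^sup>2"
proof -
  have l: "matrix (\<lambda>x. coords (P ** M2_of4 x)) = hcat (stack P 0) (stack 0 P)"
    by (simp add: vec_eq_iff forall_4 matrix_def coords_def matrix_matrix_mult_def sum_2)
  have r: "matrix (\<lambda>x. coords (M2_of4 x ** Q)) =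
     hcat (stack (Q$1$1 *\<^sub>R mat 1) (Q$1$2 *\<^sub>R mat 1)) (stack (Q$2$1 *\<^sub>R mat 1) (Q$2$2 *\<^sub>R mat 1))"
    by (simp add: vec_eq_iff forall_4 matrix_def coords_def matrix_matrix_mult_def sum_2 mat_def)
  have lin: "linear (\<lambda>x. coords (P ** M2_of4 x))" "linear (\<lambda>x. coords (M2_of4 x ** Q))"
    by (auto intro!: linearI simp: linear_add[OF linear_M2_of4] linear_cmul[OF linear_M2_of4]
        linear_add[OF linear_coords] linear_cmul[OF linear_coords] matrix_mult_algebra)
  have "matrix ((\<lambda>x. coords (M2_of4 x ** Q)) \<circ> (\<lambda>x. coords (P ** M2_of4 x)))
    = matrix (\<lambda>x. coords (M2_of4 x ** Q)) ** matrix (\<lambda>x. coords (P ** M2_of4 x))"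
    by (rule matrix_compose[OF lin])
  then have "matrix (\<lambda>x. coords (P ** M2_of4 x ** Q))
    = matrix (\<lambda>x. coords (M2_of4 x ** Q)) ** matrix (\<lambda>x. coords (P ** M2_of4 x))"
    by (simp add: o_def)
  then have "det (matrix (\<lambda>x. coords (P ** M2_of4 x ** Q))) = det (matrix (\<lambda>x. coords (M2_of4 x ** Q))) * (det P * det P)"
    by (simp add: det_mul l det_block_triangular)
  also have "det (matrix (\<lambda>x. coords (M2_of4 x ** Q))) = (det Q)\<^sup>2"
    unfolding r by (simp add: det_4 det_2 mat_def power2_eq_square algebra_simps)
  finally show ?thesis by (simp add: power2_eq_square mult_ac)
qed

lemma bounded_linear_vec1: "bounded_linear (vec :: real \<Rightarrow> real^1)"
  by (simp add: linear_conv_bounded_linear[symmetric] linear_iff vec_eq_iff)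

text \<open>Because the functions are nonnegative and the sets omitted are null, one may pass freely
  between integrals over the whole space and over \<open>D\<close> or its image, and between the two
  notions of integral involved.\<close>

lemma M2_change_of_variables:
  fixes \<psi> :: "M2 \<Rightarrow> M2" and F F' :: "M2 \<Rightarrow> real"
  assumes D: "open D" "emeasure lborel (- D) = 0" "open (\<psi> ` D)" "emeasure lborel (- (\<psi> ` D)) = 0"
    and inj: "inj_on \<psi> D"
    and der: "\<And>X. X \<in> D \<Longrightarrow> (\<psi> has_derivative (\<lambda>V. P X ** V ** Q X)) (at X)"
    and F: "\<And>X. X \<in> D \<Longrightarrow> F X = (det (P X) * det (Q X))\<^sup>2 * F' (\<psi> X)"
    and m: "F \<in> borel_measurable borel" "F' \<in> borel_measurable borel" and nonneg: "\<And>X. 0 \<le> F X" "\<And>X. 0 \<le> F' X"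
    and I: "(\<integral>\<^sup>+X. ennreal (F X) \<partial>lborel) = ennreal I" "0 \<le> I"
  shows "(\<integral>\<^sup>+X. ennreal (F' X) \<partial>lborel) = ennreal I"
proof -
  note [measurable] = m
  let ?S = "M2_of4 -` D" and ?S' = "M2_of4 -` (\<psi> ` D)"
  have null: "negligible (- (M2_of4 -` A))" if "open A" "emeasure lborel (- A) = 0" for A
  proof -
    have [measurable]: "A \<in> sets borel" using that by auto
    have "emeasure lborel (M2_of4 -` (- A)) = 0"
      using that(2) by (subst (asm) lborel_M2_of4) (simp add: emeasure_distr)
    moreover have "M2_of4 -` (- A) \<in> sets borel" using measurable_sets_borel[OF measurable_M2_of4, of "- A"] by simp
    ultimately have "M2_of4 -` (- A) \<in> null_sets lebesgue"
      by (intro null_sets_completionI) (auto simp: null_sets_def)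
    then show ?thesis by (simp add: negligible_iff_null_sets vimage_Compl)
  qed
  have tr: "(\<integral>\<^sup>+X. ennreal (f X) \<partial>lborel) = (\<integral>\<^sup>+x. ennreal (f (M2_of4 x)) \<partial>lborel)"
    if "f \<in> borel_measurable borel" for f
    using that by (subst lborel_M2_of4) (simp add: nn_integral_distr)
  have Fi: "((\<lambda>x. F (M2_of4 x)) has_integral I) UNIV"
  proof -
    have i: "integrable lborel (\<lambda>x. F (M2_of4 x))"
      by (rule integrableI_nn_integral_finite[where x = I]) (use I nonneg tr[OF m(1)] in auto)
    have "ennreal (integral\<^sup>L lborel (\<lambda>x. F (M2_of4 x))) = ennreal I"
      using nn_integral_eq_integral[OF i] nonneg tr[OF m(1)] I by simp
    then have "integral\<^sup>L lborel (\<lambda>x. F (M2_of4 x)) = I"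
      using I(2) nonneg by (simp add: integral_nonneg)
    then show ?thesis using has_integral_integral_lborel[OF i] by simp
  qed
  then have FS: "((\<lambda>x. F (M2_of4 x)) has_integral I) ?S"
    by (rule has_integral_spike_set_eq[THEN iffD1, rotated 2]; intro negligible_subset[OF null[OF D(1,2)]]) auto
  define g where "g x = coords (\<psi> (M2_of4 x))" for x
  define g' where "g' x = (\<lambda>y. coords (P (M2_of4 x) ** M2_of4 y ** Q (M2_of4 x)))" for x
  \<comment> \<open>Values in \<open>real^1\<close>, because the change of variables theorem takes
    vector-valued integrands.\<close>
  define f :: "real^4 \<Rightarrow> real^1" where "f x = vec (F' (M2_of4 x))" for x
  have S_leb: "?S \<in> sets lebesgue"
    using measurable_sets_borel[OF measurable_M2_of4, of D] D(1) by (auto intro: sets_completionI_sets)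
  have dg: "(g has_derivative g' x) (at x within ?S)" if "x \<in> ?S" for x
  proof -
    have "(M2_of4 has_derivative M2_of4) (at x)" by (rule bounded_linear_imp_has_derivative[OF bounded_linear_M2_of4])
    from diff_chain_at[OF this der] that
    have "((\<lambda>x. \<psi> (M2_of4 x)) has_derivative (\<lambda>y. P (M2_of4 x) ** M2_of4 y ** Q (M2_of4 x))) (at x)"
      by (simp add: o_def)
    from bounded_linear.has_derivative[OF bounded_linear_coords this]
    show ?thesis unfolding g_def[abs_def] g'_def by (rule has_derivative_at_withinI)
  qed
  have ig: "inj_on g ?S"
  proof (rule inj_onI)
    fix x y assume xy: "x \<in> ?S" "y \<in> ?S" "g x = g y"
    then have "\<psi> (M2_of4 x) = \<psi> (M2_of4 y)" unfolding g_def by (metis M2_of4_coords(1))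
    then have "M2_of4 x = M2_of4 y" using inj xy(1,2) by (auto dest: inj_onD)
    then show "x = y" by (metis M2_of4_coords(2))
  qed
  have im: "g ` ?S = ?S'"
  proof
    show "?S' \<subseteq> g ` ?S"
    proof
      fix y assume "y \<in> ?S'"
      then obtain X where X: "X \<in> D" "M2_of4 y = \<psi> X" by auto
      have "g (coords X) = y" by (simp add: g_def X(2)[symmetric])
      then show "y \<in> g ` ?S" using X(1) by (intro image_eqI[of _ _ "coords X"]) auto
    qed
  qed (auto simp: g_def)
  have e: "\<bar>det (matrix (g' x))\<bar> *\<^sub>R f (g x) = vec (F (M2_of4 x))" if "x \<in> ?S" for x
    using that F by (simp add: g'_def det_two_sided_mult f_def g_def vec_eq_iff)
  have "((\<lambda>x. \<bar>det (matrix (g' x))\<bar> *\<^sub>R f (g x)) has_integral vec I) ?S"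
    using has_integral_linear[OF FS bounded_linear_vec1]
    by (rule has_integral_eq[rotated]) (simp add: e o_def)
  then have L: "(\<lambda>x. \<bar>det (matrix (g' x))\<bar> *\<^sub>R f (g x)) absolutely_integrable_on ?S \<and>
      integral ?S (\<lambda>x. \<bar>det (matrix (g' x))\<bar> *\<^sub>R f (g x)) = vec I"
    by (auto intro!: nonnegative_absolutely_integrable simp: integral_unique has_integral_integrable
        Basis_vec_def inner_axis f_def nonneg intro!: mult_nonneg_nonneg)
  have "f absolutely_integrable_on ?S' \<and> integral ?S' f = vec I"
    using has_absolute_integral_change_of_variables[OF S_leb dg ig, of f "vec I"] L im by simp
  then have "(f has_integral vec I) ?S'"
    by (metis absolutely_integrable_on_def integrable_integral)
  from has_integral_linear[OF this bounded_linear_vec_nth[of 1]]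
  have "((\<lambda>x. F' (M2_of4 x)) has_integral I) ?S'" by (simp add: o_def f_def)
  then have "((\<lambda>x. F' (M2_of4 x)) has_integral I) UNIV"
    by (rule has_integral_spike_set_eq[THEN iffD1, rotated 2]; intro negligible_subset[OF null[OF D(3,4)]]) auto
  from nn_integral_has_integral_lborel[OF _ _ this] nonneg
  show ?thesis using tr[OF m(2)] by simp
qed

lemma chart_change_image:
  assumes "det g \<noteq> 0" "det h \<noteq> 0"
  shows "chart_change g h ` chart_dom g h = chart_dom h g"
proof
  show "chart_change g h ` chart_dom g h \<subseteq> chart_dom h g"
    using chart_den_inverse(3)[OF assms] by (auto simp: chart_dom_def)
  show "chart_dom h g \<subseteq> chart_change g h ` chart_dom g h"
  proof
    fix Y assume Y: "Y \<in> chart_dom h g"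
    then show "Y \<in> chart_change g h ` chart_dom g h"
      using chart_den_inverse(2,3)[OF assms(2,1), of Y]
      by (intro image_eqI[of _ _ "chart_change h g Y"]) (auto simp: chart_dom_def)
  qed
qed

lemma inj_on_chart_change:
  assumes "det g \<noteq> 0" "det h \<noteq> 0"
  shows "inj_on (chart_change g h) (chart_dom g h)"
  using chart_den_inverse(2)[OF assms] by (intro inj_on_inverseI[of _ "chart_change h g"]) (auto simp: chart_dom_def)

text \<open>Both determinants are 1 at the centre of an orthogonal chart, and in passing to
  \<open>g\<close> they change by the squares of the determinants of \<open>chart_lin\<close> and
  \<open>chart_den\<close>, which are inverse to each other.\<close>

lemma det_comp_gram:
  assumes g: "det g = 1"
  shows "det (comp_gram g X) * det (euclidean_gram g X) = 1"
proof -
  obtain \<kappa> where \<kappa>: "transpose \<kappa> ** \<kappa> = mat 1" "det \<kappa> = 1" "Psi \<kappa> 0 = Psi g X"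
    using orthogonal_chart_exists[OF g] .
  have n: "det \<kappa> \<noteq> 0" "det g \<noteq> 0" using g \<kappa> by auto
  have d: "det (chart_den \<kappa> g 0) \<noteq> 0" and c: "chart_change \<kappa> g 0 = X"
    using \<kappa>(3) Psi_eq_iff[OF n] by auto
  let ?l = "det (chart_lin \<kappa> g 0)" and ?d = "det (chart_den \<kappa> g 0)"
  have 1: "?l * ?d = 1" by (rule det_chart_lin[OF \<kappa>(2) g d])
  have 2: "?l * det (comp_gram g X) * ?l = 1"
    using arg_cong[OF comp_gram_change[OF n(2) d], of det] orthogonal_chart_centre(2)[OF \<kappa>(1)]
    by (simp add: c det_mul det_transpose)
  have 3: "?d * det (euclidean_gram g X) * ?d = 1"
    using arg_cong[OF gram_change[OF n(2) d], of det] orthogonal_chart_centre(1)[OF \<kappa>(1)]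
    by (simp add: c det_mul det_transpose)
  have "(?l * det (comp_gram g X) * ?l) * (?d * det (euclidean_gram g X) * ?d)
     = (?l * ?d) * (?l * ?d) * (det (comp_gram g X) * det (euclidean_gram g X))"
    by (simp add: mult_ac)
  then show ?thesis by (simp add: 1 2 3)
qed

text \<open>The Jacobian of a coordinate change is the inverse fourth power of the determinant of
  \<open>chart_den\<close>, which is how the inverse square of the Gram determinant transforms. This
  density is the volume invariant under the isometries of \<open>transpose a ** a\<close>.\<close>

lemma integral_chart_independent:
  fixes \<phi> :: "(real^4) set \<Rightarrow> real"
  assumes g: "det g = 1" and k: "det k = 1" and a: "det a = 1"
    and c: "continuous_on UNIV (\<lambda>X. \<phi> (Psi g X))" "continuous_on UNIV (\<lambda>X. \<phi> (Psi k X))"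
    and nonneg: "\<And>p. p \<in> Gr \<Longrightarrow> 0 \<le> \<phi> p"
    and I: "(\<integral>\<^sup>+X. ennreal (\<phi> (Psi g X) / (det (euclidean_gram (a ** g) X))\<^sup>2) \<partial>lborel) = ennreal I" "0 \<le> I"
  shows "(\<integral>\<^sup>+X. ennreal (\<phi> (Psi k X) / (det (euclidean_gram (a ** k) X))\<^sup>2) \<partial>lborel) = ennreal I"
proof (rule M2_change_of_variables[OF open_chart_dom chart_dom_compl_null[OF g k], where
      \<psi> = "chart_change g k" and P = "chart_lin g k" and Q = "\<lambda>X. matrix_inv (chart_den g k X)" and
      F = "\<lambda>X. \<phi> (Psi g X) / (det (euclidean_gram (a ** g) X))\<^sup>2"])
  have n: "det g \<noteq> 0" "det k \<noteq> 0" "det a \<noteq> 0" "det (a ** g) \<noteq> 0" "det (a ** k) \<noteq> 0"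
    using g k a by (simp_all add: det_mul)
  show "open (chart_change g k ` chart_dom g k)" "emeasure lborel (- chart_change g k ` chart_dom g k) = 0"
    unfolding chart_change_image[OF n(1,2)] by (rule open_chart_dom, rule chart_dom_compl_null[OF k g])
  show "inj_on (chart_change g k) (chart_dom g k)" by (rule inj_on_chart_change[OF n(1,2)])
  show "(chart_change g k has_derivative (\<lambda>V. chart_lin g k X ** V ** matrix_inv (chart_den g k X))) (at X)"
    if "X \<in> chart_dom g k" for X
    using that by (intro has_derivative_chart_change) (simp add: chart_dom_def)
  show "\<phi> (Psi g X) / (det (euclidean_gram (a ** g) X))\<^sup>2 =
     (det (chart_lin g k X) * det (matrix_inv (chart_den g k X)))\<^sup>2 *
       (\<phi> (Psi k (chart_change g k X)) / (det (euclidean_gram (a ** k) (chart_change g k X)))\<^sup>2)"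
    if "X \<in> chart_dom g k" for X
  proof -
    have d: "det (chart_den g k X) \<noteq> 0" using that by (simp add: chart_dom_def)
    let ?d = "det (chart_den g k X)"
    have l: "det (chart_lin g k X) = 1 / ?d"
      using det_chart_lin[OF g k d] d by (simp add: field_simps)
    have N: "det (euclidean_gram (a ** g) X) = ?d\<^sup>2 * det (euclidean_gram (a ** k) (chart_change g k X))"
      using gram_change[OF n(5), of "a ** g" X] d
      by (simp add: chart_translate[OF n(3,2)] det_mul det_transpose power2_eq_square)
    show ?thesis
      unfolding l N det_matrix_inv[OF d] Psi_chart_change[OF n(1,2) d]
      using d by (simp add: power2_eq_square)
  qed
  have cN: "continuous_on UNIV (\<lambda>X. det (euclidean_gram b X))" for b
    by (intro smooth_on_imp_continuous_on smooth_on_det2 smooth_on_euclidean_gram) auto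
  show "(\<lambda>X. \<phi> (Psi g X) / (det (euclidean_gram (a ** g) X))\<^sup>2) \<in> borel_measurable borel"
    "(\<lambda>X. \<phi> (Psi k X) / (det (euclidean_gram (a ** k) X))\<^sup>2) \<in> borel_measurable borel"
    using n by (auto intro!: borel_measurable_continuous_onI continuous_intros c cN simp: det_euclidean_gram_nz)
  show "0 \<le> \<phi> (Psi g X) / (det (euclidean_gram (a ** g) X))\<^sup>2"
    "0 \<le> \<phi> (Psi k X) / (det (euclidean_gram (a ** k) X))\<^sup>2" for X
    using nonneg Psi_in_Gr[OF n(1)] Psi_in_Gr[OF n(2)] by auto
qed (use I in auto)

lemma det2_scaleR: "det (c *\<^sub>R A) = c\<^sup>2 * det A" for A :: M2
  by (simp add: det_2 power2_eq_square algebra_simps)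

section \<open>The charge determines the curvature\<close>

context invariant_asdym_solution
begin

text \<open>On each patch the trace of the wedge square is 4 t^2 times the invariant density,
  because the determinants of \<open>comp_gram\<close> and of the Gram matrix are inverse. All patch
  integrals are moved to a single chart, where the partition of unity sums to 1 and the total volume
  is 2 \<pi>^2; thus the charge is - t^2.\<close>

lemma charge_curvature:
  assumes charge: "has_topological_charge E (-1)"
    and t: "\<And>i X. i \<in> patches E \<Longrightarrow> X \<in> patch_dom E i \<Longrightarrow> eq_up_to_sign (curvature_matrix E i X)
      ((t / sqrt (det (euclidean_gram (h ** chart E i) X))) *\<^sub>R comp_gram (h ** chart E i) X)"
  shows "t\<^sup>2 = 1"
proof -
  obtain J \<rho> where pu: "partition_of_unity E J \<rho>" and
    ch: "-1 = - (1 / (8 * pi\<^sup>2)) * (\<Sum>i\<in>J. integral (patch_dom E i)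
           (\<lambda>X. \<rho> i (Psi (chart E i) X) * trace_wedge_square (curvature (pot E i) X)))"
    using charge unfolding has_topological_charge_def by blast
  have J: "finite J" "J \<subseteq> patches E"
    and \<rho>: "\<And>i g. i \<in> J \<Longrightarrow> g \<in> carrier SL4 \<Longrightarrow> smooth_on UNIV (\<lambda>X. \<rho> i (Psi g X))"
      "\<And>i p. i \<in> J \<Longrightarrow> p \<in> Gr \<Longrightarrow> \<rho> i p \<ge> 0"
      "\<And>i. i \<in> J \<Longrightarrow> \<exists>S. compact S \<and> S \<subseteq> patch_dom E i \<and> (\<forall>p\<in>Gr. \<rho> i p \<noteq> 0 \<longrightarrow> p \<in> Psi (chart E i) ` S)"
    and sum1: "\<And>p. p \<in> Gr \<Longrightarrow> (\<Sum>i\<in>J. \<rho> i p) = 1"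
    using pu unfolding partition_of_unity_def by auto
  define F where "F i g X = \<rho> i (Psi g X) / (det (euclidean_gram (h ** g) X))\<^sup>2" for i g X
  have cN: "continuous_on UNIV (\<lambda>X. det (euclidean_gram b X))" for b
    by (intro smooth_on_imp_continuous_on smooth_on_det2 smooth_on_euclidean_gram) auto
  have cF: "continuous_on UNIV (F i g)" if "i \<in> J" "det g = 1" for i g
  proof -
    have "det (h ** g) \<noteq> 0" using that det_h by (simp add: det_mul)
    then show ?thesis unfolding F_def
      using that by (intro continuous_intros cN smooth_on_imp_continuous_on \<rho>(1)) (auto simp: det_euclidean_gram_nz carrier_SL4)
  qed
  have F0: "0 \<le> F i g X" if "i \<in> J" "det g = 1" for i g X
    using \<rho>(2)[OF that(1) Psi_in_Gr] that(2) by (simp add: F_def)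
  \<comment> \<open>In this chart \<open>h ** k\<close> is the identity, so the density is the
    standard one.\<close>
  define k where "k = matrix_inv h"
  have k: "det k = 1" "h ** k = mat 1" using det_h by (simp_all add: k_def det_matrix_inv matrix_inv_props)
  have "\<exists>I\<ge>0. integral (patch_dom E i) (\<lambda>X. \<rho> i (Psi (chart E i) X) * trace_wedge_square (curvature (pot E i) X)) = 4 * t\<^sup>2 * I
     \<and> (\<integral>\<^sup>+X. ennreal (F i k X) \<partial>lborel) = ennreal I" if i: "i \<in> J" for i
  proof -
    let ?g = "chart E i"
    have ip: "i \<in> patches E" using i J by blast
    have g: "det ?g = 1" by (rule det_chart[OF ip])
    have gn: "det ?g \<noteq> 0" using g by simp
    have hg: "det (h ** ?g) = 1" using g det_h by (simp add: det_mul)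
    obtain S where S: "compact S" "S \<subseteq> patch_dom E i" "\<And>p. p \<in> Gr \<Longrightarrow> \<rho> i p \<noteq> 0 \<Longrightarrow> p \<in> Psi ?g ` S"
      using \<rho>(3)[OF i] by blast
    have supp: "X \<in> S" if "F i ?g X \<noteq> 0" for X
      using S(3)[OF Psi_in_Gr[OF gn, of X]] that Psi_inj[OF gn] by (auto simp: F_def)
    have tws: "trace_wedge_square (curvature (pot E i) X) = 4 * t\<^sup>2 / (det (euclidean_gram (h ** ?g) X))\<^sup>2"
      if X: "X \<in> patch_dom E i" for X
    proof -
      let ?N = "det (euclidean_gram (h ** ?g) X)" and ?C = "comp_gram (h ** ?g) X"
      have N: "?N > 0" using det_euclidean_gram hg by simp
      have "curvature (pot E i) X = (\<lambda>V W. asd_form (curvature_matrix E i X) V W *\<^sub>R jmat (gram E i X))"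
        by (intro ext curvature_matrix(2)[OF ip X])
      then have "trace_wedge_square (curvature (pot E i) X) = 4 * det (curvature_matrix E i X)"
        using trace_wedge_square_asd[OF curvature_matrix(1)[OF ip X] jmat_gram(1)[OF ip X]] by simp
      also have "det (curvature_matrix E i X) = det ((t / sqrt ?N) *\<^sub>R ?C)"
        using t[OF ip X] unfolding eq_up_to_sign_def by (auto simp: det_2)
      also have "\<dots> = (t / sqrt ?N)\<^sup>2 * det ?C" by (rule det2_scaleR)
      also have "\<dots> = t\<^sup>2 / ?N * (1 / ?N)"
        using det_comp_gram[OF hg, of X] N by (simp add: power_divide field_simps)
      finally show ?thesis by (simp add: power2_eq_square)
    qed
    have int: "integrable lborel (F i ?g)"
    proof -
      have "integrable lborel (\<lambda>X. indicator S X *\<^sub>R F i ?g X)"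
        by (rule borel_integrable_compact[OF S(1)]) (rule continuous_on_subset[OF cF[OF i g]], simp)
      moreover have "(\<lambda>X. indicator S X *\<^sub>R F i ?g X) = F i ?g"
        using supp by (auto simp: fun_eq_iff indicator_def)
      ultimately show ?thesis by simp
    qed
    define I where "I = integral\<^sup>L lborel (F i ?g)"
    have I0: "0 \<le> I" unfolding I_def using F0[OF i g] by (intro Bochner_Integration.integral_nonneg) auto
    have nn: "(\<integral>\<^sup>+X. ennreal (F i ?g X) \<partial>lborel) = ennreal I"
      unfolding I_def using F0[OF i g] by (intro nn_integral_eq_integral[OF int]) auto
    have "integral (patch_dom E i) (\<lambda>X. \<rho> i (Psi ?g X) * trace_wedge_square (curvature (pot E i) X))
       = integral (patch_dom E i) (\<lambda>X. 4 * t\<^sup>2 * F i ?g X)"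
      by (intro integral_cong) (simp add: tws F_def)
    also have "\<dots> = 4 * t\<^sup>2 * integral (patch_dom E i) (F i ?g)" by simp
    also have "integral (patch_dom E i) (F i ?g) = integral UNIV (\<lambda>X. if X \<in> patch_dom E i then F i ?g X else 0)"
      by (rule integral_restrict_UNIV[symmetric])
    also have "(\<lambda>X. if X \<in> patch_dom E i then F i ?g X else 0) = F i ?g"
      using supp S(2) by (auto simp: fun_eq_iff)
    also have "integral UNIV (F i ?g) = I" unfolding I_def by (rule integral_lborel[OF int])
    finally have 1: "integral (patch_dom E i) (\<lambda>X. \<rho> i (Psi ?g X) * trace_wedge_square (curvature (pot E i) X)) = 4 * t\<^sup>2 * I" .
    have "(\<integral>\<^sup>+X. ennreal (F i k X) \<partial>lborel) = ennreal I"
      using nn I0 unfolding F_def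
      by (intro integral_chart_independent[OF g k(1) det_h _ _ \<rho>(2)[OF i]] smooth_on_imp_continuous_on \<rho>(1)[OF i])
        (auto simp: carrier_SL4 g k)
    with 1 I0 show ?thesis by blast
  qed
  then have "\<forall>i\<in>J. \<exists>I. 0 \<le> I \<and>
      integral (patch_dom E i) (\<lambda>X. \<rho> i (Psi (chart E i) X) * trace_wedge_square (curvature (pot E i) X)) = 4 * t\<^sup>2 * I \<and>
      (\<integral>\<^sup>+X. ennreal (F i k X) \<partial>lborel) = ennreal I" by (intro ballI)
  from bchoice[OF this] obtain I where I': "\<forall>i\<in>J. 0 \<le> I i \<and>
      integral (patch_dom E i) (\<lambda>X. \<rho> i (Psi (chart E i) X) * trace_wedge_square (curvature (pot E i) X)) = 4 * t\<^sup>2 * I i \<and>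
      (\<integral>\<^sup>+X. ennreal (F i k X) \<partial>lborel) = ennreal (I i)" by (rule exE)
  have I: "\<And>i. i \<in> J \<Longrightarrow> I i \<ge> 0"
    "\<And>i. i \<in> J \<Longrightarrow> integral (patch_dom E i) (\<lambda>X. \<rho> i (Psi (chart E i) X) * trace_wedge_square (curvature (pot E i) X)) = 4 * t\<^sup>2 * I i"
    "\<And>i. i \<in> J \<Longrightarrow> (\<integral>\<^sup>+X. ennreal (F i k X) \<partial>lborel) = ennreal (I i)"
    by (rule conjunct1[OF bspec[OF I']], assumption, rule conjunct1[OF conjunct2[OF bspec[OF I']]], assumption,
        rule conjunct2[OF conjunct2[OF bspec[OF I']]], assumption)
  have "ennreal (\<Sum>i\<in>J. I i) = (\<Sum>i\<in>J. \<integral>\<^sup>+X. ennreal (F i k X) \<partial>lborel)"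
    using I by (simp add: sum_ennreal)
  also have "\<dots> = (\<integral>\<^sup>+X. (\<Sum>i\<in>J. ennreal (F i k X)) \<partial>lborel)"
    using cF[OF _ k(1)] by (intro nn_integral_sum[symmetric]) (auto intro!: borel_measurable_continuous_onI continuous_on_ennreal)
  also have "\<dots> = (\<integral>\<^sup>+X. ennreal (1 / (det (euclidean_gram (mat 1) X))\<^sup>2) \<partial>lborel)"
  proof (intro nn_integral_cong)
    fix X
    have "(\<Sum>i\<in>J. ennreal (F i k X)) = ennreal (\<Sum>i\<in>J. F i k X)"
      using F0[OF _ k(1)] by (intro sum_ennreal) auto
    also have "(\<Sum>i\<in>J. F i k X) = 1 / (det (euclidean_gram (mat 1) X))\<^sup>2"
      using sum1[OF Psi_in_Gr, of k X] k by (simp add: F_def sum_divide_distrib[symmetric])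
    finally show "(\<Sum>i\<in>J. ennreal (F i k X)) = ennreal (1 / (det (euclidean_gram (mat 1) X))\<^sup>2)" .
  qed
  also have "\<dots> = ennreal (2 * pi\<^sup>2)" by (rule nn_integral_volume)
  finally have "(\<Sum>i\<in>J. I i) = 2 * pi\<^sup>2" using I(1) by (simp add: sum_nonneg)
  moreover have "(\<Sum>i\<in>J. integral (patch_dom E i)
           (\<lambda>X. \<rho> i (Psi (chart E i) X) * trace_wedge_square (curvature (pot E i) X))) = 4 * t\<^sup>2 * (\<Sum>i\<in>J. I i)"
    using I(2) by (simp add: sum_distrib_left)
  ultimately have "-1 = - (1 / (8 * pi\<^sup>2)) * (4 * t\<^sup>2 * (2 * pi\<^sup>2))" using ch by simp
  then show ?thesis by simp
qed

end

section \<open>Intertwiners of connections\<close>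

text \<open>The gauge equation at one point, free of inverses. \<open>A\<close> and \<open>B\<close>
  are functions of the tangent vector only, so that pulled-back potentials can be inserted.\<close>

definition intertwines :: "(M2 \<Rightarrow> M2) \<Rightarrow> (M2 \<Rightarrow> M2) \<Rightarrow> (M2 \<Rightarrow> M2) \<Rightarrow> M2 \<Rightarrow> bool" where
  "intertwines u A B X \<longleftrightarrow> u differentiable (at X) \<and>
     (\<forall>V. u X ** A V = B V ** u X + frechet_derivative u (at X) V)"

lemma intertwinesI:
  assumes "(u has_derivative u') (at X)" "\<And>V. u X ** A V = B V ** u X + u' V"
  shows "intertwines u A B X"
  using assms frechet_derivative_eqI[OF assms(1)] by (auto simp: intertwines_def differentiable_def)

lemma intertwinesD:
  assumes "intertwines u A B X"
  shows "(u has_derivative frechet_derivative u (at X)) (at X)"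
    "u X ** A V = B V ** u X + frechet_derivative u (at X) V"
  using assms by (auto simp: intertwines_def differentiable_has_frechet)

lemma intertwines_comp:
  assumes "intertwines u A B X" "intertwines v B C X"
  shows "intertwines (\<lambda>X. v X ** u X) A C X"
proof (rule intertwinesI[OF has_derivative_matrix_mult[OF intertwinesD(1)[OF assms(2)] intertwinesD(1)[OF assms(1)]]])
  fix V
  have "v X ** u X ** A V = v X ** (u X ** A V)" by (simp add: matrix_mul_assoc)
  also have "\<dots> = (v X ** B V) ** u X + v X ** frechet_derivative u (at X) V"
    unfolding intertwinesD(2)[OF assms(1)] by (simp add: matrix_mult_algebra matrix_mul_assoc)
  finally show "v X ** u X ** A V = C V ** (v X ** u X) +
      (v X ** frechet_derivative u (at X) V + frechet_derivative v (at X) V ** u X)"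
    unfolding intertwinesD(2)[OF assms(2)] by (simp add: matrix_mult_algebra matrix_mul_assoc)
qed

text \<open>This gives the equation for a quotient of two intertwiners without computing the
  derivative of an inverse; only differentiability of \<open>u\<close> has to be supplied.\<close>

lemma intertwines_cancel:
  assumes "intertwines (\<lambda>X. v X ** u X) A C X" "intertwines v B C X" "det (v X) \<noteq> 0" "u differentiable (at X)"
  shows "intertwines u A B X"
proof -
  note u = differentiable_has_frechet[OF assms(4)]
  note vu = frechet_derivative_eqI[OF has_derivative_matrix_mult[OF intertwinesD(1)[OF assms(2)] u]]
  show ?thesis
  proof (rule intertwinesI[OF u])
    fix V
    have "v X ** (u X ** A V) = v X ** u X ** A V" by (simp add: matrix_mul_assoc)
    also have "\<dots> = C V ** v X ** u X + frechet_derivative v (at X) V ** u X + v X ** frechet_derivative u (at X) V"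
      unfolding intertwinesD(2)[OF assms(1)] vu by (simp add: matrix_mul_assoc)
    also have "C V ** v X ** u X + frechet_derivative v (at X) V ** u X = (v X ** B V) ** u X"
      unfolding intertwinesD(2)[OF assms(2)] by (simp add: matrix_mult_algebra)
    finally have "v X ** (u X ** A V) = v X ** (B V ** u X + frechet_derivative u (at X) V)"
      by (simp add: matrix_mult_algebra matrix_mul_assoc)
    then show "u X ** A V = B V ** u X + frechet_derivative u (at X) V"
      by (simp add: matrix_cancel_left[OF assms(3)])
  qed
qed

lemma intertwines_pullback:
  assumes "intertwines u A B (\<psi> X)" "(\<psi> has_derivative \<psi>') (at X)"
  shows "intertwines (\<lambda>X. u (\<psi> X)) (\<lambda>V. A (\<psi>' V)) (\<lambda>V. B (\<psi>' V)) X"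
proof (rule intertwinesI)
  show "((\<lambda>X. u (\<psi> X)) has_derivative (\<lambda>V. frechet_derivative u (at (\<psi> X)) (\<psi>' V))) (at X)"
    using has_derivative_compose[OF assms(2) intertwinesD(1)[OF assms(1)]] .
qed (rule intertwinesD(2)[OF assms(1)])

lemma intertwines_cong_open:
  assumes "open S" "X \<in> S" "\<And>Y. Y \<in> S \<Longrightarrow> u Y = v Y"
  shows "intertwines u A B X \<longleftrightarrow> intertwines v A B X"
  using frechet_derivative_cong_open[OF assms] has_derivative_cong_open[OF assms] assms(3)[OF assms(2)]
  by (auto simp: intertwines_def differentiable_def)

text \<open>The equation expresses the derivative of \<open>u\<close> by \<open>u\<close>, which raises the order of
  differentiability.\<close>

lemma intertwines_smooth:
  assumes S: "open S" and u: "\<And>X. X \<in> S \<Longrightarrow> intertwines u (A X) (B X) X"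
    and A: "\<And>V. smooth_on S (\<lambda>X. A X V)" and B: "\<And>V. smooth_on S (\<lambda>X. B X V)"
  shows "smooth_on S u"
proof -
  have "Ck_on n S u" for n
  proof (induction n)
    case 0
    have "continuous_on S u"
      using intertwinesD(1)[OF u] by (intro continuous_at_imp_continuous_on ballI has_derivative_continuous)
    then show ?case by simp
  next
    case (Suc n)
    show ?case
    proof (rule Ck_on_SucI[OF S])
      fix X assume X: "X \<in> S"
      have e: "frechet_derivative u (at X) = (\<lambda>V. u X ** A X V + - (B X V ** u X))"
        using intertwinesD(2)[OF u[OF X]] by (simp add: fun_eq_iff)
      show "(u has_derivative (\<lambda>V. u X ** A X V + - (B X V ** u X))) (at X)"
        using intertwinesD(1)[OF u[OF X]] unfolding e .
    next
      fix V
      have c: "Ck_on n S (\<lambda>X. A X V)" "Ck_on n S (\<lambda>X. B X V)" using A B by (auto simp: smooth_on_def)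
      show "Ck_on n S (\<lambda>X. u X ** A X V + - (B X V ** u X))"
        by (intro Ck_on_add[OF S] Ck_on_bounded_linear[OF bounded_linear_minus[OF bounded_linear_ident] S]
            Ck_on_bilinear[OF bounded_bilinear_matrix_mult S] Suc c)
    qed
  qed
  then show ?thesis by (simp add: smooth_on_def)
qed

lemma intertwines_chart_den:
  assumes "det a \<noteq> 0" "det g \<noteq> 0" "det k \<noteq> 0" "det (chart_den g k X) \<noteq> 0"
  shows "intertwines (chart_den g k) (basic_pot (a ** g) X)
    (\<lambda>V. basic_pot (a ** k) (chart_change g k X) (frechet_derivative (chart_change g k) (at X) V)) X"
  using basic_pot_change[of "a ** g" "a ** k" X] assms chart_translate[of a k g]
    smooth_onD[OF smooth_on_chart_den[OF open_UNIV], of X g k]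
  by (auto simp: intertwines_def det_mul)

section \<open>Rotations of the fibres\<close>

definition rot2 :: "real \<Rightarrow> M2" where
  "rot2 c = cos c *\<^sub>R mat 1 + sin c *\<^sub>R J2"

text \<open>The exponential of \<open>c *\<^sub>R jmat N\<close>, an isometry of the inner product
  \<open>N\<close>.\<close>

definition rotation :: "M2 \<Rightarrow> real \<Rightarrow> M2" where
  "rotation N c = cos c *\<^sub>R mat 1 + sin c *\<^sub>R jmat N"

lemma rot2_nth: "rot2 c $ 1 $ 1 = cos c" "rot2 c $ 1 $ 2 = - sin c" "rot2 c $ 2 $ 1 = sin c" "rot2 c $ 2 $ 2 = cos c"
  by (simp_all add: rot2_def mat_def)

lemma rot2_orthogonal: "transpose (rot2 c) ** rot2 c = mat 1"
  using sin_cos_squared_add[of c]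
  by (intro mat2_eqI) (simp_all add: matrix_matrix_mult_def transpose_def sum_2 rot2_nth mat_def power2_eq_square algebra_simps)

lemma rot2_J2: "rot2 c ** J2 = J2 ** rot2 c"
  by (simp add: rot2_def matrix_mult_algebra)

lemma rot2_add: "rot2 c ** rot2 d = rot2 (c + d)"
  by (intro mat2_eqI) (simp_all add: matrix_matrix_mult_def sum_2 rot2_nth sin_add cos_add algebra_simps)

lemma orthogonal2_rot2:
  fixes Q :: M2
  assumes "transpose Q ** Q = mat 1" "det Q > 0"
  obtains c where "Q = rot2 c"
proof -
  let ?a = "Q$1$1" and ?b = "Q$1$2" and ?c = "Q$2$1" and ?d = "Q$2$2"
  have e: "?a * ?a + ?c * ?c = 1" "?a * ?b + ?c * ?d = 0" "?b * ?b + ?d * ?d = 1"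
    using arg_cong[OF assms(1), of "\<lambda>A. A$1$1"] arg_cong[OF assms(1), of "\<lambda>A. A$1$2"]
      arg_cong[OF assms(1), of "\<lambda>A. A$2$2"]
    by (simp_all add: matrix_matrix_mult_def transpose_def sum_2 mat_def)
  have d: "?a * ?d - ?b * ?c > 0" using assms(2) by (simp add: det_2)
  have "(?a * ?d - ?b * ?c)\<^sup>2 = 1" using e by algebra
  then have d1: "?a * ?d - ?b * ?c = 1" using d by (simp add: power2_eq_1_iff)
  have "?d = ?a" "?b = - ?c" using e d1 by algebra+
  moreover have "?a\<^sup>2 + ?c\<^sup>2 = 1" using e(1) by (simp add: power2_eq_square)
  then obtain t where "?a = cos t" "?c = sin t" by (rule sincos_total_2pi)
  ultimately have "Q = rot2 t" by (intro mat2_eqI) (simp_all add: rot2_nth)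
  then show thesis by (rule that)
qed

text \<open>The square norm of \<open>Q - mat 1\<close> is 4 - 2 \<open>trace Q\<close>.\<close>

lemma orthogonal2_trace_2:
  fixes Q :: M2
  assumes "transpose Q ** Q = mat 1" "trace Q = 2"
  shows "Q = mat 1"
proof -
  let ?a = "Q$1$1" and ?b = "Q$1$2" and ?c = "Q$2$1" and ?d = "Q$2$2"
  have e: "?a\<^sup>2 + ?c\<^sup>2 = 1" "?b\<^sup>2 + ?d\<^sup>2 = 1"
    using arg_cong[OF assms(1), of "\<lambda>A. A$1$1"] arg_cong[OF assms(1), of "\<lambda>A. A$2$2"]
    by (simp_all add: matrix_matrix_mult_def transpose_def sum_2 mat_def power2_eq_square)
  have t: "?a + ?d = 2" using assms(2) by (simp add: trace_def sum_2)
  have "(?a - 1)\<^sup>2 + (?d - 1)\<^sup>2 + ?b\<^sup>2 + ?c\<^sup>2 = 0"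
    using e t by (simp add: power2_eq_square algebra_simps)
  then have "(?a - 1)\<^sup>2 = 0 \<and> (?d - 1)\<^sup>2 = 0 \<and> ?b\<^sup>2 = 0 \<and> ?c\<^sup>2 = 0"
    by (smt (verit) zero_le_power2)
  then show ?thesis by (intro mat2_eqI) (simp_all add: mat_def)
qed

lemma rotation_conv:
  assumes "pos_def N"
  shows "chol N ** rotation N c = rot2 c ** chol N"
  using det_chol_pos[OF assms]
  by (simp add: rotation_def rot2_def jmat_chol[OF assms] matrix_mult_algebra matrix_mul_assoc matrix_inv_props)

lemma rotation_add:
  assumes "pos_def N"
  shows "rotation N c ** rotation N d = rotation N (c + d)"
proof -
  have "chol N ** (rotation N c ** rotation N d) = (chol N ** rotation N c) ** rotation N d"
    by (simp add: matrix_mul_assoc)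
  also have "\<dots> = rot2 c ** (chol N ** rotation N d)" unfolding rotation_conv[OF assms, of c] by (simp add: matrix_mul_assoc)
  also have "\<dots> = (rot2 c ** rot2 d) ** chol N" unfolding rotation_conv[OF assms] by (simp add: matrix_mul_assoc)
  also have "\<dots> = chol N ** rotation N (c + d)" unfolding rotation_conv[OF assms] rot2_add ..
  finally show ?thesis using det_chol_pos[OF assms] by (simp add: matrix_cancel_left)
qed

lemma rotation_gram:
  assumes "pos_def N"
  shows "transpose (rotation N c) ** N ** rotation N c = N"
proof -
  have "transpose (rotation N c) ** (transpose (chol N) ** chol N) ** rotation N c
      = transpose (chol N ** rotation N c) ** (chol N ** rotation N c)"
    by (simp add: matrix_transpose_mul matrix_mul_assoc)
  also have "\<dots> = transpose (chol N) ** (transpose (rot2 c) ** rot2 c) ** chol N"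
    unfolding rotation_conv[OF assms] by (simp add: matrix_transpose_mul matrix_mul_assoc)
  finally show ?thesis unfolding chol_sq[OF assms] rot2_orthogonal by (simp add: chol_sq[OF assms])
qed

text \<open>A frame change of negative determinant reverses the sense of rotation, so the angle
  changes sign with it.\<close>

lemma rotation_congruence:
  assumes "det S > 0" "det D \<noteq> 0"
  shows "D ** rotation (transpose D ** S ** D) (sgn (det D) * c) = rotation S c ** D"
proof -
  have "D ** jmat (transpose D ** S ** D) = sgn (det D) *\<^sub>R (jmat S ** D)"
    unfolding jmat_congruence[OF assms] using assms(2) by (simp add: matrix_mult_scaleR matrix_mul_assoc matrix_inv_props)
  moreover have "cos (sgn (det D) * c) = cos c" "sin (sgn (det D) * c) = sgn (det D) * sin c"
    using assms(2) by (auto simp: sgn_if)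
  ultimately show ?thesis using assms(2) by (simp add: rotation_def matrix_mult_algebra sgn_if)
qed

lemma isometry_conj:
  assumes N: "pos_def N" and Q: "transpose Q ** N ** Q = N"
  shows "transpose (chol N ** Q ** matrix_inv (chol N)) ** (chol N ** Q ** matrix_inv (chol N)) = mat 1"
proof -
  have d: "det (chol N) \<noteq> 0" "det (transpose (chol N)) \<noteq> 0" using det_chol_pos[OF N] by (simp_all add: det_transpose)
  have "transpose (chol N ** Q ** matrix_inv (chol N)) ** (chol N ** Q ** matrix_inv (chol N))
     = transpose (matrix_inv (chol N)) ** (transpose Q ** (transpose (chol N) ** chol N) ** Q) ** matrix_inv (chol N)"
    by (simp add: matrix_transpose_mul matrix_mul_assoc)
  also have "\<dots> = transpose (matrix_inv (chol N)) ** (transpose (chol N) ** chol N) ** matrix_inv (chol N)"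
    unfolding chol_sq[OF N] Q ..
  also have "\<dots> = matrix_inv (transpose (chol N)) ** transpose (chol N) ** (chol N ** matrix_inv (chol N))"
    unfolding matrix_inv_transpose[OF d(1)] by (simp add: matrix_mul_assoc)
  finally show ?thesis using d by (simp add: matrix_inv_props)
qed

text \<open>In an orthonormal frame the quotient is an orthogonal matrix, and the equality of signs
  puts it into the rotation component.\<close>

lemma isometries_differ_by_rotation:
  assumes N: "pos_def N" and U: "transpose U ** N ** U = G" and U': "transpose U' ** N ** U' = G"
    and d: "det U \<noteq> 0" "sgn (det U') = sgn (det U)"
  obtains c where "U' = rotation N c ** U"
proof -
  define Q where "Q = U' ** matrix_inv U"
  have dU': "det U' \<noteq> 0" using d by (metis sgn_0_0)
  have dt: "det (transpose U) \<noteq> 0" using d by (simp add: det_transpose)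
  have QU: "Q ** U = U'" unfolding Q_def using d(1) by (simp add: matrix_inv_mult_cancel)
  have "transpose Q ** N ** Q = transpose (matrix_inv U) ** (transpose U' ** N ** U') ** matrix_inv U"
    by (simp add: Q_def matrix_transpose_mul matrix_mul_assoc)
  also have "\<dots> = (matrix_inv (transpose U) ** transpose U) ** N ** (U ** matrix_inv U)"
    unfolding U' U[symmetric] matrix_inv_transpose[OF d(1)] by (simp only: matrix_mul_assoc)
  finally have QN: "transpose Q ** N ** Q = N" using d(1) dt by (simp add: matrix_inv_props)
  note dC = det_chol_pos[OF N]
  have "det (chol N ** Q ** matrix_inv (chol N)) = det U' / det U"
    using dC d(1) by (simp add: det_mul Q_def det_matrix_inv)
  moreover have "det U' / det U > 0" using d(2) d(1) dU' by (simp add: zero_less_divide_iff sgn_if split: if_splits)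
  ultimately obtain c where c: "chol N ** Q ** matrix_inv (chol N) = rot2 c"
    using orthogonal2_rot2[OF isometry_conj[OF N QN]] by (metis)
  have "chol N ** Q = rot2 c ** chol N" unfolding c[symmetric] using dC by (simp add: matrix_inv_mult_cancel)
  then have "chol N ** Q = chol N ** rotation N c" by (simp add: rotation_conv[OF N])
  then have "Q = rotation N c" using dC by (simp add: matrix_cancel_left)
  with QU that show thesis by blast
qed

lemma isometry_trace_2:
  fixes N Q :: M2
  assumes N: "pos_def N" and Q: "transpose Q ** N ** Q = N" "trace Q = 2"
  shows "Q = mat 1"
proof -
  note dC = det_chol_pos[OF N]
  have "trace (chol N ** Q ** matrix_inv (chol N)) = trace (matrix_inv (chol N) ** (chol N ** Q))"
    by (rule trace_mul_sym)
  then have "trace (chol N ** Q ** matrix_inv (chol N)) = 2"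
    using dC Q(2) by (simp add: matrix_inv_mult_cancel)
  from orthogonal2_trace_2[OF isometry_conj[OF N Q(1)] this]
  have "chol N ** Q ** matrix_inv (chol N) ** chol N = mat 1 ** chol N" by simp
  then have e: "chol N ** Q = chol N ** mat 1" using dC by (simp add: matrix_inv_mult_cancel)
  show ?thesis by (rule iffD1[OF matrix_cancel_left e]) (use dC in simp)
qed

lemma has_derivative_rot2:
  assumes "(\<theta> has_derivative \<theta>') (at X)"
  shows "((\<lambda>X. rot2 (\<theta> X)) has_derivative (\<lambda>V. \<theta>' V *\<^sub>R (J2 ** rot2 (\<theta> X)))) (at X)"
proof -
  have "((\<lambda>X. rot2 (\<theta> X)) has_derivative (\<lambda>V. (- (\<theta>' V * sin (\<theta> X))) *\<^sub>R mat 1 + (\<theta>' V * cos (\<theta> X)) *\<^sub>R J2)) (at X)"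
    unfolding rot2_def by (auto intro!: derivative_eq_intros assms)
  also have "(\<lambda>V. (- (\<theta>' V * sin (\<theta> X))) *\<^sub>R mat 1 + (\<theta>' V * cos (\<theta> X)) *\<^sub>R J2) = (\<lambda>V. \<theta>' V *\<^sub>R (J2 ** rot2 (\<theta> X)))"
    by (simp add: fun_eq_iff rot2_def matrix_mult_algebra J2_sq scaleR_add_right scaleR_diff_right)
  finally show ?thesis .
qed

lemma basic_connection_form:
  assumes "det b \<noteq> 0"
  obtains a :: "M2 \<Rightarrow> M2 \<Rightarrow> real" where
    "\<And>V. smooth_on UNIV (\<lambda>X. a X V)" "\<And>X. linear (a X)"
    "\<And>X. intertwines (\<lambda>X. chol (euclidean_gram b X)) (basic_pot b X) (\<lambda>V. a X V *\<^sub>R J2) X"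
    "\<And>X V W. curvature (basic_pot b) X V W =
       (frechet_derivative (\<lambda>Y. a Y W) (at X) V - frechet_derivative (\<lambda>Y. a Y V) (at X) W) *\<^sub>R jmat (euclidean_gram b X)"
proof (rule orthonormal_connection_form[of UNIV "euclidean_gram b" "basic_pot b"], goal_cases)
  case (7 a)
  have "(\<lambda>X. chol (euclidean_gram b X)) differentiable (at X)" for X
    by (rule smooth_onD[OF smooth_on_chol[OF open_UNIV smooth_on_euclidean_gram[OF open_UNIV]]])
      (simp_all add: pos_def_euclidean_gram[OF assms])
  then have "intertwines (\<lambda>X. chol (euclidean_gram b X)) (basic_pot b X) (\<lambda>V. a X V *\<^sub>R J2) X" for X
    unfolding intertwines_def using 7(4) by (auto simp: matrix_mult_scaleR)
  then show ?case using 7(1)[of a] 7(2) 7(3) 7(5) by simp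
qed (use assms in \<open>auto intro: smooth_on_euclidean_gram pos_def_euclidean_gram smooth_on_basic_pot linear_basic_pot basic_compatible\<close>)

text \<open>In the Gram-Schmidt frame the potential is a multiple of \<open>J2\<close>, with which
  constant rotations commute.\<close>

lemma intertwines_rotation:
  assumes b: "det b \<noteq> 0"
  shows "intertwines (\<lambda>X. rotation (euclidean_gram b X) c) (basic_pot b X) (basic_pot b X) X"
proof -
  let ?C = "\<lambda>X. chol (euclidean_gram b X)"
  obtain a :: "M2 \<Rightarrow> M2 \<Rightarrow> real" where a: "\<And>X. intertwines ?C (basic_pot b X) (\<lambda>V. a X V *\<^sub>R J2) X"
    using basic_connection_form[OF b] by metis
  note p = pos_def_euclidean_gram[OF b]
  have R: "intertwines (\<lambda>X. rot2 c) (\<lambda>V. a X V *\<^sub>R J2) (\<lambda>V. a X V *\<^sub>R J2) X"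
    by (rule intertwinesI[OF has_derivative_const]) (simp add: matrix_mult_scaleR rot2_J2)
  have e: "rotation (euclidean_gram b X) c = matrix_inv (?C X) ** (rot2 c ** ?C X)" for X
    unfolding rotation_conv[OF p, symmetric] using det_chol_pos[OF p, of X] by (simp add: matrix_inv_mult_cancel)
  show ?thesis
  proof (rule intertwines_cancel[OF _ a])
    show "intertwines (\<lambda>X. ?C X ** rotation (euclidean_gram b X) c) (basic_pot b X) (\<lambda>V. a X V *\<^sub>R J2) X"
      unfolding rotation_conv[OF p] by (rule intertwines_comp[OF a R])
    show "det (?C X) \<noteq> 0" using det_chol_pos[OF p, of X] by simp
    have "smooth_on UNIV (\<lambda>X. rotation (euclidean_gram b X) c)"
      unfolding e using det_chol_pos[OF p]
      by (intro smooth_on_matrix_mult smooth_on_matrix_inv2 smooth_on_const smooth_on_chol smooth_on_euclidean_gram p)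
        (simp_all add: less_imp_neq[symmetric])
    then show "(\<lambda>X. rotation (euclidean_gram b X) c) differentiable (at X)" by (rule smooth_onD) simp
  qed
qed

section \<open>Local gauge transformations to the basic solution\<close>

text \<open>The classification from here on starts from the curvature alone; it no longer refers to
  the group or to the charge.\<close>

locale basic_curvature_solution = asdym_solution E for E :: "'i metric_bundle" +
  fixes h :: "real^4^4"
  assumes det_h: "det h = 1"
    and basic_curvature: "i \<in> patches E \<Longrightarrow> X \<in> patch_dom E i \<Longrightarrow> eq_up_to_sign (curvature_matrix E i X)
      ((1 / sqrt (det (euclidean_gram (h ** chart E i) X))) *\<^sub>R comp_gram (h ** chart E i) X)"
begin

definition target_gram :: "'i \<Rightarrow> M2 \<Rightarrow> M2" where
  "target_gram i = euclidean_gram (h ** chart E i)"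

definition target_pot :: "'i \<Rightarrow> M2 \<Rightarrow> M2 \<Rightarrow> M2" where
  "target_pot i = basic_pot (h ** chart E i)"

abbreviation den :: "'i \<Rightarrow> 'i \<Rightarrow> M2 \<Rightarrow> M2" where
  "den i k \<equiv> chart_den (chart E i) (chart E k)"

abbreviation chg :: "'i \<Rightarrow> 'i \<Rightarrow> M2 \<Rightarrow> M2" where
  "chg i k \<equiv> chart_change (chart E i) (chart E k)"

lemma det_target: "i \<in> patches E \<Longrightarrow> det (h ** chart E i) = 1"
  by (simp add: det_mul det_h det_chart)

lemma det_chart_nz: "i \<in> patches E \<Longrightarrow> det (chart E i) \<noteq> 0"
  by (simp add: det_chart)

lemma pos_def_target_gram: "i \<in> patches E \<Longrightarrow> pos_def (target_gram i X)"
  unfolding target_gram_def by (rule pos_def_euclidean_gram) (simp add: det_target)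

lemma target_gram_change:
  assumes "det (chart_den g k X) \<noteq> 0" "det g \<noteq> 0" "det k \<noteq> 0"
  shows "euclidean_gram (h ** g) X = transpose (chart_den g k X) ** euclidean_gram (h ** k) (chart_change g k X) ** chart_den g k X"
  using gram_change[of "h ** k" "h ** g" X] assms chart_translate[of h k g] by (simp add: det_mul det_h)

text \<open>Minus the curvature matrix of the pull-back of the basic solution. The root of the Gram
  determinant is the normalisation contained in \<open>jmat\<close>.\<close>

definition target_curvature :: "'i \<Rightarrow> M2 \<Rightarrow> M2" where
  "target_curvature i X = (1 / sqrt (det (target_gram i X))) *\<^sub>R comp_gram (h ** chart E i) X"

lemma target_curvature:
  assumes i: "i \<in> patches E"
  shows "transpose (target_curvature i X) = target_curvature i X" "target_curvature i X $ 1 $ 1 \<noteq> 0"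
    "curvature (target_pot i) X V W = - asd_form (target_curvature i X) V W *\<^sub>R jmat (target_gram i X)"
proof -
  let ?b = "h ** chart E i" and ?K = "comp_gram (h ** chart E i) X"
  have b: "det ?b = 1" "det ?b \<noteq> 0" using det_target[OF i] by simp_all
  have N: "det (target_gram i X) > 0" using pos_defD(3)[OF pos_def_target_gram[OF i]] .
  have K: "transpose ?K = ?K" by (rule transpose_comp_gram[OF b(2)])
  show "transpose (target_curvature i X) = target_curvature i X"
    unfolding target_curvature_def linear_cmul[OF bounded_linear.linear[OF bounded_linear_transpose]] K ..
  \<comment> \<open>A symmetric 2x2 matrix of positive determinant is definite, so its diagonal
    entries do not vanish.\<close>
  have "det ?K > 0" using det_comp_gram[OF b(1), of X] N unfolding target_gram_def
    by (metis zero_less_mult_pos2 zero_less_one)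
  then have "?K $ 1 $ 1 \<noteq> 0" using sym2_eq[OF K] by (auto simp: det_2)
  then show "target_curvature i X $ 1 $ 1 \<noteq> 0" using N by (simp add: target_curvature_def)
  show "curvature (target_pot i) X V W = - asd_form (target_curvature i X) V W *\<^sub>R jmat (target_gram i X)"
    unfolding target_pot_def curvature_basic[OF b(2)] target_curvature_def asd_form_scale jmat_def
    using N by (simp add: target_gram_def)
qed

lemma curvature_matrix_target:
  assumes "i \<in> patches E" "X \<in> patch_dom E i"
  obtains \<delta> :: real where "\<delta> = 1 \<or> \<delta> = -1" "curvature_matrix E i X = \<delta> *\<^sub>R target_curvature i X"
proof -
  have "curvature_matrix E i X = target_curvature i X \<or> curvature_matrix E i X = - target_curvature i X"
    using basic_curvature[OF assms] by (simp add: eq_up_to_sign_def target_curvature_def target_gram_def)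
  then show thesis
  proof
    assume "curvature_matrix E i X = target_curvature i X"
    then show thesis using that[of 1] by simp
  next
    assume "curvature_matrix E i X = - target_curvature i X"
    then show thesis using that[of "-1"] by simp
  qed
qed

lemma chol_differentiable:
  assumes "i \<in> patches E" "X \<in> patch_dom E i"
  shows "(\<lambda>X. chol (gram E i X)) differentiable (at X)"
  using smooth_onD[OF smooth_on_chol[OF open_patch_dom smooth_gram pos_def_gram] assms(2)] assms(1) by blast

text \<open>In orthonormal frames both connections are given by real 1-forms \<open>a\<close>, \<open>b\<close>, whose
  differentials agree up to a locally constant sign \<open>\<epsilon>\<close>; the gauge transformation is the reflection
  determined by \<open>\<epsilon>\<close> followed by the rotation by a primitive of \<open>\<epsilon> a - b\<close>.\<close>

lemma local_gauge:
  assumes i: "i \<in> patches E" and X0: "X0 \<in> patch_dom E i"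
  obtains r U where "r > 0" "ball X0 r \<subseteq> patch_dom E i"
    "\<And>X. X \<in> ball X0 r \<Longrightarrow> intertwines U (pot E i X) (target_pot i X) X"
    "\<And>X. X \<in> ball X0 r \<Longrightarrow> transpose (U X) ** target_gram i X ** U X = gram E i X"
proof -
  obtain r where r: "r > 0" "ball X0 r \<subseteq> patch_dom E i"
    using open_patch_dom[OF i] X0 open_contains_ball by blast
  let ?B = "ball X0 r"
  have P: "X \<in> patch_dom E i" if "X \<in> ?B" for X using that r(2) by blast
  have bn: "det (h ** chart E i) \<noteq> 0" using det_target[OF i] by simp
  obtain a where a: "\<And>V. smooth_on (patch_dom E i) (\<lambda>X. a X V)" "\<And>X. X \<in> patch_dom E i \<Longrightarrow> linear (a X)"
    and aC: "\<And>X V. X \<in> patch_dom E i \<Longrightarrow> chol (gram E i X) ** pot E i X V =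
       a X V *\<^sub>R (J2 ** chol (gram E i X)) + frechet_derivative (\<lambda>X. chol (gram E i X)) (at X) V"
    and ac: "\<And>X V W. X \<in> patch_dom E i \<Longrightarrow> curvature (pot E i) X V W =
       (frechet_derivative (\<lambda>Y. a Y W) (at X) V - frechet_derivative (\<lambda>Y. a Y V) (at X) W) *\<^sub>R jmat (gram E i X)"
    by (rule connection_form[OF i]) blast
  obtain b where b: "\<And>V. smooth_on UNIV (\<lambda>X. b X V)" "\<And>X. linear (b X)"
    and bC: "\<And>X. intertwines (\<lambda>X. chol (target_gram i X)) (target_pot i X) (\<lambda>V. b X V *\<^sub>R J2) X"
    and bc: "\<And>X V W. curvature (target_pot i) X V W =
       (frechet_derivative (\<lambda>Y. b Y W) (at X) V - frechet_derivative (\<lambda>Y. b Y V) (at X) W) *\<^sub>R jmat (target_gram i X)"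
    unfolding target_gram_def target_pot_def by (rule basic_connection_form[OF bn]) blast
  define da where "da X V W = frechet_derivative (\<lambda>Y. a Y W) (at X) V - frechet_derivative (\<lambda>Y. a Y V) (at X) W" for X V W
  define db where "db X V W = frechet_derivative (\<lambda>Y. b Y W) (at X) V - frechet_derivative (\<lambda>Y. b Y V) (at X) W" for X V W
  have db: "db X V W = - asd_form (target_curvature i X) V W" for X V W
  proof -
    have "jmat (target_gram i X) \<noteq> 0"
    proof
      assume "jmat (target_gram i X) = 0"
      then have "(- mat 1 :: M2) = 0"
        using jmat_sq[of "target_gram i X"] pos_def_target_gram[OF i, of X] pos_defD(3)[OF pos_def_target_gram[OF i, of X]]
        by (simp add: matrix_mult_zero pos_def_def)
      from arg_cong[OF this, of "\<lambda>A. A $ 1 $ 1"] show False by (simp add: mat_def)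
    qed
    then show ?thesis using target_curvature(3)[OF i, of X V W] unfolding bc db_def[symmetric] by (simp only: scaleR_cancel_right) simp
  qed
  have da: "\<exists>\<delta>. (\<delta> = 1 \<or> \<delta> = -1) \<and> (\<forall>V W. da X V W = \<delta> * db X V W)" if X: "X \<in> ?B" for X
  proof -
    obtain \<delta> :: real where \<delta>: "\<delta> = 1 \<or> \<delta> = -1" "curvature_matrix E i X = \<delta> *\<^sub>R target_curvature i X"
      using curvature_matrix_target[OF i P[OF X]] .
    have "da X V W = asd_form (curvature_matrix E i X) V W" for V W
      using curvature_matrix(2)[OF i P[OF X], of V W] jmat_gram(2)[OF i P[OF X]]
      unfolding ac[OF P[OF X]] da_def[symmetric] by simp
    then have "da X V W = (- \<delta>) * db X V W" for V W by (simp add: \<delta>(2) asd_form_scale db)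
    then show ?thesis using \<delta>(1) by (intro exI[of _ "- \<delta>"]) auto
  qed
  have nz: "db X E11 E12 \<noteq> 0" for X
    using target_curvature(2)[OF i, of X] sym2_eq[OF target_curvature(1)[OF i, of X]] by (simp add: db asd_form_explicit)
  \<comment> \<open>Since \<open>db\<close> does not vanish on these two vectors, the sign is a
    continuous quotient; with values 1 and -1 it must be constant on the ball.\<close>
  define e where "e X = da X E11 E12 / db X E11 E12" for X
  have e: "(e X = 1 \<or> e X = -1) \<and> (\<forall>V W. da X V W = e X * db X V W)" if X: "X \<in> ?B" for X
  proof -
    obtain \<delta> where \<delta>: "\<delta> = 1 \<or> \<delta> = -1" "\<forall>V W. da X V W = \<delta> * db X V W" using da[OF X] by blast
    have "e X = \<delta>" using \<delta>(2) nz by (simp add: e_def)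
    show ?thesis unfolding \<open>e X = \<delta>\<close> by (rule conjI[OF \<delta>])
  qed
  have sa: "smooth_on ?B (\<lambda>X. a X V)" and sb: "smooth_on ?B (\<lambda>X. b X V)" for V
    using smooth_on_subset[OF a(1) r(2)] smooth_on_subset[OF b(1)] by auto
  have "continuous_on ?B e"
    unfolding e_def da_def db_def using nz[unfolded db_def]
    by (intro continuous_on_divide continuous_on_diff smooth_on_imp_continuous_on smooth_on_derivative sa sb) auto
  moreover have "finite (e ` ?B)"
  proof (rule finite_subset)
    show "e ` ?B \<subseteq> {1, -1}"
    proof (rule image_subsetI)
      fix X assume X: "X \<in> ?B"
      show "e X \<in> {1, -1}" using conjunct1[OF e[OF X]] by simp
    qed
  qed simp
  ultimately have "e constant_on ?B" by (intro continuous_finite_range_constant) auto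
  then obtain \<epsilon> where e\<epsilon>: "\<And>X. X \<in> ?B \<Longrightarrow> e X = \<epsilon>" unfolding constant_on_def by blast
  have X0B: "X0 \<in> ?B" using r(1) by simp
  have \<epsilon>: "\<epsilon> = 1 \<or> \<epsilon> = -1" using conjunct1[OF e[OF X0B]] e\<epsilon>[OF X0B] by simp
  have \<epsilon>d: "da X V W = \<epsilon> * db X V W" if X: "X \<in> ?B" for X V W
    using conjunct2[OF e[OF X]] e\<epsilon>[OF X] by simp
  have \<epsilon>2: "\<epsilon> * \<epsilon> = 1" using \<epsilon> by auto
  obtain \<theta> where \<theta>: "\<And>X. X \<in> ?B \<Longrightarrow> (\<theta> has_derivative (\<lambda>V. \<epsilon> * a X V - b X V)) (at X)"
  proof (rule closed_form_exact_on_ball[of X0 r "\<lambda>X V. \<epsilon> * a X V - b X V"])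
    show "smooth_on ?B (\<lambda>X. \<epsilon> * a X V - b X V)" for V
      by (intro smooth_on_diff smooth_on_mult smooth_on_const sa sb) auto
    show "linear (\<lambda>V. \<epsilon> * a X V - b X V)" if "X \<in> ?B" for X
      using a(2)[OF P[OF that]] b(2)[of X] by (auto intro!: linearI simp: linear_add linear_cmul algebra_simps)
    fix X V W assume X: "X \<in> ?B"
    have f: "frechet_derivative (\<lambda>Y. \<epsilon> * a Y W - b Y W) (at X) V =
        \<epsilon> * frechet_derivative (\<lambda>Y. a Y W) (at X) V - frechet_derivative (\<lambda>Y. b Y W) (at X) V" for V W
    proof -
      have "((\<lambda>Y. \<epsilon> * a Y W - b Y W) has_derivative (\<lambda>V. \<epsilon> * frechet_derivative (\<lambda>Y. a Y W) (at X) V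
          - frechet_derivative (\<lambda>Y. b Y W) (at X) V)) (at X)"
        by (intro has_derivative_diff has_derivative_mult_right smooth_on_has_derivative[OF sa X] smooth_on_has_derivative[OF sb X])
      from frechet_derivative_eqI[OF this] show ?thesis by simp
    qed
    \<comment> \<open>Closedness of \<epsilon> a - b: its differential is \<epsilon> da - db, which
      is zero because \<epsilon> squares to 1.\<close>
    have "\<epsilon> * da X V W - db X V W = (\<epsilon> * \<epsilon>) * db X V W - db X V W" unfolding \<epsilon>d[OF X] by (simp add: mult.assoc)
    then have "\<epsilon> * da X V W = db X V W" by (simp add: \<epsilon>2)
    then show "frechet_derivative (\<lambda>Y. \<epsilon> * a Y W - b Y W) (at X) V = frechet_derivative (\<lambda>Y. \<epsilon> * a Y V - b Y V) (at X) W"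
      unfolding f da_def db_def by (simp add: algebra_simps)
  qed blast
  \<comment> \<open>The identity or a reflection; conjugation by it multiplies \<open>J2\<close> by
    \<epsilon>.\<close>
  define D :: M2 where "D = vector [vector [1, 0], vector [0, \<epsilon>]]"
  have DJ: "D ** J2 = \<epsilon> *\<^sub>R (J2 ** D)"
    using \<epsilon>2 by (intro mat2_eqI) (simp_all add: D_def matrix_matrix_mult_def sum_2)
  have DD: "transpose D ** D = mat 1"
    using \<epsilon>2 by (intro mat2_eqI) (simp_all add: D_def matrix_matrix_mult_def transpose_def sum_2 mat_def)
  let ?C = "\<lambda>X. chol (gram E i X)" and ?C' = "\<lambda>X. chol (target_gram i X)"
  define U where "U X = matrix_inv (?C' X) ** (rot2 (\<theta> X) ** D ** ?C X)" for X
  have C': "det (?C' X) \<noteq> 0" for X using det_chol_pos[OF pos_def_target_gram[OF i, of X]] by simp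
  have CU: "?C' X ** U X = rot2 (\<theta> X) ** D ** ?C X" for X
    unfolding U_def using C' by (simp add: matrix_inv_mult_cancel)
  show thesis
  proof (rule that[OF r])
    fix X assume X: "X \<in> ?B"
    have 1: "intertwines ?C (pot E i X) (\<lambda>V. a X V *\<^sub>R J2) X"
      unfolding intertwines_def using chol_differentiable[OF i P[OF X]] aC[OF P[OF X]] by (simp add: matrix_mult_scaleR)
    have dR: "((\<lambda>X. rot2 (\<theta> X) ** D) has_derivative (\<lambda>V. ((\<epsilon> * a X V - b X V) *\<^sub>R (J2 ** rot2 (\<theta> X))) ** D)) (at X)"
      by (rule bounded_linear.has_derivative[OF bounded_bilinear.bounded_linear_left[OF bounded_bilinear_matrix_mult]
          has_derivative_rot2[OF \<theta>[OF X]]])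
    have 2: "intertwines (\<lambda>X. rot2 (\<theta> X) ** D) (\<lambda>V. a X V *\<^sub>R J2) (\<lambda>V. b X V *\<^sub>R J2) X"
    proof (rule intertwinesI[OF dR])
      fix V
      have "rot2 (\<theta> X) ** D ** (a X V *\<^sub>R J2) = (\<epsilon> * a X V) *\<^sub>R ((rot2 (\<theta> X) ** J2) ** D)"
        by (simp add: matrix_mult_scaleR matrix_mul_assoc[symmetric] DJ)
      then show "rot2 (\<theta> X) ** D ** (a X V *\<^sub>R J2) = (b X V *\<^sub>R J2) ** (rot2 (\<theta> X) ** D)
         + ((\<epsilon> * a X V - b X V) *\<^sub>R (J2 ** rot2 (\<theta> X))) ** D"
        unfolding rot2_J2 by (simp add: matrix_mult_algebra matrix_mul_assoc scaleR_diff_left)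
    qed
    have "U differentiable (at X)"
    proof -
      have "?C' differentiable (at X)" using intertwinesD(1)[OF bC] by (auto simp: differentiable_def)
      note c' = has_derivative_matrix_inv[OF differentiable_has_frechet[OF this] open_UNIV UNIV_I C']
      note c = differentiable_has_frechet[OF chol_differentiable[OF i P[OF X]]]
      show ?thesis unfolding U_def using has_derivative_matrix_mult[OF c' has_derivative_matrix_mult[OF dR c]]
        unfolding differentiable_def by blast
    qed
    then show "intertwines U (pot E i X) (target_pot i X) X"
      by (rule intertwines_cancel[OF _ bC C', rotated]) (unfold CU, rule intertwines_comp[OF 1 2])
    have "transpose (U X) ** (transpose (?C' X) ** ?C' X) ** U X = transpose (?C' X ** U X) ** (?C' X ** U X)"
      by (simp add: matrix_transpose_mul matrix_mul_assoc)
    also have "\<dots> = transpose (?C X) ** (transpose D ** (transpose (rot2 (\<theta> X)) ** rot2 (\<theta> X)) ** D) ** ?C X"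
      unfolding CU by (simp add: matrix_transpose_mul matrix_mul_assoc)
    also have "\<dots> = gram E i X"
      using pos_def_gram[OF i P[OF X]] by (simp add: rot2_orthogonal DD chol_sq)
    finally show "transpose (U X) ** target_gram i X ** U X = gram E i X"
      unfolding chol_sq[OF pos_def_target_gram[OF i]] .
  qed
qed

text \<open>The family \<open>s\<close> is a parallel isometry from \<open>E\<close> to the
  pull-back of the basic solution. On the patch \<open>i\<close> the target carries the tautological
  frame of the chart of this patch; therefore \<open>den\<close> appears as transition function on
  its side.\<close>

definition section_at :: "('i \<Rightarrow> M2 \<Rightarrow> M2) \<Rightarrow> 'i \<Rightarrow> M2 \<Rightarrow> bool" where
  "section_at s i X \<longleftrightarrow> intertwines (s i) (pot E i X) (target_pot i X) X \<and>
     transpose (s i X) ** target_gram i X ** s i X = gram E i X \<and>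
     (\<forall>k\<in>patches E. X \<in> overlap E i E k \<longrightarrow> den i k X ** s i X = s k (chg i k X) ** trans E i k X)"

definition section_on :: "('i \<Rightarrow> M2 \<Rightarrow> M2) \<Rightarrow> (real^4) set set \<Rightarrow> bool" where
  "section_on s W \<longleftrightarrow> (\<forall>i\<in>patches E. \<forall>X\<in>patch_dom E i. Psi (chart E i) X \<in> W \<longrightarrow> section_at s i X)"

definition agree_on :: "('i \<Rightarrow> M2 \<Rightarrow> M2) \<Rightarrow> ('i \<Rightarrow> M2 \<Rightarrow> M2) \<Rightarrow> (real^4) set set \<Rightarrow> bool" where
  "agree_on s s' W \<longleftrightarrow> (\<forall>i\<in>patches E. \<forall>X\<in>patch_dom E i. Psi (chart E i) X \<in> W \<longrightarrow> s i X = s' i X)"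

lemma overlapI:
  assumes "i \<in> patches E" "k \<in> patches E" "X \<in> patch_dom E i" "Z \<in> patch_dom E k" "Psi (chart E i) X = Psi (chart E k) Z"
  shows "X \<in> overlap E i E k" "chg i k X = Z"
  using Psi_eq_iff[OF det_chart_nz[OF assms(1)] det_chart_nz[OF assms(2)], of X Z] assms by (auto simp: overlap_def)

lemma overlapD:
  assumes "i \<in> patches E" "k \<in> patches E" "X \<in> overlap E i E k"
  shows "X \<in> patch_dom E i" "chg i k X \<in> patch_dom E k" "det (den i k X) \<noteq> 0"
    "Psi (chart E k) (chg i k X) = Psi (chart E i) X"
  using assms Psi_chart_change[OF det_chart_nz[OF assms(1)] det_chart_nz[OF assms(2)]] by (auto simp: overlap_def)

text \<open>The local gauge transformation lives on one patch. On any other patch \<open>k\<close>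
  the formula for \<open>s k\<close> is forced by compatibility with the transition functions, and
  its consistency on further patches follows from the two cocycle identities.\<close>

lemma local_section:
  assumes i: "i \<in> patches E" and X0: "X0 \<in> patch_dom E i"
  obtains r s where "r > 0" "section_on s (Psi (chart E i) ` ball X0 r)"
proof -
  obtain r U where r: "r > 0" "ball X0 r \<subseteq> patch_dom E i"
    and U: "\<And>X. X \<in> ball X0 r \<Longrightarrow> intertwines U (pot E i X) (target_pot i X) X"
    "\<And>X. X \<in> ball X0 r \<Longrightarrow> transpose (U X) ** target_gram i X ** U X = gram E i X"
    using local_gauge[OF i X0] by blast
  define s where "s k Z = matrix_inv (den k i Z) ** (U (chg k i Z) ** trans E k i Z)" for k Z
  have "section_at s k Z" if k: "k \<in> patches E" and Z: "Z \<in> patch_dom E k" and Zb: "Psi (chart E k) Z \<in> Psi (chart E i) ` ball X0 r" for k Z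
  proof -
    let ?\<phi> = "chg k i"
    have F: "Y \<in> overlap E k E i \<and> ?\<phi> Y \<in> ball X0 r \<and> det (den k i Y) \<noteq> 0"
      if Y: "Y \<in> patch_dom E k" "Psi (chart E k) Y \<in> Psi (chart E i) ` ball X0 r" for Y
    proof -
      obtain X where X: "X \<in> ball X0 r" "Psi (chart E k) Y = Psi (chart E i) X" using Y(2) by blast
      have "X \<in> patch_dom E i" using X(1) r(2) by blast
      from overlapI[OF k i Y(1) this X(2)] X(1) show ?thesis by (auto simp: overlap_def)
    qed
    note FZ = F[OF Z Zb]
    define S where "S = {Y \<in> overlap E k E i. ?\<phi> Y \<in> ball X0 r}"
    have "open S"
    proof -
      have "S = {Y \<in> patch_dom E k. det (chart_den (chart E k) (chart E i) Y) \<noteq> 0 \<and> chart_change (chart E k) (chart E i) Y \<in> patch_dom E i}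
          \<inter> (chart_dom (chart E k) (chart E i) \<inter> ?\<phi> -` ball X0 r)"
        by (auto simp: S_def overlap_def chart_dom_def)
      moreover have "open (chart_dom (chart E k) (chart E i) \<inter> ?\<phi> -` ball X0 r)"
        by (rule continuous_open_preimage[OF smooth_on_imp_continuous_on[OF smooth_on_chart_change] open_chart_dom open_ball])
      ultimately show ?thesis using open_overlap_like[OF k i] by auto
    qed
    have ZS: "Z \<in> S" using FZ by (simp add: S_def)
    have SD: "det (den k i Y) \<noteq> 0" if "Y \<in> S" for Y using that by (auto simp: S_def overlap_def)
    have T: "intertwines (trans E k i) (pot E k Z) (\<lambda>V. pot E i (?\<phi> Z) (frechet_derivative ?\<phi> (at Z) V)) Z"
      using pot_trans[OF k i] smooth_onD[OF smooth_trans[OF k i]] FZ by (auto simp: intertwines_def)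
    have d\<phi>: "(?\<phi> has_derivative frechet_derivative ?\<phi> (at Z)) (at Z)"
      by (rule smooth_on_has_derivative[OF smooth_on_chart_change]) (use FZ in \<open>simp add: chart_dom_def\<close>)
    have UT: "intertwines (\<lambda>Z. U (?\<phi> Z) ** trans E k i Z) (pot E k Z)
        (\<lambda>V. target_pot i (?\<phi> Z) (frechet_derivative ?\<phi> (at Z) V)) Z"
      by (rule intertwines_comp[OF T intertwines_pullback[OF U(1) d\<phi>]]) (use FZ in blast)
    have den: "intertwines (den k i) (target_pot k Z) (\<lambda>V. target_pot i (?\<phi> Z) (frechet_derivative ?\<phi> (at Z) V)) Z"
      unfolding target_pot_def
      by (rule intertwines_chart_den) (use FZ det_h det_chart_nz[OF i] det_chart_nz[OF k] in auto)
    have ds: "den k i Y ** s k Y = U (?\<phi> Y) ** trans E k i Y" if "det (den k i Y) \<noteq> 0" for Y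
      unfolding s_def using that by (simp add: matrix_inv_mult_cancel)
    have dif: "s k differentiable (at Z)"
      unfolding s_def[abs_def] using has_derivative_matrix_mult[OF has_derivative_matrix_inv[OF intertwinesD(1)[OF den] \<open>open S\<close> ZS SD]
          intertwinesD(1)[OF UT]] unfolding differentiable_def by blast
    have int: "intertwines (s k) (pot E k Z) (target_pot k Z) Z"
    proof (rule intertwines_cancel[OF _ den _ dif])
      show "intertwines (\<lambda>Z. den k i Z ** s k Z) (pot E k Z) (\<lambda>V. target_pot i (?\<phi> Z) (frechet_derivative ?\<phi> (at Z) V)) Z"
        by (rule iffD1[OF intertwines_cong_open[OF \<open>open S\<close> ZS] UT]) (simp add: ds SD)
    qed (use FZ in blast)
    have "transpose (s k Z) ** (transpose (den k i Z) ** target_gram i (?\<phi> Z) ** den k i Z) ** s k Z =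
       transpose (den k i Z ** s k Z) ** target_gram i (?\<phi> Z) ** (den k i Z ** s k Z)"
      by (simp add: matrix_transpose_mul matrix_mul_assoc)
    also have "\<dots> = transpose (trans E k i Z) ** (transpose (U (?\<phi> Z)) ** target_gram i (?\<phi> Z) ** U (?\<phi> Z)) ** trans E k i Z"
      using FZ by (simp add: ds matrix_transpose_mul matrix_mul_assoc)
    also have "\<dots> = gram E k Z" using U(2)[of "?\<phi> Z"] FZ gram_trans[OF k i, of Z] by simp
    finally have gr: "transpose (s k Z) ** target_gram k Z ** s k Z = gram E k Z"
      using target_gram_change[of "chart E k" "chart E i" Z] FZ det_chart_nz[OF i] det_chart_nz[OF k]
      by (simp add: target_gram_def)
    have "den k l Z ** s k Z = s l (chg k l Z) ** trans E k l Z" if l: "l \<in> patches E" and Zl: "Z \<in> overlap E k E l" for l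
    proof -
      let ?Y = "chg k l Z"
      note o = overlapD[OF k l Zl]
      have Zi: "Z \<in> overlap E k E i" using FZ by blast
      have kl: "det (den k i Z) \<noteq> 0" using FZ by blast
      note cc = chart_change_cocycle[OF det_chart_nz[OF l] o(3) kl]
      have "den l i ?Y ** (den k l Z ** s k Z) = den k i Z ** s k Z"
        unfolding chart_den_cocycle(1)[OF det_chart_nz[OF l] o(3), of "chart E i"] by (simp add: matrix_mul_assoc)
      also have "\<dots> = U (?\<phi> Z) ** (trans E l i ?Y ** trans E k l Z)"
        unfolding ds[OF kl] trans_cocycle[OF k l i Zl Zi] ..
      also have "\<dots> = den l i ?Y ** (s l ?Y ** trans E k l Z)"
        unfolding s_def[of l] cc(2) using cc(1) by (simp add: matrix_mul_assoc matrix_inv_props)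
      finally show ?thesis by (simp add: matrix_cancel_left[OF cc(1)])
    qed
    with int gr show ?thesis by (simp add: section_at_def)
  qed
  then have "section_on s (Psi (chart E i) ` ball X0 r)" by (simp add: section_on_def)
  with r(1) show thesis by (rule that)
qed

end

section \<open>Sections over charts\<close>

definition gr_open :: "(real^4) set set \<Rightarrow> bool" where
  "gr_open W \<longleftrightarrow> (\<forall>g. det g \<noteq> 0 \<longrightarrow> open {X. Psi g X \<in> W})"

lemma gr_open_image:
  assumes "det g \<noteq> 0" "open S"
  shows "gr_open (Psi g ` S)"
  unfolding gr_open_def
proof (intro allI impI)
  fix k :: "real^4^4" assume k: "det k \<noteq> 0"
  have "{X. Psi k X \<in> Psi g ` S} = chart_dom k g \<inter> chart_change k g -` S"
    using Psi_eq_iff[OF k assms(1)] by (auto simp: chart_dom_def image_iff)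
  moreover have "open (chart_dom k g \<inter> chart_change k g -` S)"
    by (rule continuous_open_preimage[OF smooth_on_imp_continuous_on[OF smooth_on_chart_change] open_chart_dom assms(2)])
  ultimately show "open {X. Psi k X \<in> Psi g ` S}" by simp
qed

lemma gr_open_Un: "gr_open W \<Longrightarrow> gr_open V \<Longrightarrow> gr_open (W \<union> V)"
  unfolding gr_open_def by (auto simp: Collect_disj_eq intro: open_Un)

context basic_curvature_solution
begin

lemma section_onD:
  "section_on s W \<Longrightarrow> i \<in> patches E \<Longrightarrow> X \<in> patch_dom E i \<Longrightarrow> Psi (chart E i) X \<in> W \<Longrightarrow> section_at s i X"
  by (simp add: section_on_def)

lemma agree_onD:
  "agree_on s t W \<Longrightarrow> i \<in> patches E \<Longrightarrow> X \<in> patch_dom E i \<Longrightarrow> Psi (chart E i) X \<in> W \<Longrightarrow> s i X = t i X"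
  by (simp add: agree_on_def)

lemma section_at_cong:
  assumes "i \<in> patches E" "X \<in> patch_dom E i" "Psi (chart E i) X \<in> V" "gr_open V" "agree_on s s' V" "section_at s' i X"
  shows "section_at s i X"
proof -
  let ?S = "patch_dom E i \<inter> {X. Psi (chart E i) X \<in> V}"
  have S: "open ?S" using open_patch_dom[OF assms(1)] assms(4) det_chart_nz[OF assms(1)] by (auto simp: gr_open_def)
  have e: "s i Y = s' i Y" if "Y \<in> ?S" for Y using that assms(1,5) by (auto simp: agree_on_def)
  have X: "X \<in> ?S" using assms by auto
  have k: "s k (chg i k X) = s' k (chg i k X)" if "k \<in> patches E" "X \<in> overlap E i E k" for k
    using overlapD[OF assms(1) that] that assms(3,5) by (auto simp: agree_on_def)
  show ?thesis
    using assms(6) k e[OF X] intertwines_cong_open[OF S X e] unfolding section_at_def by auto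
qed

text \<open>Being a section is a local condition: the differential equation needs values near the
  plane, the other conditions only values at the plane.\<close>

lemma section_glue:
  assumes "\<And>p. p \<in> W \<Longrightarrow> \<exists>V s'. gr_open V \<and> p \<in> V \<and> section_on s' V \<and> agree_on s s' V"
  shows "section_on s W"
  unfolding section_on_def
proof (intro ballI impI)
  fix i X assume i: "i \<in> patches E" "X \<in> patch_dom E i" "Psi (chart E i) X \<in> W"
  from assms[OF i(3)] show "section_at s i X"
  proof (elim exE conjE)
    fix V s' assume V: "gr_open V" "Psi (chart E i) X \<in> V" "section_on s' V" "agree_on s s' V"
    have "section_at s' i X" by (rule V(3)[unfolded section_on_def, rule_format, OF i(1,2) V(2)])
    then show "section_at s i X" by (rule section_at_cong[OF i(1,2) V(2,1,4)])
  qed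
qed

lemma section_on_subset: "section_on s W \<Longrightarrow> V \<subseteq> W \<Longrightarrow> section_on s V"
  unfolding section_on_def by blast

lemma agree_on_subset: "agree_on s t W \<Longrightarrow> V \<subseteq> W \<Longrightarrow> agree_on s t V"
  unfolding agree_on_def by blast

lemma agree_on_sym: "agree_on s t W \<Longrightarrow> agree_on t s W"
  unfolding agree_on_def by simp

lemma agree_on_trans: "agree_on s t W \<Longrightarrow> agree_on t u W \<Longrightarrow> agree_on s u W"
  unfolding agree_on_def by simp

lemma agree_on_refl: "agree_on s s W"
  unfolding agree_on_def by simp

lemma agree_on_pointwise: "(\<And>p. p \<in> W \<Longrightarrow> agree_on s t {p}) \<Longrightarrow> agree_on s t W"
  unfolding agree_on_def by blast

lemma patch_exists:
  assumes "det g \<noteq> 0"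
  obtains i X where "i \<in> patches E" "X \<in> patch_dom E i" "Psi (chart E i) X = Psi g Y"
proof -
  have "Psi g Y \<in> (\<Union>i\<in>patches E. Psi (chart E i) ` patch_dom E i)"
    using Psi_in_Gr[OF assms, of Y] by (simp only: Gr_patches)
  then show thesis
  proof (elim UN_E imageE)
    fix i X assume "i \<in> patches E" "Psi g Y = Psi (chart E i) X" "X \<in> patch_dom E i"
    then show thesis by (intro that[of i X]) simp_all
  qed
qed

text \<open>The transition functions determine the value on every patch containing the plane from
  the value on a single one.\<close>

lemma agree_at:
  assumes s: "section_on s W" "section_on s' W" and i: "i \<in> patches E" "X \<in> patch_dom E i" "Psi (chart E i) X \<in> W"
    and e: "s i X = s' i X"
  shows "agree_on s s' {Psi (chart E i) X}"
  unfolding agree_on_def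
proof (intro ballI impI)
  fix k Z assume k: "k \<in> patches E" "Z \<in> patch_dom E k" "Psi (chart E k) Z \<in> {Psi (chart E i) X}"
  then have o: "X \<in> overlap E i E k" "chg i k X = Z" using overlapI[OF i(1) k(1) i(2) k(2)] by auto
  have "section_at s i X" "section_at s' i X"
    using s[unfolded section_on_def, rule_format, OF i] by simp_all
  then have "s k Z ** trans E i k X = s' k Z ** trans E i k X"
    using o k(1) e unfolding section_at_def by metis
  then show "s k Z = s' k Z" using det_trans[OF i(1) k(1) o(1)] by (simp add: matrix_cancel_right)
qed

lemma section_det:
  assumes "section_at s i X" "i \<in> patches E" "X \<in> patch_dom E i"
  shows "det (s i X) \<noteq> 0"
proof -
  have "det (s i X) * det (target_gram i X) * det (s i X) = det (gram E i X)"
    using arg_cong[of _ _ det, OF conjunct1[OF conjunct2[OF assms(1)[unfolded section_at_def]]]]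
    by (simp add: det_mul det_transpose)
  then show ?thesis using pos_defD(3)[OF pos_def_gram[OF assms(2,3)]] by auto
qed

lemma open_patch_part:
  assumes "i \<in> patches E" "gr_open W"
  shows "open (patch_dom E i \<inter> {X. Psi (chart E i) X \<in> W})"
  using open_patch_dom[OF assms(1)] assms(2) det_chart_nz[OF assms(1)] by (auto simp: gr_open_def)

text \<open>The quotient of two sections is a parallel isometry, so its trace is locally constant; and an
  isometry of trace 2 is the identity.\<close>

lemma unique_continuation:
  assumes g: "det g \<noteq> 0" and W: "gr_open W" "section_on s W" "section_on s' W"
    and S: "connected S" "Psi g ` S \<subseteq> W" "Y \<in> S" and a: "agree_on s s' {Psi g Y}"
  shows "agree_on s s' (Psi g ` S)"
proof -
  have "eventually (\<lambda>Y'. agree_on s s' {Psi g Y} = agree_on s s' {Psi g Y'}) (at Y within S)" if Y: "Y \<in> S" for Y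
  proof -
    obtain i X where i: "i \<in> patches E" "X \<in> patch_dom E i" "Psi (chart E i) X = Psi g Y"
      by (rule patch_exists[OF g])
    define D where "D = patch_dom E i \<inter> {X. Psi (chart E i) X \<in> W}"
    have D: "open D" unfolding D_def by (rule open_patch_part[OF i(1) W(1)])
    have "X \<in> D" using i S(2) Y by (auto simp: D_def)
    then obtain r where r: "r > 0" "ball X r \<subseteq> D" using D open_contains_ball by blast
    have rD: "Z \<in> patch_dom E i" "Psi (chart E i) Z \<in> W" if "Z \<in> ball X r" for Z
      using that r(2) by (auto simp: D_def)
    have sec: "section_at s i Z" "section_at s' i Z" "Z \<in> patch_dom E i" if "Z \<in> ball X r" for Z
      by (rule section_onD[OF W(2) i(1) rD[OF that]] section_onD[OF W(3) i(1) rD[OF that]] rD(1)[OF that])+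
    define Q where "Q Z = matrix_inv (s i Z) ** s' i Z" for Z
    have sQ: "s i Z ** Q Z = s' i Z" if "Z \<in> ball X r" for Z
      using section_det[OF sec(1)[OF that] i(1) sec(3)[OF that]] by (simp add: Q_def matrix_inv_mult_cancel)
    have iso: "transpose (Q Z) ** gram E i Z ** Q Z = gram E i Z" if Z: "Z \<in> ball X r" for Z
    proof -
      have e: "transpose (s i Z) ** target_gram i Z ** s i Z = gram E i Z" "transpose (s' i Z) ** target_gram i Z ** s' i Z = gram E i Z"
        using sec[OF Z] by (auto simp: section_at_def)
      have "transpose (Q Z) ** (transpose (s i Z) ** target_gram i Z ** s i Z) ** Q Z =
         transpose (s i Z ** Q Z) ** target_gram i Z ** (s i Z ** Q Z)"
        by (simp add: matrix_transpose_mul matrix_mul_assoc)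
      then show ?thesis unfolding sQ[OF Z] e .
    qed
    have "((\<lambda>Z. trace (Q Z)) has_derivative (\<lambda>V. 0)) (at Z)" if Z: "Z \<in> ball X r" for Z
    proof -
      have int: "intertwines (s i) (pot E i Z) (target_pot i Z) Z" "intertwines (s' i) (pot E i Z) (target_pot i Z) Z"
        using sec[OF Z] by (auto simp: section_at_def)
      have "Q differentiable (at Z)"
        unfolding Q_def[abs_def] using has_derivative_matrix_mult[OF has_derivative_matrix_inv[OF intertwinesD(1)[OF int(1)] open_ball Z] intertwinesD(1)[OF int(2)]]
          section_det[OF sec(1) i(1) sec(3)] unfolding differentiable_def by blast
      moreover have "intertwines (\<lambda>Z. s i Z ** Q Z) (pot E i Z) (target_pot i Z) Z"
        by (rule iffD1[OF intertwines_cong_open[OF open_ball Z] int(2)]) (simp add: sQ)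
      ultimately have q: "intertwines Q (pot E i Z) (pot E i Z) Z"
        by (intro intertwines_cancel[OF _ int(1) section_det[OF sec(1)[OF Z] i(1) sec(3)[OF Z]]])
      note bounded_linear.has_derivative[OF bounded_linear_trace intertwinesD(1)[OF q]]
      moreover have "trace (frechet_derivative Q (at Z) V) = 0" for V
      proof -
        have "frechet_derivative Q (at Z) V = Q Z ** pot E i Z V - pot E i Z V ** Q Z"
          using intertwinesD(2)[OF q, of V] by simp
        then show ?thesis using trace_mul_sym[of "Q Z" "pot E i Z V"] by (simp add: trace_sub)
      qed
      ultimately show ?thesis by simp
    qed
    then have "\<exists>c. \<forall>Z\<in>ball X r. trace (Q Z) = c"
      by (intro has_derivative_zero_constant) (auto intro: has_derivative_at_withinI)
    then have tr: "trace (Q Z) = trace (Q X)" if "Z \<in> ball X r" for Z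
      using that r(1) centre_in_ball by metis
    have eq: "s i Z = s' i Z \<longleftrightarrow> trace (Q Z) = 2" if Z: "Z \<in> ball X r" for Z
    proof
      assume "s i Z = s' i Z"
      then have "Q Z = mat 1" using section_det[OF sec(1)[OF Z] i(1) sec(3)[OF Z]] by (simp add: Q_def matrix_inv_props)
      then show "trace (Q Z) = 2" by (simp add: trace_def sum_2 mat_def)
    next
      assume "trace (Q Z) = 2"
      from isometry_trace_2[OF pos_def_gram[OF i(1) sec(3)[OF Z]] iso[OF Z] this] sQ[OF Z]
      show "s i Z = s' i Z" by simp
    qed
    have ag: "agree_on s s' {Psi (chart E i) Z} \<longleftrightarrow> s i Z = s' i Z" if Z: "Z \<in> ball X r" for Z
    proof
      show "agree_on s s' {Psi (chart E i) Z} \<Longrightarrow> s i Z = s' i Z"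
        using agree_onD[OF _ i(1) sec(3)[OF Z]] by blast
      show "s i Z = s' i Z \<Longrightarrow> agree_on s s' {Psi (chart E i) Z}"
        by (rule agree_at[OF W(2,3) i(1) rD[OF Z]])
    qed
    have Xb: "X \<in> ball X r" using r(1) by simp
    define T where "T = {Y'. Psi g Y' \<in> Psi (chart E i) ` ball X r}"
    have "open T" using gr_open_image[OF det_chart_nz[OF i(1)] open_ball] g unfolding gr_open_def T_def by blast
    moreover have "Y \<in> T" using i(3) Xb by (force simp: T_def)
    moreover have "agree_on s s' {Psi g Y} = agree_on s s' {Psi g Y'}" if "Y' \<in> T" for Y'
    proof -
      from that have "Psi g Y' \<in> Psi (chart E i) ` ball X r" unfolding T_def by (rule CollectD)
      then obtain Z where Z: "Z \<in> ball X r" "Psi g Y' = Psi (chart E i) Z" by blast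
      show ?thesis unfolding Z(2) i(3)[symmetric] ag[OF Z(1)] ag[OF Xb] eq[OF Z(1)] eq[OF Xb] tr[OF Z(1)] ..
    qed
    ultimately show ?thesis unfolding eventually_at_topological by blast
  qed
  then have ev: "\<forall>Y\<in>S. eventually (\<lambda>Y'. agree_on s s' {Psi g Y} = agree_on s s' {Psi g Y'}) (at Y within S)" ..
  show ?thesis
  proof (rule agree_on_pointwise)
    fix p assume "p \<in> Psi g ` S"
    then obtain Y' where Y': "Y' \<in> S" "p = Psi g Y'" by (rule imageE)
    show "agree_on s s' {p}" using connected_local_const[OF S(1,3) Y'(1) ev] a Y'(2) by simp
  qed
qed

text \<open>Rotation of the target fibres by \<open>c\<close> in the orientation given by the frame
  of the chart \<open>g\<close>; the sign translates this orientation to the frame of the patch. At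
  planes outside the chart \<open>g\<close> the sign is 0 and nothing is rotated.\<close>

definition rot :: "real^4^4 \<Rightarrow> real \<Rightarrow> ('i \<Rightarrow> M2 \<Rightarrow> M2) \<Rightarrow> 'i \<Rightarrow> M2 \<Rightarrow> M2" where
  "rot g c s i X = rotation (target_gram i X) (sgn (det (chart_den (chart E i) g X)) * c) ** s i X"

lemma rot_add: "i \<in> patches E \<Longrightarrow> rot g c (rot g d s) i X = rot g (c + d) s i X"
  using rotation_add[OF pos_def_target_gram, of i X]
  by (simp add: rot_def matrix_mul_assoc distrib_left)

lemma rot_agree: "agree_on s t W \<Longrightarrow> agree_on (rot g c s) (rot g c t) W"
  by (simp add: agree_on_def rot_def)

text \<open>Inside the chart \<open>g\<close> the sign of the determinant is locally constant, so
  locally this is a constant rotation. The cocycle rule for the signs makes it agree across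
  patches.\<close>

lemma section_on_rot:
  assumes g: "det g \<noteq> 0" and s: "section_on s W" and W: "W \<subseteq> range (Psi g)"
  shows "section_on (rot g c s) W"
  unfolding section_on_def
proof (intro ballI impI)
  fix i X assume i: "i \<in> patches E" "X \<in> patch_dom E i" "Psi (chart E i) X \<in> W"
  have sec: "section_at s i X" by (rule section_onD[OF s i])
  have dn: "det (chart_den (chart E i) g X) \<noteq> 0"
    using W i(3) Psi_eq_iff[OF det_chart_nz[OF i(1)] g] by blast
  define \<sigma> where "\<sigma> = sgn (det (chart_den (chart E i) g X))"
  define S where "S = {Y. 0 < \<sigma> * det (chart_den (chart E i) g Y)}"
  have S: "open S" unfolding S_def
    by (intro open_Collect_less continuous_intros smooth_on_imp_continuous_on smooth_on_det2 smooth_on_chart_den open_UNIV)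
  have XS: "X \<in> S" using dn by (auto simp: S_def \<sigma>_def sgn_if)
  have b: "det (h ** chart E i) \<noteq> 0" using det_target[OF i(1)] by simp
  have R: "intertwines (\<lambda>X. rotation (target_gram i X) (\<sigma> * c) ** s i X) (pot E i X) (target_pot i X) X"
    using sec unfolding section_at_def target_gram_def target_pot_def
    by (intro intertwines_comp[OF _ intertwines_rotation[OF b]]) blast
  have sg: "sgn (det (chart_den (chart E i) g Y)) = \<sigma>" if "Y \<in> S" for Y
    using that dn by (auto simp: S_def \<sigma>_def sgn_if zero_less_mult_iff split: if_splits)
  have 1: "intertwines (rot g c s i) (pot E i X) (target_pot i X) X"
    by (rule iffD1[OF intertwines_cong_open[OF S XS] R]) (simp add: rot_def sg)
  have gr: "transpose (s i X) ** target_gram i X ** s i X = gram E i X" using sec by (simp add: section_at_def)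
  let ?R = "rotation (target_gram i X) (sgn (det (chart_den (chart E i) g X)) * c)"
  have "transpose (rot g c s i X) ** target_gram i X ** rot g c s i X
     = transpose (s i X) ** (transpose ?R ** target_gram i X ** ?R) ** s i X"
    unfolding rot_def by (simp add: matrix_transpose_mul matrix_mul_assoc)
  then have 2: "transpose (rot g c s i X) ** target_gram i X ** rot g c s i X = gram E i X"
    unfolding rotation_gram[OF pos_def_target_gram[OF i(1)]] gr .
  have 3: "den i k X ** rot g c s i X = rot g c s k (chg i k X) ** trans E i k X"
    if k: "k \<in> patches E" and o: "X \<in> overlap E i E k" for k
  proof -
    let ?Y = "chg i k X" and ?D = "den i k X"
    note oD = overlapD[OF i(1) k o]
    have N: "target_gram i X = transpose ?D ** target_gram k ?Y ** ?D"
      unfolding target_gram_def by (rule target_gram_change[OF oD(3) det_chart_nz[OF i(1)] det_chart_nz[OF k]])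
    have "sgn (det (chart_den (chart E i) g X)) * c = sgn (det ?D) * (sgn (det (chart_den (chart E k) g ?Y)) * c)"
      unfolding chart_den_cocycle(1)[OF det_chart_nz[OF k] oD(3), of g] by (simp add: det_mul sgn_mult)
    then have DR: "?D ** ?R = rotation (target_gram k ?Y) (sgn (det (chart_den (chart E k) g ?Y)) * c) ** ?D"
      unfolding N by (simp only: rotation_congruence[OF pos_defD(3)[OF pos_def_target_gram[OF k]] oD(3)])
    have Ds: "?D ** s i X = s k ?Y ** trans E i k X" using sec k o by (simp add: section_at_def)
    have "?D ** rot g c s i X = (?D ** ?R) ** s i X" by (simp add: rot_def matrix_mul_assoc)
    also have "\<dots> = rotation (target_gram k ?Y) (sgn (det (chart_den (chart E k) g ?Y)) * c) ** (?D ** s i X)"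
      unfolding DR by (simp only: matrix_mul_assoc)
    also have "\<dots> = rot g c s k ?Y ** trans E i k X" unfolding Ds by (simp add: rot_def matrix_mul_assoc)
    finally show ?thesis .
  qed
  show "section_at (rot g c s) i X" using 1 2 3 by (simp add: section_at_def)
qed

text \<open>Where two charts orient the fibre oppositely, the same rotation has opposite angles in
  them. This is the twist of the circle bundle.\<close>

lemma rot_flip:
  assumes "det g \<noteq> 0" "det k \<noteq> 0" "Psi g Y = Psi k Z"
  shows "agree_on (rot g c s) (rot k (sgn (det (chart_den g k Y)) * c) s) {Psi g Y}"
  unfolding agree_on_def
proof (intro ballI impI)
  fix i X assume i: "i \<in> patches E" "X \<in> patch_dom E i" "Psi (chart E i) X \<in> {Psi g Y}"
  have 1: "det (chart_den (chart E i) g X) \<noteq> 0" "Y = chart_change (chart E i) g X"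
    using Psi_eq_iff[OF det_chart_nz[OF i(1)] assms(1)] i(3) by auto
  have "det (chart_den g k Y) \<noteq> 0" using Psi_eq_iff[OF assms(1,2)] assms(3) by auto
  then have "sgn (det (chart_den g k Y)) * sgn (det (chart_den g k Y)) = 1" by (simp add: sgn_if)
  then have "sgn (det (chart_den (chart E i) k X)) * (sgn (det (chart_den g k Y)) * c) = sgn (det (chart_den (chart E i) g X)) * c"
    unfolding chart_den_cocycle(1)[OF assms(1) 1(1), of k] 1(2)[symmetric] det_mul sgn_mult by algebra
  then show "rot g c s i X = rot k (sgn (det (chart_den g k Y)) * c) s i X" by (simp only: rot_def)
qed

text \<open>A section carries one curvature to the other, so the sign of its determinant can be read
  off from the nonzero curvature. Consequently two sections never differ by a reflection.\<close>

lemma section_det_sign: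
  assumes W: "gr_open W" "section_on s W" and i: "i \<in> patches E" "X \<in> patch_dom E i" "Psi (chart E i) X \<in> W"
  shows "curvature_matrix E i X = (- sgn (det (s i X))) *\<^sub>R target_curvature i X"
proof -
  define D where "D = patch_dom E i \<inter> {X. Psi (chart E i) X \<in> W}"
  have D: "open D" unfolding D_def by (rule open_patch_part[OF i(1) W(1)])
  have X: "X \<in> D" using i by (simp add: D_def)
  have sec: "section_at s i Z" if "Z \<in> D" for Z
    by (rule section_onD[OF W(2) i(1)]) (use that in \<open>auto simp: D_def\<close>)
  have int: "intertwines (s i) (pot E i Z) (target_pot i Z) Z" if "Z \<in> D" for Z
    using sec[OF that] by (auto simp: section_at_def)
  have b: "det (h ** chart E i) \<noteq> 0" using det_target[OF i(1)] by simp
  have sp: "smooth_on D (\<lambda>X. pot E i X V)" "smooth_on D (\<lambda>X. target_pot i X V)" for V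
    using smooth_on_subset[OF smooth_pot[OF i(1)]] smooth_on_basic_pot[OF D b] by (auto simp: D_def target_pot_def)
  have ss: "smooth_on D (s i)" by (rule intertwines_smooth[OF D int sp])
  note fi = frechet_derivative_eqI[OF has_derivative_ident]
  have lin: "linear (target_pot i Y)" for Y unfolding target_pot_def by (rule linear_basic_pot)
  have c: "s i X ** curvature (pot E i) X V W = curvature (target_pot i) X V W ** s i X" for V W
    using curvature_gauge[of D X "s i" "\<lambda>X. X" D "target_pot i" "pot E i" V W, OF D X ss smooth_on_ident[OF D] D _ sp(2) lin sp(1)]
      intertwinesD(2)[OF int] by (simp add: fi)
  note dn = section_det[OF sec[OF X] i(1,2)]
  define \<sigma> where "\<sigma> = sgn (det (s i X))"
  have gr: "transpose (s i X) ** target_gram i X ** s i X = gram E i X" using sec[OF X] by (simp add: section_at_def)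
  have \<sigma>: "\<sigma> * \<sigma> = 1" using dn by (simp add: \<sigma>_def sgn_if)
  have "jmat (gram E i X) = \<sigma> *\<^sub>R (matrix_inv (s i X) ** jmat (target_gram i X) ** s i X)"
    unfolding \<sigma>_def gr[symmetric] by (rule jmat_congruence[OF pos_defD(3)[OF pos_def_target_gram[OF i(1)]] dn])
  then have j: "matrix_inv (s i X) ** jmat (target_gram i X) ** s i X = \<sigma> *\<^sub>R jmat (gram E i X)"
    using \<sigma> by simp
  have "curvature (pot E i) X V W = asd_form ((- \<sigma>) *\<^sub>R target_curvature i X) V W *\<^sub>R jmat (gram E i X)" for V W
  proof -
    have "curvature (pot E i) X V W = matrix_inv (s i X) ** (s i X ** curvature (pot E i) X V W)"
      using dn by (simp add: matrix_inv_mult_cancel)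
    also have "\<dots> = - asd_form (target_curvature i X) V W *\<^sub>R (matrix_inv (s i X) ** jmat (target_gram i X) ** s i X)"
      unfolding c target_curvature(3)[OF i(1)] by (simp add: matrix_mult_algebra matrix_mul_assoc)
    finally show ?thesis unfolding j asd_form_scale by (simp add: mult.commute)
  qed
  moreover have "transpose ((- \<sigma>) *\<^sub>R target_curvature i X) = (- \<sigma>) *\<^sub>R target_curvature i X"
    unfolding linear_cmul[OF bounded_linear.linear[OF bounded_linear_transpose]] target_curvature(1)[OF i(1)] ..
  ultimately show ?thesis unfolding \<sigma>_def[symmetric] by (intro curvature_matrix(3)[OF i(1,2)])
qed

text \<open>At one plane the two sections differ by a rotation, as their determinants have the same
  sign. Its angle, corrected to the orientation of the chart \<open>g\<close>, is then used over all
  of \<open>V\<close>.\<close>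

lemma adjust_section:
  assumes g: "det g \<noteq> 0" and W: "gr_open W" "section_on s W" and V: "gr_open V" "section_on t V" "V \<subseteq> range (Psi g)"
    and p: "Psi g Y \<in> W" "Psi g Y \<in> V"
  obtains c where "section_on (rot g c t) V" "agree_on (rot g c t) s {Psi g Y}"
proof -
  obtain i X where i: "i \<in> patches E" "X \<in> patch_dom E i" "Psi (chart E i) X = Psi g Y"
    by (rule patch_exists[OF g])
  have sec: "section_at s i X" "section_at t i X"
    by (rule section_onD[OF W(2) i(1,2)] section_onD[OF V(2) i(1,2)], simp only: i(3) p)+
  have "(- sgn (det (t i X))) *\<^sub>R target_curvature i X = (- sgn (det (s i X))) *\<^sub>R target_curvature i X"
    using section_det_sign[OF W i(1,2)] section_det_sign[OF V(1,2) i(1,2)] p i(3) by simp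
  moreover have "target_curvature i X \<noteq> 0" using target_curvature(2)[OF i(1), of X] by auto
  ultimately have sg: "sgn (det (s i X)) = sgn (det (t i X))" by simp
  have gr: "transpose (s i X) ** target_gram i X ** s i X = gram E i X" "transpose (t i X) ** target_gram i X ** t i X = gram E i X"
    using sec by (auto simp: section_at_def)
  obtain d where d: "s i X = rotation (target_gram i X) d ** t i X"
    by (rule isometries_differ_by_rotation[OF pos_def_target_gram[OF i(1)] gr(2,1) section_det[OF sec(2) i(1,2)] sg])
  have dn: "det (chart_den (chart E i) g X) \<noteq> 0" using Psi_eq_iff[OF det_chart_nz[OF i(1)] g] i(3) by blast
  define c where "c = sgn (det (chart_den (chart E i) g X)) * d"
  have "rot g c t i X = s i X" unfolding d rot_def c_def using dn by (simp add: sgn_if)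
  note sr = section_on_rot[OF g V(2,3), of c]
  have "agree_on (rot g c t) s {Psi (chart E i) X}"
    by (rule agree_at[OF section_on_subset[OF sr] section_on_subset[OF W(2)] i(1,2), of "W \<inter> V"])
      (use p i(3) \<open>rot g c t i X = s i X\<close> in auto)
  then show thesis unfolding i(3) by (rule that[OF sr])
qed

end

section \<open>Continuation of a section over growing balls of a chart\<close>

lemma midpoint_in_ball:
  fixes x y :: "'a::euclidean_space"
  assumes "norm x = r" "norm y = r" "x \<noteq> y"
  shows "norm (midpoint x y) < r"
proof -
  have "0 < (norm (x - y))\<^sup>2" using assms(3) by simp
  moreover have "(norm (x + y))\<^sup>2 + (norm (x - y))\<^sup>2 = 2 * (norm x)\<^sup>2 + 2 * (norm y)\<^sup>2"
    by (simp add: power2_norm_eq_inner inner_add_left inner_add_right inner_diff_left inner_diff_right inner_commute)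
  ultimately have "(norm (x + y))\<^sup>2 < 4 * r\<^sup>2" unfolding assms(1,2) by linarith
  also have "4 * r\<^sup>2 = (2 * r)\<^sup>2" by (simp add: power_mult_distrib)
  finally have "(norm (x + y))\<^sup>2 < (2 * r)\<^sup>2" .
  moreover have "0 \<le> 2 * r" unfolding assms(1)[symmetric] by simp
  ultimately have "norm (x + y) < 2 * r" by (rule power2_less_imp_less)
  then show ?thesis by (simp add: midpoint_def)
qed

lemma sphere_projection:
  fixes Y :: "'a::real_normed_vector"
  assumes "0 < r" "r \<le> norm Y"
  shows "norm ((r / norm Y) *\<^sub>R Y) = r" "dist ((r / norm Y) *\<^sub>R Y) Y = norm Y - r"
proof -
  have n: "norm Y > 0" using assms by linarith
  show "norm ((r / norm Y) *\<^sub>R Y) = r" using assms n by simp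
  have "(r / norm Y) *\<^sub>R Y - Y = (r / norm Y - 1) *\<^sub>R Y" by (simp add: scaleR_diff_left)
  then have "dist ((r / norm Y) *\<^sub>R Y) Y = \<bar>r / norm Y - 1\<bar> * norm Y" by (simp add: dist_norm)
  also have "\<dots> = norm Y - r" using assms n by (simp add: abs_if field_simps)
  finally show "dist ((r / norm Y) *\<^sub>R Y) Y = norm Y - r" .
qed

context basic_curvature_solution
begin

lemma section_near:
  assumes "det g \<noteq> 0"
  obtains G s where "open G" "Y \<in> G" "section_on s (Psi g ` G)"
proof -
  obtain i X where i: "i \<in> patches E" "X \<in> patch_dom E i" "Psi (chart E i) X = Psi g Y"
    by (rule patch_exists[OF assms])
  obtain r s where r: "r > 0" "section_on s (Psi (chart E i) ` ball X r)" by (rule local_section[OF i(1,2)])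
  show thesis
  proof (rule that)
    show "open {Y. Psi g Y \<in> Psi (chart E i) ` ball X r}"
      using gr_open_image[OF det_chart_nz[OF i(1)] open_ball] assms unfolding gr_open_def by blast
    show "Y \<in> {Y. Psi g Y \<in> Psi (chart E i) ` ball X r}"
      unfolding mem_Collect_eq i(3)[symmetric] using r(1) by (intro imageI) simp
    show "section_on s (Psi g ` {Y. Psi g Y \<in> Psi (chart E i) ` ball X r})"
      by (rule section_on_subset[OF r(2)]) blast
  qed
qed

lemma agree_on_connected:
  assumes g: "det g \<noteq> 0" and S: "open G" "section_on s (Psi g ` G)" "open H" "section_on t (Psi g ` H)"
    and C: "connected C" "C \<subseteq> G" "C \<subseteq> H" "Y \<in> C" and a: "agree_on s t {Psi g Y}"
  shows "agree_on s t (Psi g ` C)"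
proof -
  have i: "Psi g ` (G \<inter> H) \<subseteq> Psi g ` G" "Psi g ` (G \<inter> H) \<subseteq> Psi g ` H" "Psi g ` C \<subseteq> Psi g ` (G \<inter> H)"
    using C by blast+
  show ?thesis
    by (rule unique_continuation[OF g gr_open_image[OF g open_Int[OF S(1,3)]] section_on_subset[OF S(2) i(1)]
        section_on_subset[OF S(4) i(2)] C(1) i(3) C(4) a])
qed

lemma section_adjusted:
  assumes g: "det g \<noteq> 0" and S: "open G" "section_on s (Psi g ` G)" "open H" "section_on t (Psi g ` H)"
    and Y: "Y \<in> G" "Y \<in> H" and C: "connected (G \<inter> H)"
  obtains t' where "section_on t' (Psi g ` H)" "agree_on s t' (Psi g ` (G \<inter> H))"
proof -
  have Hr: "Psi g ` H \<subseteq> range (Psi g)" by blast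
  obtain c where c: "section_on (rot g c t) (Psi g ` H)" "agree_on (rot g c t) s {Psi g Y}"
    by (rule adjust_section[OF g gr_open_image[OF g S(1)] S(2) gr_open_image[OF g S(3)] S(4) Hr imageI[OF Y(1)] imageI[OF Y(2)]])
  have "agree_on s (rot g c t) (Psi g ` (G \<inter> H))"
    by (rule agree_on_connected[OF g S(1,2,3) c(1) C _ _ _ agree_on_sym[OF c(2)]]) (use Y in auto)
  with c(1) show thesis by (rule that)
qed

text \<open>This glues an infinite family of sections at once: at the plane with coordinate Y in the
  chart \<open>g\<close> it takes the value of \<open>f Y\<close>.\<close>

definition select :: "real^4^4 \<Rightarrow> (M2 \<Rightarrow> 'i \<Rightarrow> M2 \<Rightarrow> M2) \<Rightarrow> 'i \<Rightarrow> M2 \<Rightarrow> M2" where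
  "select g f i X = f (chart_change (chart E i) g X) i X"

lemma agree_select:
  assumes g: "det g \<noteq> 0" and a: "\<And>Y. Y \<in> V \<Longrightarrow> agree_on (f Y) s {Psi g Y}"
  shows "agree_on (select g f) s (Psi g ` V)"
  unfolding agree_on_def
proof (intro ballI impI)
  fix i X assume i: "i \<in> patches E" "X \<in> patch_dom E i" and p: "Psi (chart E i) X \<in> Psi g ` V"
  obtain Y where Y: "Psi (chart E i) X = Psi g Y" "Y \<in> V" using p by (rule imageE)
  have e: "chart_change (chart E i) g X = Y" using Psi_eq_iff[OF det_chart_nz[OF i(1)] g, of X Y] Y(1) by auto
  have "f Y i X = s i X" by (rule agree_onD[OF a[OF Y(2)] i]) (simp add: Y(1))
  then show "select g f i X = s i X" by (simp add: select_def e)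
qed

text \<open>A section over the ball of radius \<open>r\<close> is continued across its boundary sphere by sections
  over balls of radius \<open>\<delta>\<close> centred at the sphere; two of these which meet also meet inside the ball
  of radius \<open>r\<close>, namely at the midpoint of their centres.\<close>

lemma enlarge_ball:
  assumes g: "det g \<noteq> 0" and r: "r > 0" "\<delta> > 0" and s: "section_on s (Psi g ` ball 0 r)"
    and loc: "\<And>x. norm x = r \<Longrightarrow> \<exists>t. section_on t (Psi g ` ball x \<delta>)"
  obtains t where "section_on t (Psi g ` ball 0 (r + \<delta>))"
proof -
  have "\<exists>t. section_on t (Psi g ` ball x \<delta>) \<and> agree_on s t (Psi g ` (ball 0 r \<inter> ball x \<delta>))" if x: "norm x = r" for x
  proof -
    obtain t where t: "section_on t (Psi g ` ball x \<delta>)" using loc[OF x] by (rule exE)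
    \<comment> \<open>The point \<open>l *\<^sub>R x\<close> lies in both balls: its distance (1 -
      l) r from \<open>x\<close> is at most \<delta> / 2. The bound 1/2 keeps \<open>l\<close>
      positive when \<delta> is large.\<close>
    define l where "l = max (1/2) (1 - \<delta> / (2 * r))"
    have l: "0 < l" "l < 1" "(1 - l) * r < \<delta>"
    proof -
      show "0 < l" by (simp add: l_def)
      show "l < 1" using r by (simp add: l_def)
      have "1 - l \<le> \<delta> / (2 * r)" by (simp add: l_def)
      then have "(1 - l) * r \<le> \<delta> / (2 * r) * r" using r by (intro mult_right_mono) auto
      then show "(1 - l) * r < \<delta>" using r by simp
    qed
    have "x - l *\<^sub>R x = (1 - l) *\<^sub>R x" by (simp add: scaleR_diff_left)
    then have "dist x (l *\<^sub>R x) = (1 - l) * r" using l x by (simp add: dist_norm)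
    then have y: "l *\<^sub>R x \<in> ball x \<delta>" using l by simp
    have z: "l *\<^sub>R x \<in> ball 0 r" using l x r by simp
    have "connected (ball 0 r \<inter> ball x \<delta>)" by (intro convex_connected convex_Int convex_ball)
    from section_adjusted[OF g open_ball s open_ball t z y this] show ?thesis by blast
  qed
  then obtain \<tau> where \<tau>: "\<And>x. norm x = r \<Longrightarrow> section_on (\<tau> x) (Psi g ` ball x \<delta>)"
    "\<And>x. norm x = r \<Longrightarrow> agree_on s (\<tau> x) (Psi g ` (ball 0 r \<inter> ball x \<delta>))" by metis
  \<comment> \<open>Radial projection to the sphere of radius \<open>r\<close>: beyond the sphere
    the section centred at the projected point is used.\<close>
  define \<pi> where "\<pi> Y = (r / norm Y) *\<^sub>R Y" for Y :: M2
  define f where "f Y = (if norm Y < r then s else \<tau> (\<pi> Y))" for Y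
  have \<pi>: "norm (\<pi> Y) = r" "Y \<in> ball (\<pi> Y) \<delta>" if "\<not> norm Y < r" "norm Y < r + \<delta>" for Y
    using sphere_projection[OF r(1), of Y] that by (simp_all add: \<pi>_def)
  have 1: "agree_on (select g f) s (Psi g ` ball 0 r)"
    by (rule agree_select[OF g]) (simp add: f_def agree_on_refl)
  have 2: "agree_on (select g f) (\<tau> x) (Psi g ` (ball x \<delta> \<inter> ball 0 (r + \<delta>)))" if x: "norm x = r" for x
  proof (rule agree_select[OF g])
    fix Y assume Y: "Y \<in> ball x \<delta> \<inter> ball 0 (r + \<delta>)"
    show "agree_on (f Y) (\<tau> x) {Psi g Y}"
    proof (cases "norm Y < r")
      case True
      then have "Psi g Y \<in> Psi g ` (ball 0 r \<inter> ball x \<delta>)" using Y by simp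
      then show ?thesis unfolding f_def using True by (simp, intro agree_on_subset[OF \<tau>(2)[OF x]]) blast
    next
      case False
      then have p: "norm (\<pi> Y) = r" "Y \<in> ball (\<pi> Y) \<delta>" using \<pi>[of Y] Y by auto
      have "agree_on (\<tau> (\<pi> Y)) (\<tau> x) {Psi g Y}"
      proof (cases "\<pi> Y = x")
        case True
        then show ?thesis by (simp add: agree_on_refl)
      next
        case ne: False
        let ?m = "midpoint (\<pi> Y) x"
        have "dist (\<pi> Y) x \<le> dist (\<pi> Y) Y + dist x Y" by (rule dist_triangle2)
        then have d: "dist (\<pi> Y) x < 2 * \<delta>" using p(2) Y by simp
        have m: "?m \<in> ball 0 r" "?m \<in> ball (\<pi> Y) \<delta>" "?m \<in> ball x \<delta>"
          using midpoint_in_ball[OF p(1) x ne] d by (simp_all add: dist_midpoint)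
        have ms: "agree_on s (\<tau> (\<pi> Y)) {Psi g ?m}" "agree_on s (\<tau> x) {Psi g ?m}"
          by (rule agree_on_subset[OF \<tau>(2)[OF p(1)]], use m in simp, rule agree_on_subset[OF \<tau>(2)[OF x]], use m in simp)
        have "agree_on (\<tau> (\<pi> Y)) (\<tau> x) (Psi g ` (ball (\<pi> Y) \<delta> \<inter> ball x \<delta>))"
          by (rule agree_on_connected[OF g open_ball \<tau>(1)[OF p(1)] open_ball \<tau>(1)[OF x] _ _ _ _
              agree_on_trans[OF agree_on_sym[OF ms(1)] ms(2)]])
            (use m in \<open>auto intro: convex_connected convex_Int\<close>)
        then show ?thesis by (rule agree_on_subset) (use p(2) Y in auto)
      qed
      then show ?thesis using False by (simp add: f_def)
    qed
  qed
  have "section_on (select g f) (Psi g ` ball 0 (r + \<delta>))"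
  proof (rule section_glue)
    fix p assume "p \<in> Psi g ` ball 0 (r + \<delta>)"
    then obtain Y where Y: "p = Psi g Y" "Y \<in> ball 0 (r + \<delta>)" by (rule imageE)
    show "\<exists>V s'. gr_open V \<and> p \<in> V \<and> section_on s' V \<and> agree_on (select g f) s' V"
    proof (cases "norm Y < r")
      case True
      have "p \<in> Psi g ` ball 0 r" unfolding Y(1) by (rule imageI) (use True in simp)
      then show ?thesis using gr_open_image[OF g open_ball] s 1 by (intro exI conjI)
    next
      case False
      then have q: "norm (\<pi> Y) = r" "Y \<in> ball (\<pi> Y) \<delta>" using \<pi>[of Y] Y(2) by auto
      have "p \<in> Psi g ` (ball (\<pi> Y) \<delta> \<inter> ball 0 (r + \<delta>))" unfolding Y(1) by (rule imageI) (use q Y in simp)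
      moreover have "section_on (\<tau> (\<pi> Y)) (Psi g ` (ball (\<pi> Y) \<delta> \<inter> ball 0 (r + \<delta>)))"
        by (rule section_on_subset[OF \<tau>(1)[OF q(1)]]) blast
      ultimately show ?thesis using gr_open_image[OF g open_Int[OF open_ball open_ball]] 2[OF q(1)]
        by (intro exI conjI)
    qed
  qed
  then show thesis by (rule that)
qed

text \<open>Compactness of a slightly larger ball provides a uniform radius \<delta> on which local
  sections exist, a Lebesgue number of the cover. The radius then grows in steps of
  \<delta>.\<close>

lemma section_on_ball:
  assumes g: "det g \<noteq> 0"
  shows "\<exists>s. section_on s (Psi g ` ball 0 (real m))"
proof -
  let ?G = "{G. open G \<and> (\<exists>s. section_on s (Psi g ` G))}"
  have "cball 0 (real m + 1) \<subseteq> \<Union>?G"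
  proof
    fix Y :: M2
    obtain G s where "open G" "Y \<in> G" "section_on s (Psi g ` G)" by (rule section_near[OF g])
    then show "Y \<in> \<Union>?G" by blast
  qed
  then obtain e where e: "e > 0" "\<And>x. x \<in> cball 0 (real m + 1) \<Longrightarrow> \<exists>G\<in>?G. ball x e \<subseteq> G"
    using Heine_Borel_lemma[of "cball 0 (real m + 1)" ?G] by (metis (mono_tags, lifting) compact_cball mem_Collect_eq)
  define \<delta> where "\<delta> = min e 1"
  have \<delta>: "\<delta> > 0" "\<delta> \<le> 1" using e(1) by (auto simp: \<delta>_def)
  have loc: "\<exists>t. section_on t (Psi g ` ball x \<delta>)" if x: "norm x \<le> real m + 1" for x :: M2
  proof -
    have "x \<in> cball 0 (real m + 1)" using x by simp
    from e(2)[OF this] obtain G t where G: "ball x e \<subseteq> G" "section_on t (Psi g ` G)" by blast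
    have "ball x \<delta> \<subseteq> G" using G(1) subset_ball[of \<delta> e x] by (auto simp: \<delta>_def)
    then show ?thesis using section_on_subset[OF G(2) image_mono] by blast
  qed
  have n: "\<exists>s. section_on s (Psi g ` ball 0 (real (Suc n) * \<delta>))" if "real n * \<delta> \<le> real m + 1" for n
    using that
  proof (induction n)
    case 0
    then show ?case using loc[of 0] by simp
  next
    case (Suc n)
    have "real n * \<delta> \<le> real m + 1" using Suc.prems \<delta> by (simp add: algebra_simps)
    from Suc.IH[OF this] obtain s where s: "section_on s (Psi g ` ball 0 (real (Suc n) * \<delta>))" by (rule exE)
    have rp: "real (Suc n) * \<delta> > 0" using \<delta> by simp
    obtain t where t: "section_on t (Psi g ` ball 0 (real (Suc n) * \<delta> + \<delta>))"
      by (rule enlarge_ball[OF g rp \<delta>(1) s loc]) (use Suc.prems in simp)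
    have "real (Suc n) * \<delta> + \<delta> = real (Suc (Suc n)) * \<delta>" by (simp add: algebra_simps)
    with t show ?case by (intro exI) simp
  qed
  \<comment> \<open>The last step whose centres still lie in the compact ball; after it the radius
    exceeds \<open>real m + 1\<close>.\<close>
  define N where "N = nat \<lfloor>(real m + 1) / \<delta>\<rfloor>"
  have q: "0 \<le> (real m + 1) / \<delta>" using \<delta> by simp
  then have "real N \<le> (real m + 1) / \<delta>" "(real m + 1) / \<delta> < real N + 1" unfolding N_def by linarith+
  then have N: "real N * \<delta> \<le> real m + 1" "real m + 1 < real (Suc N) * \<delta>" using \<delta> by (simp_all add: field_simps)
  from n[OF N(1)] obtain s where s: "section_on s (Psi g ` ball 0 (real (Suc N) * \<delta>))" by (rule exE)
  have "ball 0 (real m) \<subseteq> (ball 0 (real (Suc N) * \<delta>) :: M2 set)" using N(2) by (intro subset_ball) linarith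
  from section_on_subset[OF s image_mono[OF this]] show ?thesis by (rule exI[of _ s])
qed

text \<open>Sections over the balls of integral radius are adjusted to agree at the origin. By
  unique continuation any two then agree where both are defined, so at each plane any sufficiently
  large ball may be used.\<close>

theorem chart_section:
  assumes g: "det g \<noteq> 0"
  obtains s where "section_on s (range (Psi g))"
proof -
  obtain s0 where s0: "section_on s0 (Psi g ` ball 0 (real 1))" using section_on_ball[OF g, of 1] by (rule exE)
  have "\<exists>s. section_on s (Psi g ` ball 0 (real (Suc m))) \<and> agree_on s0 s {Psi g 0}" for m
  proof -
    obtain t where t: "section_on t (Psi g ` ball 0 (real (Suc m)))" using section_on_ball[OF g, of "Suc m"] by (rule exE)
    have "connected (ball 0 (real 1) \<inter> ball (0::M2) (real (Suc m)))" by (intro convex_connected convex_Int convex_ball)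
    then obtain t' where t': "section_on t' (Psi g ` ball 0 (real (Suc m)))" "agree_on s0 t' (Psi g ` (ball 0 (real 1) \<inter> ball 0 (real (Suc m))))"
      by (rule section_adjusted[OF g open_ball s0 open_ball t, of 0, rotated 2]) simp_all
    have "agree_on s0 t' {Psi g 0}" by (rule agree_on_subset[OF t'(2)]) simp
    with t'(1) show ?thesis by blast
  qed
  then obtain \<sigma> where \<sigma>: "\<And>m. section_on (\<sigma> m) (Psi g ` ball 0 (real (Suc m)))" "\<And>m. agree_on s0 (\<sigma> m) {Psi g 0}"
    by metis
  have c: "agree_on (\<sigma> k) (\<sigma> m) {Psi g Y}" if Y: "norm Y < real (Suc k)" "norm Y < real (Suc m)" for k m and Y :: M2
  proof -
    have "agree_on (\<sigma> k) (\<sigma> m) (Psi g ` (ball 0 (real (Suc k)) \<inter> ball 0 (real (Suc m))))"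
      by (rule agree_on_connected[OF g open_ball \<sigma>(1) open_ball \<sigma>(1) _ _ _ _ agree_on_trans[OF agree_on_sym[OF \<sigma>(2)] \<sigma>(2)]])
        (auto intro: convex_connected convex_Int)
    then show ?thesis by (rule agree_on_subset) (use Y in simp)
  qed
  define f where "f Y = \<sigma> (nat \<lceil>norm Y\<rceil>)" for Y :: M2
  have fY: "norm Y < real (Suc (nat \<lceil>norm Y\<rceil>))" for Y :: M2 by (simp add: less_ceiling_iff) linarith
  have "section_on (select g f) (range (Psi g))"
  proof (rule section_glue)
    fix p assume "p \<in> range (Psi g)"
    then obtain Y where Y: "p = Psi g Y" by blast
    let ?m = "nat \<lceil>norm Y\<rceil>"
    have "agree_on (select g f) (\<sigma> ?m) (Psi g ` ball 0 (real (Suc ?m)))"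
      by (rule agree_select[OF g]) (unfold f_def, rule c[OF fY], simp)
    moreover have "p \<in> Psi g ` ball 0 (real (Suc ?m))" unfolding Y by (rule imageI) (use fY[of Y] in simp)
    ultimately show "\<exists>V s'. gr_open V \<and> p \<in> V \<and> section_on s' V \<and> agree_on (select g f) s' V"
      using gr_open_image[OF g open_ball] \<sigma>(1)[of ?m] by (intro exI conjI)
  qed
  then show thesis by (rule that)
qed

end

section \<open>Gluing over the coordinate charts\<close>

lemma chart_den_coord_chart:
  assumes "coord_chart i j k l \<in> coord_charts"
  shows "chart_den g (coord_chart i j k l) X = vector [std_frame g X $ k, std_frame g X $ l]"
proof -
  have "transpose (coord_chart i j k l) ** g ** stack X (mat 1) = transpose (coord_chart i j k l) ** std_frame g X"
    by (simp add: std_frame_def matrix_mul_assoc)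
  then show ?thesis unfolding chart_den_def matrix_inv_coord_chart[OF assms] by (simp only: blocks_coord_chart)
qed

lemma std_frame_coord_chart:
  "std_frame (coord_chart i j k l) X $ m = (if m = i then X $ 1 else 0) + (if m = j then X $ 2 else 0)
     + (if m = k then axis 1 1 else 0) + (if m = l then axis 2 1 else 0)"
  by (auto simp: std_frame_def coord_chart_def matrix_matrix_mult_def sum_4 stack_def transpose_def vec_eq_iff forall_2 mat_def)

lemma coord_chart_in: 
  "coord_chart 1 2 3 4 \<in> coord_charts" "coord_chart 4 2 1 3 \<in> coord_charts" "coord_chart 2 3 1 4 \<in> coord_charts"
  "coord_chart 1 4 2 3 \<in> coord_charts" "coord_chart 3 1 2 4 \<in> coord_charts" "coord_chart 3 4 1 2 \<in> coord_charts"
  by (simp_all add: coord_charts_def)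

lemma convex_coordinate_halfspace: "convex {X :: M2. 0 < \<tau> * X $ a $ b}"
proof -
  have "{X :: M2. 0 < \<tau> * X $ a $ b} = {X. inner (axis a (axis b \<tau>)) X > 0}"
    by (simp add: inner_axis')
  then show ?thesis by (simp only: convex_halfspace_gt)
qed

context basic_curvature_solution
begin

lemma glue_two:
  assumes W: "gr_open W" "section_on s W" and V: "gr_open V" "section_on t V" and a: "agree_on s t (W \<inter> V)"
  obtains u where "section_on u (W \<union> V)"
proof -
  define u where "u i X = (if Psi (chart E i) X \<in> W then s i X else t i X)" for i X
  have 1: "agree_on u s W" by (simp add: agree_on_def u_def)
  have 2: "agree_on u t V" using a by (simp add: agree_on_def u_def)
  have "section_on u (W \<union> V)"
  proof (rule section_glue)
    fix p assume "p \<in> W \<union> V"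
    then show "\<exists>V' s'. gr_open V' \<and> p \<in> V' \<and> section_on s' V' \<and> agree_on u s' V'"
    proof
      assume "p \<in> W"
      with W 1 show ?thesis by (intro exI conjI)
    next
      assume "p \<in> V"
      with V 2 show ?thesis by (intro exI conjI)
    qed
  qed
  then show thesis by (rule that)
qed

text \<open>The situation of two coordinate charts whose pairs of independent coordinates share one
  index: the transition determinant is then a single entry up to sign, and the overlap consists of
  two convex half-spaces of the chart \<open>g\<close>.\<close>

context
  fixes g k :: "real^4^4" and a b :: 2 and \<sigma> :: real
  assumes g: "det g \<noteq> 0" and k: "det k \<noteq> 0"
    and \<sigma>: "\<sigma> = 1 \<or> \<sigma> = -1" "\<And>X. det (chart_den g k X) = \<sigma> * X $ a $ b"
begin

definition halfspace :: "real \<Rightarrow> M2 set" where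
  "halfspace \<tau> = {X. 0 < \<tau> * X $ a $ b}"

lemma halfspace: "open (halfspace \<tau>)" "connected (halfspace \<tau>)"
  "X \<in> halfspace \<tau> \<Longrightarrow> Psi g X \<in> range (Psi k)"
proof -
  show "open (halfspace \<tau>)" unfolding halfspace_def by (intro open_Collect_less continuous_intros)
  show "connected (halfspace \<tau>)" unfolding halfspace_def by (intro convex_connected convex_coordinate_halfspace)
  assume "X \<in> halfspace \<tau>"
  then have "det (chart_den g k X) \<noteq> 0" using \<sigma> by (auto simp: halfspace_def)
  from Psi_chart_change[OF g k this] show "Psi g X \<in> range (Psi k)" by (metis rangeI)
qed

lemma point_of_halfspace_near:
  fixes Y :: M2
  assumes "Y $ a $ b = 0" "r > 0" "\<tau> = 1 \<or> \<tau> = -1"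
  obtains Z where "Z \<in> ball Y r" "Z \<in> halfspace \<tau>"
proof -
  let ?Z = "Y + axis a (axis b (\<tau> * (r / 2)))"
  have "norm (axis a (axis b (\<tau> * (r / 2))) :: M2) = r / 2"
    using assms by (auto simp: norm_eq_sqrt_inner inner_axis_axis real_sqrt_divide)
  then have "dist Y ?Z = r / 2" by (simp add: dist_norm)
  then have "?Z \<in> ball Y r" using assms by simp
  moreover have "?Z \<in> halfspace \<tau>" using assms by (auto simp: halfspace_def)
  ultimately show thesis by (rule that)
qed

text \<open>The part of the chart \<open>g\<close> inside \<open>W\<close> contains both half-spaces
  and, at \<open>Y0\<close>, a point of the hyperplane between them. Agreement at \<open>Y0\<close>
  therefore spreads to both half-spaces and from there to every other point of the hyperplane that
  lies in \<open>W\<close>. Hence a single rotation suffices.\<close>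

lemma extend_section:
  assumes W: "gr_open W" "section_on s W" "range (Psi k) \<subseteq> W"
    and Y0: "Y0 $ a $ b = 0" "Psi g Y0 \<in> W"
  obtains s' where "section_on s' (W \<union> range (Psi g))"
proof -
  define G where "G = {X. Psi g X \<in> W}"
  have G: "open G" using W(1) g unfolding gr_open_def G_def by blast
  have sG: "section_on s (Psi g ` G)" by (rule section_on_subset[OF W(2)]) (auto simp: G_def)
  have hG: "halfspace \<tau> \<subseteq> G" for \<tau> unfolding G_def using halfspace(3) W(3) by blast
  obtain t0 where t0: "section_on t0 (range (Psi g))" by (rule chart_section[OF g])
  have UG: "Y0 \<in> G" using Y0 by (simp add: G_def)
  obtain c where t: "section_on (rot g c t0) (Psi g ` UNIV)" "agree_on (rot g c t0) s {Psi g Y0}"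
    by (rule adjust_section[OF g W(1,2) gr_open_image[OF g open_UNIV] t0 subset_refl Y0(2) rangeI])
  note ag = agree_on_connected[OF g open_UNIV t(1) G sG]
  have near: "agree_on (rot g c t0) s (Psi g ` ball Y r)" if "Z \<in> ball Y r" "ball Y r \<subseteq> G" "agree_on (rot g c t0) s {Psi g Z}" for Y Z r
    by (rule ag[OF _ subset_UNIV that(2,1,3)]) (intro convex_connected convex_ball)
  have half: "agree_on (rot g c t0) s (Psi g ` halfspace \<tau>)" if \<tau>: "\<tau> = 1 \<or> \<tau> = -1" for \<tau>
  proof -
    obtain r where r: "r > 0" "ball Y0 r \<subseteq> G" using G UG open_contains_ball by blast
    obtain Z where Z: "Z \<in> ball Y0 r" "Z \<in> halfspace \<tau>" by (rule point_of_halfspace_near[OF Y0(1) r(1) \<tau>])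
    have "Y0 \<in> ball Y0 r" using r(1) by simp
    from near[OF this r(2) t(2)] have "agree_on (rot g c t0) s {Psi g Z}"
      by (rule agree_on_subset) (use Z(1) in blast)
    from ag[OF halfspace(2) subset_UNIV hG Z(2) this] show ?thesis .
  qed
  have "agree_on (rot g c t0) s {Psi g Y}" if Y: "Y \<in> G" for Y
  proof -
    consider "Y $ a $ b = 0" | "Y \<in> halfspace 1" | "Y \<in> halfspace (-1)" by (fastforce simp: halfspace_def)
    then show ?thesis
    proof cases
      case 1
      obtain r where r: "r > 0" "ball Y r \<subseteq> G" using G Y open_contains_ball by blast
      obtain Z where Z: "Z \<in> ball Y r" "Z \<in> halfspace 1" by (rule point_of_halfspace_near[OF 1 r(1), of 1]) simp
      have "agree_on (rot g c t0) s {Psi g Z}" by (rule agree_on_subset[OF half[of 1]]) (use Z(2) in simp_all)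
      from near[OF Z(1) r(2) this] show ?thesis by (rule agree_on_subset) (use r(1) in simp)
    next
      case 2
      show ?thesis by (rule agree_on_subset[OF half[of 1]]) (use 2 in simp_all)
    next
      case 3
      show ?thesis by (rule agree_on_subset[OF half[of "-1"]]) (use 3 in simp_all)
    qed
  qed
  then have eq: "agree_on (rot g c t0) s {Psi g Y}" if "Psi g Y \<in> W" for Y using that by (simp add: G_def)
  have "agree_on s (rot g c t0) (W \<inter> range (Psi g))"
  proof (rule agree_on_pointwise)
    fix p assume "p \<in> W \<inter> range (Psi g)"
    then obtain Y where Y: "p = Psi g Y" "Psi g Y \<in> W" by blast
    show "agree_on s (rot g c t0) {p}" unfolding Y(1) by (rule agree_on_sym[OF eq[OF Y(2)]])
  qed
  from glue_two[OF W(1,2) gr_open_image[OF g open_UNIV] t(1) this] that show thesis .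
qed

text \<open>The two rotation angles by which the sections over the two charts differ on the two components
  of the overlap can be removed simultaneously because the orientations of the charts agree on one
  component and are opposite on the other.\<close>

lemma section_on_two_charts:
  obtains s where "section_on s (range (Psi k) \<union> range (Psi g))"
proof -
  obtain s where s: "section_on s (range (Psi k))" by (rule chart_section[OF k])
  obtain t where t: "section_on t (range (Psi g))" by (rule chart_section[OF g])
  note ok = gr_open_image[OF k open_UNIV] and og = gr_open_image[OF g open_UNIV]
  have "\<exists>c. agree_on (rot g c t) s (Psi g ` halfspace \<tau>)" if \<tau>: "\<tau> = 1 \<or> \<tau> = -1" for \<tau>
  proof -
    obtain Z :: M2 where Z: "Z \<in> halfspace \<tau>" by (rule point_of_halfspace_near[of 0 1, OF _ _ \<tau>]) simp_all
    obtain c where c: "section_on (rot g c t) (range (Psi g))" "agree_on (rot g c t) s {Psi g Z}"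
      by (rule adjust_section[OF g ok s og t subset_refl halfspace(3)[OF Z] rangeI])
    have "section_on s (Psi g ` halfspace \<tau>)" by (rule section_on_subset[OF s]) (use halfspace(3) in blast)
    from agree_on_connected[OF g open_UNIV c(1) halfspace(1) this halfspace(2) subset_UNIV subset_refl Z c(2)]
    show ?thesis by (rule exI[of _ c])
  qed
  from this[of 1] this[of "-1"] obtain c d where cd: "agree_on (rot g c t) s (Psi g ` halfspace 1)" "agree_on (rot g d t) s (Psi g ` halfspace (-1))"
    by auto
  \<comment> \<open>The solution of \<sigma> m + c = e and - \<sigma> m + d = e, one equation for
    each component of the overlap.\<close>
  define m where "m = \<sigma> * (d - c) / 2"
  define e where "e = (c + d) / 2"
  have *: "agree_on (rot k m s) (rot g e t) (Psi g ` halfspace \<tau>)"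
    if c: "agree_on (rot g c t) s (Psi g ` halfspace \<tau>)" and \<tau>: "\<tau> = 1 \<or> \<tau> = -1" and e: "\<tau> * \<sigma> * m + c = e" for \<tau> c
  proof (rule agree_on_pointwise)
    fix p assume "p \<in> Psi g ` halfspace \<tau>"
    then obtain Y where Y: "Y \<in> halfspace \<tau>" "p = Psi g Y" by blast
    have sg: "sgn (det (chart_den g k Y)) = \<tau> * \<sigma>"
      using Y(1) \<sigma> \<tau> by (auto simp: halfspace_def sgn_if)
    have dn: "det (chart_den g k Y) \<noteq> 0" using Y(1) \<sigma> by (auto simp: halfspace_def)
    have mm: "\<tau> * \<sigma> * (\<tau> * \<sigma> * m) = m" using \<sigma>(1) \<tau> by auto
    note rot_flip[OF g k Psi_chart_change[OF g k dn, symmetric], of "\<tau> * \<sigma> * m" s]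
    then have 1: "agree_on (rot g (\<tau> * \<sigma> * m) s) (rot k m s) {p}" unfolding sg mm Y(2) .
    have "agree_on (rot g c t) s {p}" by (rule agree_on_subset[OF c]) (use Y in simp)
    from rot_agree[OF this, of g "\<tau> * \<sigma> * m"] have "agree_on (rot g e t) (rot g (\<tau> * \<sigma> * m) s) {p}"
      unfolding e[symmetric] by (simp add: agree_on_def rot_add)
    from agree_on_sym[OF agree_on_trans[OF this 1]] show "agree_on (rot k m s) (rot g e t) {p}" .
  qed
  have 1: "1 * \<sigma> * m + c = e" and 2: "-1 * \<sigma> * m + d = e"
    using \<sigma>(1) by (auto simp: m_def e_def field_simps)
  have "agree_on (rot k m s) (rot g e t) (range (Psi k) \<inter> range (Psi g))"
  proof (rule agree_on_pointwise)
    fix p assume "p \<in> range (Psi k) \<inter> range (Psi g)"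
    then obtain Y Z where Y: "p = Psi g Y" "Psi g Y = Psi k Z" by blast
    then have "\<sigma> * Y $ a $ b \<noteq> 0" using Psi_eq_iff[OF g k, of Y Z] \<sigma>(2) by auto
    then consider "Y \<in> halfspace 1" | "Y \<in> halfspace (-1)" by (fastforce simp: halfspace_def)
    then show "agree_on (rot k m s) (rot g e t) {p}"
    proof cases
      case 1
      show ?thesis by (rule agree_on_subset[OF *[OF cd(1) _ \<open>1 * \<sigma> * m + c = e\<close>]]) (use 1 in \<open>simp_all add: Y(1)\<close>)
    next
      case 2
      show ?thesis by (rule agree_on_subset[OF *[OF cd(2) _ \<open>-1 * \<sigma> * m + d = e\<close>]]) (use 2 in \<open>simp_all add: Y(1)\<close>)
    qed
  qed
  from glue_two[OF ok section_on_rot[OF k s subset_refl] og section_on_rot[OF g t subset_refl] this] that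
  show thesis .
qed

end

text \<open>Only the first pair of charts meets in a disconnected set that requires both angles.
  Each further chart is compared with a chart already covered with which it shares one index, and
  has a point of the separating hyperplane in another chart already covered.\<close>

theorem global_section:
  obtains s where "section_on s Gr"
proof -
  let ?c34 = "coord_chart 1 2 3 4" and ?c13 = "coord_chart 4 2 1 3" and ?c14 = "coord_chart 2 3 1 4"
    and ?c23 = "coord_chart 1 4 2 3" and ?c24 = "coord_chart 3 1 2 4" and ?c12 = "coord_chart 3 4 1 2"
  have n: "det c \<noteq> 0" if "c \<in> coord_charts" for c using det_coord_charts[OF that] by simp
  note nc = coord_chart_in[THEN n]
  note op = nc[THEN gr_open_image, OF open_UNIV]
  note den = coord_chart_in[THEN chart_den_coord_chart] 
  have dt: "det (vector [v, w] :: M2) = v $ 1 * w $ 2 - v $ 2 * w $ 1" for v w :: "real^2" by (simp add: det_2)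
  have mem: "Psi g Y \<in> W" if "det (chart_den g k Y) \<noteq> 0" "det g \<noteq> 0" "det k \<noteq> 0" "range (Psi k) \<subseteq> W" for g k Y W
    using Psi_chart_change[OF that(2,3,1)] that(4) by blast
  have f13: "det (chart_den ?c13 ?c34 X) = -1 * X $ 1 $ 1" and f14: "det (chart_den ?c14 ?c34 X) = 1 * X $ 2 $ 1"
    and f23: "det (chart_den ?c23 ?c34 X) = -1 * X $ 2 $ 1" and f24: "det (chart_den ?c24 ?c34 X) = 1 * X $ 1 $ 1"
    and f12: "det (chart_den ?c12 ?c13 X) = 1 * X $ 1 $ 2" for X
    by (simp_all add: den dt std_frame_coord_chart)
  \<comment> \<open>These matrices lie on the hyperplanes where the determinants above vanish, but
    in the chart named second here, which is covered before they are used.\<close>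
  have q14: "det (chart_den ?c14 ?c13 E22) \<noteq> 0" and q23: "det (chart_den ?c23 ?c13 E11) \<noteq> 0"
    and q24: "det (chart_den ?c24 ?c13 (E21 + E12)) \<noteq> 0" and q12: "det (chart_den ?c12 ?c34 (mat 1)) \<noteq> 0"
    by (simp_all add: den dt std_frame_coord_chart mat_def)
  define W1 where "W1 = range (Psi ?c34) \<union> range (Psi ?c13)"
  define W2 where "W2 = W1 \<union> range (Psi ?c14)"
  define W3 where "W3 = W2 \<union> range (Psi ?c23)"
  define W4 where "W4 = W3 \<union> range (Psi ?c24)"
  note W = W1_def W2_def W3_def W4_def
  have oW: "gr_open W1" "gr_open W2" "gr_open W3" "gr_open W4" unfolding W by (intro gr_open_Un op)+
  have sub: "range (Psi ?c34) \<subseteq> W1" "range (Psi ?c34) \<subseteq> W2" "range (Psi ?c34) \<subseteq> W3" "range (Psi ?c34) \<subseteq> W4"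
    "range (Psi ?c13) \<subseteq> W1" "range (Psi ?c13) \<subseteq> W2" "range (Psi ?c13) \<subseteq> W3" "range (Psi ?c13) \<subseteq> W4"
    unfolding W by blast+
  have pm: "(1::real) = 1 \<or> (1::real) = -1" "(-1::real) = 1 \<or> (-1::real) = -1" by simp_all
  obtain s1 where s1: "section_on s1 W1"
    unfolding W1_def by (rule section_on_two_charts[OF nc(2,1) pm(2) f13])
  obtain s2 where s2: "section_on s2 W2"
    unfolding W2_def by (rule extend_section[OF nc(3,1) pm(1) f14 oW(1) s1 sub(1) _ mem[OF q14 nc(3,2) sub(5)]]) simp
  obtain s3 where s3: "section_on s3 W3"
    unfolding W3_def by (rule extend_section[OF nc(4,1) pm(2) f23 oW(2) s2 sub(2) _ mem[OF q23 nc(4,2) sub(6)]]) simp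
  obtain s4 where s4: "section_on s4 W4"
    unfolding W4_def by (rule extend_section[OF nc(5,1) pm(1) f24 oW(3) s3 sub(3) _ mem[OF q24 nc(5,2) sub(7)]]) simp
  obtain s5 where s5: "section_on s5 (W4 \<union> range (Psi ?c12))"
    by (rule extend_section[OF nc(6,2) pm(1) f12 oW(4) s4 sub(8) _ mem[OF q12 nc(6,1) sub(4)]]) (simp add: mat_def)
  have "Gr \<subseteq> W4 \<union> range (Psi ?c12)"
  proof
    fix p assume "p \<in> Gr"
    then obtain g X where "g \<in> coord_charts" "p = Psi g X" by (rule coord_charts_cover)
    then show "p \<in> W4 \<union> range (Psi ?c12)" unfolding W coord_charts_def by auto
  qed
  from section_on_subset[OF s5 this] show thesis by (rule that)
qed

end

section \<open>The gauge equivalence with a solution from the ansatz\<close>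

context basic_curvature_solution
begin

theorem gauge_equivalent_thooft_solution: "gauge_equivalent E (thooft_solution h)"
proof -
  let ?T = "thooft_solution h"
  obtain s where s: "section_on s Gr" by (rule global_section)
  have sec: "section_at s i X" if "i \<in> patches E" "X \<in> patch_dom E i" for i X
    by (rule section_onD[OF s that Psi_in_Gr[OF det_chart_nz[OF that(1)]]])
  \<comment> \<open>The target has a frame for every chart in SL(4,\<real>), whereas
    \<open>s\<close> refers to the chart of the patch; the factor converts one tautological frame
    into the other.\<close>
  define u where "u i g X = chart_den (chart E i) g X ** s i X" for i g X
  have ovl: "overlap E i ?T g = {X \<in> patch_dom E i. det (chart_den (chart E i) g X) \<noteq> 0}" for i g
    by (simp add: overlap_def)
  have "gauge_equivalence E ?T u"
    unfolding gauge_equivalence_def Let_def thooft_solution_simps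
  proof (intro conjI ballI allI)
    fix i g assume i: "i \<in> patches E" and g': "g \<in> carrier SL4"
    have g: "det g \<noteq> 0" using g' by (simp add: carrier_SL4)
    have oD: "open (overlap E i ?T g)"
    proof -
      have "overlap E i ?T g = patch_dom E i \<inter> chart_dom (chart E i) g" by (auto simp: ovl chart_dom_def)
      then show ?thesis using open_Int[OF open_patch_dom[OF i] open_chart_dom] by simp
    qed
    have bi: "det (h ** chart E i) \<noteq> 0" using det_target[OF i] by simp
    have "smooth_on (patch_dom E i) (s i)"
    proof (rule intertwines_smooth[OF open_patch_dom[OF i]])
      show "intertwines (s i) (pot E i X) (target_pot i X) X" if "X \<in> patch_dom E i" for X
        using sec[OF i that] by (simp add: section_at_def)
      show "smooth_on (patch_dom E i) (\<lambda>X. target_pot i X V)" for V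
        unfolding target_pot_def by (rule smooth_on_basic_pot[OF open_patch_dom[OF i] bi])
    qed (rule smooth_pot[OF i])
    then have "smooth_on (overlap E i ?T g) (s i)" by (rule smooth_on_subset) (auto simp: ovl)
    then show "smooth_on (overlap E i ?T g) (u i g)"
      unfolding u_def[abs_def] by (intro smooth_on_matrix_mult oD smooth_on_chart_den)
    fix X assume X: "X \<in> overlap E i ?T g"
    have Xi: "X \<in> patch_dom E i" and d: "det (chart_den (chart E i) g X) \<noteq> 0" using X by (auto simp: ovl)
    note sX = sec[OF i Xi]
    show du: "det (u i g X) \<noteq> 0" using d section_det[OF sX i Xi] by (simp add: u_def det_mul)
    have "transpose (u i g X) ** euclidean_gram (h ** g) (chart_change (chart E i) g X) ** u i g X
       = transpose (s i X) ** target_gram i X ** s i X"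
      unfolding u_def target_gram_def target_gram_change[OF d det_chart_nz[OF i] g]
      by (simp add: matrix_transpose_mul matrix_mul_assoc)
    then show "gram E i X = transpose (u i g X) ** euclidean_gram (h ** g) (chart_change (chart E i) g X) ** u i g X"
      using sX by (simp add: section_at_def)
    have int: "intertwines (u i g) (pot E i X)
       (\<lambda>V. basic_pot (h ** g) (chart_change (chart E i) g X) (frechet_derivative (chart_change (chart E i) g) (at X) V)) X"
      unfolding u_def[abs_def]
      by (rule intertwines_comp[OF _ intertwines_chart_den[OF _ det_chart_nz[OF i] g d]])
        (use sX det_h in \<open>simp_all add: section_at_def target_pot_def\<close>)
    fix V
    have "pot E i X V = matrix_inv (u i g X) ** (u i g X ** pot E i X V)" using du by (simp add: matrix_inv_mult_cancel)
    also have "\<dots> = matrix_inv (u i g X) **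
         basic_pot (h ** g) (chart_change (chart E i) g X) (frechet_derivative (chart_change (chart E i) g) (at X) V) ** u i g X
         + matrix_inv (u i g X) ** frechet_derivative (u i g) (at X) V"
      unfolding intertwinesD(2)[OF int] by (simp add: matrix_mult_algebra matrix_mul_assoc)
    finally show "pot E i X V = matrix_inv (u i g X) **
         pot ?T g (chart_change (chart E i) g X) (frechet_derivative (chart_change (chart E i) g) (at X) V) ** u i g X
         + matrix_inv (u i g X) ** frechet_derivative (u i g) (at X) V"
      unfolding pot_thooft_solution[OF g' det_h] .
  next
    fix i k g l X
    assume i: "i \<in> patches E" and k: "k \<in> patches E" and g: "g \<in> carrier SL4"
      and X: "X \<in> overlap E i E k \<inter> overlap E i ?T g \<inter> overlap E i ?T l"
    have o: "X \<in> overlap E i E k" and dg: "det (chart_den (chart E i) g X) \<noteq> 0" using X by (auto simp: ovl)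
    have gn: "det g \<noteq> 0" using g by (simp add: carrier_SL4)
    note ik = overlapD[OF i k o]
    have "u k l (chg i k X) ** trans E i k X = chart_den (chart E k) l (chg i k X) ** (den i k X ** s i X)"
      using sec[OF i ik(1)] k o by (simp add: section_at_def u_def matrix_mul_assoc)
    also have "\<dots> = chart_den (chart E i) l X ** s i X"
      unfolding chart_den_cocycle(1)[OF det_chart_nz[OF k] ik(3), of l] by (simp add: matrix_mul_assoc)
    also have "\<dots> = chart_den g l (chart_change (chart E i) g X) ** u i g X"
      unfolding chart_den_cocycle(1)[OF gn dg, of l] by (simp add: u_def matrix_mul_assoc)
    finally show "u k l (chg i k X) ** trans E i k X = chart_den g l (chart_change (chart E i) g X) ** u i g X" .
  qed
  then show ?thesis unfolding gauge_equivalent_def by (rule exI[of _ u])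
qed

end

section \<open>Maximal compact subgroups\<close>

lemma group_SL4: "group SL4"
proof (rule groupI)
  fix x assume "x \<in> carrier SL4"
  then show "\<exists>y\<in>carrier SL4. y \<otimes>\<^bsub>SL4\<^esub> x = \<one>\<^bsub>SL4\<^esub>"
    by (intro bexI[of _ "matrix_inv x"]) (auto simp: SL4_def det_matrix_inv matrix_inv_props)
qed (auto simp: SL4_def det_mul matrix_mul_assoc)

lemma inv_SL4:
  assumes "det a = 1"
  shows "inv\<^bsub>SL4\<^esub> a = matrix_inv a"
  by (rule group.inv_equality[OF group_SL4]) (use assms in \<open>auto simp: SL4_def det_matrix_inv matrix_inv_props\<close>)

lemma compact_orthogonal: "compact {q :: real^'n^'n. transpose q ** q = mat 1}"
proof -
  have "norm q \<le> real CARD('n)" if "transpose q ** q = mat 1" for q :: "real^'n^'n"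
  proof -
    have "orthogonal_matrix (transpose q)" using that by (simp add: orthogonal_matrix_def matrix_left_right_inverse)
    then have "norm (q $ i) = 1" for i
      using orthogonal_matrix_orthonormal_columns[of "transpose q"] by (simp add: column_transpose row_def vec_lambda_eta)
    then have "(\<Sum>i\<in>UNIV. norm (q $ i)) = real CARD('n)" by simp
    moreover have "norm q \<le> (\<Sum>i\<in>UNIV. norm (q $ i))" unfolding norm_vec_def by (rule L2_set_le_sum) simp
    ultimately show ?thesis by simp
  qed
  then have "bounded {q :: real^'n^'n. transpose q ** q = mat 1}" by (intro boundedI) auto
  moreover have "closed {q :: real^'n^'n. transpose q ** q = mat 1}"
    by (intro closed_Collect_eq continuous_on_const bounded_bilinear.continuous_on[OF bounded_bilinear_matrix_mult]
        bounded_linear.continuous_on[OF bounded_linear_transpose] continuous_on_id)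
  ultimately show ?thesis by (simp add: compact_eq_bounded_closed)
qed

lemma continuous_on_det: "continuous_on S (det :: real^'n^'n \<Rightarrow> real)"
  unfolding det_def by (intro continuous_intros)

text \<open>Gram-Schmidt for the inner product \<open>B\<close>, as an induction on the number of
  orthonormal vectors; the next one is taken outside the span for dimension reasons.\<close>

lemma orthonormal_rows:
  fixes B :: "real^4^4"
  assumes B: "pos_def B"
  obtains R :: "real^4^4" where "R ** B ** transpose R = mat 1"
proof -
  define b where "b x y = x \<bullet> (B *v y)" for x y
  have tB: "transpose B = B" and pos: "b x x > 0" if "x \<noteq> 0" for x
    using B that by (auto simp: pos_def_def b_def)
  have tB: "transpose B = B" using B by (simp add: pos_def_def)
  have sym: "b x y = b y x" for x y
    unfolding b_def using dot_lmul_matrix[of x B y] tB by (metis inner_commute transpose_matrix_vector)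
  have lin: "b (x - y) z = b x z - b y z" "b (c *\<^sub>R x) z = c * b x z" for x y z c
    by (simp_all add: b_def inner_diff_left)
  have linsum: "b (\<Sum>i<n. c i *\<^sub>R v i) z = (\<Sum>i<n. c i * b (v i) z)" for c v z and n :: nat
    by (simp add: b_def inner_sum_left)
  have linr: "b z (c *\<^sub>R x) = c * b z x" for x z c using lin(2) sym by metis
  have ex: "\<exists>v :: nat \<Rightarrow> real^4. \<forall>i<n. \<forall>j<n. b (v i) (v j) = (if i = j then 1 else 0)" if "n \<le> 4" for n
    using that
  proof (induction n)
    case (Suc n)
    then obtain v where v: "\<And>i j. i < n \<Longrightarrow> j < n \<Longrightarrow> b (v i) (v j) = (if i = j then 1 else 0)" by auto
    have "dim (v ` {..<n}) \<le> card (v ` {..<n})" by (rule dim_le_card') simp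
    also have "\<dots> \<le> n" using card_image_le[of "{..<n}" v] by simp
    finally have "dim (v ` {..<n}) < DIM(real^4)" using Suc.prems by simp
    then have "span (v ` {..<n}) \<noteq> UNIV" by (metis dim_UNIV dim_span less_irrefl)
    then obtain x where x: "x \<notin> span (v ` {..<n})" by blast
    define y where "y = x - (\<Sum>i<n. b x (v i) *\<^sub>R v i)"
    have "(\<Sum>i<n. b x (v i) *\<^sub>R v i) \<in> span (v ` {..<n})" by (intro span_sum span_scale span_base) auto
    then have "y \<noteq> 0" using x by (auto simp: y_def)
    then have p: "b y y > 0" by (rule pos)
    have o: "b y (v j) = 0" if j: "j < n" for j
    proof -
      have "(\<Sum>i<n. b x (v i) * b (v i) (v j)) = (\<Sum>i<n. if i = j then b x (v j) else 0)"
        using v[OF _ j] by (intro sum.cong) auto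
      then show ?thesis using j by (simp add: y_def lin linsum)
    qed
    define z where "z = (1 / sqrt (b y y)) *\<^sub>R y"
    have "b z z = 1" using p by (simp add: z_def lin linr)
    moreover have "b z (v j) = 0" "b (v j) z = 0" if "j < n" for j
      using o[OF that] sym[of y "v j"] by (simp_all add: z_def lin linr)
    ultimately show ?case
      using v by (intro exI[of _ "\<lambda>i. if i = n then z else v i"]) (auto simp: less_Suc_eq)
  qed simp
  from ex[of 4] obtain v :: "nat \<Rightarrow> real^4" where v: "\<forall>i<4. \<forall>j<4. b (v i) (v j) = (if i = j then 1 else 0)" by auto
  define R :: "real^4^4" where "R = vector [v 0, v 1, v 2, v 3]"
  have RB: "(R ** B ** transpose R) $ i $ j = b (R $ i) (R $ j)" for i j
  proof -
    have "(R ** (B ** transpose R)) $ i $ j = (\<Sum>k\<in>UNIV. R $ i $ k * (\<Sum>l\<in>UNIV. B $ k $ l * R $ j $ l))"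
      by (simp add: matrix_matrix_mult_def transpose_def)
    then show ?thesis by (simp add: matrix_mul_assoc b_def inner_vec_def matrix_vector_mult_def)
  qed
  have "b (R $ i) (R $ j) = (if i = j then 1 else 0)" for i j
    using exhaust_4[of i] exhaust_4[of j] v by (auto simp: R_def)
  then have "R ** B ** transpose R = mat 1" by (simp add: vec_eq_iff RB mat_def)
  then show thesis by (rule that)
qed

lemma pos_def_factorization:
  fixes B :: "real^4^4"
  assumes "pos_def B"
  obtains h c where "det h = 1" "c > 0" "transpose h ** h = c *\<^sub>R B"
proof -
  obtain R :: "real^4^4" where R: "R ** B ** transpose R = mat 1" by (rule orthonormal_rows[OF assms])
  have dR: "det R \<noteq> 0" using arg_cong[OF R, of det] by (auto simp: det_mul)
  then have dt: "det (transpose R) \<noteq> 0" by (simp add: det_transpose)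
  \<comment> \<open>Changing the sign of one row, if necessary, makes the determinant positive
    without affecting the inner product.\<close>
  let ?s = "vector [axis 1 (sgn (det R)), axis 2 1, axis 3 1, axis 4 1] :: real^4^4"
  have ds: "det ?s = sgn (det R)" by (simp add: det_4)
  have ss: "transpose ?s ** ?s = mat 1"
    using dR by (simp add: vec_eq_iff forall_4 matrix_matrix_mult_def transpose_def sum_4 mat_def sgn_if)
  define h0 where "h0 = ?s ** matrix_inv (transpose R)"
  have "transpose h0 ** h0 = transpose (matrix_inv (transpose R)) ** (transpose ?s ** ?s) ** matrix_inv (transpose R)"
    by (simp add: h0_def matrix_transpose_mul matrix_mul_assoc)
  also have "\<dots> = matrix_inv R ** (R ** B ** transpose R) ** matrix_inv (transpose R)"
    unfolding ss R by (simp add: matrix_inv_transpose[OF dt, symmetric])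
  also have "\<dots> = B" using dR dt by (simp add: matrix_mul_assoc matrix_inv_props matrix_inv_mult_cancel)
  finally have hh: "transpose h0 ** h0 = B" .
  have "det h0 = sgn (det R) / det R"
    unfolding h0_def det_mul ds det_matrix_inv[OF dt] by (simp add: det_transpose)
  then have d0: "det h0 > 0" using dR by (simp add: sgn_if)
  \<comment> \<open>Scaling a 4x4 matrix by t multiplies its determinant by t^4. This normalisation
    is the reason why \<open>B\<close> is recovered only up to the factor \<open>c\<close>.\<close>
  define t where "t = root 4 (1 / det h0)"
  have t: "t > 0" "t ^ 4 = 1 / det h0" using d0 by (simp_all add: t_def real_root_gt_zero)
  have "det (t *\<^sub>R h0) = t ^ 4 * det h0"
    by (simp add: det_4 algebra_simps power4_eq_xxxx)
  then have "det (t *\<^sub>R h0) = 1" using t d0 by simp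
  moreover have "transpose (t *\<^sub>R h0) ** (t *\<^sub>R h0) = t\<^sup>2 *\<^sub>R B"
    by (simp add: linear_cmul[OF bounded_linear.linear[OF bounded_linear_transpose]] matrix_mult_scaleR hh power2_eq_square)
  ultimately show thesis using that[of "t *\<^sub>R h0" "t\<^sup>2"] t(1) by simp
qed

text \<open>A compact subgroup fixes an inner product and hence lies in its special orthogonal
  group, for which a positive factor of the inner product is immaterial. That group is itself
  compact, so maximality gives equality.\<close>

lemma maximal_compact_subgroup_eq:
  assumes "maximal_compact_subgroup K"
  obtains h where "det h = 1" "K = {a. det a = 1 \<and> transpose a ** (transpose h ** h) ** a = transpose h ** h}"
proof -
  have K: "subgroup K SL4" "compact K" and max: "\<And>K'. subgroup K' SL4 \<Longrightarrow> compact K' \<Longrightarrow> K \<subseteq> K' \<Longrightarrow> K' = K"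
    using assms unfolding maximal_compact_subgroup_def by auto
  have d: "det a = 1" if "a \<in> K" for a using subgroup.mem_carrier[OF K(1) that] by (simp add: carrier_SL4)
  have one: "mat 1 \<in> K" and mult: "\<And>a b. a \<in> K \<Longrightarrow> b \<in> K \<Longrightarrow> a ** b \<in> K"
    using subgroup.one_closed[OF K(1)] subgroup.m_closed[OF K(1)] by (auto simp: SL4_def)
  have inv: "matrix_inv a \<in> K" if "a \<in> K" for a
    using subgroup.m_inv_closed[OF K(1) that] by (simp add: inv_SL4[OF d[OF that]])
  obtain B where B: "pos_def B" "\<And>a. a \<in> K \<Longrightarrow> transpose a ** B ** a = B"
    by (rule compact_group_fixes_pos_def[OF K(2) one mult _ inv]) (use d in auto)
  obtain h c where h: "det h = 1" "c > 0" "transpose h ** h = c *\<^sub>R B" by (rule pos_def_factorization[OF B(1)])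
  let ?S = "transpose h ** h"
  define K' where "K' = {a. det a = 1 \<and> transpose a ** ?S ** a = ?S}"
  have hn: "det h \<noteq> 0" "det (transpose h) \<noteq> 0" using h(1) by (simp_all add: det_transpose)
  have sub: "K \<subseteq> K'" using d B(2) by (auto simp: K'_def h(3) matrix_mult_scaleR)
  have sg: "subgroup K' SL4"
  proof (rule group.subgroupI[OF group_SL4])
    show "K' \<subseteq> carrier SL4" by (auto simp: K'_def carrier_SL4)
    show "K' \<noteq> {}" using sub one by blast
    fix a assume a: "a \<in> K'"
    have da: "det a = 1" "det a \<noteq> 0" "det (transpose a) \<noteq> 0" and ea: "transpose a ** ?S ** a = ?S"
      using a by (auto simp: K'_def det_transpose)
    have "transpose (matrix_inv a) ** (transpose a ** ?S ** a) ** matrix_inv a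
       = (matrix_inv (transpose a) ** transpose a) ** ?S ** (a ** matrix_inv a)"
      unfolding matrix_inv_transpose[OF da(2)] by (simp only: matrix_mul_assoc)
    then have "transpose (matrix_inv a) ** ?S ** matrix_inv a = ?S"
      unfolding ea using da by (simp add: matrix_inv_props)
    then show "inv\<^bsub>SL4\<^esub> a \<in> K'" unfolding inv_SL4[OF da(1)] using da by (simp add: K'_def det_matrix_inv)
    fix b assume b: "b \<in> K'"
    have "transpose (a ** b) ** ?S ** (a ** b) = transpose b ** (transpose a ** ?S ** a) ** b"
      by (simp only: matrix_transpose_mul matrix_mul_assoc)
    then have "transpose (a ** b) ** ?S ** (a ** b) = ?S" unfolding ea using b by (simp add: K'_def)
    then show "a \<otimes>\<^bsub>SL4\<^esub> b \<in> K'" using a b by (simp add: K'_def SL4_def det_mul)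
  qed
  have "compact K'"
  proof -
    let ?O = "{q :: real^4^4. transpose q ** q = mat 1}"
    have c: "compact ((\<lambda>q. matrix_inv h ** q ** h) ` ?O)"
      by (intro compact_continuous_image compact_orthogonal bounded_bilinear.continuous_on[OF bounded_bilinear_matrix_mult]
          continuous_on_const continuous_on_id)
    have cl: "closed K'"
    proof -
      have "K' = {a. det a = 1} \<inter> {a. transpose a ** ?S ** a = ?S}" by (auto simp: K'_def)
      moreover have "closed {a :: real^4^4. det a = 1}" by (intro closed_Collect_eq continuous_on_det continuous_on_const)
      moreover have "closed {a. transpose a ** ?S ** a = ?S}"
        by (intro closed_Collect_eq continuous_on_const bounded_bilinear.continuous_on[OF bounded_bilinear_matrix_mult]
            bounded_linear.continuous_on[OF bounded_linear_transpose] continuous_on_id)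
      ultimately show ?thesis by (simp add: closed_Int)
    qed
    \<comment> \<open>Conjugation by \<open>h\<close> turns isometries of
      \<open>transpose h ** h\<close> into orthogonal matrices, so the closed set \<open>K'\<close>
      lies in a compact one.\<close>
    have "K' \<subseteq> (\<lambda>q. matrix_inv h ** q ** h) ` ?O"
    proof
      fix a assume "a \<in> K'"
      then have ea: "transpose a ** ?S ** a = ?S" by (simp add: K'_def)
      let ?q = "h ** a ** matrix_inv h"
      have "transpose ?q ** ?q = transpose (matrix_inv h) ** (transpose a ** ?S ** a) ** matrix_inv h"
        by (simp only: matrix_transpose_mul matrix_mul_assoc)
      also have "\<dots> = (matrix_inv (transpose h) ** transpose h) ** (h ** matrix_inv h)"
        unfolding ea matrix_inv_transpose[OF hn(1)] by (simp only: matrix_mul_assoc)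
      finally have "?q \<in> ?O" using hn by (simp add: matrix_inv_props)
      moreover have "a = matrix_inv h ** ?q ** h"
        using hn by (simp add: matrix_mul_assoc matrix_inv_props matrix_inv_mult_cancel)
      ultimately show "a \<in> (\<lambda>q. matrix_inv h ** q ** h) ` ?O" by blast
    qed
    then have "(\<lambda>q. matrix_inv h ** q ** h) ` ?O \<inter> K' = K'" by (rule Int_absorb1)
    with compact_Int_closed[OF c cl] show ?thesis by (simp only:)
  qed
  then have "K = K'" using max[OF sg _ sub] by (simp only:)
  then show thesis unfolding K'_def by (rule that[OF h(1)])
qed

theorem split_anti_instanton_gauge_equivalent:
  assumes "split_anti_instanton_charge_minus_1 E"
  obtains h where "det h = 1" "gauge_equivalent E (thooft_solution h)"
proof -
  have E: "O2_ASDYM_solution E" "has_topological_charge E (-1)"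
    using assms by (simp_all add: split_anti_instanton_charge_minus_1_def)
  obtain K where K: "maximal_compact_subgroup K" "\<And>k. k \<in> K \<Longrightarrow> T_isomorphic (pull_back k E) E"
    using assms unfolding split_anti_instanton_charge_minus_1_def by blast
  obtain h where h: "det h = 1" "K = {a. det a = 1 \<and> transpose a ** (transpose h ** h) ** a = transpose h ** h}"
    by (rule maximal_compact_subgroup_eq[OF K(1)])
  interpret invariant_asdym_solution E h
  proof
    show "O2_ASDYM_solution E" by (rule E(1))
    show "det h = 1" by (rule h(1))
    fix k k' assume k: "k \<in> adapted_frames h" and k': "k' \<in> adapted_frames h"
    have d: "det k = 1" "det k' = 1" "det k' \<noteq> 0" "det (transpose k') \<noteq> 0"
      using k k' by (auto simp: adapted_frames_def det_transpose)
    have e: "transpose k ** (transpose h ** h) ** k = mat 1" "transpose k' ** (transpose h ** h) ** k' = mat 1"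
      using k k' by (simp_all add: adapted_frames_def matrix_transpose_mul matrix_mul_assoc)
    \<comment> \<open>Both frames are orthonormal for \<open>transpose h ** h\<close>, so their
      quotient preserves it and belongs to \<open>K\<close>.\<close>
    have "transpose (k ** matrix_inv k') ** (transpose h ** h) ** (k ** matrix_inv k')
       = transpose (matrix_inv k') ** (transpose k ** (transpose h ** h) ** k) ** matrix_inv k'"
      by (simp only: matrix_transpose_mul matrix_mul_assoc)
    also have "\<dots> = transpose (matrix_inv k') ** (transpose k' ** (transpose h ** h) ** k') ** matrix_inv k'"
      unfolding e ..
    also have "\<dots> = (matrix_inv (transpose k') ** transpose k') ** (transpose h ** h) ** (k' ** matrix_inv k')"
      unfolding matrix_inv_transpose[OF d(3)] by (simp only: matrix_mul_assoc)
    also have "\<dots> = transpose h ** h" using d by (simp add: matrix_inv_props)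
    finally have "k ** matrix_inv k' \<in> K" using d unfolding h(2) by (simp add: det_mul det_matrix_inv)
    then show "T_isomorphic (pull_back (k ** matrix_inv k') E) E" by (rule K(2))
  qed
  obtain t where t: "\<And>i X. i \<in> patches E \<Longrightarrow> X \<in> patch_dom E i \<Longrightarrow> eq_up_to_sign (curvature_matrix E i X)
      ((t / sqrt (det (euclidean_gram (h ** chart E i) X))) *\<^sub>R comp_gram (h ** chart E i) X)"
    by (rule curvature_matrix_basic) blast
  have "t\<^sup>2 = 1" by (rule charge_curvature[OF E(2) t])
  then have t1: "t = 1 \<or> t = -1" by (simp add: power2_eq_1_iff)
  interpret basic_curvature_solution E h
  proof
    show "det h = 1" by (rule h(1))
    fix i X assume "i \<in> patches E" "X \<in> patch_dom E i"
    from t[OF this] t1 show "eq_up_to_sign (curvature_matrix E i X)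
      ((1 / sqrt (det (euclidean_gram (h ** chart E i) X))) *\<^sub>R comp_gram (h ** chart E i) X)"
      by (auto simp: eq_up_to_sign_def)
  qed
  show thesis by (rule that[OF h(1) gauge_equivalent_thooft_solution])
qed

theorem corollary4p8:
  fixes F\<^sub>0 :: "real^4 \<Rightarrow> real"
  defines "F\<^sub>0 \<equiv> \<lambda>x. 1 / ((x $ 1)\<^sup>2 + (x $ 2)\<^sup>2 + (x $ 3)\<^sup>2 + (x $ 4)\<^sup>2)"
  shows "(thooft_applicable F\<^sub>0 \<and>
          tautological (thooft_pot (xray F\<^sub>0)) euclidean_gram = basic_split_anti_instanton) \<and>
         (\<forall>E :: 'i metric_bundle. split_anti_instanton_charge_minus_1 E \<longrightarrow>
            (\<exists>F \<mu>. thooft_applicable F \<and>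
               O2_ASDYM_solution (tautological (thooft_pot (xray F)) \<mu>) \<and>
               T_isomorphic E (tautological (thooft_pot (xray F)) \<mu>)))"
proof (intro conjI allI impI)
  have F: "F\<^sub>0 = (\<lambda>x. inverse_square (mat 1 *v x))"
    by (simp add: fun_eq_iff F\<^sub>0_def inverse_square_def inner_vec_def sum_4 power2_eq_square)
  show "thooft_applicable F\<^sub>0" unfolding F by (rule thooft_applicable_inverse_square) simp
  have "thooft_pot (xray F\<^sub>0) = projected_pot"
  proof
    fix g
    show "thooft_pot (xray F\<^sub>0) g = projected_pot g"
    proof (cases "g \<in> carrier SL4")
      case True
      then show ?thesis
        unfolding F by (simp only: thooft_pot_inverse_square[OF True det_I] projected_pot_eq matrix_mul_lid)
    next
      \<comment> \<open>Outside SL(4,\<real>) both families of potentials are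
        \<open>undefined\<close>, so they are equal as functions on all matrices.\<close>
      case False
      then show ?thesis by (simp add: thooft_pot_def projected_pot_def)
    qed
  qed
  then show "tautological (thooft_pot (xray F\<^sub>0)) euclidean_gram = basic_split_anti_instanton"
    by (simp add: basic_split_anti_instanton_def)
next
  fix E :: "'i metric_bundle" assume "split_anti_instanton_charge_minus_1 E"
  then obtain h where h: "det h = 1" "gauge_equivalent E (thooft_solution h)"
    by (rule split_anti_instanton_gauge_equivalent)
  have "thooft_applicable (\<lambda>x. inverse_square (h *v x))" by (rule thooft_applicable_inverse_square[OF h(1)])
  moreover have "T_isomorphic E (thooft_solution h)" using h(2) by (simp add: T_isomorphic_def)
  ultimately show "\<exists>F \<mu>. thooft_applicable F \<and> O2_ASDYM_solution (tautological (thooft_pot (xray F)) \<mu>) \<and>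
      T_isomorphic E (tautological (thooft_pot (xray F)) \<mu>)"
    using O2_ASDYM_thooft_solution[OF h(1)] unfolding thooft_solution_def by (intro exI conjI)
qed

end
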